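(* A map $\operatorname{z}\colon\operatorname{Conv}_{\mathrm{sc}}(\mathbb{R}^n)\to\mathbb{R}^n$ is a continuous, translation covariant, vertically translation invariant, simple valuation if and only if there exist $\psi\in C_c(\mathbb{R}^n;\mathbb{R}^n)$ and $\zeta\in C_c(\mathbb{R}^n)$ such that \[ \operatorname{z}(u)=\int_{\operatorname{dom}(u)}\psi(\nabla u(x))\,\mathrm{d}x+\int_{\operatorname{dom}(u)}\zeta(\nabla u(x))\,x\,\mathrm{d}x \] for every $u\in\operatorname{Conv}_{\mathrm{sc}}(\mathbb{R}^n)$. For $n\geq3$, such a valuation $\operatorname{z}$ is in addition rotation equivariant if and only if there exist $\alpha\in C_c([0,\infty))$ and $\xi\in C_b((0,\infty))$ with $\lim_{t\to0^+}\xi(t)t=0$ such that $\operatorname{z}(u)=\operatorname{t}_{n,\xi}(u)+\operatorname{m}_\alpha(u)$ for every $u\in\operatorname{Conv}_{\mathrm{sc}}(\mathbb{R}^n)$. For $n\in\{1,2\}$ the same holds with rotation equivariance replaced by $\operatorname{O}(n)$ equivariance.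
   Context: $\operatorname{Conv}_{\mathrm{sc}}(\mathbb{R}^n)$ is the space of proper, lower semicontinuous, convex $u\colon\mathbb{R}^n\to(-\infty,\infty]$ with $\lim_{|x|\to\infty}u(x)/|x|=\infty$, with the topology of epi-convergence; $\operatorname{dom}(u)=\{u<\infty\}$. Valuation: $\operatorname{z}(u\vee w)+\operatorname{z}(u\wedge w)=\operatorname{z}(u)+\operatorname{z}(w)$ whenever $u,w$, their pointwise max and min lie in the space. Translation covariant: there exists $\operatorname{z}^0\colon\operatorname{Conv}_{\mathrm{sc}}(\mathbb{R}^n)\to\mathbb{R}$ with $\operatorname{z}(u\circ\tau_x^{-1})=\operatorname{z}(u)+\operatorname{z}^0(u)x$ for all $u,x$, $\tau_x(y)=y+x$. Vertically translation invariant: $\operatorname{z}(u+c)=\operatorname{z}(u)$, $c\in\mathbb{R}$. Simple: $\operatorname{z}(u)=0$ when $\dim\operatorname{dom}(u)<n$. Rotation equivariant: $\operatorname{z}(u\circ\vartheta^{-1})=\vartheta\operatorname{z}(u)$ for all $\vartheta\in\operatorname{SO}(n)$; $\operatorname{O}(n)$ equivariant analogously for $\vartheta\in\operatorname{O}(n)$. $C_c(\cdot)$: continuous compactly supported; $C_b((0,\infty))$: continuous with bounded support in $(0,\infty)$. $\operatorname{m}_\alpha(u)=\int_{\operatorname{dom}(u)}\alpha(|\nabla u(x)|)\,x\,\mathrm{d}x$ and $\operatorname{t}_{n,\xi}(u)=\int_{\operatorname{dom}(u)}\xi(|\nabla u(x)|)\nabla u(x)\,\mathrm{d}x$, where $y\mapsto\xi(|y|)y$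 is extended continuously by $o$ at $y=o$. *)

theory Defs
  imports "HOL-Analysis.Analysis"
begin

type_synonym 'n cfun = "real^'n \<Rightarrow> ereal"

definition dom_fn :: "'n::finite cfun \<Rightarrow> (real^'n) set" where
  "dom_fn u = {x. u x < \<infinity>}"

definition conv_sc :: "'n::finite cfun set" where
  "conv_sc = {u.
     (\<forall>x. u x > -\<infinity>) \<and> (\<exists>x. u x < \<infinity>)
   \<and> (\<forall>x xs. xs \<longlonglongrightarrow> x \<longrightarrow> u x \<le> Liminf sequentially (\<lambda>k. u (xs k)))
   \<and> (\<forall>x y t. 0 \<le> t \<and> t \<le> 1 \<longrightarrow>
        u ((1 - t) *\<^sub>R x + t *\<^sub>R y) \<le> ereal (1 - t) * u x + ereal t * u y)
   \<and> ((\<lambda>x. u x / ereal (norm x)) \<longlongrightarrow> \<infinity>) at_infinity}"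

definition epi_conv :: "(nat \<Rightarrow> 'n::finite cfun) \<Rightarrow> 'n cfun \<Rightarrow> bool" where
  "epi_conv us u \<longleftrightarrow> (\<forall>x.
     (\<forall>xs. xs \<longlonglongrightarrow> x \<longrightarrow> u x \<le> Liminf sequentially (\<lambda>k. us k (xs k)))
   \<and> (\<exists>xs. xs \<longlonglongrightarrow> x \<and> (\<lambda>k. us k (xs k)) \<longlonglongrightarrow> u x))"

text \<open>Gradient of u at x (defined where u is differentiable at an interior point of its domain;
  elsewhere an arbitrary value, which only matters on a null set).\<close>
definition grad :: "'n::finite cfun \<Rightarrow> real^'n \<Rightarrow> real^'n" where
  "grad u x = (SOME g. ((\<lambda>y. real_of_ereal (u y)) has_derivative (\<lambda>h. g \<bullet> h)) (at x))"

definition is_valuation :: "('n::finite cfun \<Rightarrow> 'b::ab_group_add) \<Rightarrow> bool" where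
  "is_valuation z \<longleftrightarrow> (\<forall>u\<in>conv_sc. \<forall>w\<in>conv_sc.
     (\<lambda>x. max (u x) (w x)) \<in> conv_sc \<longrightarrow> (\<lambda>x. min (u x) (w x)) \<in> conv_sc \<longrightarrow>
     z (\<lambda>x. max (u x) (w x)) + z (\<lambda>x. min (u x) (w x)) = z u + z w)"

definition epi_continuous :: "('n::finite cfun \<Rightarrow> 'b::topological_space) \<Rightarrow> bool" where
  "epi_continuous z \<longleftrightarrow> (\<forall>us u. (\<forall>k. us k \<in> conv_sc) \<longrightarrow> u \<in> conv_sc \<longrightarrow> epi_conv us u \<longrightarrow>
     (\<lambda>k. z (us k)) \<longlonglongrightarrow> z u)"

definition translation_covariant :: "('n::finite cfun \<Rightarrow> real^'n) \<Rightarrow> bool" where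
  "translation_covariant z \<longleftrightarrow> (\<exists>z0 :: 'n cfun \<Rightarrow> real. \<forall>u\<in>conv_sc. \<forall>x.
     z (\<lambda>y. u (y - x)) = z u + z0 u *\<^sub>R x)"

definition vert_trans_invariant :: "('n::finite cfun \<Rightarrow> 'b) \<Rightarrow> bool" where
  "vert_trans_invariant z \<longleftrightarrow> (\<forall>u\<in>conv_sc. \<forall>c::real. z (\<lambda>x. u x + ereal c) = z u)"

definition simple_val :: "('n::finite cfun \<Rightarrow> 'b::zero) \<Rightarrow> bool" where
  "simple_val z \<longleftrightarrow> (\<forall>u\<in>conv_sc. aff_dim (dom_fn u) < int CARD('n) \<longrightarrow> z u = 0)"

definition SO_equivariant :: "('n::finite cfun \<Rightarrow> real^'n) \<Rightarrow> bool" where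
  "SO_equivariant z \<longleftrightarrow> (\<forall>A::real^'n^'n. orthogonal_matrix A \<and> det A = 1 \<longrightarrow>
     (\<forall>u\<in>conv_sc. z (\<lambda>y. u (transpose A *v y)) = A *v z u))"

definition O_equivariant :: "('n::finite cfun \<Rightarrow> real^'n) \<Rightarrow> bool" where
  "O_equivariant z \<longleftrightarrow> (\<forall>A::real^'n^'n. orthogonal_matrix A \<longrightarrow>
     (\<forall>u\<in>conv_sc. z (\<lambda>y. u (transpose A *v y)) = A *v z u))"

definition Cc :: "('a::euclidean_space \<Rightarrow> 'b::real_normed_vector) \<Rightarrow> bool" where
  "Cc f \<longleftrightarrow> continuous_on UNIV f \<and> compact (closure {x. f x \<noteq> 0})"

text \<open>C_c([0,\<infinity>)): continuous on [0,\<infinity>) with compact support in [0,\<infinity>)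
  (values on negative reals are irrelevant).\<close>
definition Cc_halfline :: "(real \<Rightarrow> real) \<Rightarrow> bool" where
  "Cc_halfline a \<longleftrightarrow> continuous_on {0..} a \<and> (\<exists>R. \<forall>t\<ge>R. a t = 0)"

definition Cb_open_halfline :: "(real \<Rightarrow> real) \<Rightarrow> bool" where
  "Cb_open_halfline a \<longleftrightarrow> continuous_on {0<..} a \<and> (\<exists>R. \<forall>t\<ge>R. a t = 0)"

definition m_op :: "(real \<Rightarrow> real) \<Rightarrow> 'n::finite cfun \<Rightarrow> real^'n" where
  "m_op \<alpha> u = integral (dom_fn u) (\<lambda>x. \<alpha> (norm (grad u x)) *\<^sub>R x)"

definition t_op :: "(real \<Rightarrow> real) \<Rightarrow> 'n::finite cfun \<Rightarrow> real^'n" where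
  "t_op \<xi> u = integral (dom_fn u)
     (\<lambda>x. if grad u x = 0 then 0 else \<xi> (norm (grad u x)) *\<^sub>R grad u x)"

end

theory Submission
  imports Defs
begin

text \<open>
  Fenchel conjugation turns \<open>z\<close> into a valuation \<open>Z v = z (v*)\<close> on finite convex functions.
  Consider first a real \<open>Z\<close> that is continuous for pointwise convergence, unchanged by adding an affine function
  (translation and vertical translation invariance) and zero on functions constant along some direction (simplicity).
  Its density at \<open>\<tau>\<close> is its value at \<open>y \<mapsto> \<Sum>\<^sub>i max 0 (y\<^sub>i - \<tau>\<^sub>i)\<close>, the conjugate of the linear function with
  slope \<open>\<tau>\<close> on the unit cube. Elementary row operations show that replacing the coordinate functionals by the rows
  of a matrix multiplies the value by the absolute determinant. Hence if the density vanishes,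
  then \<open>Z\<close> vanishes on all sums of convex ridge functions, so on the convex functions \<open>|y|\<^sup>2 / 2 + F\<close> with \<open>F\<close> a
  trigonometric polynomial (adding convex ridges makes these sums of ridges), so by convolution with powers of a
  cosine kernel on \<open>|y|\<^sup>2 / 2 + f\<close> with \<open>f\<close> periodic, and so on every Lipschitz convex \<open>v\<close>: the
  suprema of the \<open>p\<close>-lattice translates of \<open>v - |y|\<^sup>2 / 2\<close> are such \<open>f\<close>, and they converge as \<open>p\<close> grows.
  Thus \<open>z\<close> is determined by its density, which is continuous with compact support, and it equals the integral of the
  density at the gradient.

  For covariant \<open>z\<close> this applies to \<open>z\<^sup>0\<close>, giving \<open>\<zeta>\<close>, and then to the components of \<open>z\<close> minus its moment
  part, giving \<open>\<psi>\<close>. As densities are unique, equivariance under a matrix \<open>A\<close> means \<open>\<zeta> (A \<tau>) = \<zeta> \<tau>\<close> and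
  \<open>\<psi> (A \<tau>) = A (\<psi> \<tau>)\<close>; if the group is transitive on spheres and contains, for each \<open>e\<close> and \<open>p\<close> orthogonal to it,
  a map fixing \<open>e\<close> and negating \<open>p\<close>, then \<open>\<zeta>\<close> is radial and \<open>\<psi> \<tau>\<close> is parallel to \<open>\<tau>\<close>.
\<close>

section \<open>Valuations on finite convex functions\<close>

text \<open>Everything rests on locality: the increment of \<open>Z\<close> under adding
  \<open>max 0 (a \<bullet> y - t)\<close> depends only on the values of the function on the
  hyperplane \<open>a \<bullet> y = t\<close>. The obstacle is that the valuation identity asks for
  a convex minimum; it is met by functions glued along a hyperplane, so the identities come from
  exchanging halves. Locality allows a summand to be replaced by its projection onto the hyperplane,
  which is constant in one direction and thus has value 0; this reduces arbitrary hinges to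
  independent ones. The quadratic is the convexity that \<open>F\<close> may use up. Its translates
  differ from it by affine functions only, so convexity of \<open>|y|^2 / 2 + f\<close> survives
  averages and suprema over translates of \<open>f\<close>. The support of the density is compact
  because hinges facing away from the origin vanish near it, however steep they are. For the
  converse, a compactly supported integrand involves only points with bounded gradient, which stay
  in one ball along an epi-convergent sequence; the gradients converge almost everywhere on the
  domain of the limit, so dominated convergence applies.\<close>

abbreviation cvx :: "('a::real_vector \<Rightarrow> real) \<Rightarrow> bool" where
  "cvx v \<equiv> convex_on UNIV v"

section \<open>Gluing convex functions along a hyperplane\<close>

definition glue :: "'a::real_inner \<Rightarrow> real \<Rightarrow> ('a \<Rightarrow> real) \<Rightarrow> ('a \<Rightarrow> real) \<Rightarrow> 'a \<Rightarrow> real" where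
  "glue a t A B y = (if a \<bullet> y \<le> t then A y else B y)"

text \<open>The segment from \<open>x\<close> to \<open>y\<close> meets the hyperplane in a point
  where \<open>X\<close> and \<open>Y\<close> agree. Convexity of \<open>X\<close> bounds the value
  there, and convexity of \<open>Y\<close> on the rest of the segment carries the bound on.\<close>

lemma glue_crossing:
  fixes a :: "'a::real_inner"
  assumes X: "cvx X" and Y: "cvx Y" and le: "\<forall>y. X y \<le> Y y"
    and eq: "\<forall>y. a \<bullet> y = t \<longrightarrow> X y = Y y"
    and s: "0 < s" "s < 1" and x: "a \<bullet> x < t" and m: "t < a \<bullet> ((1 - s) *\<^sub>R x + s *\<^sub>R y)"
  shows "Y ((1 - s) *\<^sub>R x + s *\<^sub>R y) \<le> (1 - s) * X x + s * Y y"
proof -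
  \<comment> \<open>\<open>r\<close> is the parameter of the crossing point on the segment from
    \<open>x\<close> to \<open>y\<close>, \<open>\<theta>\<close> that of the given point on the
    segment from the crossing point to \<open>y\<close>.\<close>
  define r where "r = (t - a \<bullet> x) / (a \<bullet> y - a \<bullet> x)"
  define \<theta> where "\<theta> = (s - r) / (1 - r)"
  have m': "t - a \<bullet> x < s * (a \<bullet> y - a \<bullet> x)"
    using m unfolding inner_add_right inner_scaleR_right left_diff_distrib right_diff_distrib by linarith
  then have "0 < s * (a \<bullet> y - a \<bullet> x)" using x by linarith
  then have pos: "0 < a \<bullet> y - a \<bullet> x" by (rule zero_less_mult_pos) (rule s)
  have r: "0 < r" "r < s" unfolding r_def using x pos m' by (simp_all add: pos_divide_less_eq)
  have r1: "r < 1" using r s by simp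
  have th: "0 \<le> \<theta>" "\<theta> \<le> 1" unfolding \<theta>_def using r s r1 by simp_all
  have th_eq: "(1 - \<theta>) * (1 - r) = 1 - s"
  proof -
    have "\<theta> * (1 - r) = s - r" unfolding \<theta>_def using r1 by simp
    then show ?thesis by (simp add: left_diff_distrib)
  qed
  have th_eq2: "(1 - \<theta>) * r + \<theta> = s" using th_eq by (simp add: algebra_simps)
  define p where "p = (1 - r) *\<^sub>R x + r *\<^sub>R y"
  have "a \<bullet> p = a \<bullet> x + r * (a \<bullet> y - a \<bullet> x)"
    unfolding p_def by (simp add: inner_add_right left_diff_distrib right_diff_distrib)
  also have "\<dots> = t" unfolding r_def using pos by simp
  finally have "X p = Y p" using eq by blast
  moreover have "X p \<le> (1 - r) * X x + r * X y"
    unfolding p_def using convex_onD[OF X, of r x y] r r1 by simp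
  ultimately have Yp: "Y p \<le> (1 - r) * X x + r * Y y"
    using mult_left_mono[OF spec[OF le, of y], of r] r by linarith
  have "(1 - s) *\<^sub>R x + s *\<^sub>R y = (1 - \<theta>) *\<^sub>R p + \<theta> *\<^sub>R y"
    unfolding p_def scaleR_add_right scaleR_scaleR th_eq add.assoc scaleR_add_left[symmetric] th_eq2 ..
  then have "Y ((1 - s) *\<^sub>R x + s *\<^sub>R y) \<le> (1 - \<theta>) * Y p + \<theta> * Y y"
    using convex_onD[OF Y, of \<theta> p y] th by simp
  also have "\<dots> \<le> (1 - \<theta>) * ((1 - r) * X x + r * Y y) + \<theta> * Y y"
    using mult_left_mono[OF Yp, of "1 - \<theta>"] th by simp
  also have "\<dots> = ((1 - \<theta>) * (1 - r)) * X x + ((1 - \<theta>) * r + \<theta>) * Y y" by (simp add: algebra_simps)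
  also have "\<dots> = (1 - s) * X x + s * Y y" by (simp only: th_eq th_eq2)
  finally show ?thesis .
qed

text \<open>The glued function lies above \<open>X\<close>, so a point on the \<open>X\<close> side
  needs only convexity of \<open>X\<close>. On the \<open>Y\<close> side either both endpoints can
  be read as values of \<open>Y\<close>, or the segment crosses the hyperplane and
  \<open>glue_crossing\<close> applies.\<close>

lemma convex_on_glue:
  fixes a :: "'a::real_inner"
  assumes X: "cvx X" and Y: "cvx Y" and le: "\<forall>y. X y \<le> Y y"
    and eq: "\<forall>y. a \<bullet> y = t \<longrightarrow> X y = Y y"
  shows "cvx (glue a t X Y)"
proof (rule convex_onI)
  fix s :: real and x y :: 'a assume s: "0 < s" "s < 1"
  let ?m = "(1 - s) *\<^sub>R x + s *\<^sub>R y"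
  have ge: "X z \<le> glue a t X Y z" for z using le by (simp add: glue_def)
  have am: "a \<bullet> ?m = (1 - s) * (a \<bullet> x) + s * (a \<bullet> y)" by (simp add: inner_add_right)
  consider "a \<bullet> ?m \<le> t" | "t < a \<bullet> ?m" "a \<bullet> x < t" | "t < a \<bullet> ?m" "a \<bullet> y < t"
    | "t < a \<bullet> ?m" "t \<le> a \<bullet> x" "t \<le> a \<bullet> y" by linarith
  then show "glue a t X Y ?m \<le> (1 - s) * glue a t X Y x + s * glue a t X Y y"
  proof cases
    case 1
    then have "glue a t X Y ?m \<le> (1 - s) * X x + s * X y"
      using convex_onD[OF X, of s x y] s by (simp add: glue_def)
    then show ?thesis using mult_left_mono[OF ge[of x], of "1 - s"] mult_left_mono[OF ge[of y], of s] s by linarith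
  next
    case 2
    have "\<not> a \<bullet> y \<le> t"
    proof
      assume "a \<bullet> y \<le> t"
      then have "(1 - s) * (a \<bullet> x) + s * (a \<bullet> y) \<le> (1-s) * t + s * t" using 2 s by (intro add_mono mult_left_mono) auto
      then show False using 2 am by (simp add: algebra_simps)
    qed
    then show ?thesis using glue_crossing[OF X Y le eq s 2(2) 2(1)] 2 by (simp add: glue_def)
  next
    case 3
    have "\<not> a \<bullet> x \<le> t"
    proof
      assume "a \<bullet> x \<le> t"
      then have "(1 - s) * (a \<bullet> x) + s * (a \<bullet> y) \<le> (1-s) * t + s * t" using 3 s by (intro add_mono mult_left_mono) auto
      then show False using 3 am by (simp add: algebra_simps)
    qed
    then show ?thesis using glue_crossing[OF X Y le eq, where s="1 - s" and x=y and y=x] 3 s by (simp add: glue_def add.commute)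
  next
    case 4
    then have "glue a t X Y x = Y x" "glue a t X Y y = Y y" "glue a t X Y ?m = Y ?m"
      using eq by (auto simp: glue_def)
    then show ?thesis using convex_onD[OF Y, of s x y] s by simp
  qed
qed auto

text \<open>Changing the signs of \<open>a\<close> and \<open>t\<close> exchanges the half-spaces.
  The hyperplane itself then goes to the other piece, which is harmless since the pieces agree
  there.\<close>

lemma convex_on_glue':
  fixes a :: "'a::real_inner"
  assumes X: "cvx X" and Y: "cvx Y" and le: "\<forall>y. X y \<le> Y y"
    and eq: "\<forall>y. a \<bullet> y = t \<longrightarrow> X y = Y y"
  shows "cvx (glue a t Y X)"
proof -
  have "glue a t Y X = glue (- a) (- t) X Y"
    using eq by (auto simp: glue_def fun_eq_iff)
  then show ?thesis using convex_on_glue[OF X Y le, of "- a" "- t"] eq by simp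
qed

lemma cvx_add: "cvx f \<Longrightarrow> cvx g \<Longrightarrow> cvx (\<lambda>y. f y + g y)" by (rule convex_on_add)
lemma cvx_max: assumes "cvx f" "cvx g" shows "cvx (\<lambda>y. max (f y) (g y))"
proof (rule convex_onI)
  fix s :: real and x y :: 'a assume s: "0 < s" "s < 1"
  have "f ((1 - s) *\<^sub>R x + s *\<^sub>R y) \<le> (1 - s) * f x + s * f y"
    "g ((1 - s) *\<^sub>R x + s *\<^sub>R y) \<le> (1 - s) * g x + s * g y"
    using convex_onD[OF assms(1), of s x y] convex_onD[OF assms(2), of s x y] s by auto
  moreover have "(1 - s) * f x + s * f y \<le> (1 - s) * max (f x) (g x) + s * max (f y) (g y)"
    "(1 - s) * g x + s * g y \<le> (1 - s) * max (f x) (g x) + s * max (f y) (g y)"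
    using s by (intro add_mono mult_left_mono; simp)+
  ultimately show "max (f ((1 - s) *\<^sub>R x + s *\<^sub>R y)) (g ((1 - s) *\<^sub>R x + s *\<^sub>R y)) \<le> (1 - s) * max (f x) (g x) + s * max (f y) (g y)"
    by simp
qed auto
lemma cvx_affine: "cvx (\<lambda>y. a \<bullet> y + c)"
  by (rule convex_onI) (auto simp: inner_add_right algebra_simps)

lemma cvx_compose_affine:
  fixes p :: "'a::real_vector \<Rightarrow> 'b::real_vector"
  assumes "cvx v" and p: "\<And>(s::real) x y. p ((1 - s) *\<^sub>R x + s *\<^sub>R y) = (1 - s) *\<^sub>R p x + s *\<^sub>R p y"
  shows "cvx (\<lambda>y. v (p y))"
  by (rule convex_onI) (use convex_onD[OF assms(1)] p in auto)

lemma cvx_ridge: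
  fixes a :: "'a::real_inner"
  assumes "cvx g" shows "cvx (\<lambda>y. g (a \<bullet> y))"
  by (rule cvx_compose_affine[OF assms]) (simp add: inner_add_right)

lemma cvx_hinge: fixes a :: "'a::real_inner" shows "cvx (\<lambda>y. max 0 (a \<bullet> y - t))"
proof -
  have "cvx (\<lambda>y::'a. 0 \<bullet> y + 0)" "cvx (\<lambda>y. a \<bullet> y + (-t))" by (rule cvx_affine)+
  from cvx_max[OF this] show ?thesis by simp
qed

section \<open>Locality of hinge increments\<close>

locale dual_val =
  fixes Z :: "('a::euclidean_space \<Rightarrow> real) \<Rightarrow> real"
  assumes val: "cvx v \<Longrightarrow> cvx w \<Longrightarrow> cvx (\<lambda>y. min (v y) (w y)) \<Longrightarrow>
      Z (\<lambda>y. max (v y) (w y)) + Z (\<lambda>y. min (v y) (w y)) = Z v + Z w"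
    and cont: "(\<And>k. cvx (vs k)) \<Longrightarrow> cvx v \<Longrightarrow> (\<And>y. (\<lambda>k. vs k y) \<longlonglongrightarrow> v y) \<Longrightarrow> (\<lambda>k::nat. Z (vs k)) \<longlonglongrightarrow> Z v"
    and inv: "cvx v \<Longrightarrow> Z (\<lambda>y. v y + (b \<bullet> y + c)) = Z v"
    and simple: "cvx v \<Longrightarrow> d \<noteq> 0 \<Longrightarrow> (\<And>y s. v (y + s *\<^sub>R d) = v y) \<Longrightarrow> Z v = 0"
begin

lemma inv_const: "cvx v \<Longrightarrow> Z (\<lambda>y. v y + c) = Z v"
  using inv[of v 0 c] by simp

text \<open>The two gluings have maximum \<open>Y\<close> and minimum \<open>X\<close>, both convex,
  so the valuation identity applies to them.\<close>

lemma glue_le: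
  assumes X: "cvx X" and Y: "cvx Y" and le: "\<forall>y. X y \<le> Y y"
    and eq: "\<forall>y. a \<bullet> y = t \<longrightarrow> X y = Y y"
  shows "Z X + Z Y = Z (glue a t X Y) + Z (glue a t Y X)"
proof -
  have mx: "(\<lambda>y. max (glue a t X Y y) (glue a t Y X y)) = Y"
    and mn: "(\<lambda>y. min (glue a t X Y y) (glue a t Y X y)) = X"
    using le by (auto simp: glue_def fun_eq_iff)
  show ?thesis using val[OF convex_on_glue[OF X Y le eq] convex_on_glue'[OF X Y le eq]] X
    by (simp add: mx mn)
qed

text \<open>Without an order between \<open>A\<close> and \<open>B\<close> their minimum need not be
  convex. All four functions lie below \<open>M\<close>, however, and exchanging halves with
  \<open>M\<close> by \<open>glue_le\<close> expresses both sides through the same four gluings with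
  \<open>M\<close>.\<close>

lemma glue_swap:
  assumes A: "cvx A" and B: "cvx B" and AB: "cvx (glue a t A B)" and BA: "cvx (glue a t B A)"
    and eq: "\<forall>y. a \<bullet> y = t \<longrightarrow> A y = B y"
  shows "Z A + Z B = Z (glue a t A B) + Z (glue a t B A)"
proof -
  define M where "M = (\<lambda>y. max (A y) (B y))"
  have M: "cvx M" unfolding M_def by (rule cvx_max[OF A B])
  have g: "glue a t (glue a t C D) M = glue a t C M" "glue a t M (glue a t C D) = glue a t M D" for C D
    by (auto simp: glue_def)
  have "Z A + Z M = Z (glue a t A M) + Z (glue a t M A)"
    by (rule glue_le[OF A M]) (auto simp: M_def eq)
  moreover have "Z B + Z M = Z (glue a t B M) + Z (glue a t M B)"
    by (rule glue_le[OF B M]) (auto simp: M_def eq)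
  moreover have "Z (glue a t A B) + Z M = Z (glue a t A M) + Z (glue a t M B)"
    using glue_le[OF AB M, of a t] unfolding g by (simp add: M_def eq glue_def)
  moreover have "Z (glue a t B A) + Z M = Z (glue a t B M) + Z (glue a t M A)"
    using glue_le[OF BA M, of a t] unfolding g by (simp add: M_def eq glue_def)
  ultimately show ?thesis by simp
qed

text \<open>The hinge is 0 on one side of the hyperplane and the affine \<open>l\<close> on the
  other, so exchanging halves trades it for an affine summand, which \<open>Z\<close> ignores.
  \<open>e1\<close> compares the increment at \<open>v\<close> with that at
  \<open>glue a t v w\<close>; \<open>e2\<close> and \<open>e3\<close> compare the latter with the
  increment at \<open>w\<close>.\<close>

lemma hinge_local_le:
  assumes v: "cvx v" and w: "cvx w" and le: "\<forall>y. v y \<le> w y"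
    and eq: "\<forall>y. a \<bullet> y = t \<longrightarrow> v y = w y"
  shows "Z (\<lambda>y. w y + max 0 (a \<bullet> y - t)) - Z w = Z (\<lambda>y. v y + max 0 (a \<bullet> y - t)) - Z v"
proof -
  define r where "r = (\<lambda>y::'a. max 0 (a \<bullet> y - t))"
  define l where "l = (\<lambda>y::'a. a \<bullet> y + (- t))"
  have r: "cvx r" unfolding r_def by (rule cvx_hinge)
  have l: "cvx l" unfolding l_def by (rule cvx_affine)
  have Zl: "Z (\<lambda>y. f y + l y) = Z f" if "cvx f" for f unfolding l_def by (rule inv[OF that])
  have rl: "r y = (if a \<bullet> y \<le> t then 0 else l y)" for y by (auto simp: r_def l_def)
  let ?w1 = "glue a t v w" and ?w2 = "glue a t w v"
  have w1: "cvx ?w1" and w2: "cvx ?w2"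
    using convex_on_glue[OF v w le eq] convex_on_glue'[OF v w le eq] by auto
  have l0: "a \<bullet> y = t \<Longrightarrow> l y = 0" for y by (simp add: l_def)
  have e1: "Z (\<lambda>y. ?w1 y + r y) + Z (\<lambda>y. v y + l y) = Z (\<lambda>y. v y + r y) + Z (\<lambda>y. ?w1 y + l y)"
  proof -
    have 1: "glue a t (\<lambda>y. ?w1 y + r y) (\<lambda>y. v y + l y) = (\<lambda>y. v y + r y)"
      and 2: "glue a t (\<lambda>y. v y + l y) (\<lambda>y. ?w1 y + r y) = (\<lambda>y. ?w1 y + l y)"
      by (auto simp: glue_def rl)
    show ?thesis
      using glue_swap[of "\<lambda>y. ?w1 y + r y" "\<lambda>y. v y + l y" a t] unfolding 1 2
      using cvx_add[OF w1 r] cvx_add[OF v l] cvx_add[OF v r] cvx_add[OF w1 l] l0 by (auto simp: glue_def rl)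
  qed
  have e2: "Z (\<lambda>y. w y + r y) + Z v = Z ?w2 + Z (\<lambda>y. ?w1 y + r y)"
  proof -
    have 1: "glue a t (\<lambda>y. w y + r y) v = ?w2"
      and 2: "glue a t v (\<lambda>y. w y + r y) = (\<lambda>y. ?w1 y + r y)"
      by (auto simp: glue_def rl)
    show ?thesis
      using glue_swap[of "\<lambda>y. w y + r y" v a t] unfolding 1 2
      using cvx_add[OF w r] v w2 cvx_add[OF w1 r] eq by (auto simp: rl)
  qed
  have e3: "Z v + Z w = Z ?w1 + Z ?w2" by (rule glue_le[OF v w le eq])
  have "Z (\<lambda>y. w y + r y) - Z w = Z (\<lambda>y. v y + r y) - Z v"
    using e1 e2 e3 Zl[OF v] Zl[OF w1] by simp
  then show ?thesis by (simp add: r_def)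
qed

text \<open>Both functions are compared with their maximum, which has the same values on the
  hyperplane.\<close>

lemma hinge_local:
  assumes v: "cvx v" and w: "cvx w" and eq: "\<forall>y. a \<bullet> y = t \<longrightarrow> v y = w y"
  shows "Z (\<lambda>y. v y + max 0 (a \<bullet> y - t)) - Z v = Z (\<lambda>y. w y + max 0 (a \<bullet> y - t)) - Z w"
proof -
  have M: "cvx (\<lambda>y. max (v y) (w y))" by (rule cvx_max[OF v w])
  show ?thesis
    using hinge_local_le[OF v M, of a t] hinge_local_le[OF w M, of a t] eq by simp
qed

text \<open>Projecting along \<open>d\<close> onto the hyperplane keeps the values of
  \<open>v\<close> there and makes it constant along \<open>d\<close>. So \<open>Z\<close> vanishes
  on the projected function, and locality gives the rest.\<close>

lemma hinge_split:
  assumes v: "cvx v" and ad: "a \<bullet> d = 1"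
  shows "Z (\<lambda>y. v y + max 0 (a \<bullet> y - t)) =
    Z v + Z (\<lambda>y. v (y - (a \<bullet> y - t) *\<^sub>R d) + max 0 (a \<bullet> y - t))"
proof -
  let ?w = "\<lambda>y. v (y - (a \<bullet> y - t) *\<^sub>R d)"
  have w: "cvx ?w"
    by (rule cvx_compose_affine[OF v]) (simp add: algebra_simps inner_add_right)
  have "Z ?w = 0"
  proof (rule simple[OF w])
    show "d \<noteq> 0" using ad by auto
    show "v (y + s *\<^sub>R d - (a \<bullet> (y + s *\<^sub>R d) - t) *\<^sub>R d) = ?w y" for y s
      by (simp add: inner_add_right ad algebra_simps)
  qed
  then show ?thesis using hinge_local[OF v w, of a t] by simp
qed

end

section \<open>Sums of ridge functions\<close>

inductive polygonal :: "(real \<Rightarrow> real) \<Rightarrow> bool" where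
  affine: "polygonal (\<lambda>s. \<alpha> * s + \<beta>)"
| hinge: "polygonal g \<Longrightarrow> 0 \<le> c \<Longrightarrow> polygonal (\<lambda>s. g s + c * max 0 (s - t))"

lemma cvx_const: "cvx (\<lambda>y. c)"
  by (rule convex_onI) (auto simp: algebra_simps)

lemma scale_hinge:
  "0 \<le> c \<Longrightarrow> c * max 0 (a \<bullet> y - t) = max 0 ((c *\<^sub>R a) \<bullet> y - c * t)" for c :: real
  by (simp add: max_mult_distrib_left right_diff_distrib)

lemma cvx_hinge_real: "0 \<le> c \<Longrightarrow> cvx (\<lambda>s::real. c * max 0 (s - t))"
  using convex_on_cmul[OF _ cvx_hinge[of "1::real" t]] by simp

lemma cvx_affine_real: "cvx (\<lambda>s::real. \<alpha> * s + \<beta>)"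
  using cvx_affine[of \<alpha> \<beta>] by simp

lemma polygonal_imp_cvx: "polygonal g \<Longrightarrow> cvx g"
  by (induction rule: polygonal.induct) (auto intro: cvx_add cvx_hinge_real cvx_affine_real)

lemma polygonal_interpolation:
  fixes g :: "real \<Rightarrow> real" and x0 \<delta> :: real
  assumes g: "cvx g" and \<delta>: "0 < \<delta>"
  defines "x \<equiv> \<lambda>i::nat. x0 + real i * \<delta>"
  shows "\<exists>f. polygonal f \<and> (\<forall>m\<le>M. \<forall>s\<in>{x m..x (Suc m)}.
    f s = g (x m) + (g (x (Suc m)) - g (x m)) / \<delta> * (s - x m))"
proof -
  define sl where "sl i = (g (x (Suc i)) - g (x i)) / \<delta>" for i
  have xs: "x (Suc i) = x i + \<delta>" for i by (simp add: x_def algebra_simps)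
  have sl_mono: "sl i \<le> sl (Suc i)" for i
  proof -
    have "x (Suc i) = (1 - 1/2) *\<^sub>R x i + (1/2) *\<^sub>R x (Suc (Suc i))" by (simp add: xs field_simps)
    then have "g (x (Suc i)) \<le> (1 - 1/2) * g (x i) + (1/2) * g (x (Suc (Suc i)))"
      using convex_onD[OF g, of "1/2" "x i" "x (Suc (Suc i))"] by simp
    then show ?thesis unfolding sl_def using \<delta> by (intro divide_right_mono) auto
  qed
  have x_mono: "i \<le> j \<Longrightarrow> x i \<le> x j" for i j using \<delta> by (simp add: x_def)
  \<comment> \<open>The induction also asserts that \<open>f\<close> continues its last chord beyond
    \<open>x M\<close>; the next hinge, placed at \<open>x (Suc M)\<close>, then only has to add the
    increase of slope.\<close>
  have "\<exists>f. polygonal f \<and> (\<forall>s\<ge>x M. f s = g (x M) + sl M * (s - x M)) \<and>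
    (\<forall>m\<le>M. \<forall>s\<in>{x m..x (Suc m)}. f s = g (x m) + sl m * (s - x m))"
  proof (induction M)
    case 0
    show ?case
    proof (intro exI conjI)
      show "polygonal (\<lambda>s. sl 0 * s + (g (x 0) - sl 0 * x 0))" by (rule polygonal.affine)
    qed (auto simp: algebra_simps)
  next
    case (Suc M)
    then obtain f where f: "polygonal f" "\<And>s. s \<ge> x M \<Longrightarrow> f s = g (x M) + sl M * (s - x M)"
      "\<And>m s. m \<le> M \<Longrightarrow> s\<in>{x m..x (Suc m)} \<Longrightarrow> f s = g (x m) + sl m * (s - x m)" by blast
    define f' where "f' = (\<lambda>s. f s + (sl (Suc M) - sl M) * max 0 (s - x (Suc M)))"
    have g1: "g (x (Suc M)) = g (x M) + sl M * \<delta>" unfolding sl_def using \<delta> by simp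
    have *: "f' s = g (x (Suc M)) + sl (Suc M) * (s - x (Suc M))" if s: "x (Suc M) \<le> s" for s
    proof -
      have "x M \<le> s" using s x_mono[of M "Suc M"] by simp
      then show ?thesis unfolding f'_def g1 using f(2)[of s] s by (simp add: xs algebra_simps)
    qed
    have **: "f' s = g (x m) + sl m * (s - x m)" if "m \<le> Suc M" "s\<in>{x m..x (Suc m)}" for m s
    proof (cases "m = Suc M")
      case True then show ?thesis using * that by auto
    next
      case False
      then have "m \<le> M" using that by simp
      then have "s \<le> x (Suc M)" using that x_mono[of "Suc m" "Suc M"] by simp
      then show ?thesis unfolding f'_def using f(3) \<open>m \<le> M\<close> that by simp
    qed
    have "polygonal f'" unfolding f'_def by (intro polygonal.hinge f) (simp add: sl_mono)
    then show ?case using * ** by blast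
  qed
  then show ?thesis by (auto simp: sl_def)
qed

lemma cvx_real_polygonal_limit:
  fixes g :: "real \<Rightarrow> real"
  assumes g: "cvx g"
  obtains G where "\<And>N::nat. polygonal (G N)" "\<And>s. (\<lambda>N. G N s) \<longlonglongrightarrow> g s"
proof -
  \<comment> \<open>The nodes start at \<open>- N\<close> with step \<open>1 / (N + 1)\<close>, and
    \<open>2 * N * Suc N\<close> steps reach \<open>N\<close>. Every \<open>s\<close> is eventually
    covered while the mesh tends to 0.\<close>
  define \<delta> where "\<delta> N = inverse (real (Suc N))" for N
  define x where "x N i = - real N + real i * \<delta> N" for N i
  have \<delta>: "0 < \<delta> N" for N by (simp add: \<delta>_def)
  have "\<exists>f. polygonal f \<and> (\<forall>m\<le>2 * N * Suc N. \<forall>s\<in>{x N m..x N (Suc m)}.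
    f s = g (x N m) + (g (x N (Suc m)) - g (x N m)) / \<delta> N * (s - x N m))" for N
    unfolding x_def by (rule polygonal_interpolation[OF g \<delta>])
  then obtain G where G: "\<And>N. polygonal (G N)" and Geq: "\<And>N m s. m \<le>2 * N * Suc N \<Longrightarrow> s\<in>{x N m..x N (Suc m)} \<Longrightarrow>
    G N s = g (x N m) + (g (x N (Suc m)) - g (x N m)) / \<delta> N * (s - x N m)" by metis
  have cont: "isCont g s" for s
    using convex_on_continuous[OF open_UNIV g] by (simp add: continuous_on_eq_continuous_at)
  have "(\<lambda>N. G N s) \<longlonglongrightarrow> g s" for s
  proof (rule metric_LIMSEQ_I)
    fix e :: real assume e: "0 < e"
    obtain d where d: "0 < d" "\<And>y. dist y s < d \<Longrightarrow> dist (g y) (g s) < e / 4"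
      using cont[of s, unfolded continuous_at_eps_delta] e by (metis zero_less_divide_iff zero_less_numeral)
    obtain N1 :: nat where N1: "\<bar>s\<bar> \<le> real N1" using real_arch_simple by blast
    obtain N2 :: nat where N2: "inverse (real (Suc N2)) < d" using reals_Archimedean d(1) by blast
    have "dist (G N s) (g s) < e" if N: "N \<ge> max N1 N2" for N
    proof -
      have sN: "- real N \<le> s" "s \<le> real N" using N N1 by auto
      have \<delta>d: "\<delta> N < d"
      proof -
        have "\<delta> N \<le> inverse (real (Suc N2))" unfolding \<delta>_def using N by (intro le_imp_inverse_le) auto
        then show ?thesis using N2 by simp
      qed
      define m where "m = nat \<lfloor>(s + real N) / \<delta> N\<rfloor>"
      have nn: "0 \<le> (s + real N) / \<delta> N" using sN \<delta>[of N] by simp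
      have m1: "real m \<le> (s + real N) / \<delta> N" "(s + real N) / \<delta> N < real m + 1"
        unfolding m_def using nn by linarith+
      have "(s + real N) / \<delta> N \<le> (2 * real N) * real (Suc N)"
        unfolding \<delta>_def using sN by (simp add: divide_inverse mult_right_mono)
      then have "real m \<le> real (2 * N * Suc N)" using m1(1) unfolding of_nat_mult by simp
      then have mle: "m \<le> 2 * N * Suc N" by (simp only: of_nat_le_iff)
      have xm: "x N m \<le> s" "s < x N (Suc m)" "x N (Suc m) = x N m + \<delta> N"
        using m1 \<delta>[of N] by (auto simp: x_def pos_le_divide_eq pos_divide_less_eq algebra_simps)
      define th where "th = (s - x N m) / \<delta> N"
      have th: "0 \<le> th" "th \<le> 1" unfolding th_def using xm \<delta>[of N] by auto
      have "G N s = g (x N m) + (g (x N (Suc m)) - g (x N m)) * th"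
        using Geq[OF mle, of s] xm by (simp add: th_def)
      then have eq: "G N s - g s = (g (x N m) - g s) + (g (x N (Suc m)) - g (x N m)) * th" by simp
      have a: "\<bar>g (x N m) - g s\<bar> < e / 4" using d(2)[of "x N m"] xm \<delta>d by (auto simp: dist_real_def)
      have b: "\<bar>g (x N (Suc m)) - g s\<bar> < e / 4" using d(2)[of "x N (Suc m)"] xm \<delta>d by (auto simp: dist_real_def)
      have "\<bar>(g (x N (Suc m)) - g (x N m)) * th\<bar> \<le> \<bar>g (x N (Suc m)) - g (x N m)\<bar>"
        unfolding abs_mult using th by (simp add: mult_left_le)
      then have "\<bar>G N s - g s\<bar> < e" unfolding eq using a b by linarith
      then show ?thesis by (simp add: dist_real_def)
    qed
    then show "\<exists>no. \<forall>n\<ge>no. dist (G n s) (g s) < e" by blast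
  qed
  then show ?thesis using that G by blast
qed

section \<open>Sums of convex ridges and sums of hinges\<close>

inductive zonal :: "('a::euclidean_space \<Rightarrow> real) \<Rightarrow> bool" where
  zero: "zonal (\<lambda>y. 0)"
| ridge: "zonal P \<Longrightarrow> cvx g \<Longrightarrow> zonal (\<lambda>y. P y + g (a \<bullet> y))"

lemma zonal_imp_cvx: "zonal P \<Longrightarrow> cvx P"
  by (induction rule: zonal.induct) (auto intro: cvx_add cvx_ridge cvx_const)

lemma zonal_add: "zonal P \<Longrightarrow> zonal Q \<Longrightarrow> zonal (\<lambda>y. P y + Q y)"
proof (induction rule: zonal.induct)
  case (ridge P g a)
  from zonal.ridge[OF ridge.IH[OF ridge.prems] ridge.hyps(2), of a] show ?case
    by (simp add: algebra_simps)
qed simp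

lemma zonal_sum:
  assumes "finite I" "\<And>i. i \<in> I \<Longrightarrow> cvx (g i)"
  shows "zonal (\<lambda>y. \<Sum>i\<in>I. g i (a i \<bullet> y))"
  using assms
proof (induction rule: finite_induct)
  case (insert i I)
  then have "zonal (\<lambda>y. (\<Sum>i\<in>I. g i (a i \<bullet> y)) + g i (a i \<bullet> y))" by (intro zonal.ridge) auto
  then show ?case using insert by (simp add: add.commute)
qed (simp add: zonal.zero)

definition hinge_sum :: "('a::euclidean_space \<times> real) list \<Rightarrow> 'a \<Rightarrow> real" where
  "hinge_sum L y = (\<Sum>(a, t)\<leftarrow>L. max 0 (a \<bullet> y - t))"

lemma hinge_sum_simps [simp]:
  "hinge_sum [] y = 0" "hinge_sum ((a, t) # L) y = max 0 (a \<bullet> y - t) + hinge_sum L y"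
  by (simp_all add: hinge_sum_def)

lemma cvx_hinge_sum: "cvx (hinge_sum L)"
proof (induction L)
  case Nil
  have "hinge_sum ([] :: ('a \<times> real) list) = (\<lambda>y. 0)" by auto
  then show ?case by (simp add: cvx_const)
next
  case (Cons p L)
  obtain a t where "p = (a, t)" by force
  then have "hinge_sum (p # L) = (\<lambda>y. max 0 (a \<bullet> y - t) + hinge_sum L y)" by auto
  then show ?case using cvx_add[OF cvx_hinge Cons] by simp
qed

lemma hinge_sum_orthogonal:
  "\<forall>b\<in>fst ` set S. b \<bullet> d = 0 \<Longrightarrow> hinge_sum S (y + s *\<^sub>R d) = hinge_sum S y"
  by (induction S) (auto simp: inner_add_right)

text \<open>\<open>d\<close> is the component of \<open>a\<close> orthogonal to
  \<open>span S\<close>, rescaled.\<close>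

lemma exists_dual_vector:
  fixes a :: "'a::euclidean_space"
  assumes "a \<notin> span S"
  obtains d where "a \<bullet> d = 1" "\<forall>b\<in>S. b \<bullet> d = 0"
proof -
  obtain y z where yz: "y \<in> span S" "\<And>w. w \<in> span S \<Longrightarrow> orthogonal z w" "a = y + z"
    using orthogonal_subspace_decomp_exists[of S a] by metis
  have "z \<noteq> 0" using yz assms by auto
  moreover have "a \<bullet> z = z \<bullet> z" using yz(2)[OF yz(1)] yz(3) by (simp add: inner_add_left orthogonal_def inner_commute[of y])
  ultimately have "a \<bullet> (z /\<^sub>R (z \<bullet> z)) = 1" by simp
  moreover have "\<forall>b\<in>S. b \<bullet> (z /\<^sub>R (z \<bullet> z)) = 0"
    using yz(2) span_base by (auto simp: orthogonal_def inner_commute)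
  ultimately show ?thesis using that by blast
qed

text \<open>\<open>hinge_split\<close> leaves a projected function behind. It is again a hinge sum
  of the same length, which lets the induction of \<open>hinge_sum_zero_aux\<close>
  continue.\<close>

lemma hinge_sum_project:
  "hinge_sum L (y - (a \<bullet> y - t) *\<^sub>R d) =
    hinge_sum (map (\<lambda>(b, \<tau>). (b - (b \<bullet> d) *\<^sub>R a, \<tau> - (b \<bullet> d) * t)) L) y"
  by (induction L) (auto simp: inner_diff_left inner_diff_right algebra_simps)

text \<open>This preserves the invariant of \<open>hinge_sum_zero_aux\<close> when \<open>a\<close>
  moves from the list to the independent part. The projected directions and \<open>S\<close> are
  orthogonal to \<open>d\<close> while \<open>a\<close> is not, so a common vector has no
  \<open>a\<close> component and lies in both of the original spans.\<close>

lemma span_project: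
  fixes d :: "'a::euclidean_space"
  assumes int: "span (insert a W) \<inter> span S \<subseteq> {0}" and d: "a \<bullet> d = 1" "\<forall>b\<in>S. b \<bullet> d = 0"
  shows "span ((\<lambda>b. b - (b \<bullet> d) *\<^sub>R a) ` W) \<inter> span (insert a S) \<subseteq> {0}"
proof
  fix x assume x: "x \<in> span ((\<lambda>b. b - (b \<bullet> d) *\<^sub>R a) ` W) \<inter> span (insert a S)"
  have sub: "subspace {x. d \<bullet> x = 0}" by (rule subspace_hyperplane)
  have "span ((\<lambda>b. b - (b \<bullet> d) *\<^sub>R a) ` W) \<subseteq> {x. d \<bullet> x = 0}"
    by (rule span_minimal[OF _ sub]) (auto simp: inner_diff_right inner_commute d)
  then have xd: "d \<bullet> x = 0" using x by auto
  have "span ((\<lambda>b. b - (b \<bullet> d) *\<^sub>R a) ` W) \<subseteq> span (insert a W)"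
    by (rule span_minimal) (auto intro: span_diff span_mul span_base)
  then have x1: "x \<in> span (insert a W)" using x by auto
  obtain k where k: "x - k *\<^sub>R a \<in> span S" using x by (auto simp: span_breakdown_eq)
  have "span S \<subseteq> {x. d \<bullet> x = 0}"
    by (rule span_minimal[OF _ sub]) (auto simp: inner_commute d)
  then have "d \<bullet> (x - k *\<^sub>R a) = 0" using k by auto
  then have "k = 0" using xd d by (simp add: inner_diff_right inner_commute)
  then show "x \<in> {0}" using k x1 int by auto
qed

context dual_val begin

definition additive_ridge :: "'a \<Rightarrow> (real \<Rightarrow> real) \<Rightarrow> bool" where
  "additive_ridge a g \<longleftrightarrow> (\<forall>v h. cvx v \<longrightarrow> cvx h \<longrightarrow>
    Z (\<lambda>y. v y + h (a \<bullet> y) + g (a \<bullet> y)) + Z v = Z (\<lambda>y. v y + g (a \<bullet> y)) + Z (\<lambda>y. v y + h (a \<bullet> y)))"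

text \<open>A ridge in direction \<open>a\<close> is constant on every hyperplane
  \<open>a \<bullet> y = t\<close>. By locality it has no influence on the increment of a hinge
  located there.\<close>

lemma additive_ridge_polygonal: "polygonal g \<Longrightarrow> additive_ridge a g"
proof (induction rule: polygonal.induct)
  case (affine \<alpha> \<beta>)
  have *: "Z (\<lambda>y. v y + (\<alpha> * (a \<bullet> y) + \<beta>)) = Z v" if "cvx v" for v
    using inv[OF that, of "\<alpha> *\<^sub>R a" \<beta>] by simp
  show ?case unfolding additive_ridge_def by (intro allI impI) (simp add: * cvx_add cvx_ridge)
next
  case (hinge g c t)
  show ?case unfolding additive_ridge_def
  proof (intro allI impI)
    fix v :: "'a \<Rightarrow> real" and h assume v: "cvx v" and h: "cvx (h :: real \<Rightarrow> real)"
    have g: "cvx g" using polygonal_imp_cvx[OF hinge.hyps(1)] .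
    define r where "r = (\<lambda>y. c * max 0 (a \<bullet> y - t))"
    have key: "Z (\<lambda>y. v y + f (a \<bullet> y) + r y) - Z (\<lambda>y. v y + f (a \<bullet> y)) = Z (\<lambda>y. v y + r y) - Z v" if f: "cvx f" for f
    proof (cases "c = 0")
      case True then show ?thesis by (simp add: r_def)
    next
      case False
      then have c: "c > 0" using hinge.hyps by simp
      have r: "r = (\<lambda>y. max 0 ((c *\<^sub>R a) \<bullet> y - c * t))"
        unfolding r_def using c by (simp add: scale_hinge del: inner_scaleR_left)
      have vf: "cvx (\<lambda>y. v y + f (a \<bullet> y))" by (intro cvx_add cvx_ridge v f)
      have vr: "cvx (\<lambda>y. v y + r y)" unfolding r by (intro cvx_add cvx_hinge v)
      have "Z (\<lambda>y. v y + f (a \<bullet> y) + r y) - Z (\<lambda>y. v y + f (a \<bullet> y)) = Z (\<lambda>y. (v y + f t) + r y) - Z (\<lambda>y. v y + f t)"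
        unfolding r by (rule hinge_local) (use vf c in \<open>auto intro: cvx_add v cvx_const\<close>)
      also have "(\<lambda>y. (v y + f t) + r y) = (\<lambda>y. (v y + r y) + f t)" by auto
      finally show ?thesis using inv_const[OF v] inv_const[OF vr] by simp
    qed
    have "Z (\<lambda>y. v y + h (a \<bullet> y) + g (a \<bullet> y)) + Z v = Z (\<lambda>y. v y + g (a \<bullet> y)) + Z (\<lambda>y. v y + h (a \<bullet> y))"
      using hinge.IH v h by (auto simp: additive_ridge_def)
    then show "Z (\<lambda>y. v y + h (a \<bullet> y) + (g (a \<bullet> y) + c * max 0 (a \<bullet> y - t))) + Z v =
      Z (\<lambda>y. v y + (g (a \<bullet> y) + c * max 0 (a \<bullet> y - t))) + Z (\<lambda>y. v y + h (a \<bullet> y))"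
      using key[OF g] key[OF cvx_add[OF h g]] by (simp add: add.assoc r_def)
  qed
qed

lemma additive_ridge_cvx:
  assumes g: "cvx g" shows "additive_ridge a g"
  unfolding additive_ridge_def
proof (intro allI impI)
  fix v :: "'a \<Rightarrow> real" and h assume v: "cvx v" and h: "cvx (h :: real \<Rightarrow> real)"
  obtain G where G: "\<And>N::nat. polygonal (G N)" "\<And>s. (\<lambda>N. G N s) \<longlonglongrightarrow> g s"
    using cvx_real_polygonal_limit[OF g] by blast
  have lim: "(\<lambda>N. Z (\<lambda>y. w y + G N (a \<bullet> y))) \<longlonglongrightarrow> Z (\<lambda>y. w y + g (a \<bullet> y))" if "cvx w" for w
    by (rule cont) (intro cvx_add cvx_ridge that g polygonal_imp_cvx G tendsto_intros)+
  have vh: "cvx (\<lambda>y. v y + h (a \<bullet> y))" by (intro cvx_add cvx_ridge v h)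
  have "(\<lambda>N. Z (\<lambda>y. v y + h (a \<bullet> y) + G N (a \<bullet> y)) + Z v) \<longlonglongrightarrow> Z (\<lambda>y. v y + h (a \<bullet> y) + g (a \<bullet> y)) + Z v"
    by (intro tendsto_intros lim vh)
  moreover have "(\<lambda>N. Z (\<lambda>y. v y + G N (a \<bullet> y)) + Z (\<lambda>y. v y + h (a \<bullet> y))) \<longlonglongrightarrow> Z (\<lambda>y. v y + g (a \<bullet> y)) + Z (\<lambda>y. v y + h (a \<bullet> y))"
    by (intro tendsto_intros lim v)
  moreover have "Z (\<lambda>y. v y + h (a \<bullet> y) + G N (a \<bullet> y)) + Z v = Z (\<lambda>y. v y + G N (a \<bullet> y)) + Z (\<lambda>y. v y + h (a \<bullet> y))" for N
    using additive_ridge_polygonal[OF G(1)] v h by (auto simp: additive_ridge_def)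
  ultimately show "Z (\<lambda>y. v y + h (a \<bullet> y) + g (a \<bullet> y)) + Z v = Z (\<lambda>y. v y + g (a \<bullet> y)) + Z (\<lambda>y. v y + h (a \<bullet> y))"
    using LIMSEQ_unique by auto
qed

lemma hinge_sum_degenerate:
  assumes "dim (fst ` set S) < DIM('a)"
  shows "Z (hinge_sum S) = 0"
proof -
  obtain d where d: "d \<noteq> 0" "\<And>y. y \<in> span (fst ` set S) \<Longrightarrow> orthogonal d y"
    using orthogonal_to_subspace_exists[OF assms] by blast
  have "\<forall>b\<in>fst ` set S. b \<bullet> d = 0" using d(2)[OF span_base] by (simp add: orthogonal_def inner_commute[of _ d])
  then show ?thesis using simple[OF cvx_hinge_sum d(1)] hinge_sum_orthogonal by blast
qed

end

text \<open>The directions form a basis, so the conjugate of \<open>hinge_sum S\<close> is affine on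
  a parallelepiped and infinite elsewhere; \<open>Z\<close> is assumed to vanish on these
  pieces.\<close>

locale dual_val_para = dual_val +
  assumes para: "\<And>S. length S = DIM('a) \<Longrightarrow> distinct (map fst S) \<Longrightarrow> independent (fst ` set S) \<Longrightarrow>
    Z (hinge_sum S) = 0"
begin

lemma hinge_sum_independent:
  assumes "distinct (map fst S)" "independent (fst ` set S)"
  shows "Z (hinge_sum S) = 0"
proof -
  have card: "card (fst ` set S) = length S" using assms(1) by (metis distinct_card length_map list.set_map)
  have "dim (fst ` set S) = length S" using dim_eq_card_independent[OF assms(2)] card by simp
  moreover have "dim (fst ` set S) \<le> DIM('a)" by (rule dim_subset_UNIV)
  ultimately show ?thesis using para[OF _ assms] hinge_sum_degenerate[of S] by linarith
qed

text \<open>\<open>L\<close> holds the hinges still to be processed. Splitting off the first one,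
  with \<open>d\<close> orthogonal to \<open>S\<close>, leaves a sum with a shorter list and another
  in which \<open>a\<close> has joined the independent part and the rest of the list is projected.
  That the spans meet only in 0 makes \<open>a\<close> independent of \<open>S\<close>.\<close>

lemma hinge_sum_zero_aux:
  assumes "distinct (map fst S)" "independent (fst ` set S)"
    "span (fst ` set L) \<inter> span (fst ` set S) \<subseteq> {0}"
  shows "Z (\<lambda>y. hinge_sum L y + hinge_sum S y) = 0"
  using assms
proof (induction "length L" arbitrary: L S)
  case 0
  then show ?case using hinge_sum_independent[of S] by simp
next
  case (Suc n)
  then obtain a t L' where L: "L = (a, t) # L'" "length L' = n" by (cases L) auto
  have "span (fst ` set L') \<subseteq> span (fst ` set L)" by (rule span_mono) (auto simp: L)
  then have "Z (\<lambda>y. hinge_sum L' y + hinge_sum S y) = 0"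
    using Suc.hyps(1)[of L' S] Suc.prems L by auto
  note IH = this
  have cv: "cvx (\<lambda>y. hinge_sum L' y + hinge_sum S y)" by (intro cvx_add cvx_hinge_sum)
  show ?case
  proof (cases "a = 0")
    case True
    then show ?thesis using IH inv_const[OF cv, of "max 0 (- t)"] by (simp add: L add_ac)
  next
    case False
    have "a \<in> span (fst ` set L)" by (rule span_base) (simp add: L)
    then have aS: "a \<notin> span (fst ` set S)" using False Suc.prems(3) by auto
    then obtain d where d: "a \<bullet> d = 1" "\<forall>b\<in>fst ` set S. b \<bullet> d = 0" by (rule exists_dual_vector)
    define L2 where "L2 = map (\<lambda>(b, \<tau>). (b - (b \<bullet> d) *\<^sub>R a, \<tau> - (b \<bullet> d) * t)) L'"
    have fL2: "fst ` set L2 = (\<lambda>b. b - (b \<bullet> d) *\<^sub>R a) ` fst ` set L'"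
      unfolding L2_def by (force simp: image_iff)
    have int2: "span (fst ` set L2) \<inter> span (fst ` set ((a, t) # S)) \<subseteq> {0}"
      using span_project[of a "fst ` set L'" "fst ` set S" d] Suc.prems(3) d by (simp add: fL2 L)
    have ind2: "independent (fst ` set ((a, t) # S))" "distinct (map fst ((a, t) # S))"
      using Suc.prems aS span_base[of a "fst ` set S"] by (auto simp: independent_insert)
    have "Z (\<lambda>y. hinge_sum L2 y + hinge_sum ((a, t) # S) y) = 0"
      by (rule Suc.hyps(1)[OF _ ind2(2,1) int2]) (simp add: L2_def L)
    moreover have "hinge_sum L' (y - (a \<bullet> y - t) *\<^sub>R d) + hinge_sum S (y - (a \<bullet> y - t) *\<^sub>R d) = hinge_sum L2 y + hinge_sum S y" for y
    proof -
      have "y - (a \<bullet> y - t) *\<^sub>R d = y + (- (a \<bullet> y - t)) *\<^sub>R d" by (simp only: scaleR_minus_left diff_conv_add_uminus[of y])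
      then have "hinge_sum S (y - (a \<bullet> y - t) *\<^sub>R d) = hinge_sum S y"
        using hinge_sum_orthogonal[OF d(2)] by metis
      then show ?thesis using hinge_sum_project[of L' y a t d] by (simp add: L2_def)
    qed
    ultimately show ?thesis
      using hinge_split[OF cv d(1), of t] IH by (simp add: L add_ac)
  qed
qed

lemma hinge_sum_zero: "Z (hinge_sum L) = 0"
  using hinge_sum_zero_aux[of "[]" L] by (simp add: independent_empty)

text \<open>The list \<open>L\<close> makes the induction work: the hinges of a polygonal profile
  are moved into it, until only an affine profile is left, which \<open>Z\<close> ignores.\<close>

lemma zonal_plus_hinge_sum: "zonal P \<Longrightarrow> Z (\<lambda>y. P y + hinge_sum L y) = 0"
proof (induction arbitrary: L rule: zonal.induct)
  case zero
  then show ?case using hinge_sum_zero by simp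
next
  case (ridge P g a)
  have P: "cvx P" using zonal_imp_cvx ridge by blast
  have pol: "Z (\<lambda>y. P y + G (a \<bullet> y) + hinge_sum L y) = 0" if "polygonal G" for G L
    using that
  proof (induction arbitrary: L rule: polygonal.induct)
    case (affine \<alpha> \<beta>)
    show ?case using inv[OF cvx_add[OF P cvx_hinge_sum[of L]], of "\<alpha> *\<^sub>R a" \<beta>] ridge.IH[of L] by (simp add: algebra_simps)
  next
    case (hinge g c t)
    have "c * max 0 (a \<bullet> y - t) = max 0 ((c *\<^sub>R a) \<bullet> y - c * t)" for y
      by (rule scale_hinge) (rule hinge.hyps)
    then show ?case using hinge.IH[of "(c *\<^sub>R a, c * t) # L"] by (simp add: add_ac)
  qed
  obtain G where G: "\<And>N::nat. polygonal (G N)" "\<And>s. (\<lambda>N. G N s) \<longlonglongrightarrow> g s"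
    using cvx_real_polygonal_limit[OF ridge.hyps(2)] by blast
  have "(\<lambda>N. Z (\<lambda>y. P y + G N (a \<bullet> y) + hinge_sum L y)) \<longlonglongrightarrow> Z (\<lambda>y. P y + g (a \<bullet> y) + hinge_sum L y)"
    by (rule cont) (intro cvx_add cvx_ridge P ridge polygonal_imp_cvx G tendsto_intros cvx_hinge_sum)+
  then show ?case using pol[OF G(1)] LIMSEQ_unique[OF _ tendsto_const] by auto
qed

lemma zonal_zero: "zonal P \<Longrightarrow> Z P = 0"
  using zonal_plus_hinge_sum[of P "[]"] by simp

text \<open>\<open>Z\<close> is additive along the ray \<open>j \<mapsto> v + j k\<close>, so vanishing at \<open>j = 1, 2\<close> forces vanishing at \<open>j = 0\<close>:
  convex ridges can be subtracted.\<close>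

lemma zonal_difference:
  assumes "cvx v" "zonal (\<lambda>y. v y + (\<Sum>(b, k)\<leftarrow>K. k (b \<bullet> y)))" "\<forall>(b, k)\<in>set K. cvx k" "zonal P"
  shows "Z (\<lambda>y. v y + P y) = 0"
  using assms
proof (induction K arbitrary: v P)
  case Nil
  then show ?case using zonal_zero[OF zonal_add] by simp
next
  case (Cons bk K)
  obtain b k where bk: "bk = (b, k)" by force
  have k: "cvx k" using Cons.prems bk by auto
  let ?v1 = "\<lambda>y. v y + k (b \<bullet> y)"
  have v1: "cvx ?v1" by (intro cvx_add cvx_ridge Cons.prems k)
  have IH: "Z (\<lambda>y. ?v1 y + Q y) = 0" if "zonal Q" for Q
    using Cons.IH[OF v1 _ _ that] Cons.prems by (simp add: bk add_ac)
  have vP: "cvx (\<lambda>y. v y + P y)" by (intro cvx_add Cons.prems zonal_imp_cvx)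
  have "Z (\<lambda>y. v y + P y + k (b \<bullet> y) + k (b \<bullet> y)) + Z (\<lambda>y. v y + P y) =
    Z (\<lambda>y. v y + P y + k (b \<bullet> y)) + Z (\<lambda>y. v y + P y + k (b \<bullet> y))"
    using additive_ridge_cvx[OF k, of b] vP k unfolding additive_ridge_def by blast
  moreover have "Z (\<lambda>y. v y + P y + k (b \<bullet> y)) = 0" using IH[OF Cons.prems(4)] by (simp add: add_ac)
  moreover have "Z (\<lambda>y. v y + P y + k (b \<bullet> y) + k (b \<bullet> y)) = 0"
    using IH[OF zonal.ridge[OF Cons.prems(4) k, of b]] by (simp add: add_ac)
  ultimately show ?case by simp
qed

end

section \<open>Trigonometric polynomials as differences of zonal functions\<close>

inductive trig :: "('a::euclidean_space \<Rightarrow> real) \<Rightarrow> bool" where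
  zero: "trig (\<lambda>y. 0)"
| wave: "trig F \<Longrightarrow> trig (\<lambda>y. F y + (A * cos (b \<bullet> y) + B * sin (b \<bullet> y)))"

lemma cvx_real_second_derivative:
  fixes f :: "real \<Rightarrow> real"
  assumes "\<And>x. (f has_real_derivative f' x) (at x)" "\<And>x. (f' has_real_derivative f'' x) (at x)" "\<And>x. 0 \<le> f'' x"
  shows "cvx f"
  using f''_ge0_imp_convex[of UNIV f f' f''] assms by auto

lemma cvx_square: "0 \<le> c \<Longrightarrow> cvx (\<lambda>s::real. c / 2 * s\<^sup>2)"
  by (rule cvx_real_second_derivative[where f' = "\<lambda>s. c * s" and f'' = "\<lambda>s. c"])
    (auto intro!: derivative_eq_intros)

text \<open>The second derivative of the wave is at least
  \<open>- (\<bar>A\<bar> + \<bar>B\<bar>)\<close>, which the quadratic compensates.\<close>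

lemma cvx_wave: "cvx (\<lambda>s::real. (\<bar>A\<bar> + \<bar>B\<bar>) / 2 * s\<^sup>2 + (A * cos s + B * sin s))"
proof (rule cvx_real_second_derivative)
  show "((\<lambda>s::real. (\<bar>A\<bar> + \<bar>B\<bar>) / 2 * s\<^sup>2 + (A * cos s + B * sin s)) has_real_derivative
     (\<bar>A\<bar> + \<bar>B\<bar>) * s + (- A * sin s + B * cos s)) (at s)" for s
    by (auto intro!: derivative_eq_intros)
  show "((\<lambda>s::real. (\<bar>A\<bar> + \<bar>B\<bar>) * s + (- A * sin s + B * cos s)) has_real_derivative
     (\<bar>A\<bar> + \<bar>B\<bar>) + (- A * cos s - B * sin s)) (at s)" for s
    by (auto intro!: derivative_eq_intros)
  fix s :: real
  have "\<bar>A * cos s\<bar> \<le> \<bar>A\<bar>" "\<bar>B * sin s\<bar> \<le> \<bar>B\<bar>" unfolding abs_mult by (auto intro!: mult_left_le)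
  then show "0 \<le> (\<bar>A\<bar> + \<bar>B\<bar>) + (- A * cos s - B * sin s)" by (auto simp: abs_le_iff)
qed

text \<open>Each wave becomes a convex ridge once a quadratic in the same direction is added;
  \<open>K\<close> collects these quadratics.\<close>

lemma trig_zonal_difference:
  "trig F \<Longrightarrow> \<exists>K. (\<forall>(b, k)\<in>set K. cvx k) \<and> zonal (\<lambda>y. F y + (\<Sum>(b, k)\<leftarrow>K. k (b \<bullet> y)))"
proof (induction rule: trig.induct)
  case zero
  show ?case by (rule exI[of _ "[]"]) (simp add: zonal.zero)
next
  case (wave F A b B)
  then obtain K where K: "\<forall>(b, k)\<in>set K. cvx k" "zonal (\<lambda>y. F y + (\<Sum>(b, k)\<leftarrow>K. k (b \<bullet> y)))" by blast
  let ?k = "\<lambda>s::real. (\<bar>A\<bar> + \<bar>B\<bar>) / 2 * s\<^sup>2"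
  have "zonal (\<lambda>y. (F y + (\<Sum>(b, k)\<leftarrow>K. k (b \<bullet> y))) + (?k (b \<bullet> y) + (A * cos (b \<bullet> y) + B * sin (b \<bullet> y))))"
    by (rule zonal.ridge[OF K(2) cvx_wave[of A B]])
  then show ?case using K(1) cvx_square[of "\<bar>A\<bar> + \<bar>B\<bar>"]
    by (intro exI[of _ "(b, ?k) # K"]) (simp add: add_ac)
qed

lemma zonal_norm_square: "zonal (\<lambda>y::'a::euclidean_space. (y \<bullet> y) / 2)"
proof -
  have "zonal (\<lambda>y::'a. \<Sum>i\<in>Basis. 1 / 2 * (i \<bullet> y)\<^sup>2)"
    using zonal_sum[of "Basis::'a set" "\<lambda>_ s. 1 / 2 * s\<^sup>2" "\<lambda>i. i"] cvx_square[of 1] by simp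
  also have "(\<lambda>y::'a. \<Sum>i\<in>Basis. 1 / 2 * (i \<bullet> y)\<^sup>2) = (\<lambda>y. (y \<bullet> y) / 2)"
    by (auto simp: euclidean_inner[of y y for y] sum_divide_distrib power2_eq_square inner_commute)
  finally show ?thesis .
qed

lemma (in dual_val_para) trig_zero:
  assumes "trig F" "cvx (\<lambda>y. (y \<bullet> y) / 2 + F y)"
  shows "Z (\<lambda>y. (y \<bullet> y) / 2 + F y) = 0"
proof -
  obtain K where K: "\<forall>(b, k)\<in>set K. cvx k" "zonal (\<lambda>y. F y + (\<Sum>(b, k)\<leftarrow>K. k (b \<bullet> y)))"
    using trig_zonal_difference[OF assms(1)] by blast
  have "zonal (\<lambda>y. ((y \<bullet> y) / 2 + F y) + (\<Sum>(b, k)\<leftarrow>K. k (b \<bullet> y)))"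
    using zonal_add[OF zonal_norm_square K(2)] by (simp add: add_ac)
  from zonal_difference[OF assms(2) this K(1) zonal.zero] show ?thesis by simp
qed

section \<open>Periodic perturbations of the quadratic\<close>

lemma trig_const: "trig (\<lambda>y::'a::euclidean_space. c)"
  using trig.wave[OF trig.zero, of c "0::'a" 0] by simp

text \<open>By the product-to-sum formulas a wave of frequency \<open>c\<close> turns into waves of
  frequencies \<open>c - b\<close> and \<open>c + b\<close>.\<close>

lemma trig_times_cos:
  "trig F \<Longrightarrow> trig (\<lambda>y. F y * cos (b \<bullet> y))"
proof (induction rule: trig.induct)
  case zero
  show ?case using trig.zero by simp
next
  case (wave F A c B)
  have "trig (\<lambda>y. (F y * cos (b \<bullet> y) + (A / 2 * cos ((c - b) \<bullet> y) + B / 2 * sin ((c - b) \<bullet> y)))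
     + (A / 2 * cos ((c + b) \<bullet> y) + B / 2 * sin ((c + b) \<bullet> y)))"
    by (intro trig.wave wave.IH)
  then show ?case
    by (simp add: inner_diff_left inner_add_left cos_diff cos_add sin_diff sin_add algebra_simps add_divide_distrib)
qed

lemma trig_add: "trig F \<Longrightarrow> trig G \<Longrightarrow> trig (\<lambda>y. F y + G y)"
proof (induction rule: trig.induct)
  case (wave F A b B)
  from trig.wave[OF wave.IH[OF wave.prems], of A b B] show ?case by (simp add: add_ac)
qed simp

lemma trig_cmult: "trig F \<Longrightarrow> trig (\<lambda>y. c * F y)"
proof (induction rule: trig.induct)
  case (wave F A b B)
  from trig.wave[OF wave.IH, of "c * A" b "c * B"] show ?case by (simp add: algebra_simps)
qed (simp add: trig.zero)

text \<open>For \<open>\<omega> = 2 * pi / p\<close> this trigonometric polynomial is nonnegative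
  and attains its maximum 1 exactly at the points of the period lattice, so its normalised powers
  concentrate there.\<close>

definition bump :: "real \<Rightarrow> 'a::euclidean_space \<Rightarrow> real" where
  "bump \<omega> z = (\<Prod>i\<in>Basis. (1 + cos ((\<omega> *\<^sub>R i) \<bullet> z)) / 2)"

lemma trig_bump_power: "trig (\<lambda>z::'a::euclidean_space. bump \<omega> z ^ N)"
proof -
  have one: "trig (\<lambda>z. F z * ((1 + cos (b \<bullet> z)) / 2))" if "trig F" for F and b :: 'a
    using trig_cmult[OF trig_add[OF that trig_times_cos[OF that, of b]], of "1 / 2"] by (simp add: algebra_simps add_divide_distrib)
  have fin: "trig F \<Longrightarrow> trig (\<lambda>z. F z * (\<Prod>i\<in>I. (1 + cos ((\<omega> *\<^sub>R i) \<bullet> z)) / 2))" if "finite I" for F and I :: "'a set"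
    using that
  proof (induction I arbitrary: F)
    case (insert i I)
    show ?case using insert.IH[OF one[OF insert.prems, of "\<omega> *\<^sub>R i"]] insert.hyps by (simp add: mult_ac)
  qed simp
  show ?thesis
  proof (induction N)
    case 0 then show ?case using trig_const[of 1] by simp
  next
    case (Suc N)
    show ?case using fin[OF finite_Basis Suc] by (simp add: bump_def mult_ac)
  qed
qed

lemma trig_continuous: "trig F \<Longrightarrow> continuous_on S F"
  by (induction rule: trig.induct) (auto intro!: continuous_intros)

text \<open>The addition formulas take the dependence on \<open>y\<close> out of the integral; only
  the coefficients \<open>I1\<close> and \<open>I2\<close> remain integrals.\<close>

lemma trig_convolution:
  assumes f: "continuous_on (cbox a b) f"
  shows "trig K \<Longrightarrow> trig (\<lambda>y. integral (cbox a b) (\<lambda>z. f z * K (y - z)))"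
proof (induction rule: trig.induct)
  case zero
  show ?case using trig.zero by simp
next
  case (wave K A c B)
  define I1 where "I1 = integral (cbox a b) (\<lambda>z. f z * (A * cos (c \<bullet> z) - B * sin (c \<bullet> z)))"
  define I2 where "I2 = integral (cbox a b) (\<lambda>z. f z * (A * sin (c \<bullet> z) + B * cos (c \<bullet> z)))"
  have "integral (cbox a b) (\<lambda>z. f z * (K (y - z) + (A * cos (c \<bullet> (y - z)) + B * sin (c \<bullet> (y - z))))) =
     integral (cbox a b) (\<lambda>z. f z * K (y - z)) + (I1 * cos (c \<bullet> y) + I2 * sin (c \<bullet> y))" for y
  proof -
    have K: "continuous_on (cbox a b) (\<lambda>z. K (y - z))"
      by (rule continuous_on_compose2[OF trig_continuous[OF wave.hyps, of UNIV]]) (auto intro!: continuous_intros)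
    have "(\<lambda>z. f z * (K (y - z) + (A * cos (c \<bullet> (y - z)) + B * sin (c \<bullet> (y - z))))) =
       (\<lambda>z. f z * K (y - z) + (cos (c \<bullet> y) * (f z * (A * cos (c \<bullet> z) - B * sin (c \<bullet> z)))
          + sin (c \<bullet> y) * (f z * (A * sin (c \<bullet> z) + B * cos (c \<bullet> z)))))"
      by (simp add: inner_diff_right cos_diff sin_diff algebra_simps)
    moreover have "((\<lambda>z. f z * K (y - z)) has_integral integral (cbox a b) (\<lambda>z. f z * K (y - z))) (cbox a b)"
      by (intro integrable_integral integrable_continuous continuous_on_mult f K)
    moreover have "((\<lambda>z. f z * (A * cos (c \<bullet> z) - B * sin (c \<bullet> z))) has_integral I1) (cbox a b)"
      unfolding I1_def by (intro integrable_integral integrable_continuous continuous_on_mult f continuous_intros)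
    moreover have "((\<lambda>z. f z * (A * sin (c \<bullet> z) + B * cos (c \<bullet> z))) has_integral I2) (cbox a b)"
      unfolding I2_def by (intro integrable_integral integrable_continuous continuous_on_mult f continuous_intros)
    ultimately have "((\<lambda>z. f z * (K (y - z) + (A * cos (c \<bullet> (y - z)) + B * sin (c \<bullet> (y - z))))) has_integral
       integral (cbox a b) (\<lambda>z. f z * K (y - z)) + (cos (c \<bullet> y) * I1 + sin (c \<bullet> y) * I2)) (cbox a b)"
      by (simp only:) (intro has_integral_add has_integral_mult_right)
    from integral_unique[OF this] show ?thesis by (simp add: mult.commute)
  qed
  then show ?case using trig.wave[OF wave.IH, of I1 c I2] by simp
qed

text \<open>The box from \<open>a\<close> to \<open>b + s *\<^sub>R i\<close> is cut in two ways, at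
  \<open>a \<bullet> i + s\<close> and at \<open>b \<bullet> i\<close>. One part of each cut is a
  translate of the other by a period, so the two remaining boxes have equal integrals.\<close>

lemma periodic_box_shift_axis:
  fixes g :: "'a::euclidean_space \<Rightarrow> real"
  assumes g: "continuous_on UNIV g" and i: "i \<in> Basis" and per: "\<And>y. g (y + p *\<^sub>R i) = g y"
    and s: "0 \<le> s" "s \<le> p" and b: "b \<bullet> i = a \<bullet> i + p"
  shows "integral (cbox (a + s *\<^sub>R i) (b + s *\<^sub>R i)) g = integral (cbox a b) g"
proof -
  have int: "g integrable_on cbox c d" for c d
    by (rule integrable_continuous) (rule continuous_on_subset[OF g], simp)
  define Q where "Q x \<longleftrightarrow> (\<forall>j\<in>Basis - {i}. a \<bullet> j \<le> x \<bullet> j \<and> x \<bullet> j \<le> b \<bullet> j)" for x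
  have M: "x \<in> cbox (a + \<alpha> *\<^sub>R i) (b + \<beta> *\<^sub>R i) \<longleftrightarrow> Q x \<and> a \<bullet> i + \<alpha> \<le> x \<bullet> i \<and> x \<bullet> i \<le> b \<bullet> i + \<beta>" for x \<alpha> \<beta>
  proof -
    define P where "P j \<longleftrightarrow> (a + \<alpha> *\<^sub>R i) \<bullet> j \<le> x \<bullet> j \<and> x \<bullet> j \<le> (b + \<beta> *\<^sub>R i) \<bullet> j" for j
    have "x \<in> cbox (a + \<alpha> *\<^sub>R i) (b + \<beta> *\<^sub>R i) \<longleftrightarrow> (\<forall>j\<in>insert i (Basis - {i}). P j)"
      using i unfolding P_def by (simp only: mem_box insert_Diff)
    moreover have "(\<forall>j\<in>Basis - {i}. P j) \<longleftrightarrow> Q x"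
      unfolding Q_def P_def by (rule ball_cong[OF refl]) (use i in \<open>auto simp: inner_add_left inner_not_same_Basis\<close>)
    moreover have "P i \<longleftrightarrow> a \<bullet> i + \<alpha> \<le> x \<bullet> i \<and> x \<bullet> i \<le> b \<bullet> i + \<beta>"
      using i by (simp add: P_def inner_add_left)
    ultimately show ?thesis by auto
  qed
  note M0 = M[where \<alpha> = 0, simplified] M[where \<beta> = 0, simplified] M[where \<alpha> = 0 and \<beta> = 0, simplified]
  have s1: "cbox a (b + s *\<^sub>R i) \<inter> {x. x \<bullet> i \<le> a \<bullet> i + s} = cbox a (b + (s - p) *\<^sub>R i)"
    "cbox a (b + s *\<^sub>R i) \<inter> {x. x \<bullet> i \<ge> a \<bullet> i + s} = cbox (a + s *\<^sub>R i) (b + s *\<^sub>R i)"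
    "cbox a (b + s *\<^sub>R i) \<inter> {x. x \<bullet> i \<le> b \<bullet> i} = cbox a b"
    "cbox a (b + s *\<^sub>R i) \<inter> {x. x \<bullet> i \<ge> b \<bullet> i} = cbox (a + p *\<^sub>R i) (b + s *\<^sub>R i)"
    using b s by (auto simp: M M0)
  have "integral (cbox (a + p *\<^sub>R i) (b + s *\<^sub>R i)) g = integral (cbox a (b + (s - p) *\<^sub>R i)) g"
    using integral_shift_cbox[of "a + p *\<^sub>R i" "p *\<^sub>R i" "b + s *\<^sub>R i" g] by (simp add: per algebra_simps)
  then show ?thesis
    using integral_split[OF int i, of a "b + s *\<^sub>R i" "a \<bullet> i + s"] integral_split[OF int i, of a "b + s *\<^sub>R i" "b \<bullet> i"]
    unfolding s1 by simp
qed

text \<open>Long shifts are divided into \<open>N\<close> equal steps of at most one period;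
  negative shifts are undone by positive ones.\<close>

lemma periodic_box_shift_axis':
  fixes g :: "'a::euclidean_space \<Rightarrow> real"
  assumes g: "continuous_on UNIV g" and i: "i \<in> Basis" and per: "\<And>y. g (y + p *\<^sub>R i) = g y"
    and p: "0 < p" and b: "b \<bullet> i = a \<bullet> i + p"
  shows "integral (cbox (a + s *\<^sub>R i) (b + s *\<^sub>R i)) g = integral (cbox a b) g"
proof -
  have steps: "integral (cbox (a + (real N * r) *\<^sub>R i) (b + (real N * r) *\<^sub>R i)) g = integral (cbox a b) g"
    if r: "0 \<le> r" "r \<le> p" and b: "b \<bullet> i = a \<bullet> i + p" for N r a b
  proof (induction N)
    case (Suc N)
    have "integral (cbox ((a + (real N * r) *\<^sub>R i) + r *\<^sub>R i) ((b + (real N * r) *\<^sub>R i) + r *\<^sub>R i)) g =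
      integral (cbox (a + (real N * r) *\<^sub>R i) (b + (real N * r) *\<^sub>R i)) g"
      by (rule periodic_box_shift_axis[OF g i per r]) (simp add: inner_add_left b)
    then show ?case using Suc by (simp add: algebra_simps)
  qed simp
  have pos: "integral (cbox (a + s *\<^sub>R i) (b + s *\<^sub>R i)) g = integral (cbox a b) g"
    if s: "0 \<le> s" and b: "b \<bullet> i = a \<bullet> i + p" for s a b
  proof -
    obtain N :: nat where N: "s / p < real N" using reals_Archimedean2 by blast
    then have N0: "0 < real N" using s p by (smt (verit) divide_nonneg_pos)
    have "s / real N \<le> p" using N N0 p by (simp add: field_simps)
    then show ?thesis using steps[of "s / real N" b a N] s N0 b by simp
  qed
  show ?thesis
  proof (cases "0 \<le> s")
    case False
    have "integral (cbox ((a + s *\<^sub>R i) + (- s) *\<^sub>R i) ((b + s *\<^sub>R i) + (- s) *\<^sub>R i)) g =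
       integral (cbox (a + s *\<^sub>R i) (b + s *\<^sub>R i)) g"
      by (rule pos) (use False b i in \<open>auto simp: inner_add_left\<close>)
    then show ?thesis by simp
  qed (simp add: pos b)
qed

lemma periodic_integral_shift:
  fixes g :: "'a::euclidean_space \<Rightarrow> real"
  assumes g: "continuous_on UNIV g" and per: "\<And>i y. i \<in> Basis \<Longrightarrow> g (y + p *\<^sub>R i) = g y"
    and p: "0 < p" and b: "\<And>i. i \<in> Basis \<Longrightarrow> b \<bullet> i = a \<bullet> i + p"
  shows "integral (cbox a b) (\<lambda>z. g (z + y)) = integral (cbox a b) g"
proof -
  have "integral (cbox (a + (\<Sum>i\<in>I. (y \<bullet> i) *\<^sub>R i)) (b + (\<Sum>i\<in>I. (y \<bullet> i) *\<^sub>R i))) g = integral (cbox a b) g"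
    if "I \<subseteq> Basis" for I
    using finite_subset[OF that finite_Basis] that
  proof (induction I rule: finite_induct)
    case (insert i I)
    let ?S = "\<Sum>i\<in>I. (y \<bullet> i) *\<^sub>R i"
    have "integral (cbox ((a + ?S) + (y \<bullet> i) *\<^sub>R i) ((b + ?S) + (y \<bullet> i) *\<^sub>R i)) g = integral (cbox (a + ?S) (b + ?S)) g"
      by (rule periodic_box_shift_axis'[OF g _ _ p]) (use insert per b in \<open>auto simp: inner_add_left\<close>)
    then show ?case using insert by (simp add: add_ac)
  qed simp
  from this[of Basis] have "integral (cbox (a + y) (b + y)) g = integral (cbox a b) g"
    by (simp add: euclidean_representation)
  then show ?thesis using integral_shift_cbox[of "a + y" y "b + y" g] by simp
qed

text \<open>Laplace's method: away from 0 the powers of \<open>w\<close> are at most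
  \<open>\<theta> ^ N\<close>, while their integral is at least a positive constant times
  \<open>\<theta>' ^ N\<close> with \<open>\<theta> < \<theta>'\<close>.\<close>

lemma power_kernel_limit:
  fixes g w :: "'a::euclidean_space \<Rightarrow> real" and \<rho> :: real and C :: "'a set"
  defines "C \<equiv> cbox (- \<rho> *\<^sub>R One) (\<rho> *\<^sub>R One :: 'a)"
  assumes \<rho>: "0 < \<rho>" and g: "continuous_on UNIV g" and w: "continuous_on UNIV w"
    and w0: "w 0 = 1" and wpos: "\<And>z. 0 \<le> w z" and wlt: "\<And>z. z \<in> C \<Longrightarrow> z \<noteq> 0 \<Longrightarrow> w z < 1"
  shows "0 < integral C (\<lambda>z. w z ^ N)"
    "(\<lambda>N. integral C (\<lambda>z. g z * w z ^ N) / integral C (\<lambda>z. w z ^ N)) \<longlonglongrightarrow> g 0"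
proof -
  have int: "h integrable_on cbox c d" if "continuous_on UNIV h" for h :: "'a \<Rightarrow> real" and c d
    by (rule integrable_continuous) (rule continuous_on_subset[OF that], simp)
  define sm where "sm r = cbox (- r *\<^sub>R One) (r *\<^sub>R One :: 'a)" for r
  have lower: "\<theta> ^ N * measure lborel (sm r) \<le> integral C (\<lambda>z. w z ^ N)"
    if r: "0 < r" "r \<le> \<rho>" and \<theta>: "0 \<le> \<theta>" and "\<And>z. z \<in> sm r \<Longrightarrow> \<theta> \<le> w z" for \<theta> r N
  proof -
    have sub: "sm r \<subseteq> C" unfolding C_def sm_def subset_box(1) using r by auto
    have "\<theta> ^ N * measure lborel (sm r) = integral (sm r) (\<lambda>z. \<theta> ^ N)" unfolding sm_def by simp
    also have "\<dots> \<le> integral (sm r) (\<lambda>z. w z ^ N)" unfolding sm_def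
      by (rule integral_le) (use that in \<open>auto intro!: int continuous_intros w power_mono simp: sm_def\<close>)
    also have "\<dots> \<le> integral C (\<lambda>z. w z ^ N)"
      by (rule integral_subset_le[OF sub]) (auto simp: sm_def C_def wpos intro!: int continuous_intros w)
    finally show ?thesis .
  qed
  have csm: "0 < measure lborel (sm r)" if "0 < r" for r unfolding sm_def
    by (rule content_pos_lt) (use that in auto)
  have near: "\<exists>r>0. r \<le> \<rho> \<and> (\<forall>z\<in>sm r. \<theta> \<le> w z)" if "\<theta> < 1" for \<theta>
  proof -
    have "open {z. \<theta> < w z}" by (rule open_Collect_less) (auto intro!: continuous_intros w)
    moreover have "0 \<in> {z. \<theta> < w z}" using w0 that by simp
    ultimately obtain e where e: "0 < e" "cball 0 e \<subseteq> {z. \<theta> < w z}" by (meson open_contains_cball)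
    \<comment> \<open>The Euclidean norm is at most the sum of the \<open>DIM('a)\<close> absolute
      coordinates, hence the divisor.\<close>
    define r where "r = min \<rho> (e / real DIM('a))"
    have "sm r \<subseteq> cball 0 e"
    proof
      fix z assume "z \<in> sm r"
      then have "\<And>i. i \<in> Basis \<Longrightarrow> \<bar>z \<bullet> i\<bar> \<le> r" by (auto simp: sm_def mem_box abs_le_iff minus_le_iff)
      then have "norm z \<le> (\<Sum>i\<in>(Basis::'a set). r)" by (intro order_trans[OF norm_le_l1] sum_mono)
      also have "\<dots> \<le> e" unfolding r_def by (simp add: min_def field_simps)
      finally show "z \<in> cball 0 e" by simp
    qed
    then have "\<forall>z\<in>sm r. \<theta> \<le> w z" using e(2) by fastforce
    moreover have "0 < r" "r \<le> \<rho>" using e(1) \<rho> by (auto simp: r_def)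
    ultimately show ?thesis by blast
  qed
  show pos: "0 < integral C (\<lambda>z. w z ^ N)" for N
  proof -
    obtain r where r: "0 < r" "r \<le> \<rho>" "\<forall>z\<in>sm r. 1/2 \<le> w z" using near[of "1/2"] by auto
    then have "(1/2) ^ N * measure lborel (sm r) \<le> integral C (\<lambda>z. w z ^ N)" by (intro lower) auto
    moreover have "0 < (1/2) ^ N * measure lborel (sm r)" using csm[OF r(1)] by simp
    ultimately show ?thesis by linarith
  qed
  have cC: "compact C" by (simp add: C_def)
  have "bounded (g ` C)" by (rule compact_imp_bounded[OF compact_continuous_image[OF continuous_on_subset[OF g] cC]]) simp
  then obtain M0 where M0: "\<And>z. z \<in> C \<Longrightarrow> \<bar>g z\<bar> \<le> M0" by (auto simp: bounded_iff)
  define M where "M = M0 + \<bar>g 0\<bar>"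
  have zC: "0 \<in> C" using \<rho> by (auto simp: C_def mem_box)
  have M: "0 \<le> M" "\<And>z. z \<in> C \<Longrightarrow> \<bar>g z - g 0\<bar> \<le> M" using M0 M0[OF zC] unfolding M_def by (fastforce)+
  show "(\<lambda>N. integral C (\<lambda>z. g z * w z ^ N) / integral C (\<lambda>z. w z ^ N)) \<longlonglongrightarrow> g 0"
  proof (rule LIMSEQ_I)
    fix e :: real assume e: "0 < e"
    have "isCont g 0" using g by (simp add: continuous_on_eq_continuous_at)
    then obtain d where d: "0 < d" "\<And>z. norm z < d \<Longrightarrow> \<bar>g z - g 0\<bar> < e / 2"
      using e unfolding continuous_at_eps_delta dist_norm by (metis diff_zero half_gt_zero real_norm_def)
    define K where "K = C - ball 0 d"
    have cK: "compact K" unfolding K_def using cC by (simp add: compact_diff)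
    obtain \<theta> where \<theta>: "0 \<le> \<theta>" "\<theta> < 1" "\<And>z. z \<in> K \<Longrightarrow> w z \<le> \<theta>"
    proof (cases "K = {}")
      case True then show ?thesis using that[of 0] by auto
    next
      case False
      obtain z0 where z0: "z0 \<in> K" "\<And>z. z \<in> K \<Longrightarrow> w z \<le> w z0"
        using continuous_attains_sup[OF cK False continuous_on_subset[OF w]] by auto
      moreover have "w z0 < 1" using z0(1) d(1) by (intro wlt) (auto simp: K_def)
      ultimately show ?thesis using that[of "w z0"] wpos by auto
    qed
    define \<theta>' where "\<theta>' = (1 + \<theta>) / 2"
    have th': "0 < \<theta>'" "\<theta> < \<theta>'" "\<theta>' < 1" using \<theta> by (auto simp: \<theta>'_def)
    obtain r where r: "0 < r" "r \<le> \<rho>" "\<forall>z\<in>sm r. \<theta>' \<le> w z" using near[OF th'(3)] by auto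
    \<comment> \<open>With this \<open>A\<close>, the lower bound of the kernel integral times
      \<open>A * (\<theta> / \<theta>') ^ N\<close> is exactly the error term from points outside
      the ball of radius \<open>d\<close>.\<close>
    define A where "A = M * measure lborel C / measure lborel (sm r)"
    have "(\<lambda>N. A * (\<theta> / \<theta>') ^ N) \<longlonglongrightarrow> A * 0"
      using \<theta> th' by (intro tendsto_mult tendsto_const LIMSEQ_realpow_zero) auto
    then obtain N0 where N0: "\<And>N. N \<ge> N0 \<Longrightarrow> \<bar>A * (\<theta> / \<theta>') ^ N\<bar> < e / 2"
      using LIMSEQ_D[of _ 0 "e / 2"] e by fastforce
    have "norm (integral C (\<lambda>z. g z * w z ^ N) / integral C (\<lambda>z. w z ^ N) - g 0) < e" if N: "N \<ge> N0" for N
    proof -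
      let ?W = "integral C (\<lambda>z. w z ^ N)"
      have "integral C (\<lambda>z. g z * w z ^ N) - g 0 * ?W = integral C (\<lambda>z. g z * w z ^ N - g 0 * w z ^ N)"
        unfolding C_def by (subst integral_diff) (auto intro!: int continuous_intros w g)
      also have "\<bar>\<dots>\<bar> \<le> integral C (\<lambda>z. e / 2 * w z ^ N + M * \<theta> ^ N)"
        unfolding real_norm_def[symmetric] C_def
      proof (rule integral_norm_bound_integral)
        fix z :: 'a assume z: "z \<in> cbox (- \<rho> *\<^sub>R One) (\<rho> *\<^sub>R One)"
        have "norm (g z * w z ^ N - g 0 * w z ^ N) = \<bar>g z - g 0\<bar> * w z ^ N"
          using wpos[of z] by (simp add: left_diff_distrib[symmetric] abs_mult)
        also have "\<dots> \<le> e / 2 * w z ^ N + M * \<theta> ^ N"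
        proof (cases "norm z < d")
          case True
          have "\<bar>g z - g 0\<bar> * w z ^ N \<le> e / 2 * w z ^ N" using d(2)[OF True] wpos[of z] by (intro mult_right_mono) auto
          then show ?thesis using M(1) \<theta>(1) by (simp add: add_increasing2)
        next
          case False
          then have "w z \<le> \<theta>" using z by (intro \<theta>) (auto simp: K_def C_def)
          then have "\<bar>g z - g 0\<bar> * w z ^ N \<le> M * \<theta> ^ N" using M(2)[of z] z wpos[of z] M(1)
            by (intro mult_mono power_mono) (auto simp: C_def)
          then show ?thesis using e wpos[of z] by (simp add: add_increasing)
        qed
        finally show "norm (g z * w z ^ N - g 0 * w z ^ N) \<le> e / 2 * w z ^ N + M * \<theta> ^ N" .
      qed (auto intro!: int continuous_intros w g)
      also have "\<dots> = e / 2 * ?W + M * \<theta> ^ N * measure lborel C"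
        unfolding C_def by (subst integral_add) (auto intro!: int continuous_intros w)
      finally have 1: "\<bar>integral C (\<lambda>z. g z * w z ^ N) - g 0 * ?W\<bar> \<le> e / 2 * ?W + M * \<theta> ^ N * measure lborel C" .
      have low: "\<theta>' ^ N * measure lborel (sm r) \<le> ?W" using r th' by (intro lower) auto
      have "A * (\<theta> / \<theta>') ^ N * (\<theta>' ^ N * measure lborel (sm r)) = M * \<theta> ^ N * measure lborel C"
        unfolding A_def power_divide using csm[OF r(1)] th'(1) by simp
      moreover have "A * (\<theta> / \<theta>') ^ N * (\<theta>' ^ N * measure lborel (sm r)) \<le> A * (\<theta> / \<theta>') ^ N * ?W"
        using low M(1) csm[OF r(1)] \<theta>(1) th'(1) by (intro mult_left_mono) (auto simp: A_def)
      ultimately have 2: "M * \<theta> ^ N * measure lborel C \<le> A * (\<theta> / \<theta>') ^ N * ?W" by simp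
      also have "\<dots> < e / 2 * ?W" using N0[OF N] pos[of N] by (intro mult_strict_right_mono) auto
      finally have "\<bar>integral C (\<lambda>z. g z * w z ^ N) - g 0 * ?W\<bar> < e * ?W" using 1 by simp
      moreover have "integral C (\<lambda>z. g z * w z ^ N) / ?W - g 0 = (integral C (\<lambda>z. g z * w z ^ N) - g 0 * ?W) / ?W"
        using pos[of N] by (simp add: diff_divide_distrib)
      ultimately show ?thesis using pos[of N] by (simp add: abs_divide pos_divide_less_eq)
    qed
    then show "\<exists>N0. \<forall>N\<ge>N0. norm (integral C (\<lambda>z. g z * w z ^ N) / integral C (\<lambda>z. w z ^ N) - g 0) < e" by blast
  qed
qed

lemma bump_props:
  fixes z :: "'a::euclidean_space"
  assumes p: "0 < p"
  defines "\<omega> \<equiv> 2 * pi / p"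
  shows "bump \<omega> (0::'a) = 1" "0 \<le> bump \<omega> z" "bump \<omega> (- z) = bump \<omega> z"
    "i \<in> Basis \<Longrightarrow> bump \<omega> (z + p *\<^sub>R i) = bump \<omega> z"
    "z \<in> cbox (- (p / 2) *\<^sub>R One) ((p / 2) *\<^sub>R One) \<Longrightarrow> z \<noteq> 0 \<Longrightarrow> bump \<omega> z < 1"
proof -
  have fac: "0 \<le> (1 + cos x) / 2" "(1 + cos x) / 2 \<le> 1" for x :: real
  proof -
    have "0 \<le> 1 + cos x" using cos_ge_minus_one[of x] by linarith
    then show "0 \<le> (1 + cos x) / 2" by simp
    show "(1 + cos x) / 2 \<le> 1" by simp
  qed
  show "bump \<omega> (0::'a) = 1" "0 \<le> bump \<omega> z" "bump \<omega> (- z) = bump \<omega> z"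
    using fac by (auto simp: bump_def intro!: prod_nonneg)
  show "bump \<omega> (z + p *\<^sub>R i) = bump \<omega> z" if i: "i \<in> Basis"
    unfolding bump_def
  proof (rule prod.cong[OF refl])
    fix j :: 'a assume j: "j \<in> Basis"
    have "(\<omega> *\<^sub>R j) \<bullet> (z + p *\<^sub>R i) = (\<omega> *\<^sub>R j) \<bullet> z + (if i = j then 2 * pi else 0)"
      using i j p by (simp add: inner_add_right inner_Basis \<omega>_def algebra_simps)
    then show "(1 + cos ((\<omega> *\<^sub>R j) \<bullet> (z + p *\<^sub>R i))) / 2 = (1 + cos ((\<omega> *\<^sub>R j) \<bullet> z)) / 2" by simp
  qed
  assume z: "z \<in> cbox (- (p / 2) *\<^sub>R One) ((p / 2) *\<^sub>R One)" "z \<noteq> 0"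
  then obtain i where i: "i \<in> Basis" "z \<bullet> i \<noteq> 0" using euclidean_all_zero_iff by blast
  \<comment> \<open>Half of the angle: \<open>cos (2 * x) = 1 - 2 * (sin x)\<^sup>2\<close>, and on
    the cell \<open>x\<close> ranges between \<open>- (pi / 2)\<close> and \<open>pi / 2\<close>,
    where the sine vanishes only at 0.\<close>
  define x where "x = \<omega> * (z \<bullet> i) / 2"
  have zi: "- (p / 2) \<le> z \<bullet> i" "z \<bullet> i \<le> p / 2" using z(1) i(1) by (auto simp: mem_box)
  have x: "x = (pi / p) * (z \<bullet> i)" by (simp add: x_def \<omega>_def)
  have x0: "x \<noteq> 0" using i p by (simp add: x)
  have "x \<le> (pi / p) * (p / 2)" "(pi / p) * (- (p / 2)) \<le> x" unfolding x using zi p by (intro mult_left_mono; simp)+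
  then have xb: "- (pi / 2) \<le> x" "x \<le> pi / 2" using p by auto
  have "sin x \<noteq> 0"
  proof (cases "x > 0")
    case True then show ?thesis using sin_gt_zero[of x] xb pi_gt_zero by linarith
  next
    case False then show ?thesis using sin_gt_zero[of "- x"] xb x0 pi_gt_zero by auto
  qed
  then have "cos (2 * x) < 1" by (simp add: cos_double_sin)
  moreover have "(\<omega> *\<^sub>R i) \<bullet> z = 2 * x" by (simp add: x_def inner_commute)
  ultimately have lt: "(1 + cos ((\<omega> *\<^sub>R i) \<bullet> z)) / 2 < 1" by simp
  have "bump \<omega> z = (1 + cos ((\<omega> *\<^sub>R i) \<bullet> z)) / 2 * (\<Prod>j\<in>Basis - {i}. (1 + cos ((\<omega> *\<^sub>R j) \<bullet> z)) / 2)"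
    unfolding bump_def using i(1) by (rule prod.remove[OF finite_Basis])
  also have "\<dots> \<le> (1 + cos ((\<omega> *\<^sub>R i) \<bullet> z)) / 2 * 1"
    using fac by (intro mult_left_mono prod_le_1) auto
  finally show "bump \<omega> z < 1" using lt by linarith
qed

lemma bump_continuous: "continuous_on S (bump \<omega>)"
  unfolding bump_def[abs_def] by (intro continuous_intros) auto

text \<open>\<open>F N\<close> averages translates of \<open>f\<close> against a normalised power of
  \<open>bump\<close>, so it is a trigonometric polynomial and tends to \<open>f\<close>. The
  quadratic keeps \<open>F N\<close> admissible, because convexity of its sum with \<open>f\<close>
  is a condition on all translates of \<open>f\<close> alike.\<close>

lemma (in dual_val_para) periodic_zero:
  fixes f :: "'a \<Rightarrow> real"
  assumes p: "0 < p" and per: "\<And>i y. i \<in> Basis \<Longrightarrow> f (y + p *\<^sub>R i) = f y"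
    and cv: "cvx (\<lambda>y. (y \<bullet> y) / 2 + f y)"
  shows "Z (\<lambda>y. (y \<bullet> y) / 2 + f y) = 0"
proof -
  define \<omega> where "\<omega> = 2 * pi / p"
  define w where "w = (bump \<omega> :: 'a \<Rightarrow> real)"
  define C where "C = cbox (- (p / 2) *\<^sub>R One) ((p / 2) *\<^sub>R One :: 'a)"
  define W where "W N = integral C (\<lambda>z. w z ^ N)" for N
  define F where "F N y = integral C (\<lambda>z. f (z + y) * w z ^ N) / W N" for N y
  note w = bump_props[OF p, where 'a='a, folded \<omega>_def, folded w_def]
  have w_cont: "continuous_on S w" for S unfolding w_def by (rule bump_continuous)
  have "continuous_on UNIV (\<lambda>y. (y \<bullet> y) / 2 + f y)" by (rule convex_on_continuous[OF open_UNIV cv])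
  moreover have "continuous_on UNIV (\<lambda>y::'a. (y \<bullet> y) / 2)" by (intro continuous_intros) auto
  ultimately have "continuous_on UNIV (\<lambda>y. ((y \<bullet> y) / 2 + f y) - (y \<bullet> y) / 2)" by (rule continuous_on_diff)
  then have f: "continuous_on UNIV f" by simp
  have fs: "continuous_on S (\<lambda>z. f (z + y))" for S y
    by (rule continuous_on_compose2[OF f]) (auto intro!: continuous_intros)
  have W_pos: "0 < W N" for N
    unfolding W_def C_def
    by (rule power_kernel_limit(1)[OF _ f w_cont w(1,2)]) (use p w(5) in auto)
  have lim: "(\<lambda>N. F N y) \<longlonglongrightarrow> f y" for y
    using power_kernel_limit(2)[OF _ fs[of UNIV y] w_cont w(1,2), of "p / 2"] p w(5)
    unfolding F_def W_def C_def by simp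
  have int: "(\<lambda>z. f (z + y) * w z ^ N) integrable_on C" for y N
    unfolding C_def by (intro integrable_continuous continuous_intros fs w_cont)
  have trigF: "trig (F N)" for N
  proof -
    \<comment> \<open>Periodicity allows a change of variable over the fixed cell, which moves
      \<open>y\<close> from \<open>f\<close> into the kernel.\<close>
    have "integral C (\<lambda>z. f (z + y) * w z ^ N) = integral C (\<lambda>z. f z * w (y - z) ^ N)" for y
    proof -
      have g: "continuous_on UNIV (\<lambda>z. f z * w (y - z) ^ N)"
        by (intro continuous_intros f continuous_on_compose2[OF w_cont[of UNIV]]) auto
      have gper: "f (z + p *\<^sub>R i) * w (y - (z + p *\<^sub>R i)) ^ N = f z * w (y - z) ^ N" if "i \<in> Basis" for z i
        using per[OF that, of z] w(4)[OF that, of "y - z - p *\<^sub>R i"] by (simp add: algebra_simps)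
      have "integral C (\<lambda>z. f (z + y) * w (y - (z + y)) ^ N) = integral C (\<lambda>z. f z * w (y - z) ^ N)"
        unfolding C_def by (rule periodic_integral_shift[OF g gper p]) auto
      then show ?thesis using w(3) by simp
    qed
    then have "F N = (\<lambda>y. inverse (W N) * integral C (\<lambda>z. f z * w (y - z) ^ N))"
      by (auto simp: F_def divide_inverse mult.commute)
    moreover have "trig (\<lambda>y. integral C (\<lambda>z. f z * w (y - z) ^ N))"
      unfolding C_def w_def by (rule trig_convolution[OF continuous_on_subset[OF f] trig_bump_power]) simp
    ultimately show ?thesis using trig_cmult by simp
  qed
  have cvF: "cvx (\<lambda>y. (y \<bullet> y) / 2 + F N y)" for N
  proof (rule convex_onI)
    fix t :: real and x y :: 'a assume t: "0 < t" "t < 1"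
    let ?m = "(1 - t) *\<^sub>R x + t *\<^sub>R y"
    \<comment> \<open>\<open>\<kappa>\<close> is the convexity defect of the quadratic on the
      segment. Moving the segment by \<open>z\<close> does not change it, so the inequality below
      can be averaged over \<open>z\<close>.\<close>
    define \<kappa> where "\<kappa> = (1 - t) * ((x \<bullet> x) / 2) + t * ((y \<bullet> y) / 2) - (?m \<bullet> ?m) / 2"
    have *: "f (z + ?m) \<le> (1 - t) * f (z + x) + t * f (z + y) + \<kappa>" for z
    proof -
      have "(1 - t) *\<^sub>R (z + x) + t *\<^sub>R (z + y) = z + ?m" by (simp add: algebra_simps)
      then have "((z + ?m) \<bullet> (z + ?m)) / 2 + f (z + ?m) \<le>
        (1 - t) * (((z + x) \<bullet> (z + x)) / 2 + f (z + x)) + t * (((z + y) \<bullet> (z + y)) / 2 + f (z + y))"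
        using convex_onD[OF cv, of t "z + x" "z + y"] t by simp
      moreover have "(1 - t) * (((z + x) \<bullet> (z + x)) / 2) + t * (((z + y) \<bullet> (z + y)) / 2) - ((z + ?m) \<bullet> (z + ?m)) / 2 = \<kappa>"
        unfolding \<kappa>_def by (simp add: inner_add_left inner_add_right inner_commute algebra_simps add_divide_distrib diff_divide_distrib)
      ultimately show ?thesis by (simp add: distrib_left)
    qed
    have "integral C (\<lambda>z. f (z + ?m) * w z ^ N) \<le>
      integral C (\<lambda>z. (1 - t) * (f (z + x) * w z ^ N) + t * (f (z + y) * w z ^ N) + \<kappa> * w z ^ N)"
    proof (rule integral_le)
      fix z assume "z \<in> C"
      show "f (z + ?m) * w z ^ N \<le> (1 - t) * (f (z + x) * w z ^ N) + t * (f (z + y) * w z ^ N) + \<kappa> * w z ^ N"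
        using mult_right_mono[OF *[of z], of "w z ^ N"] w(2) by (simp add: algebra_simps)
    qed (auto simp: C_def intro!: integrable_continuous continuous_intros fs w_cont)
    also have "\<dots> = (1 - t) * integral C (\<lambda>z. f (z + x) * w z ^ N) + t * integral C (\<lambda>z. f (z + y) * w z ^ N) + \<kappa> * W N"
    proof (rule integral_unique)
      have "((\<lambda>z. w z ^ N) has_integral W N) C"
        unfolding W_def C_def by (intro integrable_integral integrable_continuous continuous_intros w_cont)
      then show "((\<lambda>z. (1 - t) * (f (z + x) * w z ^ N) + t * (f (z + y) * w z ^ N) + \<kappa> * w z ^ N) has_integral
        (1 - t) * integral C (\<lambda>z. f (z + x) * w z ^ N) + t * integral C (\<lambda>z. f (z + y) * w z ^ N) + \<kappa> * W N) C"
        by (intro has_integral_add has_integral_mult_right integrable_integral[OF int])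
    qed
    finally have "integral C (\<lambda>z. f (z + ?m) * w z ^ N) / W N \<le> ((1 - t) * integral C (\<lambda>z. f (z + x) * w z ^ N) + t * integral C (\<lambda>z. f (z + y) * w z ^ N) + \<kappa> * W N) / W N"
      using W_pos[of N] by (intro divide_right_mono) auto
    also have "\<dots> = (1 - t) * F N x + t * F N y + \<kappa>"
      unfolding F_def using W_pos[of N] by (simp add: add_divide_distrib)
    finally have "F N ?m \<le> (1 - t) * F N x + t * F N y + \<kappa>" by (simp only: F_def)
    then show "(?m \<bullet> ?m) / 2 + F N ?m \<le> (1 - t) * ((x \<bullet> x) / 2 + F N x) + t * ((y \<bullet> y) / 2 + F N y)"
      unfolding \<kappa>_def distrib_left by linarith
  qed simp
  have "(\<lambda>N. Z (\<lambda>y. (y \<bullet> y) / 2 + F N y)) \<longlonglongrightarrow> Z (\<lambda>y. (y \<bullet> y) / 2 + f y)"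
    by (rule cont[OF cvF cv]) (intro tendsto_intros lim)
  then show ?thesis using trig_zero[OF trigF cvF] LIMSEQ_unique[OF _ tendsto_const] by auto
qed

section \<open>Suprema over lattice translates\<close>

definition lattice :: "real \<Rightarrow> 'a::euclidean_space set" where
  "lattice p = {z. \<forall>i\<in>Basis. \<exists>k::int. z \<bullet> i = p * k}"

lemma lattice_zero: "0 \<in> lattice p"
  by (auto simp: lattice_def intro!: exI[of _ "0::int"])

lemma lattice_shift: "i \<in> Basis \<Longrightarrow> z \<in> lattice p \<Longrightarrow> z + (of_int m * p) *\<^sub>R i \<in> lattice p"
proof -
  assume i: "i \<in> Basis" and z: "z \<in> lattice p"
  have "\<exists>k::int. (z + (of_int m * p) *\<^sub>R i) \<bullet> j = p * k" if j: "j \<in> Basis" for j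
  proof -
    obtain k :: int where "z \<bullet> j = p * k" using z j by (auto simp: lattice_def)
    then show ?thesis using i j
      by (intro exI[of _ "k + (if i = j then m else 0)"]) (auto simp: inner_add_left inner_Basis algebra_simps)
  qed
  then show ?thesis by (simp add: lattice_def)
qed

lemma lattice_norm_ge:
  assumes "z \<in> lattice p" "z \<noteq> 0" "0 < p" shows "p \<le> norm z"
proof -
  obtain i where i: "i \<in> Basis" "z \<bullet> i \<noteq> 0" using assms(2) euclidean_all_zero_iff by blast
  obtain k :: int where k: "z \<bullet> i = p * k" using assms(1) i by (auto simp: lattice_def)
  then have "k \<noteq> 0" using i by auto
  then have "1 \<le> \<bar>real_of_int k\<bar>" by linarith
  then have "p \<le> \<bar>z \<bullet> i\<bar>" using assms(3) by (simp add: k abs_mult)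
  then show ?thesis using Basis_le_norm[OF i(1), of z] by linarith
qed

text \<open>The quadratic plus a translate of \<open>u\<close> is a translate of \<open>v\<close>
  plus an affine function, hence convex, and so is the supremum. Since \<open>v\<close> grows at
  most linearly, on a wide lattice the supremum at a fixed \<open>y\<close> is attained at
  \<open>z = 0\<close>.\<close>

lemma (in dual_val_para) lipschitz_zero:
  assumes v: "cvx v" and L: "0 \<le> L" "\<And>x y. \<bar>v x - v y\<bar> \<le> L * norm (x - y)"
  shows "Z v = 0"
proof -
  define u where "u x = v x - (x \<bullet> x) / 2" for x
  define f where "f p y = (SUP z\<in>lattice p. u (y - z))" for p y
  have ub: "u x \<le> \<bar>v 0\<bar> + L * norm x - (norm x)\<^sup>2 / 2" for x
    using L(2)[of x 0] by (simp add: u_def power2_norm_eq_inner)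
  have ub': "u x \<le> \<bar>v 0\<bar> + L\<^sup>2 / 2" for x
  proof -
    have "0 \<le> (norm x - L)\<^sup>2 / 2" by simp
    also have "\<dots> = (norm x)\<^sup>2 / 2 - L * norm x + L\<^sup>2 / 2" by (simp add: power2_diff field_simps)
    finally show ?thesis using ub[of x] by linarith
  qed
  have bdd: "bdd_above ((\<lambda>z. u (y - z)) ` lattice p)" for y p by (rule bdd_aboveI2) (rule ub')
  have ne: "lattice p \<noteq> ({} :: 'a set)" for p using lattice_zero by auto
  have upper: "z \<in> lattice p \<Longrightarrow> u (y - z) \<le> f p y" for z y p
    unfolding f_def by (rule cSUP_upper[OF _ bdd])
  have least: "(\<And>z. z \<in> lattice p \<Longrightarrow> u (y - z) \<le> B) \<Longrightarrow> f p y \<le> B" for y p B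
    unfolding f_def by (rule cSUP_least[OF ne])
  have per: "f p (y + p *\<^sub>R i) = f p y" if i: "i \<in> Basis" for p y i
  proof (rule antisym; rule least)
    fix z :: 'a assume z: "z \<in> lattice p"
    show "u (y + p *\<^sub>R i - z) \<le> f p y"
      using upper[OF lattice_shift[OF i z, of "-1"], of y] by (simp add: algebra_simps)
    show "u (y - z) \<le> f p (y + p *\<^sub>R i)"
      using upper[OF lattice_shift[OF i z, of 1], of "y + p *\<^sub>R i"] by (simp add: algebra_simps)
  qed
  have cv: "cvx (\<lambda>y. (y \<bullet> y) / 2 + f p y)" for p
  proof (rule convex_onI)
    fix t :: real and x y :: 'a assume t: "0 < t" "t < 1"
    let ?m = "(1 - t) *\<^sub>R x + t *\<^sub>R y"
    have "f p ?m \<le> (1 - t) * ((x \<bullet> x) / 2 + f p x) + t * ((y \<bullet> y) / 2 + f p y) - (?m \<bullet> ?m) / 2"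
    proof (rule least)
      fix z :: 'a assume z: "z \<in> lattice p"
      define l where "l y = v (y - z) + (z \<bullet> y - (z \<bullet> z) / 2)" for y
      have l: "l y = (y \<bullet> y) / 2 + u (y - z)" for y
      proof -
        have "(y - z) \<bullet> (y - z) = y \<bullet> y - 2 * (z \<bullet> y) + z \<bullet> z"
          by (simp add: inner_diff_left inner_diff_right inner_commute[of y z])
        then show ?thesis unfolding l_def u_def by (simp add: add_divide_distrib diff_divide_distrib)
      qed
      have "cvx l" unfolding l_def
        by (intro cvx_add cvx_compose_affine[OF v] cvx_affine[of z "- ((z \<bullet> z) / 2)", simplified]) (simp add: algebra_simps)
      then have "l ?m \<le> (1 - t) * l x + t * l y" using convex_onD[of UNIV l t x y] t by simp
      also have "\<dots> \<le> (1 - t) * ((x \<bullet> x) / 2 + f p x) + t * ((y \<bullet> y) / 2 + f p y)"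
        unfolding l using t upper[OF z] by (intro add_mono mult_left_mono) auto
      finally show "u (?m - z) \<le> (1 - t) * ((x \<bullet> x) / 2 + f p x) + t * ((y \<bullet> y) / 2 + f p y) - (?m \<bullet> ?m) / 2"
        unfolding l by linarith
    qed
    then show "(?m \<bullet> ?m) / 2 + f p ?m \<le> (1 - t) * ((x \<bullet> x) / 2 + f p x) + t * ((y \<bullet> y) / 2 + f p y)" by linarith
  qed simp
  have ev: "\<forall>\<^sub>F k in sequentially. (y \<bullet> y) / 2 + f (real (Suc k)) y = v y" for y
  proof -
    \<comment> \<open>Once the lattice spacing exceeds \<open>S\<close>, every nonzero
      \<open>z\<close> has \<open>norm (y - z)\<close> at least
      \<open>2 * L + 2 + \<bar>v 0\<bar> + \<bar>u y\<bar>\<close>. There the quadratic term exceeds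
      the linear one by at least \<open>norm (y - z)\<close>.\<close>
    define S where "S = norm y + 2 * L + 2 + \<bar>v 0\<bar> + \<bar>u y\<bar>"
    obtain K :: nat where K: "S \<le> real K" using real_arch_simple by blast
    have "f (real (Suc k)) y = u y" if "k \<ge> K" for k
    proof (rule antisym)
      show "u y \<le> f (real (Suc k)) y" using upper[OF lattice_zero, of y] by simp
      show "f (real (Suc k)) y \<le> u y"
      proof (rule least)
        fix z :: 'a assume z: "z \<in> lattice (real (Suc k))"
        show "u (y - z) \<le> u y"
        proof (cases "z = 0")
          case False
          define s where "s = norm (y - z)"
          have "S \<le> norm z" using lattice_norm_ge[OF z False] K that by simp
          then have s: "2 * L + 2 + \<bar>v 0\<bar> + \<bar>u y\<bar> \<le> s"
            using norm_triangle_ineq2[of z y] by (simp add: s_def S_def norm_minus_commute)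
          have "s * 1 \<le> s * (s / 2 - L)" using s L(1) by (intro mult_left_mono) auto
          then have "s \<le> s\<^sup>2 / 2 - L * s" by (simp add: power2_eq_square right_diff_distrib mult.commute)
          then show ?thesis using ub[of "y - z"] s L(1) unfolding s_def[symmetric] by linarith
        qed simp
      qed
    qed
    then show ?thesis unfolding eventually_sequentially u_def by (intro exI[of _ K]) auto
  qed
  have "(\<lambda>k. Z (\<lambda>y. (y \<bullet> y) / 2 + f (real (Suc k)) y)) \<longlonglongrightarrow> Z v"
    by (rule cont[OF cv v]) (rule tendsto_eventually[OF ev])
  moreover have "Z (\<lambda>y. (y \<bullet> y) / 2 + f (real (Suc k)) y) = 0" for k
    by (rule periodic_zero[OF _ per cv]) auto
  ultimately show ?thesis using LIMSEQ_unique[OF _ tendsto_const] by auto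
qed

section \<open>Densities on hinge frames\<close>

text \<open>All hinges vanish at the common apex \<open>\<tau>\<close>. For independent
  \<open>a i\<close> this is the conjugate of the linear function with slope \<open>\<tau>\<close>
  on the parallelepiped spanned by the \<open>a i\<close>.\<close>

definition hinge_frame :: "('n \<Rightarrow> real^'n) \<Rightarrow> real^'n \<Rightarrow> real^'n::finite \<Rightarrow> real" where
  "hinge_frame a \<tau> y = (\<Sum>i\<in>UNIV. max 0 (a i \<bullet> (y - \<tau>)))"

lemma cvx_sum: "finite I \<Longrightarrow> (\<And>i. i \<in> I \<Longrightarrow> cvx (f i)) \<Longrightarrow> cvx (\<lambda>y. \<Sum>i\<in>I. f i y)"
  by (induction I rule: finite_induct) (simp_all add: cvx_const cvx_add)

lemma cvx_hinge_at: "cvx (\<lambda>y. max 0 (a \<bullet> (y - \<tau>)))"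
  using cvx_hinge[of a "a \<bullet> \<tau>"] by (simp add: inner_diff_right)

lemma cvx_hinge_frame: "cvx (hinge_frame a \<tau>)"
  unfolding hinge_frame_def[abs_def] by (intro cvx_sum cvx_hinge_at) simp

lemma hinge_frame_remove:
  "hinge_frame a \<tau> y = (\<Sum>i\<in>UNIV - {m}. max 0 (a i \<bullet> (y - \<tau>))) + max 0 (a m \<bullet> (y - \<tau>))"
  unfolding hinge_frame_def by (subst sum.remove[of UNIV m]) (auto simp: add.commute)

lemma hinge_frame_upd:
  "hinge_frame (a(m := b)) \<tau> y = (\<Sum>i\<in>UNIV - {m}. max 0 (a i \<bullet> (y - \<tau>))) + max 0 (b \<bullet> (y - \<tau>))"
  unfolding hinge_frame_remove[of "a(m := b)" \<tau> y m] by simp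

section \<open>The determinant rule and the density\<close>

locale dual_val_cart = dual_val Z for Z :: "(real^'n::finite \<Rightarrow> real) \<Rightarrow> real"
begin

lemma partial_frame_zero:
  fixes I :: "'n set"
  assumes "I \<noteq> UNIV"
  shows "Z (\<lambda>y. \<Sum>i\<in>I. max 0 (a i \<bullet> (y - \<tau>))) = 0"
proof -
  have "card I < CARD('n)" using psubset_card_mono[of UNIV I] assms by auto
  then have "dim (a ` I) < DIM(real^'n)"
    using dim_le_card'[of "a ` I"] card_image_le[of I a] by simp
  then obtain d where d: "d \<noteq> 0" "\<And>y. y \<in> span (a ` I) \<Longrightarrow> orthogonal d y"
    using orthogonal_to_subspace_exists by blast
  have ad: "a i \<bullet> d = 0" if "i \<in> I" for i
    using d(2)[OF span_base, of "a i"] that by (simp add: orthogonal_def inner_commute[of _ d])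
  show ?thesis
  proof (rule simple[OF _ d(1)])
    show "cvx (\<lambda>y. \<Sum>i\<in>I. max 0 (a i \<bullet> (y - \<tau>)))" by (intro cvx_sum cvx_hinge_at) simp
  qed (simp add: ad inner_add_right inner_diff_right)
qed

text \<open>The hinge of \<open>a k\<close> feels the other summands only on its own hyperplane,
  where adding a multiple of \<open>a k\<close> to \<open>a m\<close> changes nothing. Without that
  hinge both sums have value 0.\<close>

lemma frame_shear:
  assumes "m \<noteq> k"
  shows "Z (hinge_frame (a(m := a m + c *\<^sub>R a k)) \<tau>) = Z (hinge_frame a \<tau>)"
proof -
  define b where "b = a(m := a m + c *\<^sub>R a k)"
  have bk: "b k = a k" using assms by (simp add: b_def)
  define v where "v a y = (\<Sum>i\<in>UNIV - {k}. max 0 (a i \<bullet> (y - \<tau>)))" for a :: "'n \<Rightarrow> real^'n" and y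
  have Zv: "Z (v a) = 0" for a unfolding v_def[abs_def] by (rule partial_frame_zero) auto
  have cv: "cvx (v a)" for a unfolding v_def[abs_def] by (intro cvx_sum cvx_hinge_at) auto
  have fr: "hinge_frame a \<tau> = (\<lambda>y. v a y + max 0 (a k \<bullet> y - a k \<bullet> \<tau>))" for a
    by (simp add: fun_eq_iff hinge_frame_remove[of _ _ _ k] v_def inner_diff_right)
  have "v b y = v a y" if "a k \<bullet> y = a k \<bullet> \<tau>" for y
    unfolding v_def by (rule sum.cong) (use that in \<open>auto simp: b_def inner_add_left inner_diff_right\<close>)
  then have "Z (\<lambda>y. v b y + max 0 (a k \<bullet> y - a k \<bullet> \<tau>)) - Z (v b) = Z (\<lambda>y. v a y + max 0 (a k \<bullet> y - a k \<bullet> \<tau>)) - Z (v a)"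
    by (intro hinge_local cv) auto
  then show ?thesis unfolding b_def[symmetric] by (simp add: Zv fr bk)
qed

text \<open>The value \<open>D s\<close> with a scaled hinge is additive in \<open>s\<close>, since
  the hinge vanishes on its own hyperplane, and continuity makes it linear. A negative factor turns
  the hinge over, which amounts to an affine summand.\<close>

lemma frame_scale:
  "Z (hinge_frame (a(m := s *\<^sub>R a m)) \<tau>) = \<bar>s\<bar> * Z (hinge_frame a \<tau>)"
proof -
  define v where "v y = (\<Sum>i\<in>UNIV - {m}. max 0 (a i \<bullet> (y - \<tau>)))" for y
  define r where "r y = max 0 (a m \<bullet> (y - \<tau>))" for y
  have Zv: "Z v = 0" unfolding v_def[abs_def] by (rule partial_frame_zero) auto
  have cv: "cvx v" unfolding v_def[abs_def] by (intro cvx_sum cvx_hinge_at) auto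
  have sr: "s * r y = max 0 ((s *\<^sub>R a m) \<bullet> y - s * (a m \<bullet> \<tau>))" "s * r y = max 0 ((s *\<^sub>R a m) \<bullet> (y - \<tau>))" if "0 \<le> s" for s y
    using scale_hinge[OF that, of "a m" y "a m \<bullet> \<tau>"] by (simp_all add: r_def inner_diff_right right_diff_distrib)
  define D where "D s = Z (\<lambda>y. v y + s * r y)" for s
  have csr: "cvx (\<lambda>y. v y + s * r y)" if "0 \<le> s" for s
    unfolding sr(1)[OF that] by (intro cvx_add cv cvx_hinge)
  have D0: "D 0 = 0" by (simp add: D_def Zv)
  have Dadd: "D (s + t) = D s + D t" if s: "0 \<le> s" and t: "0 \<le> t" for s t
  proof (cases "t = 0")
    case False
    have "Z (\<lambda>y. (v y + s * r y) + max 0 ((t *\<^sub>R a m) \<bullet> y - t * (a m \<bullet> \<tau>))) - Z (\<lambda>y. v y + s * r y) =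
      Z (\<lambda>y. v y + max 0 ((t *\<^sub>R a m) \<bullet> y - t * (a m \<bullet> \<tau>))) - Z v"
      by (rule hinge_local) (use csr[OF s] cv False in \<open>auto simp: r_def inner_diff_right\<close>)
    then have "Z (\<lambda>y. (v y + s * r y) + t * r y) - D s = D t"
      by (simp add: sr(1)[OF t, symmetric] D_def Zv del: inner_scaleR_left)
    then show ?thesis by (simp add: D_def algebra_simps)
  qed (simp add: D0)
  have Dmult: "D (real N * s) = real N * D s" if "0 \<le> s" for N s
    by (induction N) (use that D0 Dadd in \<open>auto simp: algebra_simps\<close>)
  have Drat: "D (real N / real (Suc M)) = real N / real (Suc M) * D 1" for N M
    using Dmult[of "1 / real (Suc M)" "Suc M"] Dmult[of "1 / real (Suc M)" N] by (simp add: field_simps)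
  have Dlin: "D s = s * D 1" if s: "0 \<le> s" for s
  proof -
    define q where "q M = real (nat \<lfloor>s * real (Suc M)\<rfloor>) / real (Suc M)" for M
    have q: "q \<longlonglongrightarrow> s"
    proof (rule LIMSEQ_I)
      fix e :: real assume "0 < e"
      then obtain M0 where M0: "inverse (real (Suc M0)) < e" using reals_Archimedean by blast
      have "norm (q M - s) < e" if "M \<ge> M0" for M
      proof -
        have "real (nat \<lfloor>s * real (Suc M)\<rfloor>) \<le> s * real (Suc M)" "s * real (Suc M) < real (nat \<lfloor>s * real (Suc M)\<rfloor>) + 1"
          using s by (simp_all add: of_nat_nat)
        then have "q M \<le> s" "s < q M + inverse (real (Suc M))"
          unfolding q_def by (simp_all add: field_simps)
        moreover have "inverse (real (Suc M)) \<le> inverse (real (Suc M0))" using that by simp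
        ultimately show ?thesis using M0 unfolding real_norm_def by linarith
      qed
      then show "\<exists>no. \<forall>n\<ge>no. norm (q n - s) < e" by blast
    qed
    have q0: "0 \<le> q M" for M by (simp add: q_def)
    have "(\<lambda>M. D (q M)) \<longlonglongrightarrow> D s" unfolding D_def
      by (rule cont) (auto intro!: csr s q0 tendsto_intros q)
    moreover have "(\<lambda>M. D (q M)) \<longlonglongrightarrow> s * D 1"
      unfolding q_def Drat using q unfolding q_def by (intro tendsto_intros)
    ultimately show ?thesis using LIMSEQ_unique by blast
  qed
  have fr: "hinge_frame a \<tau> = (\<lambda>y. v y + 1 * r y)"
    by (simp add: fun_eq_iff hinge_frame_remove[of _ _ _ m] v_def r_def)
  show ?thesis
  proof (cases "0 \<le> s")
    case True
    have "hinge_frame (a(m := s *\<^sub>R a m)) \<tau> = (\<lambda>y. v y + s * r y)"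
      by (simp add: fun_eq_iff hinge_frame_upd v_def sr(2)[OF True])
    then show ?thesis using Dlin[OF True] True by (simp add: fr D_def)
  next
    case False
    have "max 0 ((s *\<^sub>R a m) \<bullet> (y - \<tau>)) = (- s) * r y + ((s *\<^sub>R a m) \<bullet> y + - (s * (a m \<bullet> \<tau>)))" for y
      using sr(2)[of "- s" y] False by (simp add: inner_diff_right right_diff_distrib max_def)
    then have "hinge_frame (a(m := s *\<^sub>R a m)) \<tau> = (\<lambda>y. (v y + (- s) * r y) + ((s *\<^sub>R a m) \<bullet> y + - (s * (a m \<bullet> \<tau>))))"
      by (simp add: fun_eq_iff hinge_frame_upd v_def)
    then have "Z (hinge_frame (a(m := s *\<^sub>R a m)) \<tau>) = D (- s)"
      using inv[OF csr[of "- s"], of "s *\<^sub>R a m" "- (s * (a m \<bullet> \<tau>))"] False unfolding D_def by (simp only:)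
    then show ?thesis using Dlin[of "- s"] False by (simp add: fr D_def)
  qed
qed

lemma frame_scale_all:
  "finite I \<Longrightarrow> Z (hinge_frame (\<lambda>i. if i \<in> I then s i *\<^sub>R a i else a i) \<tau>) = (\<Prod>i\<in>I. \<bar>s i\<bar>) * Z (hinge_frame a \<tau>)"
proof (induction I rule: finite_induct)
  case (insert m I)
  let ?b = "\<lambda>i. if i \<in> I then s i *\<^sub>R a i else a i"
  have "(\<lambda>i. if i \<in> insert m I then s i *\<^sub>R a i else a i) = ?b(m := s m *\<^sub>R ?b m)"
    using insert.hyps by auto
  then have "Z (hinge_frame (\<lambda>i. if i \<in> insert m I then s i *\<^sub>R a i else a i) \<tau>) = \<bar>s m\<bar> * Z (hinge_frame ?b \<tau>)"
    using frame_scale[of ?b m "s m" \<tau>] by (simp only:)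
  then show ?case unfolding insert.IH prod.insert[OF insert.hyps] mult.assoc .
qed simp

text \<open>On elementary factors: a zero row leaves a partial frame, diagonal entries scale the
  hinges, a transposition permutes the summands, and a shear changes nothing. Keeping
  \<open>B\<close> arbitrary lets the factors be peeled off one after the other.\<close>

lemma frame_det:
  "Z (hinge_frame (\<lambda>i. (A ** B) $ i) \<tau>) = \<bar>det A\<bar> * Z (hinge_frame (\<lambda>i. B $ i) \<tau>)"
proof (induction A arbitrary: B rule: induct_matrix_elementary)
  case (1 A C)
  show ?case using 1(1)[of "C ** B"] 1(2)[of B] by (simp add: matrix_mul_assoc det_mul abs_mult mult.assoc)
next
  case (2 A i)
  have "(A ** B) $ i = 0" using 2 by (simp add: matrix_matrix_mult_def row_def vec_eq_iff)
  then have "Z (hinge_frame (\<lambda>i. (A ** B) $ i) \<tau>) = Z (\<lambda>y. \<Sum>j\<in>UNIV - {i}. max 0 ((A ** B) $ j \<bullet> (y - \<tau>)))"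
    by (intro arg_cong[of _ _ Z]) (simp add: fun_eq_iff hinge_frame_remove[of _ _ _ i])
  also have "\<dots> = 0" by (rule partial_frame_zero) auto
  finally show ?case using det_zero_row(2)[of i A] 2 by (simp add: row_def)
next
  case (3 A)
  have "(A ** B) $ i = A $ i $ i *\<^sub>R B $ i" for i
  proof -
    have "(A ** B) $ i $ j = A $ i $ i * B $ i $ j" for j
      unfolding matrix_matrix_mult_def using 3 by (simp add: sum.remove[of UNIV i])
    then show ?thesis by (simp add: vec_eq_iff)
  qed
  then show ?case using frame_scale_all[of UNIV "\<lambda>i. A $ i $ i" "\<lambda>i. B $ i" \<tau>] det_diagonal[of A] 3
    by (simp add: abs_prod)
next
  case (4 m k)
  let ?p = "Transposition.transpose m k"
  have p: "?p permutes UNIV" by (rule permutes_swap_id) auto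
  have "\<bar>det ((\<chi> i j. mat 1 $ i $ ?p j) :: real^'n^'n)\<bar> = 1"
    by (subst det_permute_columns[OF p]) (auto simp: sign_def)
  moreover have "hinge_frame (\<lambda>i. ((\<chi> i j. mat 1 $ i $ ?p j) ** B) $ i) \<tau> = hinge_frame (\<lambda>i. B $ i) \<tau>"
  proof
    fix y
    have "((\<chi> i j. mat 1 $ i $ ?p j) ** B) $ i = B $ (?p i)" for i
    proof (rule vec_eq_iff[THEN iffD2], rule allI)
      fix j
      have "((\<chi> i j. mat 1 $ i $ ?p j) ** B) $ i $ j = (\<Sum>l\<in>UNIV. mat 1 $ i $ ?p l * B $ l $ j)"
        by (simp add: matrix_matrix_mult_def)
      also have "\<dots> = (\<Sum>l\<in>UNIV. if l = ?p i then B $ l $ j else 0)"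
        by (rule sum.cong) (auto simp: mat_def Transposition.transpose_def)
      finally show "((\<chi> i j. mat 1 $ i $ ?p j) ** B) $ i $ j = B $ (?p i) $ j" by simp
    qed
    then show "hinge_frame (\<lambda>i. ((\<chi> i j. mat 1 $ i $ ?p j) ** B) $ i) \<tau> y = hinge_frame (\<lambda>i. B $ i) \<tau> y"
      unfolding hinge_frame_def using sum.permute[OF p, of "\<lambda>i. max 0 (B $ i \<bullet> (y - \<tau>))"] by (simp add: o_def)
  qed
  ultimately show ?case by simp
next
  case (5 m k c)
  let ?E = "(\<chi> i j. if i = m \<and> j = k then c else of_bool (i = j)) :: real^'n^'n"
  have "?E = (\<chi> i. if i = m then row m (mat 1) + c *s row k (mat 1) else row i (mat 1))"
    using 5 by (auto simp: vec_eq_iff row_def mat_def)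
  then have "det ?E = 1" using det_row_operation[OF 5, where c = c and A = "mat 1 :: real^'n^'n"] by (simp only: det_I)
  moreover have e2: "(\<lambda>i. (?E ** B) $ i) = (\<lambda>i. B $ i)(m := B $ m + c *\<^sub>R B $ k)"
  proof
    fix i
    have "(?E ** B) $ i $ j = (if i = m then B $ m $ j + c * B $ k $ j else B $ i $ j)" for j
    proof -
      have "(?E ** B) $ i $ j = (\<Sum>l\<in>UNIV. (if i = m \<and> l = k then c else of_bool (i = l)) * B $ l $ j)"
        by (simp add: matrix_matrix_mult_def)
      also have "\<dots> = (\<Sum>l\<in>UNIV. (if l = i then B $ i $ j else 0) + (if l = k then (if i = m then c * B $ k $ j else 0) else 0))"
        by (rule sum.cong) (use 5 in auto)
      finally show ?thesis by (simp add: sum.distrib)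
    qed
    then show "(?E ** B) $ i = ((\<lambda>i. B $ i)(m := B $ m + c *\<^sub>R B $ k)) i" by (simp add: vec_eq_iff)
  qed
  moreover have "Z (hinge_frame (\<lambda>i. (?E ** B) $ i) \<tau>) = Z (hinge_frame (\<lambda>i. B $ i) \<tau>)"
    unfolding e2 by (rule frame_shear[OF 5])
  ultimately show ?case by (simp only: abs_one mult_1_left)
qed

definition density :: "real^'n \<Rightarrow> real" where
  "density \<tau> = Z (hinge_frame (\<lambda>i. axis i 1) \<tau>)"

lemma frame_density:
  "Z (hinge_frame a \<tau>) = \<bar>det (\<chi> i. a i)\<bar> * density \<tau>"
proof -
  have "(\<lambda>i. (mat 1 :: real^'n^'n) $ i) = (\<lambda>i. axis i 1)"
    by (simp add: fun_eq_iff mat_def axis_def vec_eq_iff eq_commute)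
  then show ?thesis using frame_det[of "\<chi> i. a i" "mat 1" \<tau>] by (simp add: density_def)
qed

lemma continuous_density: "continuous_on UNIV density"
  unfolding continuous_on_sequentially
proof (intro ballI allI impI)
  fix x :: "nat \<Rightarrow> real^'n" and a assume "(\<forall>n. x n \<in> UNIV) \<and> x \<longlonglongrightarrow> a"
  then show "(density \<circ> x) \<longlonglongrightarrow> density a" unfolding density_def o_def
    by (intro cont cvx_hinge_frame) (auto simp: hinge_frame_def intro!: tendsto_intros)
qed

text \<open>Points of nonzero density with one coordinate beyond every bound would carry frames that
  face away from the origin, flat in the other coordinates and arbitrarily steep in the large one.
  They tend to 0 pointwise, yet the steepness can be chosen to keep the value of \<open>Z\<close> at
  absolute value 1.\<close>

lemma bounded_density_support: "bounded {\<tau>. density \<tau> \<noteq> 0}"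
proof (rule ccontr)
  assume unb: "\<not> bounded {\<tau>. density \<tau> \<noteq> 0}"
  have "\<exists>\<tau> i. density \<tau> \<noteq> 0 \<and> real k < \<bar>\<tau> $ i\<bar>" for k
  proof (rule ccontr)
    assume "\<nexists>\<tau> i. density \<tau> \<noteq> 0 \<and> real k < \<bar>\<tau> $ i\<bar>"
    then have le: "\<And>\<tau> i. density \<tau> \<noteq> 0 \<Longrightarrow> \<bar>\<tau> $ i\<bar> \<le> real k" by (meson not_le)
    have "norm \<tau> \<le> real CARD('n) * real k" if "density \<tau> \<noteq> 0" for \<tau>
    proof -
      have "norm \<tau> \<le> (\<Sum>i\<in>UNIV. \<bar>\<tau> $ i\<bar>)" by (rule norm_le_l1_cart)
      also have "\<dots> \<le> (\<Sum>i\<in>(UNIV::'n set). real k)" by (intro sum_mono le that)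
      finally show ?thesis by simp
    qed
    then show False using unb by (auto simp: bounded_iff)
  qed
  then obtain T I where T: "\<And>k. density (T k) \<noteq> 0" and I: "\<And>k. real k < \<bar>T k $ I k\<bar>" by metis
  \<comment> \<open>With this sign the hinge in coordinate \<open>i\<close> vanishes as long as
    \<open>\<bar>y $ i\<bar> \<le> \<bar>T k $ i\<bar>\<close>.\<close>
  define \<sigma> where "\<sigma> k i = (if 0 \<le> T k $ i then 1 else - 1 :: real)" for k i
  define e where "e k = inverse (real (Suc k))" for k
  \<comment> \<open>All factors are the small \<open>e k\<close>, except in the coordinate
    \<open>I k\<close>, which compensates the density and the other factors of the
    determinant.\<close>
  define s where "s k i = (if i = I k then inverse (\<bar>density (T k)\<bar> * e k ^ (CARD('n) - 1)) else e k)" for k i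
  define a where "a k i = (s k i * \<sigma> k i) *\<^sub>R (axis i 1 :: real^'n)" for k i
  have e: "0 < e k" for k by (simp add: e_def)
  have s: "0 < s k i" for k i using T[of k] e[of k] by (auto simp: s_def)
  have ab: "\<bar>Z (hinge_frame (a k) (T k))\<bar> = 1" for k
  proof -
    have "det (\<chi> i. a k i) = (\<Prod>i\<in>UNIV. s k i * \<sigma> k i)"
      by (subst det_diagonal) (auto simp: a_def axis_def)
    then have "\<bar>det (\<chi> i. a k i)\<bar> = (\<Prod>i\<in>UNIV. s k i)"
      using s[THEN less_imp_le] by (simp add: abs_prod abs_mult \<sigma>_def if_distrib[of abs] cong: if_cong)
    also have "\<dots> = s k (I k) * (\<Prod>i\<in>UNIV - {I k}. s k i)" by (rule prod.remove) auto
    also have "(\<Prod>i\<in>UNIV - {I k}. s k i) = (\<Prod>i\<in>UNIV - {I k}. e k)" by (rule prod.cong) (auto simp: s_def)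
    also have "\<dots> = e k ^ (CARD('n) - 1)" by (simp add: card_Diff_singleton)
    finally have "\<bar>det (\<chi> i. a k i)\<bar> = s k (I k) * e k ^ (CARD('n) - 1)" .
    moreover have "inverse (x * E) * E * x = 1" if "0 < x" "0 < E" for x E :: real
      using that by (simp add: field_simps)
    from this[of "\<bar>density (T k)\<bar>" "e k ^ (CARD('n) - 1)"]
    have "s k (I k) * e k ^ (CARD('n) - 1) * \<bar>density (T k)\<bar> = 1"
      using T[of k] e[of k] by (simp add: s_def del: inverse_mult_distrib)
    ultimately have "\<bar>det (\<chi> i. a k i)\<bar> * \<bar>density (T k)\<bar> = 1" by (simp only:)
    then show ?thesis by (simp add: frame_density abs_mult)
  qed
  have lim: "(\<lambda>k. hinge_frame (a k) (T k) y) \<longlonglongrightarrow> 0" for y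
  proof (rule Lim_null_comparison)
    have "e \<longlonglongrightarrow> 0" unfolding e_def by (rule LIMSEQ_inverse_real_of_nat)
    then have "(\<lambda>k. real CARD('n) * (e k * norm y)) \<longlonglongrightarrow> real CARD('n) * (0 * norm y)" by (intro tendsto_intros)
    then show "(\<lambda>k. real CARD('n) * (e k * norm y)) \<longlonglongrightarrow> 0" by simp
    obtain N where N: "norm y \<le> real N" using real_arch_simple by blast
    have "norm (hinge_frame (a k) (T k) y) \<le> real CARD('n) * (e k * norm y)" if "k \<ge> N" for k
    proof -
      have bnd: "max 0 (a k i \<bullet> (y - T k)) \<le> e k * norm y" for i
      proof -
        have sg: "\<sigma> k i * (y $ i - T k $ i) \<le> \<bar>y $ i\<bar> - \<bar>T k $ i\<bar>" by (auto simp: \<sigma>_def)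
        have ai: "a k i \<bullet> (y - T k) = s k i * (\<sigma> k i * (y $ i - T k $ i))"
          by (simp add: a_def inner_axis' )
        have yi: "\<bar>y $ i\<bar> \<le> norm y" by (rule component_le_norm_cart)
        show ?thesis
        proof (cases "i = I k")
          case True
          then have "\<sigma> k i * (y $ i - T k $ i) \<le> 0" using sg yi I[of k] N that by simp
          then have "a k i \<bullet> (y - T k) \<le> 0" unfolding ai using s[of k i] by (simp add: mult_nonneg_nonpos)
          then show ?thesis using e[of k] by simp
        next
          case False
          have "s k i * (\<sigma> k i * (y $ i - T k $ i)) \<le> s k i * norm y"
            using sg yi s[of k i] by (intro mult_left_mono) auto
          then show ?thesis unfolding ai using False e[of k] by (simp add: s_def)
        qed
      qed
      have "norm (hinge_frame (a k) (T k) y) = hinge_frame (a k) (T k) y"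
        by (simp add: hinge_frame_def sum_nonneg)
      also have "\<dots> \<le> (\<Sum>i\<in>(UNIV::'n set). e k * norm y)" unfolding hinge_frame_def by (intro sum_mono bnd)
      finally show ?thesis by simp
    qed
    then show "\<forall>\<^sub>F k in sequentially. norm (hinge_frame (a k) (T k) y) \<le> real CARD('n) * (e k * norm y)"
      unfolding eventually_sequentially by blast
  qed
  have "(\<lambda>k. Z (hinge_frame (a k) (T k))) \<longlonglongrightarrow> Z (\<lambda>y. 0)"
    by (rule cont[OF cvx_hinge_frame cvx_const lim])
  from tendsto_rabs[OF this] have "(\<lambda>k::nat. 1) \<longlonglongrightarrow> \<bar>Z (\<lambda>y. 0)\<bar>" unfolding ab .
  moreover have "Z (\<lambda>y. 0) = 0" using partial_frame_zero[of "{}"] by simp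
  ultimately show False by (simp add: LIMSEQ_const_iff)
qed

text \<open>Hinges whose directions form a basis are a frame: the apex \<open>\<tau>\<close> has to
  solve \<open>a j \<bullet> \<tau> = t j\<close> and is given by the dual basis \<open>d\<close>.
  So \<open>frame_density\<close> provides the assumption of \<open>dual_val_para\<close>.\<close>

lemma density_zero_imp_zero:
  assumes dens: "\<And>\<tau>. density \<tau> = 0"
    and v: "cvx v" and L: "0 \<le> L" "\<And>x y. \<bar>v x - v y\<bar> \<le> L * norm (x - y)"
  shows "Z v = 0"
proof -
  interpret dual_val_para Z
  proof
    fix S :: "((real^'n) \<times> real) list"
    assume S: "length S = DIM(real^'n)" "distinct (map fst S)" "independent (fst ` set S)"
    have "card (UNIV :: 'n set) = card {..<length S}" using S(1) by simp
    then obtain f where f: "bij_betw f (UNIV :: 'n set) {..<length S}"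
      using finite_same_card_bij[OF finite[of UNIV] finite_lessThan[of "length S"]] by blast
    have fl: "f i < length S" for i using bij_betw_apply[OF f, of i] by simp
    define a where "a i = fst (S ! f i)" for i
    define t where "t i = snd (S ! f i)" for i
    have indep: "a i \<notin> span (a ` (UNIV - {i}))" for i
    proof -
      have "a j \<noteq> a i" if "j \<noteq> i" for j
      proof
        assume "a j = a i"
        then have "map fst S ! f j = map fst S ! f i" using fl by (simp add: a_def)
        then have "f j = f i"
          using nth_eq_iff_index_eq[OF S(2), of "f j" "f i"] fl by (simp only: length_map)
        then show False using that f by (auto simp: bij_betw_def inj_on_def)
      qed
      then have "a ` (UNIV - {i}) \<subseteq> fst ` set S - {a i}" using fl by (auto simp: a_def)
      moreover have "a i \<notin> span (fst ` set S - {a i})"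
        using S(3) fl unfolding dependent_def a_def by (meson image_eqI nth_mem)
      ultimately show ?thesis using span_mono by blast
    qed
    have "\<exists>d. a i \<bullet> d = 1 \<and> (\<forall>j. j \<noteq> i \<longrightarrow> a j \<bullet> d = 0)" for i
    proof -
      obtain d where "a i \<bullet> d = 1" "\<forall>b\<in>a ` (UNIV - {i}). b \<bullet> d = 0"
        by (rule exists_dual_vector[OF indep[of i]])
      then show ?thesis by (intro exI[of _ d]) simp
    qed
    then obtain d where d: "\<And>i. a i \<bullet> d i = 1" "\<And>i j. j \<noteq> i \<Longrightarrow> a j \<bullet> d i = 0" by metis
    define \<tau> where "\<tau> = (\<Sum>i\<in>UNIV. t i *\<^sub>R d i)"
    have a\<tau>: "a j \<bullet> \<tau> = t j" for j
    proof -
      have "a j \<bullet> \<tau> = (\<Sum>i\<in>UNIV. t i * (a j \<bullet> d i))" by (simp add: \<tau>_def inner_sum_right)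
      also have "\<dots> = t j * (a j \<bullet> d j)" by (subst sum.remove[of UNIV j]) (auto simp: d(2))
      finally show ?thesis by (simp add: d)
    qed
    have "hinge_sum S = hinge_frame a \<tau>"
    proof
      fix y
      have "hinge_sum S y = (\<Sum>k<length S. max 0 (fst (S ! k) \<bullet> y - snd (S ! k)))"
        unfolding hinge_sum_def by (simp add: sum_list_sum_nth case_prod_beta atLeast0LessThan)
      also have "\<dots> = (\<Sum>i\<in>UNIV. max 0 (a i \<bullet> y - t i))"
        unfolding a_def t_def by (rule sum.reindex_bij_betw[OF f, symmetric])
      finally show "hinge_sum S y = hinge_frame a \<tau> y" by (simp add: hinge_frame_def inner_diff_right a\<tau>)
    qed
    then show "Z (hinge_sum S) = 0" by (simp add: frame_density dens)
  qed
  show ?thesis by (rule lipschitz_zero[OF v L])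
qed

end

section \<open>Fenchel conjugates\<close>

text \<open>The epigraph of \<open>f\<close> and the strict hypograph of \<open>g\<close> are
  disjoint and convex. A hyperplane separating them is not vertical, because both functions are
  finite everywhere.\<close>

lemma affine_sandwich:
  fixes f g :: "'a::euclidean_space \<Rightarrow> real"
  assumes f: "cvx f" and g: "cvx (\<lambda>y. - g y)" and le: "\<And>y. g y \<le> f y"
  obtains z b where "\<And>y. g y \<le> z \<bullet> y + b" "\<And>y. z \<bullet> y + b \<le> f y"
proof -
  define S where "S = {p :: 'a \<times> real. f (fst p) \<le> snd p}"
  define T where "T = {p :: 'a \<times> real. snd p < g (fst p)}"
  have cS: "convex S"
  proof (rule convexI)
    fix p q :: "'a \<times> real" and u w :: real assume pq: "p \<in> S" "q \<in> S" and uw: "0 \<le> u" "0 \<le> w" "u + w = 1"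
    have "f (u *\<^sub>R fst p + w *\<^sub>R fst q) \<le> u * f (fst p) + w * f (fst q)"
      using f uw unfolding convex_on_def by auto
    also have "\<dots> \<le> u * snd p + w * snd q" using pq uw by (intro add_mono mult_left_mono) (auto simp: S_def)
    finally show "u *\<^sub>R p + w *\<^sub>R q \<in> S" by (simp add: S_def)
  qed
  have cT: "convex T"
  proof (rule convexI)
    fix p q :: "'a \<times> real" and u w :: real assume pq: "p \<in> T" "q \<in> T" and uw: "0 \<le> u" "0 \<le> w" "u + w = 1"
    have 1: "- g (u *\<^sub>R fst p + w *\<^sub>R fst q) \<le> u * (- g (fst p)) + w * (- g (fst q))"
      using g uw unfolding convex_on_def by auto
    have "u * snd p + w * snd q < u * g (fst p) + w * g (fst q)"
    proof (cases "u = 0")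
      case True then show ?thesis using pq uw by (simp add: T_def)
    next
      case False
      then have "u * snd p < u * g (fst p)" using pq uw by (simp add: T_def)
      moreover have "w * snd q \<le> w * g (fst q)" using pq uw by (intro mult_left_mono) (auto simp: T_def)
      ultimately show ?thesis by linarith
    qed
    then show "u *\<^sub>R p + w *\<^sub>R q \<in> T" using 1 by (simp add: T_def)
  qed
  have "(0, f 0) \<in> S" "(0, g 0 - 1) \<in> T" by (auto simp: S_def T_def)
  then have ne: "S \<noteq> {}" "T \<noteq> {}" by blast+
  have "p \<notin> T" if "p \<in> S" for p using that le[of "fst p"] by (simp add: S_def T_def)
  then have "S \<inter> T = {}" by blast
  then obtain a b where ab: "a \<noteq> 0" "\<forall>x\<in>S. inner a x \<le> b" "\<forall>x\<in>T. inner a x \<ge> b"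
    using separating_hyperplane_sets[OF cS cT ne] by blast
  obtain p q where a: "a = (p, q)" by force
  have 1: "p \<bullet> y + q * s \<le> b" if "f y \<le> s" for y s using ab(2) that by (auto simp: S_def a inner_prod_def)
  have 2: "b \<le> p \<bullet> y + q * s" if "s < g y" for y s using ab(3) that by (auto simp: T_def a inner_prod_def)
  have "q \<noteq> 0"
  proof
    assume q: "q = 0"
    have "p \<bullet> y = b" for y using 1[of y "f y"] 2[of "g y - 1" y] q by simp
    from this[of p] this[of 0] have "p = 0" by simp
    then show False using ab(1) a q by (simp add: zero_prod_def)
  qed
  moreover have "q \<le> 0"
  proof (rule ccontr)
    assume "\<not> q \<le> 0"
    then have q: "0 < q" by simp
    have "q * max (f 0) ((b + 1) / q) \<ge> q * ((b + 1) / q)" using q by (intro mult_left_mono) auto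
    then show False using 1[of 0 "max (f 0) ((b + 1) / q)"] q by simp
  qed
  ultimately have q: "q < 0" by simp
  define z where "z = (- (1 / q)) *\<^sub>R p"
  have zq: "p \<bullet> y = - q * (z \<bullet> y)" for y using q by (simp add: z_def)
  have "z \<bullet> y + b / q \<le> f y" for y
  proof -
    have "q * (f y - z \<bullet> y) \<le> b" using 1[of y "f y"] by (simp add: zq algebra_simps)
    then have "b / q \<le> f y - z \<bullet> y" using q by (simp add: neg_divide_le_eq mult.commute)
    then show ?thesis by simp
  qed
  \<comment> \<open>The hypograph is strict, so \<open>g y\<close> is approached from below.\<close>
  moreover have "g y \<le> z \<bullet> y + b / q" for y
  proof (rule field_le_epsilon)
    fix e :: real assume "0 < e"
    then have "b \<le> q * ((g y - e) - z \<bullet> y)" using 2[of "g y - e" y] by (simp add: zq algebra_simps)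
    then have "(g y - e) - z \<bullet> y \<le> b / q" using q by (simp add: neg_le_divide_eq mult.commute)
    then show "g y \<le> z \<bullet> y + b / q + e" by simp
  qed
  ultimately show ?thesis using that by blast
qed

text \<open>Convergence at the finitely many vertices of a cube around \<open>y\<close> bounds all
  \<open>h k\<close> from above on the cube. With this bound, convexity controls the difference
  between \<open>h k (ys k)\<close> and \<open>h k y\<close>.\<close>

lemma convex_seq_limit:
  fixes h :: "nat \<Rightarrow> 'a::euclidean_space \<Rightarrow> real"
  assumes h: "\<And>k. cvx (h k)" and lim: "\<And>y. (\<lambda>k. h k y) \<longlonglongrightarrow> g y" and y: "ys \<longlonglongrightarrow> y"
  shows "(\<lambda>k. h k (ys k)) \<longlonglongrightarrow> g y"
proof -
  obtain S where S: "finite S" "cbox (y - 1 *\<^sub>R One) (y + 1 *\<^sub>R One) = convex hull S"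
    using cube_convex_hull[of 1 y] by auto
  obtain M where M: "\<And>s k. s \<in> S \<Longrightarrow> h k s \<le> M"
  proof -
    have "\<forall>s. \<exists>B. \<forall>k. \<bar>h k s\<bar> \<le> B"
      using convergent_imp_Bseq[OF convergentI[OF lim]] by (auto simp: Bseq_def)
    then obtain B where B: "\<And>s k. \<bar>h k s\<bar> \<le> B s" by metis
    have "h k s \<le> (\<Sum>s\<in>S. \<bar>B s\<bar>)" if "s \<in> S" for s k
    proof -
      have "h k s \<le> \<bar>B s\<bar>" using B[of k s] by linarith
      also have "\<dots> \<le> (\<Sum>s\<in>S. \<bar>B s\<bar>)" by (rule member_le_sum) (use that S in auto)
      finally show ?thesis .
    qed
    then show ?thesis using that by blast
  qed
  have up: "h k x \<le> M" if "norm (x - y) \<le> 1" for k x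
  proof -
    have "convex_on (convex hull S) (h k)" by (rule convex_on_subset[OF h]) auto
    moreover have "x \<in> convex hull S"
      unfolding S(2)[symmetric] mem_box
    proof
      fix i :: 'a assume i: "i \<in> Basis"
      have "\<bar>(x - y) \<bullet> i\<bar> \<le> 1" using Basis_le_norm[OF i, of "x - y"] that by linarith
      then show "(y - 1 *\<^sub>R One) \<bullet> i \<le> x \<bullet> i \<and> x \<bullet> i \<le> (y + 1 *\<^sub>R One) \<bullet> i"
        using i by (auto simp: inner_diff_left inner_add_left abs_le_iff)
    qed
    ultimately show ?thesis using convex_on_convex_hull_bound[of S "h k" M] M by blast
  qed
  define t where "t k = norm (ys k - y)" for k
  have t: "t \<longlonglongrightarrow> 0" "\<And>k. 0 \<le> t k"
    unfolding t_def[abs_def] using tendsto_norm_zero[OF LIM_zero[OF y]] by auto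
  \<comment> \<open>\<open>y\<^sub>k\<close> lies between \<open>y\<close> and a point at distance 1, and \<open>y\<close> between \<open>y\<^sub>k\<close> and the opposite point.\<close>
  have upper: "h k (ys k) \<le> (1 - t k) * h k y + t k * M" if "t k \<le> 1" for k
  proof -
    define e where "e = (1 / t k) *\<^sub>R (ys k - y)"
    have e: "norm e \<le> 1" "t k *\<^sub>R e = ys k - y" unfolding e_def by (cases "ys k = y"; simp add: t_def)+
    have "ys k = (1 - t k) *\<^sub>R y + t k *\<^sub>R (y + e)" by (simp add: scaleR_add_right e algebra_simps)
    then have "h k (ys k) \<le> (1 - t k) * h k y + t k * h k (y + e)"
      using convex_onD[OF h, of "t k" y "y + e" k] t(2)[of k] that by simp
    also have "\<dots> \<le> (1 - t k) * h k y + t k * M"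
      using up[of "y + e" k] e t(2)[of k] by (intro add_left_mono mult_left_mono) auto
    finally show ?thesis .
  qed
  have lower: "(1 + t k) * h k y - t k * M \<le> h k (ys k)" for k
  proof -
    define e where "e = (1 / t k) *\<^sub>R (ys k - y)"
    have e: "norm e \<le> 1" "t k *\<^sub>R e = ys k - y" unfolding e_def by (cases "ys k = y"; simp add: t_def)+
    define s where "s = t k / (1 + t k)"
    have s: "0 \<le> s" "s \<le> 1" "(1 + t k) * s = t k" "(1 + t k) * (1 - s) = 1" using t(2)[of k] by (auto simp: s_def field_simps)
    have "(1 + t k) *\<^sub>R ((1 - s) *\<^sub>R ys k + s *\<^sub>R (y - e)) = ys k + t k *\<^sub>R y - t k *\<^sub>R e"
      by (simp add: scaleR_add_right scaleR_diff_right s)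
    also have "\<dots> = (1 + t k) *\<^sub>R y" by (simp add: e algebra_simps)
    finally have "y = (1 - s) *\<^sub>R ys k + s *\<^sub>R (y - e)" using t(2)[of k] by (metis add_nonneg_pos less_irrefl scaleR_cancel_left zero_less_one add.commute)
    then have "h k y \<le> (1 - s) * h k (ys k) + s * h k (y - e)"
      using convex_onD[OF h, of s "ys k" "y - e" k] s by simp
    also have "\<dots> \<le> (1 - s) * h k (ys k) + s * M"
      using up[of "y - e" k] e s by (intro add_left_mono mult_left_mono) auto
    finally have "(1 + t k) * h k y \<le> (1 + t k) * ((1 - s) * h k (ys k) + s * M)" using t(2)[of k] by (intro mult_left_mono) auto
    also have "\<dots> = h k (ys k) + t k * M" by (simp add: distrib_left mult.assoc[symmetric] s)
    finally show ?thesis by simp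
  qed
  have "(\<lambda>k. (1 - t k) * h k y + t k * M) \<longlonglongrightarrow> (1 - 0) * g y + 0 * M" "(\<lambda>k. (1 + t k) * h k y - t k * M) \<longlonglongrightarrow> (1 + 0) * g y - 0 * M"
    by (intro tendsto_intros t lim)+
  then have l: "(\<lambda>k. (1 - t k) * h k y + t k * M) \<longlonglongrightarrow> g y" "(\<lambda>k. (1 + t k) * h k y - t k * M) \<longlonglongrightarrow> g y" by simp_all
  have "\<forall>\<^sub>F k in sequentially. t k < 1" using order_tendstoD(2)[OF t(1), of 1] by simp
  then have "\<forall>\<^sub>F k in sequentially. h k (ys k) \<le> (1 - t k) * h k y + t k * M" by eventually_elim (rule upper, simp)
  then show ?thesis by (rule tendsto_sandwich[OF always_eventually[OF allI[OF lower]] _ l(2) l(1)])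
qed

text \<open>Violations along a subsequence would have a cluster point \<open>l\<close> in
  \<open>K\<close>, and by \<open>convex_seq_limit\<close> both functions tend to \<open>g l\<close>
  along them.\<close>

lemma convex_seq_uniform:
  fixes h :: "nat \<Rightarrow> 'a::euclidean_space \<Rightarrow> real"
  assumes h: "\<And>k. cvx (h k)" and g: "cvx g" and lim: "\<And>y. (\<lambda>k. h k y) \<longlonglongrightarrow> g y" and e: "0 < e" and K: "compact K"
  shows "\<forall>\<^sub>F k in sequentially. \<forall>y\<in>K. \<bar>h k y - g y\<bar> < e"
proof (rule ccontr)
  assume "\<not> ?thesis"
  then have "\<exists>\<^sub>F k in sequentially. \<exists>y\<in>K. e \<le> \<bar>h k y - g y\<bar>" by (simp add: not_eventually not_less)
  then have "infinite {k. \<exists>y\<in>K. e \<le> \<bar>h k y - g y\<bar>}"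
    by (simp add: frequently_cofinite[symmetric] cofinite_eq_sequentially)
  then obtain r :: "nat \<Rightarrow> nat" where r: "strict_mono r" "\<And>j. \<exists>y\<in>K. e \<le> \<bar>h (r j) y - g y\<bar>"
    using infinite_enumerate by blast
  then obtain ys where ys: "\<And>j. ys j \<in> K" "\<And>j. e \<le> \<bar>h (r j) (ys j) - g (ys j)\<bar>" by metis
  obtain l q where l: "l \<in> K" "strict_mono q" "(ys \<circ> q) \<longlonglongrightarrow> l"
    using K ys(1) unfolding compact_def by metis
  have "(\<lambda>j. h (r (q j)) ((ys \<circ> q) j)) \<longlonglongrightarrow> g l"
  proof (rule convex_seq_limit[OF h _ l(3)])
    fix y
    show "(\<lambda>j. h (r (q j)) y) \<longlonglongrightarrow> g y"
      using LIMSEQ_subseq_LIMSEQ[OF lim[of y] strict_mono_o[OF r(1) l(2)]] by (simp add: o_def)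
  qed
  moreover have "(\<lambda>j. g ((ys \<circ> q) j)) \<longlonglongrightarrow> g l"
    by (rule convex_seq_limit[OF g tendsto_const l(3)])
  ultimately have "(\<lambda>j. h (r (q j)) ((ys \<circ> q) j) - g ((ys \<circ> q) j)) \<longlonglongrightarrow> g l - g l" by (rule tendsto_diff)
  then have "\<exists>N. \<forall>j\<ge>N. \<bar>h (r (q j)) ((ys \<circ> q) j) - g ((ys \<circ> q) j)\<bar> < e"
    using LIMSEQ_D[OF _ e] by fastforce
  then show False using ys(2) by (fastforce simp: not_less[symmetric])
qed

text \<open>The epigraph is closed and convex, and \<open>q\<close> is nonnegative because it is
  unbounded upwards. A vertical hyperplane, \<open>q = 0\<close>, can occur only when
  \<open>u x0\<close> is infinite.\<close>

lemma conv_sc_epi_separation: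
  fixes u :: "'n::finite cfun"
  assumes u: "u \<in> conv_sc" and r: "ereal r < u x0"
  obtains p q b where "0 \<le> q" "p \<bullet> x0 + q * r < b" "\<forall>x s. u x \<le> ereal s \<longrightarrow> b < p \<bullet> x + q * s"
proof -
  define E where "E = {p :: (real^'n) \<times> real. u (fst p) \<le> ereal (snd p)}"
  have cE: "convex E"
  proof (rule convexI)
    fix p q :: "(real^'n) \<times> real" and a w :: real assume pq: "p \<in> E" "q \<in> E" and uw: "0 \<le> a" "0 \<le> w" "a + w = 1"
    have a: "a = 1 - w" using uw by simp
    have "u ((1 - w) *\<^sub>R fst p + w *\<^sub>R fst q) \<le> ereal (1 - w) * u (fst p) + ereal w * u (fst q)"
      using u uw by (auto simp: conv_sc_def)
    also have "\<dots> \<le> ereal (1 - w) * ereal (snd p) + ereal w * ereal (snd q)"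
      using pq uw by (intro add_mono ereal_mult_left_mono) (auto simp: E_def)
    finally show "a *\<^sub>R p + w *\<^sub>R q \<in> E" by (simp add: E_def a)
  qed
  have "closed E" unfolding closed_sequential_limits
  proof (intro allI impI)
    fix ps :: "nat \<Rightarrow> (real^'n) \<times> real" and l assume *: "(\<forall>n. ps n \<in> E) \<and> ps \<longlonglongrightarrow> l"
    then have l: "(\<lambda>n. fst (ps n)) \<longlonglongrightarrow> fst l" "(\<lambda>n. snd (ps n)) \<longlonglongrightarrow> snd l" by (auto intro: tendsto_fst tendsto_snd)
    have "u (fst l) \<le> Liminf sequentially (\<lambda>n. u (fst (ps n)))" using u l(1) by (auto simp: conv_sc_def)
    also have "\<dots> \<le> Liminf sequentially (\<lambda>n. ereal (snd (ps n)))"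
      using * by (intro Liminf_mono always_eventually) (auto simp: E_def)
    also have "\<dots> = ereal (snd l)" using l(2) by (intro lim_imp_Liminf) auto
    finally show "l \<in> E" by (simp add: E_def)
  qed
  moreover have "(x0, r) \<notin> E" using r by (simp add: E_def)
  ultimately obtain a b where ab: "inner a (x0, r) < b" "\<forall>x\<in>E. b < inner a x"
    using separating_hyperplane_closed_point[OF cE] by blast
  obtain p q where a: "a = (p, q)" by force
  have 1: "b < p \<bullet> x + q * s" if "u x \<le> ereal s" for x s using ab(2) that by (auto simp: E_def a inner_prod_def)
  obtain x1 where "u x1 < \<infinity>" using u by (auto simp: conv_sc_def)
  moreover have "u x1 > - \<infinity>" using u by (auto simp: conv_sc_def)
  ultimately obtain s1 where s1: "u x1 = ereal s1" by (cases "u x1") auto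
  have "0 \<le> q"
  proof (rule ccontr)
    assume "\<not> 0 \<le> q"
    then have q: "q < 0" by simp
    define s where "s = max s1 ((b - p \<bullet> x1) / q)"
    have "q * s \<le> q * ((b - p \<bullet> x1) / q)" using q by (intro mult_left_mono_neg) (auto simp: s_def)
    moreover have "b < p \<bullet> x1 + q * s" by (rule 1) (simp add: s1 s_def)
    ultimately show False using q by simp
  qed
  then show ?thesis using that 1 ab(1) by (simp add: a inner_prod_def)
qed

lemma conv_sc_affine_minorant:
  assumes u: "u \<in> conv_sc" and r: "u x0 = ereal s0" "r < s0"
  obtains z c where "r < z \<bullet> x0 + c" "\<And>x. ereal (z \<bullet> x + c) \<le> u x"
proof -
  obtain p q b where pqb: "0 \<le> q" "p \<bullet> x0 + q * r < b" "\<forall>x s. u x \<le> ereal s \<longrightarrow> b < p \<bullet> x + q * s"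
    by (rule conv_sc_epi_separation[OF u, of r x0]) (use r in auto)
  have "b < p \<bullet> x0 + q * s0" using pqb(3)[rule_format, of x0 s0] r by simp
  then have "0 < q * (s0 - r)" using pqb(2) by (simp add: right_diff_distrib)
  then have q: "0 < q" using r(2) by (simp add: zero_less_mult_iff)
  have "ereal ((- (1 / q)) *\<^sub>R p \<bullet> x + b / q) \<le> u x" for x
  proof (cases "u x")
    case (real s)
    then have "b < p \<bullet> x + q * s" using pqb(3)[rule_format, of x s] by simp
    then have "b / q < (p \<bullet> x + q * s) / q" using q by (intro divide_strict_right_mono)
    then show ?thesis using real q by (simp add: add_divide_distrib)
  next
    case MInf
    then show ?thesis using u by (auto simp: conv_sc_def)
  qed simp
  moreover have "r < (- (1 / q)) *\<^sub>R p \<bullet> x0 + b / q"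
  proof -
    have "(p \<bullet> x0 + q * r) / q < b / q" using pqb(2) q by (intro divide_strict_right_mono)
    then show ?thesis using q by (simp add: add_divide_distrib)
  qed
  ultimately show ?thesis using that by blast
qed

section \<open>Conjugation: limits, lattice operations and inversion\<close>

definition fenchel :: "(real^'n \<Rightarrow> real) \<Rightarrow> 'n::finite cfun" where
  "fenchel v x = (SUP y. ereal (x \<bullet> y - v y))"

lemma fenchel_upper: "ereal (x \<bullet> y - v y) \<le> fenchel v x"
  unfolding fenchel_def by (rule SUP_upper) simp

lemma fenchel_le_iff: "fenchel v x \<le> ereal m \<longleftrightarrow> (\<forall>y. x \<bullet> y - v y \<le> m)"
  unfolding fenchel_def by (simp add: SUP_le_iff)

lemma fenchel_liminf:
  assumes "\<And>y. (\<lambda>k. vs k y) \<longlonglongrightarrow> v y" "xs \<longlonglongrightarrow> x"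
  shows "fenchel v x \<le> Liminf sequentially (\<lambda>k. fenchel (vs k) (xs k))"
  unfolding fenchel_def[of v]
proof (rule SUP_least)
  fix y
  have "(\<lambda>k. ereal (xs k \<bullet> y - vs k y)) \<longlonglongrightarrow> ereal (x \<bullet> y - v y)" by (intro tendsto_intros assms)
  then have "ereal (x \<bullet> y - v y) = Liminf sequentially (\<lambda>k. ereal (xs k \<bullet> y - vs k y))"
    by (intro lim_imp_Liminf[symmetric]) auto
  also have "\<dots> \<le> Liminf sequentially (\<lambda>k. fenchel (vs k) (xs k))"
    by (intro Liminf_mono always_eventually allI fenchel_upper)
  finally show "ereal (x \<bullet> y - v y) \<le> Liminf sequentially (\<lambda>k. fenchel (vs k) (xs k))" .
qed

lemma cvx_affine_minorant:
  fixes v :: "'a::euclidean_space \<Rightarrow> real"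
  assumes v: "cvx v"
  obtains z c where "\<And>y. z \<bullet> y + c \<le> v y"
proof -
  have cont: "continuous_on UNIV v" by (rule convex_on_continuous[OF open_UNIV v])
  define E where "E = {p :: 'a \<times> real. v (fst p) \<le> snd p}"
  have "convex E"
  proof (rule convexI)
    fix p q :: "'a \<times> real" and u w :: real assume pq: "p \<in> E" "q \<in> E" and uw: "0 \<le> u" "0 \<le> w" "u + w = 1"
    have "v (u *\<^sub>R fst p + w *\<^sub>R fst q) \<le> u * v (fst p) + w * v (fst q)"
      using v uw unfolding convex_on_def by auto
    also have "\<dots> \<le> u * snd p + w * snd q" using pq uw by (intro add_mono mult_left_mono) (auto simp: E_def)
    finally show "u *\<^sub>R p + w *\<^sub>R q \<in> E" by (simp add: E_def)
  qed
  moreover have "closed E" unfolding E_def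
    by (rule closed_Collect_le) (auto intro!: continuous_intros continuous_on_compose2[OF cont])
  moreover have "(0, v 0 - 1) \<notin> E" by (simp add: E_def)
  ultimately obtain a b where ab: "inner a (0, v 0 - 1) < b" "\<forall>x\<in>E. b < inner a x"
    using separating_hyperplane_closed_point[of E] by blast
  obtain p q where a: "a = (p, q)" by force
  have 1: "b < p \<bullet> x + q * v x" for x using ab(2) by (auto simp: E_def a inner_prod_def)
  have q: "0 < q" using 1[of 0] ab(1) by (simp add: a inner_prod_def algebra_simps)
  have "(- (1 / q)) *\<^sub>R p \<bullet> x + b / q \<le> v x" for x
  proof -
    have "b / q < (p \<bullet> x + q * v x) / q" using q 1[of x] by (intro divide_strict_right_mono)
    then show ?thesis using q by (simp add: add_divide_distrib)
  qed
  then show ?thesis using that by blast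
qed

lemma fenchel_conv_sc:
  fixes v :: "real^'n::finite \<Rightarrow> real"
  assumes v: "cvx v"
  shows "fenchel v \<in> conv_sc"
  unfolding conv_sc_def mem_Collect_eq
proof (intro conjI allI impI)
  fix x :: "real^'n"
  show "- \<infinity> < fenchel v x" using fenchel_upper[of x 0 v] by (rule less_le_trans[rotated]) simp
next
  obtain z c where zc: "\<And>y. z \<bullet> y + c \<le> v y" using cvx_affine_minorant[OF v] by blast
  have "fenchel v z \<le> ereal (- c)" unfolding fenchel_le_iff using zc by (auto simp: algebra_simps)
  then show "\<exists>x. fenchel v x < \<infinity>" by (intro exI[of _ z]) auto
next
  fix x and xs :: "nat \<Rightarrow> real^'n" assume "xs \<longlonglongrightarrow> x"
  then show "fenchel v x \<le> Liminf sequentially (\<lambda>k. fenchel v (xs k))" by (intro fenchel_liminf tendsto_const)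
next
  fix x y :: "real^'n" and t :: real assume t: "0 \<le> t \<and> t \<le> 1"
  show "fenchel v ((1 - t) *\<^sub>R x + t *\<^sub>R y) \<le> ereal (1 - t) * fenchel v x + ereal t * fenchel v y"
    unfolding fenchel_def[of v "(1 - t) *\<^sub>R x + t *\<^sub>R y"]
  proof (rule SUP_least)
    fix w
    have "ereal (((1 - t) *\<^sub>R x + t *\<^sub>R y) \<bullet> w - v w) = ereal (1 - t) * ereal (x \<bullet> w - v w) + ereal t * ereal (y \<bullet> w - v w)"
      by (simp add: inner_add_left algebra_simps)
    also have "\<dots> \<le> ereal (1 - t) * fenchel v x + ereal t * fenchel v y"
      using t by (intro add_mono ereal_mult_left_mono fenchel_upper) auto
    finally show "ereal (((1 - t) *\<^sub>R x + t *\<^sub>R y) \<bullet> w - v w) \<le> ereal (1 - t) * fenchel v x + ereal t * fenchel v y" .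
  qed
next
  show "((\<lambda>x. fenchel v x / ereal (norm x)) \<longlongrightarrow> \<infinity>) at_infinity"
    unfolding tendsto_PInfty
  proof
    fix r :: real
    \<comment> \<open>The test point of norm \<open>R\<close> in direction \<open>x\<close> gives
      \<open>R * norm x - M\<close>; since \<open>R\<close> exceeds \<open>\<bar>r\<bar>\<close> by
      1, this is above \<open>r * norm x\<close> as soon as \<open>norm x\<close> exceeds
      \<open>M\<close>.\<close>
    define R where "R = \<bar>r\<bar> + 1"
    have cont: "continuous_on UNIV v" by (rule convex_on_continuous[OF open_UNIV v])
    have "bounded (v ` cball 0 R)"
      by (rule compact_imp_bounded[OF compact_continuous_image[OF continuous_on_subset[OF cont]]]) auto
    then obtain M where "\<forall>y\<in>cball 0 R. \<bar>v y\<bar> \<le> M" by (auto simp: bounded_iff)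
    then have M: "\<And>y. norm y \<le> R \<Longrightarrow> \<bar>v y\<bar> \<le> M" by simp
    have "ereal r < fenchel v x / ereal (norm x)" if x: "\<bar>M\<bar> + 1 \<le> norm x" for x
    proof -
      have n: "0 < norm x" using x by linarith
      define y where "y = (R / norm x) *\<^sub>R x"
      have "norm y = R" using n by (simp add: y_def R_def)
      then have "v y \<le> M" using M[of y] by simp
      moreover have "x \<bullet> y = R * norm x" using n by (simp add: y_def power2_norm_eq_inner[symmetric] power2_eq_square)
      ultimately have "ereal (R * norm x - M) \<le> fenchel v x"
        using fenchel_upper[of x y v] by (intro order_trans[OF _ fenchel_upper[of x y v]]) simp
      then have "ereal (R * norm x - M) / ereal (norm x) \<le> fenchel v x / ereal (norm x)"
        using n by (intro ereal_divide_right_mono) auto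
      moreover have "ereal r < ereal (R * norm x - M) / ereal (norm x)"
      proof -
        have "r * norm x \<le> \<bar>r\<bar> * norm x" by (intro mult_right_mono) auto
        then have "r * norm x < R * norm x - M" using x by (simp add: R_def distrib_right)
        then have "r < (R * norm x - M) / norm x" using n by (simp only: pos_less_divide_eq)
        then show ?thesis using n by simp
      qed
      ultimately show ?thesis by (rule less_le_trans[rotated])
    qed
    then show "\<forall>\<^sub>F x in at_infinity. ereal r < fenchel v x / ereal (norm x)"
      unfolding eventually_at_infinity by blast
  qed
qed

text \<open>These points form the recovery sequence. As \<open>v\<close> lies above
  \<open>x \<bullet> y - m\<close>, eventually \<open>vs k\<close> lies above the concave function
  \<open>x \<bullet> y - (m + \<delta>) - \<delta> * norm y\<close>, and an affine function in
  between has a slope within \<open>\<delta>\<close> of \<open>x\<close>.\<close>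

lemma fenchel_near_minimizer:
  fixes vs :: "nat \<Rightarrow> real^'n::finite \<Rightarrow> real"
  assumes vs: "\<And>k. cvx (vs k)" and v: "cvx v" and lim: "\<And>y. (\<lambda>k. vs k y) \<longlonglongrightarrow> v y"
    and m: "fenchel v x \<le> ereal m" and \<delta>: "0 < \<delta>"
  shows "\<forall>\<^sub>F k in sequentially. \<exists>z. dist z x \<le> \<delta> \<and> fenchel (vs k) z \<le> ereal (m + \<delta>)"
proof -
  define h where "h w y = w y + (\<delta> * norm y + ((- x) \<bullet> y + m))" for w :: "real^'n \<Rightarrow> real" and y
  have "cvx (norm :: real^'n \<Rightarrow> real)" using convex_on_dist[of UNIV "0 :: real^'n"] by simp
  then have cn: "cvx (\<lambda>y::real^'n. \<delta> * norm y)" using \<delta> by (intro convex_on_cmul) auto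
  have ch: "cvx (h w)" if "cvx w" for w unfolding h_def[abs_def] by (intro cvx_add that cn cvx_affine)
  have hlim: "(\<lambda>k. h (vs k) y) \<longlonglongrightarrow> h v y" for y unfolding h_def by (intro tendsto_intros lim)
  have hge: "\<delta> * norm y \<le> h v y" for y using m by (simp add: fenchel_le_iff h_def algebra_simps)
  define \<epsilon> where "\<epsilon> = min 1 \<delta>"
  \<comment> \<open>On the sphere of radius \<open>\<rho>\<close> the limit \<open>h v\<close> is at
    least \<open>h v 0 + 3\<close>. Errors below 1 leave \<open>h (vs k)\<close> larger there than
    at 0, and by convexity it stays larger outside the ball.\<close>
  define \<rho> where "\<rho> = (h v 0 + 3) / \<delta>"
  have h0: "0 \<le> h v 0" using hge[of 0] by simp
  have \<rho>: "0 < \<rho>" "\<delta> * \<rho> = h v 0 + 3" using \<delta> h0 by (auto simp: \<rho>_def)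
  have "\<forall>\<^sub>F k in sequentially. \<forall>y\<in>cball 0 \<rho>. \<bar>h (vs k) y - h v y\<bar> < \<epsilon>"
    by (rule convex_seq_uniform[OF ch[OF vs] ch[OF v] hlim]) (use \<delta> in \<open>auto simp: \<epsilon>_def\<close>)
  then show ?thesis
  proof eventually_elim
    case (elim k)
    have near: "\<bar>h (vs k) y - h v y\<bar> < \<delta>" "\<bar>h (vs k) y - h v y\<bar> < 1" if "norm y \<le> \<rho>" for y
      using bspec[OF elim, of y] that by (auto simp: \<epsilon>_def)
    have in_ball: "- \<delta> \<le> h (vs k) y" if "norm y \<le> \<rho>" for y
    proof -
      have "0 \<le> \<delta> * norm y" using \<delta> by simp
      then show ?thesis using near(1)[OF that] hge[of y] by linarith
    qed
    have all: "- \<delta> \<le> h (vs k) y" for y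
    proof (cases "norm y \<le> \<rho>")
      case False
      define t where "t = \<rho> / norm y"
      have ny: "0 < norm y" "\<rho> < norm y" using False \<rho>(1) by linarith+
      then have t: "0 < t" "t < 1" unfolding t_def using \<rho>(1) by (simp_all only: divide_pos_pos pos_divide_less_eq mult_1)
      define p where "p = (1 - t) *\<^sub>R 0 + t *\<^sub>R y"
      have np: "norm p = \<rho>" using ny \<rho>(1) by (simp add: p_def t_def)
      have "h v 0 + 2 < h (vs k) p" using near(2)[of p] np hge[of p] \<rho>(2) by simp
      moreover have "h (vs k) 0 < h v 0 + 1" using near(2)[of 0] \<rho>(1) by simp
      moreover have "h (vs k) p \<le> (1 - t) * h (vs k) 0 + t * h (vs k) y"
        unfolding p_def using convex_onD[OF ch[OF vs], of t 0 y k] t by simp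
      ultimately have "h (vs k) 0 < (1 - t) * h (vs k) 0 + t * h (vs k) y" by linarith
      then have "t * h (vs k) 0 < t * h (vs k) y" by (simp add: left_diff_distrib)
      then have "h (vs k) 0 < h (vs k) y" using t by simp
      then show ?thesis using in_ball[of 0] \<rho> by simp
    qed (rule in_ball)
    define g where "g y = (x \<bullet> y + - (m + \<delta>)) - \<delta> * norm y" for y
    have "cvx (\<lambda>y. \<delta> * norm y + ((- x) \<bullet> y + (m + \<delta>)))" by (intro cvx_add cn cvx_affine)
    then have "cvx (\<lambda>y. - g y)" by (simp add: g_def algebra_simps)
    moreover have "g y \<le> vs k y" for y using all[of y] by (simp add: g_def h_def)
    ultimately obtain z b where zb: "\<And>y. g y \<le> z \<bullet> y + b" "\<And>y. z \<bullet> y + b \<le> vs k y"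
      using affine_sandwich[OF vs] by blast
    have b: "- b \<le> m + \<delta>" using zb(1)[of 0] by (simp add: g_def)
    have "norm (z - x) \<le> \<delta>"
    proof (rule ccontr)
      assume "\<not> norm (z - x) \<le> \<delta>"
      define e where "e = norm (z - x)"
      have e: "\<delta> < e" using \<open>\<not> norm (z - x) \<le> \<delta>\<close> by (simp add: e_def)
      \<comment> \<open>If \<open>z\<close> were farther than \<open>\<delta>\<close> from
        \<open>x\<close>, the affine function would fall below \<open>g\<close> far out in the
        direction opposite to \<open>z - x\<close>; \<open>s\<close> is large enough to outweigh the
        intercepts.\<close>
      define s where "s = (\<bar>b + (m + \<delta>)\<bar> + 1) / (e * (e - \<delta>))"
      have s: "0 < s" using e \<delta> by (simp add: s_def)
      define w where "w = z - x"
      have "g (- (s *\<^sub>R w)) \<le> z \<bullet> (- (s *\<^sub>R w)) + b" by (rule zb)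
      moreover have "norm (- (s *\<^sub>R w)) = s * e" using s by (simp add: e_def w_def)
      moreover have "z \<bullet> (- (s *\<^sub>R w)) = x \<bullet> (- (s *\<^sub>R w)) - s * e\<^sup>2"
      proof -
        have "e\<^sup>2 = (z - x) \<bullet> w" by (simp add: e_def w_def power2_norm_eq_inner)
        then show ?thesis by (simp add: inner_diff_left right_diff_distrib)
      qed
      ultimately have "s * e\<^sup>2 \<le> b + (m + \<delta>) + \<delta> * (s * e)" by (simp only: g_def)
      then have "s * (e * (e - \<delta>)) \<le> b + (m + \<delta>)" by (simp add: power2_eq_square algebra_simps)
      moreover have "s * (e * (e - \<delta>)) = \<bar>b + (m + \<delta>)\<bar> + 1" using e \<delta> by (simp add: s_def)
      ultimately show False by linarith
    qed
    moreover have "fenchel (vs k) z \<le> ereal (m + \<delta>)"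
      unfolding fenchel_le_iff
    proof
      fix y show "z \<bullet> y - vs k y \<le> m + \<delta>" using zb(2)[of y] b by linarith
    qed
    ultimately show ?case by (intro exI[of _ z]) (simp add: dist_norm)
  qed
qed

lemma epi_conv_fenchel:
  fixes vs :: "nat \<Rightarrow> real^'n::finite \<Rightarrow> real"
  assumes vs: "\<And>k. cvx (vs k)" and v: "cvx v" and lim: "\<And>y. (\<lambda>k. vs k y) \<longlonglongrightarrow> v y"
  shows "epi_conv (\<lambda>k. fenchel (vs k)) (fenchel v)"
  unfolding epi_conv_def
proof (intro allI conjI impI)
  fix x and xs :: "nat \<Rightarrow> real^'n" assume "xs \<longlonglongrightarrow> x"
  then show "fenchel v x \<le> Liminf sequentially (\<lambda>k. fenchel (vs k) (xs k))" by (rule fenchel_liminf[OF lim])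
next
  fix x
  have minf: "- \<infinity> < fenchel v x" using fenchel_conv_sc[OF v] by (auto simp: conv_sc_def)
  show "\<exists>xs. xs \<longlonglongrightarrow> x \<and> (\<lambda>k. fenchel (vs k) (xs k)) \<longlonglongrightarrow> fenchel v x"
  proof (cases "fenchel v x")
    case PInf
    have "liminf (\<lambda>k. fenchel (vs k) x) = \<infinity>" using fenchel_liminf[of vs v "\<lambda>_. x" x, OF lim tendsto_const] PInf by simp
    then show ?thesis using PInf by (intro exI[of _ "\<lambda>_. x"]) (simp add: Liminf_PInfty)
  next
    case (real m)
    \<comment> \<open>\<open>A k\<close> holds the tolerances at which \<open>fenchel (vs k)\<close>
      has a suitable point near \<open>x\<close>. Taking \<open>d k\<close> almost minimal in it
      merges the eventual statements for the single \<open>\<delta>\<close> into one sequence with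
      \<open>d k\<close> tending to 0.\<close>
    define A where "A k = {\<delta>. 0 \<le> \<delta> \<and> (\<exists>z. dist z x \<le> \<delta> \<and> fenchel (vs k) z \<le> ereal (m + \<delta>))}" for k
    have A_bdd: "bdd_below (A k)" for k by (auto simp: A_def intro: bdd_belowI)
    have A_ne: "A k \<noteq> {}" for k
    proof -
      obtain z where z: "fenchel (vs k) z < \<infinity>" using fenchel_conv_sc[OF vs, of k] by (auto simp: conv_sc_def)
      then obtain s where s: "fenchel (vs k) z \<le> ereal s" by (cases "fenchel (vs k) z") auto
      have "s \<le> m + (\<bar>s - m\<bar> + dist z x)" using abs_ge_self[of "s - m"] zero_le_dist[of z x] by linarith
      then have "fenchel (vs k) z \<le> ereal (m + (\<bar>s - m\<bar> + dist z x))" by (intro order_trans[OF s]) simp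
      then have "\<bar>s - m\<bar> + dist z x \<in> A k" unfolding A_def by (auto intro!: exI[of _ z])
      then show ?thesis by blast
    qed
    have "\<exists>\<delta>\<in>A k. \<delta> < Inf (A k) + inverse (real (Suc k))" for k
      using cInf_lessD[OF A_ne, of k "Inf (A k) + inverse (real (Suc k))"] by simp
    then obtain d where d: "\<And>k. d k \<in> A k" "\<And>k. d k < Inf (A k) + inverse (real (Suc k))" by metis
    have "\<forall>k. \<exists>z. dist z x \<le> d k \<and> fenchel (vs k) z \<le> ereal (m + d k)" using d(1) by (simp add: A_def)
    then obtain xs where xs: "\<And>k. dist (xs k) x \<le> d k" "\<And>k. fenchel (vs k) (xs k) \<le> ereal (m + d k)" by metis
    have d0: "0 \<le> d k" for k using d(1) by (simp add: A_def)
    have dl: "d \<longlonglongrightarrow> 0"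
    proof (rule LIMSEQ_I)
      fix e :: real assume e: "0 < e"
      have "\<forall>\<^sub>F k in sequentially. e / 2 \<in> A k"
        using fenchel_near_minimizer[OF vs v lim, of x m "e / 2"] real e by (simp add: A_def)
      moreover have "\<forall>\<^sub>F k in sequentially. inverse (real (Suc k)) < e / 2"
        using order_tendstoD(2)[OF LIMSEQ_inverse_real_of_nat, of "e / 2"] e by simp
      ultimately have "\<forall>\<^sub>F k in sequentially. norm (d k - 0) < e"
      proof eventually_elim
        case (elim k)
        have "Inf (A k) \<le> e / 2" by (rule cInf_lower[OF elim(1) A_bdd])
        then show ?case using d(2)[of k] elim(2) d0[of k] by simp
      qed
      then show "\<exists>N. \<forall>k\<ge>N. norm (d k - 0) < e" by (simp add: eventually_sequentially)
    qed
    have xl: "xs \<longlonglongrightarrow> x"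
      by (rule metric_tendsto_imp_tendsto[OF dl]) (use xs d0 in \<open>auto simp: dist_real_def\<close>)
    have "(\<lambda>k. fenchel (vs k) (xs k)) \<longlonglongrightarrow> ereal m"
    proof (rule order_tendstoI)
      fix a assume "a < ereal m"
      then have "a < Liminf sequentially (\<lambda>k. fenchel (vs k) (xs k))"
        using fenchel_liminf[of vs v xs x, OF lim xl] real by simp
      then show "\<forall>\<^sub>F k in sequentially. a < fenchel (vs k) (xs k)" by (rule less_LiminfD)
    next
      fix a assume a: "ereal m < a"
      have "(\<lambda>k. ereal (m + d k)) \<longlonglongrightarrow> ereal (m + 0)" by (intro tendsto_intros dl)
      then have "\<forall>\<^sub>F k in sequentially. ereal (m + d k) < a" using a by (intro order_tendstoD(2)) auto
      then show "\<forall>\<^sub>F k in sequentially. fenchel (vs k) (xs k) < a"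
        by eventually_elim (use xs(2) in \<open>auto intro: le_less_trans\<close>)
    qed
    then show ?thesis using xl real by auto
  qed (use minf in simp)
qed

lemma fenchel_min: "fenchel (\<lambda>y. min (v y) (w y)) = (\<lambda>x. max (fenchel v x) (fenchel w x))"
proof
  fix x
  have "fenchel (\<lambda>y. min (v y) (w y)) x = (SUP y. sup (ereal (x \<bullet> y - v y)) (ereal (x \<bullet> y - w y)))"
    unfolding fenchel_def by (rule SUP_cong[OF refl]) (simp add: sup_max max_def min_def)
  also have "\<dots> = max (fenchel v x) (fenchel w x)"
    unfolding fenchel_def sup_max[symmetric] by (rule SUP_sup_distrib[symmetric]) simp_all
  finally show "fenchel (\<lambda>y. min (v y) (w y)) x = max (fenchel v x) (fenchel w x)" .
qed

text \<open>If \<open>v\<close> were negative at \<open>y1\<close> and \<open>w\<close> at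
  \<open>y2\<close>, convexity of the minimum would make it negative on the whole segment. The open
  sets where \<open>v\<close> and \<open>w\<close> are negative would then cover the segment without
  meeting on it, against connectedness.\<close>

lemma affine_minorant_max:
  fixes v w :: "'a::euclidean_space \<Rightarrow> real"
  assumes v: "cvx v" and w: "cvx w" and m: "cvx (\<lambda>y. min (v y) (w y))" and ge: "\<And>y. 0 \<le> max (v y) (w y)"
  shows "(\<forall>y. 0 \<le> v y) \<or> (\<forall>y. 0 \<le> w y)"
proof (rule ccontr)
  assume "\<not> ?thesis"
  then obtain y1 y2 where y: "v y1 < 0" "w y2 < 0" by (auto simp: not_le)
  let ?S = "closed_segment y1 y2"
  have cont: "continuous_on UNIV v" "continuous_on UNIV w" by (auto intro: convex_on_continuous v w)
  have op: "open {y. v y < 0}" "open {y. w y < 0}" using cont by (auto intro!: open_Collect_less continuous_intros)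
  have "min (v y) (w y) < 0" if ys: "y \<in> ?S" for y
  proof -
    obtain t where t: "0 \<le> t" "t \<le> 1" "y = (1 - t) *\<^sub>R y1 + t *\<^sub>R y2" using ys by (auto simp: in_segment)
    have "min (v y) (w y) \<le> (1 - t) * min (v y1) (w y1) + t * min (v y2) (w y2)"
      using convex_onD[OF m, of t y1 y2] t by simp
    also have "\<dots> \<le> max (min (v y1) (w y1)) (min (v y2) (w y2))"
      using t by (intro convex_bound_le) auto
    also have "\<dots> < 0" using y by auto
    finally show ?thesis .
  qed
  then have cover: "?S \<subseteq> {y. v y < 0} \<union> {y. w y < 0}" by (auto simp: min_less_iff_disj)
  have disj: "{y. v y < 0} \<inter> {y. w y < 0} \<inter> ?S = {}"
  proof (rule equals0I)
    fix y assume "y \<in> {y. v y < 0} \<inter> {y. w y < 0} \<inter> ?S"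
    then show False using ge[of y] by auto
  qed
  have "connected ?S" by simp
  then show False using connectedD[OF _ op disj cover] y by auto
qed

text \<open>A finite value of the conjugate is an affine minorant of the maximum. After subtracting
  it, \<open>affine_minorant_max\<close> shows that it already lies below \<open>v\<close> or below
  \<open>w\<close>.\<close>

lemma fenchel_max:
  fixes v w :: "real^'n::finite \<Rightarrow> real"
  assumes v: "cvx v" and w: "cvx w" and m: "cvx (\<lambda>y. min (v y) (w y))"
  shows "fenchel (\<lambda>y. max (v y) (w y)) = (\<lambda>x. min (fenchel v x) (fenchel w x))"
proof
  fix x
  let ?M = "\<lambda>y. max (v y) (w y)"
  have "fenchel ?M x \<le> fenchel v x" "fenchel ?M x \<le> fenchel w x"
    unfolding fenchel_def by (auto intro!: SUP_mono')
  then have le: "fenchel ?M x \<le> min (fenchel v x) (fenchel w x)" by simp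
  have "min (fenchel v x) (fenchel w x) \<le> fenchel ?M x"
  proof (cases "fenchel ?M x")
    case (real c)
    define l where "l f y = f y + ((- x) \<bullet> y + c)" for f :: "real^'n \<Rightarrow> real" and y
    have l_iff: "0 \<le> l f y \<longleftrightarrow> x \<bullet> y - f y \<le> c" for f y by (auto simp: l_def)
    have "(\<forall>y. 0 \<le> l v y) \<or> (\<forall>y. 0 \<le> l w y)"
    proof (rule affine_minorant_max)
      show "cvx (l v)" "cvx (l w)" unfolding l_def[abs_def] by (intro cvx_add v w cvx_affine)+
      have "cvx (\<lambda>y. min (v y) (w y) + ((- x) \<bullet> y + c))" by (intro cvx_add m cvx_affine)
      then show "cvx (\<lambda>y. min (l v y) (l w y))" by (simp add: l_def min_add_distrib_left)
      fix y
      have "fenchel ?M x \<le> ereal c" using real by simp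
      then show "0 \<le> max (l v y) (l w y)" unfolding fenchel_le_iff l_def by (auto simp: max_def dest!: spec[of _ y] split: if_splits)
    qed
    then have "fenchel v x \<le> ereal c \<or> fenchel w x \<le> ereal c"
      unfolding fenchel_le_iff by (simp only: l_iff)
    then show ?thesis using real by (auto simp: min_le_iff_disj)
  next
    case MInf
    then show ?thesis using fenchel_upper[of x 0 ?M] by simp
  qed simp
  then show "fenchel ?M x = min (fenchel v x) (fenchel w x)" using le by simp
qed

lemma fenchel_affine:
  fixes v :: "real^'n::finite \<Rightarrow> real"
  shows "fenchel (\<lambda>y. v y + (b \<bullet> y + c)) = (\<lambda>x. fenchel v (x - b) + ereal (- c))"
proof
  fix x
  have "fenchel (\<lambda>y. v y + (b \<bullet> y + c)) x = (SUP y. ereal ((x - b) \<bullet> y - v y) + ereal (- c))"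
    unfolding fenchel_def by (rule SUP_cong[OF refl]) (simp add: inner_diff_left)
  also have "\<dots> = fenchel v (x - b) + ereal (- c)" unfolding fenchel_def by (rule SUP_ereal_add_left) auto
  finally show "fenchel (\<lambda>y. v y + (b \<bullet> y + c)) x = fenchel v (x - b) + ereal (- c)" .
qed

text \<open>Along \<open>d\<close> the expression \<open>x \<bullet> y - v y\<close> is unbounded
  unless \<open>x\<close> is orthogonal to \<open>d\<close>.\<close>

lemma fenchel_degenerate:
  fixes v :: "real^'n::finite \<Rightarrow> real"
  assumes d: "d \<noteq> 0" and v: "\<And>y s. v (y + s *\<^sub>R d) = v y"
  shows "aff_dim (dom_fn (fenchel v)) < int CARD('n)"
proof -
  have "dom_fn (fenchel v) \<subseteq> {x. d \<bullet> x = 0}"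
  proof
    fix x assume "x \<in> dom_fn (fenchel v)"
    then obtain m where m: "fenchel v x \<le> ereal m" unfolding dom_fn_def by (cases "fenchel v x") auto
    show "x \<in> {x. d \<bullet> x = 0}"
    proof (rule ccontr)
      assume "x \<notin> {x. d \<bullet> x = 0}"
      then have dx: "x \<bullet> d \<noteq> 0" by (simp add: inner_commute)
      define s where "s = (m + v 0 + 1) / (x \<bullet> d)"
      have "x \<bullet> (0 + s *\<^sub>R d) - v (0 + s *\<^sub>R d) \<le> m" using m unfolding fenchel_le_iff by blast
      then have "s * (x \<bullet> d) - v 0 \<le> m" using v[of 0 s] by simp
      then show False using dx by (simp add: s_def)
    qed
  qed
  then have "aff_dim (dom_fn (fenchel v)) \<le> aff_dim {x. d \<bullet> x = 0}" by (rule aff_dim_subset)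
  also have "\<dots> = int CARD('n) - 1" using aff_dim_hyperplane[OF d, of 0] by simp
  finally show ?thesis by simp
qed

text \<open>Fenchel-Moreau duality. The bounded domain makes the conjugate finite with Lipschitz
  constant \<open>R\<close>, as \<open>density_zero_imp_zero\<close> requires.\<close>

lemma conv_sc_biconjugate:
  fixes u :: "'n::finite cfun"
  assumes u: "u \<in> conv_sc" and R: "dom_fn u \<subseteq> cball 0 R"
  obtains v L where "cvx v" "0 \<le> L" "\<And>x y. \<bar>v x - v y\<bar> \<le> L * norm (x - y)" "fenchel v = u"
proof -
  have fin: "u x = ereal (real_of_ereal (u x))" if "x \<in> dom_fn u" for x
    using u that by (cases "u x") (auto simp: conv_sc_def dom_fn_def)
  obtain x1 where x1: "x1 \<in> dom_fn u" using u by (auto simp: conv_sc_def dom_fn_def)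
  have R0: "0 \<le> R" using subsetD[OF R x1] norm_ge_zero[of x1] by (simp del: norm_ge_zero)
  obtain z c where zc: "\<And>x. ereal (z \<bullet> x + c) \<le> u x"
    using conv_sc_affine_minorant[OF u fin[OF x1], of "real_of_ereal (u x1) - 1"] by (metis diff_less zero_less_one diff_less_eq less_add_one)
  define f where "f x = real_of_ereal (u x)" for x
  have ux: "x \<in> dom_fn u \<Longrightarrow> u x = ereal (f x)" for x using fin by (simp add: f_def)
  have norm: "norm x \<le> R" if "x \<in> dom_fn u" for x using subsetD[OF R that] by simp
  have inR: "x \<bullet> y \<le> R * norm y" if "x \<in> dom_fn u" for x y
    using norm_cauchy_schwarz[of x y] mult_right_mono[OF norm[OF that], of "norm y"] by simp
  define v where "v y = (SUP x\<in>dom_fn u. x \<bullet> y - f x)" for y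
  have bdd: "bdd_above ((\<lambda>x. x \<bullet> y - f x) ` dom_fn u)" for y
  proof (rule bdd_aboveI2)
    fix x assume x: "x \<in> dom_fn u"
    have "z \<bullet> x + c \<le> f x" using zc[of x] ux[OF x] by simp
    moreover have "x \<bullet> (- z) \<le> R * norm z" using inR[OF x, of "- z"] by simp
    ultimately show "x \<bullet> y - f x \<le> R * norm y + R * norm z - c" using inR[OF x, of y] by (simp add: inner_commute)
  qed
  have upper: "x \<in> dom_fn u \<Longrightarrow> x \<bullet> y - f x \<le> v y" for x y unfolding v_def by (rule cSUP_upper[OF _ bdd])
  have least: "(\<And>x. x \<in> dom_fn u \<Longrightarrow> x \<bullet> y - f x \<le> B) \<Longrightarrow> v y \<le> B" for y B
    unfolding v_def using x1 by (intro cSUP_least) auto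
  have "cvx v"
  proof (rule convex_onI)
    fix t :: real and a b :: "real^'n" assume t: "0 < t" "t < 1"
    show "v ((1 - t) *\<^sub>R a + t *\<^sub>R b) \<le> (1 - t) * v a + t * v b"
    proof (rule least)
      fix x assume x: "x \<in> dom_fn u"
      have "x \<bullet> ((1 - t) *\<^sub>R a + t *\<^sub>R b) - f x = (1 - t) * (x \<bullet> a - f x) + t * (x \<bullet> b - f x)"
        by (simp add: inner_add_right algebra_simps)
      also have "\<dots> \<le> (1 - t) * v a + t * v b" using t upper[OF x] by (intro add_mono mult_left_mono) auto
      finally show "x \<bullet> ((1 - t) *\<^sub>R a + t *\<^sub>R b) - f x \<le> (1 - t) * v a + t * v b" .
    qed
  qed simp
  moreover have "v a \<le> v b + R * norm (a - b)" for a b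
  proof (rule least)
    fix x assume x: "x \<in> dom_fn u"
    have "x \<bullet> a - f x = (x \<bullet> b - f x) + x \<bullet> (a - b)" by (simp add: inner_diff_right)
    then show "x \<bullet> a - f x \<le> v b + R * norm (a - b)" using upper[OF x, of b] inR[OF x, of "a - b"] by linarith
  qed
  then have "\<bar>v a - v b\<bar> \<le> R * norm (a - b)" for a b
    unfolding abs_le_iff by (smt (verit) norm_minus_commute)
  moreover have "fenchel v = u"
  proof (rule ext, rule antisym)
    fix x
    show "fenchel v x \<le> u x"
    proof (cases "x \<in> dom_fn u")
      case True
      show ?thesis unfolding ux[OF True] fenchel_le_iff using upper[OF True] by (auto simp: algebra_simps)
    qed (auto simp: dom_fn_def)
    show "u x \<le> fenchel v x"
    proof (rule ccontr)
      assume "\<not> u x \<le> fenchel v x"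
      then have "fenchel v x < u x" by simp
      from ereal_dense2[OF this] obtain r where r: "fenchel v x < ereal r" "ereal r < u x" by blast
      have "fenchel v x \<le> ereal r" by (rule less_imp_le[OF r(1)])
      then have "\<forall>y. x \<bullet> y - v y \<le> r" unfolding fenchel_le_iff .
      then have Fr: "x \<bullet> y - v y \<le> r" for y ..
      obtain p q b where pqb: "0 \<le> q" "p \<bullet> x + q * r < b" "\<forall>x s. u x \<le> ereal s \<longrightarrow> b < p \<bullet> x + q * s"
        by (rule conv_sc_epi_separation[OF u r(2)])
      have sep: "b < p \<bullet> x' + q * f x'" if "x' \<in> dom_fn u" for x' using pqb(3)[rule_format, of x' "f x'"] ux[OF that] by simp
      show False
      proof (cases "q = 0")
        case True
        \<comment> \<open>For a vertical hyperplane \<open>v\<close> is tested far out at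
          \<open>- (s *\<^sub>R p)\<close>: there it is at most \<open>v 0 - s * b\<close>, while
          \<open>x\<close> contributes \<open>- s * (p \<bullet> x)\<close>, and the gap grows with
          \<open>s\<close>.\<close>
        define s where "s = (\<bar>r + v 0\<bar> + 1) / (b - p \<bullet> x)"
        have s: "0 \<le> s" "s * (b - p \<bullet> x) = \<bar>r + v 0\<bar> + 1" using pqb(2) True by (auto simp: s_def)
        have "v (- (s *\<^sub>R p)) \<le> - (s * b) + v 0"
        proof (rule least)
          fix x' assume x': "x' \<in> dom_fn u"
          have "s * b \<le> s * (p \<bullet> x')" using sep[OF x'] True s by (intro mult_left_mono) auto
          then show "x' \<bullet> (- (s *\<^sub>R p)) - f x' \<le> - (s * b) + v 0" using upper[OF x', of 0] by (simp add: inner_commute)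
        qed
        then show False using Fr[of "- (s *\<^sub>R p)"] s(2) by (simp add: inner_commute right_diff_distrib)
      next
        case False
        then have q: "0 < q" using pqb(1) by simp
        define z where "z = (- (1 / q)) *\<^sub>R p"
        have "v z \<le> - (b / q)"
        proof (rule least)
          fix x' assume x': "x' \<in> dom_fn u"
          have "b / q < (p \<bullet> x' + q * f x') / q" using sep[OF x'] q by (intro divide_strict_right_mono)
          then show "x' \<bullet> z - f x' \<le> - (b / q)" using q by (simp add: z_def inner_commute add_divide_distrib)
        qed
        moreover have "(p \<bullet> x + q * r) / q < b / q" using pqb(2) q by (intro divide_strict_right_mono)
        ultimately show False using Fr[of z] q by (simp add: z_def inner_commute add_divide_distrib)
      qed
    qed
  qed
  ultimately show ?thesis using that[of v R] R0 by blast
qed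

section \<open>Almost everywhere differentiability of convex functions\<close>

text \<open>A bounded part of \<open>N\<close> has infinitely many pairwise disjoint translates
  along \<open>i\<close> inside one ball, so its measure is 0.\<close>

lemma negligible_lines:
  fixes N :: "'a::euclidean_space set"
  assumes N: "N \<in> sets borel" and i: "i \<noteq> 0" and one: "\<And>x h. x \<in> N \<Longrightarrow> 0 < h \<Longrightarrow> x + h *\<^sub>R i \<notin> N"
  shows "negligible N"
proof -
  have "negligible (N \<inter> cball 0 (real m))" for m :: nat
  proof -
    define B where "B = N \<inter> cball 0 (real m)"
    have "B \<in> sets lborel" unfolding B_def using N by auto
    then have Bl: "B \<in> lmeasurable"
      by (intro bounded_set_imp_lmeasurable) (auto simp: B_def intro: bounded_subset[OF bounded_cball])
    define e where "e k = inverse (real (Suc k)) *\<^sub>R i" for k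
    define T where "T k = (+) (e k) ` B" for k
    have Tl: "T k \<in> lmeasurable" for k unfolding T_def using Bl by (rule measurable_translation)
    have disj: "disjnt (T k) (T l)" if "k \<noteq> l" for k l
    proof -
      have "False" if kl: "k < l" and ab: "a \<in> B" "b \<in> B" "e k + a = e l + b" for k l a b
      proof -
        have "b = a + (inverse (real (Suc k)) - inverse (real (Suc l))) *\<^sub>R i"
          using ab(3) by (simp add: e_def algebra_simps)
        moreover have "0 < inverse (real (Suc k)) - inverse (real (Suc l))" using kl by simp
        ultimately show False using one[of a] ab by (auto simp: B_def)
      qed
      then show ?thesis unfolding disjnt_iff T_def using that by (auto) (metis linorder_neqE_nat)
    qed
    define V where "V = cball (0::'a) (real m + norm i)"
    have sub: "T k \<subseteq> V" for k
    proof
      fix x assume "x \<in> T k"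
      then obtain b where b: "b \<in> B" "x = e k + b" by (auto simp: T_def)
      have "norm (e k) \<le> 1 * norm i" unfolding e_def norm_scaleR by (intro mult_right_mono) (auto simp: field_simps)
      then show "x \<in> V" using b norm_triangle_ineq[of "e k" b] by (auto simp: V_def B_def)
    qed
    have "real K * measure lebesgue B \<le> measure lebesgue V" for K :: nat
    proof -
      have "measure lebesgue (\<Union>k<K. T k) = (\<Sum>k<K. measure lebesgue (T k))"
        by (rule measure_UNION') (use Tl disj in \<open>auto simp: pairwise_def\<close>)
      also have "\<dots> = real K * measure lebesgue B" by (simp add: T_def measure_translation)
      finally have "real K * measure lebesgue B = measure lebesgue (\<Union>k<K. T k)" by simp
      also have "\<dots> \<le> measure lebesgue V"
        by (rule measure_mono_fmeasurable) (use sub Tl in \<open>auto simp: V_def intro!: fmeasurableD\<close>)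
      finally show ?thesis .
    qed
    then have "measure lebesgue B \<le> 0" using reals_Archimedean3[of "measure lebesgue B"] by (meson not_le)
    then have "measure lebesgue B = 0" using measure_nonneg[of lebesgue B] by linarith
    then show ?thesis using negligible_iff_measure0[OF Bl] by (simp add: B_def)
  qed
  then have "negligible (\<Union>m::nat. N \<inter> cball 0 (real m))" by (intro negligible_countable_Union) auto
  moreover have "(\<Union>m::nat. N \<inter> cball 0 (real m)) = N" using real_arch_simple by auto
  ultimately show ?thesis by simp
qed

text \<open>Jensen's inequality at the points \<open>x + (n * (h \<bullet> i)) *\<^sub>R i\<close>,
  whose mean is \<open>x + h\<close>, gives an upper estimate of the increment. The midpoint
  inequality for \<open>x + h\<close> and \<open>x - h\<close> turns it into a lower one.\<close>

lemma convex_on_differentiable_partial: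
  fixes f :: "'a::euclidean_space \<Rightarrow> real"
  assumes f: "convex_on S f" and S: "open S" and x: "x \<in> S"
    and part: "\<forall>i\<in>Basis. \<exists>g. \<forall>e>0. \<exists>d>0. \<forall>t. \<bar>t\<bar> < d \<longrightarrow> x + t *\<^sub>R i \<in> S \<and> f (x + t *\<^sub>R i) - f x - g * t \<le> e * \<bar>t\<bar>"
  shows "f differentiable (at x)"
proof -
  obtain g where g: "\<forall>i\<in>Basis. \<forall>e>0. \<exists>d>0. \<forall>t. \<bar>t\<bar> < d \<longrightarrow> x + t *\<^sub>R i \<in> S \<and> f (x + t *\<^sub>R i) - f x - g i * t \<le> e * \<bar>t\<bar>"
    using part by metis
  define G where "G = (\<Sum>i\<in>Basis. g i *\<^sub>R i)"
  have Gi: "G \<bullet> h = (\<Sum>i\<in>Basis. g i * (h \<bullet> i))" for h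
    unfolding G_def inner_sum_left by (intro sum.cong) (simp_all add: inner_commute)
  define n where "n = real DIM('a)"
  have n: "0 < n" by (simp add: n_def)
  have upper: "\<exists>d>0. \<forall>h. norm h < d \<longrightarrow> f (x + h) - f x - G \<bullet> h \<le> e * norm h" if e: "0 < e" for e
  proof -
    have "\<forall>i\<in>Basis. \<exists>d>0. \<forall>t. \<bar>t\<bar> < d \<longrightarrow> x + t *\<^sub>R i \<in> S \<and> f (x + t *\<^sub>R i) - f x - g i * t \<le> (e / n) * \<bar>t\<bar>"
      using g divide_pos_pos[OF e n] by blast
    then obtain d where d: "\<forall>i\<in>Basis. 0 < d i \<and> (\<forall>t. \<bar>t\<bar> < d i \<longrightarrow> x + t *\<^sub>R i \<in> S \<and> f (x + t *\<^sub>R i) - f x - g i * t \<le> (e / n) * \<bar>t\<bar>)"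
      by metis
    define \<delta> where "\<delta> = Min (d ` Basis) / n"
    have "\<forall>h. norm h < \<delta> \<longrightarrow> f (x + h) - f x - G \<bullet> h \<le> e * norm h"
    proof (intro allI impI)
      fix h :: 'a assume h: "norm h < \<delta>"
      have t: "\<bar>n * (h \<bullet> i)\<bar> < d i" if i: "i \<in> Basis" for i
      proof -
        have "n * \<bar>h \<bullet> i\<bar> \<le> n * norm h" using Basis_le_norm[OF i, of h] n by (intro mult_left_mono) auto
        also have "\<dots> < n * \<delta>" using h n by simp
        also have "\<dots> \<le> d i" using i n by (simp add: \<delta>_def)
        finally show ?thesis using n by (simp add: abs_mult)
      qed
      have "x + h = (\<Sum>i\<in>Basis. (1 / n) *\<^sub>R (x + (n * (h \<bullet> i)) *\<^sub>R i))"
        using n by (simp add: scaleR_add_right sum.distrib euclidean_representation n_def scaleR_sum_left[symmetric])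
      then have "f (x + h) = f (\<Sum>i\<in>Basis. (1 / n) *\<^sub>R (x + (n * (h \<bullet> i)) *\<^sub>R i))" by (rule arg_cong)
      moreover have "f (\<Sum>i\<in>Basis. (1 / n) *\<^sub>R (x + (n * (h \<bullet> i)) *\<^sub>R i)) \<le> (\<Sum>i\<in>Basis. (1 / n) * f (x + (n * (h \<bullet> i)) *\<^sub>R i))"
        by (rule convex_on_sum[OF finite_Basis nonempty_Basis f]) (use d t n in \<open>auto simp: n_def\<close>)
      moreover have "\<dots> \<le> (\<Sum>i\<in>Basis. (1 / n) * (f x + g i * (n * (h \<bullet> i)) + (e / n) * \<bar>n * (h \<bullet> i)\<bar>))"
      proof (rule sum_mono)
        fix i :: 'a assume i: "i \<in> Basis"
        have "f (x + (n * (h \<bullet> i)) *\<^sub>R i) - f x - g i * (n * (h \<bullet> i)) \<le> (e / n) * \<bar>n * (h \<bullet> i)\<bar>"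
          using d t[OF i] i by blast
        then show "(1 / n) * f (x + (n * (h \<bullet> i)) *\<^sub>R i) \<le> (1 / n) * (f x + g i * (n * (h \<bullet> i)) + (e / n) * \<bar>n * (h \<bullet> i)\<bar>)"
          using n by (intro mult_left_mono) auto
      qed
      moreover have "\<dots> = (\<Sum>i\<in>Basis. f x / n + (g i * (h \<bullet> i) + (e / n) * \<bar>h \<bullet> i\<bar>))"
        using n by (intro sum.cong refl) (simp add: abs_mult distrib_left add.assoc)
      moreover have "\<dots> = f x + (G \<bullet> h + (\<Sum>i\<in>Basis. (e / n) * \<bar>h \<bullet> i\<bar>))"
        using n by (simp add: sum.distrib Gi n_def)
      moreover have "(\<Sum>i\<in>Basis. (e / n) * \<bar>h \<bullet> i\<bar>) \<le> (\<Sum>i\<in>(Basis::'a set). (e / n) * norm h)"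
        using e n Basis_le_norm by (intro sum_mono mult_left_mono) auto
      moreover have "(\<Sum>i\<in>(Basis::'a set). (e / n) * norm h) = e * norm h" using n by (simp add: n_def)
      ultimately show "f (x + h) - f x - G \<bullet> h \<le> e * norm h" by linarith
    qed
    moreover have "0 < \<delta>" using d n by (simp add: \<delta>_def)
    ultimately show ?thesis by blast
  qed
  obtain r where r: "0 < r" "ball x r \<subseteq> S" using S x openE by blast
  have "(f has_derivative (\<lambda>h. G \<bullet> h)) (at x)"
    unfolding has_derivative_at_alt
  proof (intro conjI allI impI)
    show "bounded_linear (\<lambda>h. G \<bullet> h)" by (rule bounded_linear_inner_right)
    fix e :: real assume e: "0 < e"
    obtain d where d: "0 < d" "\<forall>h. norm h < d \<longrightarrow> f (x + h) - f x - G \<bullet> h \<le> e * norm h" using upper[OF e] by blast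
    have "norm (f y - f x - G \<bullet> (y - x)) \<le> e * norm (y - x)" if y: "norm (y - x) < min d r" for y
    proof -
      define h where "h = y - x"
      have in_S: "x + h \<in> S" "x - h \<in> S" using y r(2) by (auto simp: h_def dist_norm norm_minus_commute subset_iff)
      have "f ((1 - 1/2) *\<^sub>R (x + h) + (1/2) *\<^sub>R (x - h)) \<le> (1 - 1/2) * f (x + h) + (1/2) * f (x - h)"
        using convex_onD[OF f, of "1/2" "x + h" "x - h"] in_S by simp
      moreover have "(1 - 1/2) *\<^sub>R (x + h) + (1/2) *\<^sub>R (x - h) = x" by (simp add: algebra_simps flip: scaleR_add_left)
      ultimately have "2 * f x \<le> f (x + h) + f (x - h)" by simp
      moreover have nh: "norm h < d" using y by (simp add: h_def)
      moreover have "f (x + h) - f x - G \<bullet> h \<le> e * norm h" "f (x - h) - f x + G \<bullet> h \<le> e * norm h"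
        using d(2)[rule_format, of h] d(2)[rule_format, of "- h"] nh by simp_all
      ultimately have "\<bar>f (x + h) - f x - G \<bullet> h\<bar> \<le> e * norm h" by linarith
      then show ?thesis by (simp add: h_def)
    qed
    then show "\<exists>d>0. \<forall>y. norm (y - x) < d \<longrightarrow> norm (f y - f x - G \<bullet> (y - x)) \<le> e * norm (y - x)"
      using d(1) r(1) by (intro exI[of _ "min d r"]) auto
  qed
  then show ?thesis by (auto simp: differentiable_def)
qed

text \<open>The set where the one-sided derivatives in direction \<open>i\<close> are separated by \<open>p < q\<close> meets every
  line parallel to \<open>i\<close> at most once.\<close>

lemma convex_on_AE_differentiable:
  fixes f :: "'a::euclidean_space \<Rightarrow> real"
  assumes f: "convex_on S f" and S: "open S"
  shows "negligible {x\<in>S. \<not> f differentiable (at x)}"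
proof -
  have cont: "continuous_on S f" by (rule convex_on_continuous[OF S f])
  define N where "N i p q = {x\<in>S. \<forall>h>0. (x + h *\<^sub>R i \<in> S \<longrightarrow> q * h \<le> f (x + h *\<^sub>R i) - f x) \<and>
     (x - h *\<^sub>R i \<in> S \<longrightarrow> f x - f (x - h *\<^sub>R i) \<le> p * h)}" for i :: 'a and p q
  have neg: "negligible (N i p q)" if i: "i \<in> Basis" and pq: "p < q" for i p q
  proof (rule negligible_lines)
    show "i \<noteq> 0" using i by auto
    fix x h assume x: "x \<in> N i p q" and h: "(0::real) < h"
    show "x + h *\<^sub>R i \<notin> N i p q"
    proof
      assume y: "x + h *\<^sub>R i \<in> N i p q"
      then have "q * h \<le> f (x + h *\<^sub>R i) - f x" using x h by (auto simp: N_def)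
      moreover have "f (x + h *\<^sub>R i) - f x \<le> p * h" using x y h unfolding N_def by force
      ultimately have "q * h \<le> p * h" by linarith
      then show False using pq h by simp
    qed
  next
    \<comment> \<open>Each defining inequality of \<open>N i p q\<close> fails on an open set, and
      so does some inequality for some \<open>h\<close>; hence \<open>N i p q\<close> is
      Borel.\<close>
    have opn: "open {x\<in>S. x + t *\<^sub>R i \<in> S \<and> \<phi> (f x) (f (x + t *\<^sub>R i)) < 0}"
      if \<phi>: "continuous_on UNIV (\<lambda>(a, b). \<phi> a b)" for \<phi> :: "real \<Rightarrow> real \<Rightarrow> real" and t
    proof -
      define A where "A = S \<inter> (\<lambda>x. x + t *\<^sub>R i) -` S"
      have A: "open A" unfolding A_def by (intro open_Int S continuous_open_vimage continuous_intros)
      have "continuous_on A (\<lambda>x. (f x, f (x + t *\<^sub>R i)))"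
        by (intro continuous_on_Pair continuous_on_subset[OF cont] continuous_on_compose2[OF cont] continuous_intros) (auto simp: A_def)
      then have "continuous_on A (\<lambda>x. (\<lambda>(a, b). \<phi> a b) (f x, f (x + t *\<^sub>R i)))"
        by (rule continuous_on_compose2[OF \<phi>]) auto
      then have "open (A \<inter> (\<lambda>x. \<phi> (f x) (f (x + t *\<^sub>R i))) -` {..<0})"
        by (intro continuous_open_preimage) (auto simp: A)
      moreover have "A \<inter> (\<lambda>x. \<phi> (f x) (f (x + t *\<^sub>R i))) -` {..<0} = {x\<in>S. x + t *\<^sub>R i \<in> S \<and> \<phi> (f x) (f (x + t *\<^sub>R i)) < 0}"
        by (auto simp: A_def)
      ultimately show ?thesis by simp
    qed
    have "open {x\<in>S. x + h *\<^sub>R i \<in> S \<and> (f (x + h *\<^sub>R i) - f x) - q * h < 0}" for h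
      by (rule opn) (auto intro!: continuous_intros simp: case_prod_beta)
    moreover have "open {x\<in>S. x + (- h) *\<^sub>R i \<in> S \<and> p * h - (f x - f (x + (- h) *\<^sub>R i)) < 0}" for h
      by (rule opn) (auto intro!: continuous_intros simp: case_prod_beta)
    ultimately have "open (\<Union>h\<in>{0<..}. {x\<in>S. x + h *\<^sub>R i \<in> S \<and> (f (x + h *\<^sub>R i) - f x) - q * h < 0} \<union>
       {x\<in>S. x + (- h) *\<^sub>R i \<in> S \<and> p * h - (f x - f (x + (- h) *\<^sub>R i)) < 0})" (is "open ?U") by blast
    moreover have "N i p q = S - ?U" unfolding N_def by (auto simp: not_less)
    ultimately show "N i p q \<in> sets borel" using S by auto
  qed
  have "{x\<in>S. \<not> f differentiable (at x)} \<subseteq> (\<Union>i\<in>Basis. \<Union>(p, q)\<in>{(p, q). p \<in> \<rat> \<and> q \<in> \<rat> \<and> p < q}. N i p q)"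
  proof (rule subsetI, rule ccontr)
    fix x assume x: "x \<in> {x\<in>S. \<not> f differentiable (at x)}"
      and nx: "x \<notin> (\<Union>i\<in>Basis. \<Union>(p, q)\<in>{(p, q). p \<in> \<rat> \<and> q \<in> \<rat> \<and> p < q}. N i p q)"
    have xS: "x \<in> S" using x by simp
    obtain r where r: "0 < r" "ball x r \<subseteq> S" using S xS openE by blast
    have "\<exists>g. \<forall>e>0. \<exists>d>0. \<forall>t. \<bar>t\<bar> < d \<longrightarrow> x + t *\<^sub>R i \<in> S \<and> f (x + t *\<^sub>R i) - f x - g * t \<le> e * \<bar>t\<bar>"
      if i: "i \<in> Basis" for i
    proof -
      \<comment> \<open>Difference quotients to the right and to the left. By convexity
        \<open>Inf R\<close> and \<open>Sup L\<close> are the one-sided derivatives.\<close>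
      define R where "R = {(f (x + h *\<^sub>R i) - f x) / h | h. 0 < h \<and> x + h *\<^sub>R i \<in> S}"
      define L where "L = {(f x - f (x - h *\<^sub>R i)) / h | h. 0 < h \<and> x - h *\<^sub>R i \<in> S}"
      have inS: "x + t *\<^sub>R i \<in> S" if "\<bar>t\<bar> < r" for t
        using that r(2) i by (auto simp: dist_norm subset_iff)
      have neR: "R \<noteq> {}" unfolding R_def using inS[of "r/2"] r(1) by (auto intro!: exI[of _ "r/2"])
      have neL: "L \<noteq> {}" unfolding L_def using inS[of "-(r/2)"] r(1) by (auto intro!: exI[of _ "r/2"])
      have LR: "l \<le> \<rho>" if l: "l \<in> L" and \<rho>: "\<rho> \<in> R" for l \<rho>
      proof -
        obtain h k where h: "0 < h" "x - h *\<^sub>R i \<in> S" "l = (f x - f (x - h *\<^sub>R i)) / h"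
          and k: "0 < k" "x + k *\<^sub>R i \<in> S" "\<rho> = (f (x + k *\<^sub>R i) - f x) / k"
          using l \<rho> unfolding L_def R_def by blast
        define s where "s = h / (h + k)"
        have s: "0 \<le> s" "s \<le> 1" "(h + k) * s = h" "(h + k) * (1 - s) = k" using h k by (auto simp: s_def field_simps)
        have "(1 - s) * h = s * k" using s(3,4) h k by (simp add: s_def field_simps)
        then have "(1 - s) *\<^sub>R (x - h *\<^sub>R i) + s *\<^sub>R (x + k *\<^sub>R i) = x"
          by (simp add: algebra_simps flip: scaleR_add_left)
        then have "f x \<le> (1 - s) * f (x - h *\<^sub>R i) + s * f (x + k *\<^sub>R i)"
          using convex_onD[OF f, of s "x - h *\<^sub>R i" "x + k *\<^sub>R i"] s h k by simp
        then have "(h + k) * f x \<le> (h + k) * ((1 - s) * f (x - h *\<^sub>R i) + s * f (x + k *\<^sub>R i))"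
          using h k by (intro mult_left_mono) auto
        also have "\<dots> = k * f (x - h *\<^sub>R i) + h * f (x + k *\<^sub>R i)"
          by (simp add: distrib_left mult.assoc[symmetric] s)
        finally have "k * (f x - f (x - h *\<^sub>R i)) \<le> h * (f (x + k *\<^sub>R i) - f x)" by (simp add: algebra_simps)
        moreover have "l * (h * k) = k * (f x - f (x - h *\<^sub>R i))" "\<rho> * (h * k) = h * (f (x + k *\<^sub>R i) - f x)"
          using h k by simp_all
        ultimately have "l * (h * k) \<le> \<rho> * (h * k)" by (simp only:)
        then show ?thesis by (rule mult_right_le_imp_le) (rule mult_pos_pos[OF h(1) k(1)])
      qed
      define g where "g = Inf R"
      from neL obtain l0 where l0: "l0 \<in> L" by (metis ex_in_conv)
      from neR obtain \<rho>0 where \<rho>0: "\<rho>0 \<in> R" by (metis ex_in_conv)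
      have bL: "bdd_above L" by (rule bdd_aboveI[of _ \<rho>0]) (rule LR[OF _ \<rho>0])
      have bR: "bdd_below R" by (rule bdd_belowI[of _ l0]) (rule LR[OF l0])
      have "Sup L \<le> g" unfolding g_def
        by (rule cInf_greatest[OF neR]) (rule cSup_least[OF neL LR])
      moreover have "\<not> Sup L < g"
      proof
        assume "Sup L < g"
        obtain p where p: "Sup L < p" "p < g" "p \<in> \<rat>" using Rats_dense_in_real[OF \<open>Sup L < g\<close>] by blast
        obtain q where q: "p < q" "q < g" "q \<in> \<rat>" using Rats_dense_in_real[OF p(2)] by blast
        have "x \<in> N i p q" unfolding N_def
        proof (intro CollectI conjI allI impI xS)
          fix h :: real assume h: "0 < h"
          { assume "x + h *\<^sub>R i \<in> S"
            then have "g \<le> (f (x + h *\<^sub>R i) - f x) / h" unfolding g_def using h by (intro cInf_lower bR) (auto simp: R_def)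
            then have "q \<le> (f (x + h *\<^sub>R i) - f x) / h" using q by linarith
            then show "q * h \<le> f (x + h *\<^sub>R i) - f x" using h by (simp only: pos_le_divide_eq) }
          { assume "x - h *\<^sub>R i \<in> S"
            then have "(f x - f (x - h *\<^sub>R i)) / h \<le> Sup L" using h by (intro cSup_upper bL) (auto simp: L_def)
            then have "(f x - f (x - h *\<^sub>R i)) / h \<le> p" using p by linarith
            then show "f x - f (x - h *\<^sub>R i) \<le> p * h" using h by (simp only: pos_divide_le_eq) }
        qed
        then show False using nx i p q by auto
      qed
      ultimately have gL: "Sup L = g" by simp
      have "\<exists>d>0. \<forall>t. \<bar>t\<bar> < d \<longrightarrow> x + t *\<^sub>R i \<in> S \<and> f (x + t *\<^sub>R i) - f x - g * t \<le> e * \<bar>t\<bar>" if e: "0 < e" for e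
      proof -
        obtain \<rho> where "\<rho> \<in> R" "\<rho> < g + e" using cInf_lessD[OF neR, of "g + e"] e by (auto simp: g_def)
        then obtain h where h: "0 < h" "x + h *\<^sub>R i \<in> S" "(f (x + h *\<^sub>R i) - f x) / h < g + e" by (auto simp: R_def)
        obtain l where "l \<in> L" "g - e < l" using less_cSupD[OF neL, of "g - e"] e gL by auto
        then obtain k where k: "0 < k" "x - k *\<^sub>R i \<in> S" "g - e < (f x - f (x - k *\<^sub>R i)) / k" by (auto simp: L_def)
        have "f (x + t *\<^sub>R i) - f x - g * t \<le> e * \<bar>t\<bar>" if t: "\<bar>t\<bar> < min h k" for t
        proof (cases "0 \<le> t")
          case True
          define s where "s = t / h"
          have s: "0 \<le> s" "s \<le> 1" "s * h = t" using True t h by (auto simp: s_def)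
          have "x + t *\<^sub>R i = (1 - s) *\<^sub>R x + s *\<^sub>R (x + h *\<^sub>R i)" by (simp add: algebra_simps s(3)[symmetric])
          then have "f (x + t *\<^sub>R i) \<le> (1 - s) * f x + s * f (x + h *\<^sub>R i)"
            using convex_onD[OF f, of s x "x + h *\<^sub>R i"] s h xS by simp
          then have 1: "f (x + t *\<^sub>R i) - f x \<le> s * (f (x + h *\<^sub>R i) - f x)" by (simp add: algebra_simps)
          have "f (x + h *\<^sub>R i) - f x \<le> (g + e) * h" using h by (simp add: pos_divide_less_eq)
          then have "s * (f (x + h *\<^sub>R i) - f x) \<le> s * ((g + e) * h)" using s by (intro mult_left_mono)
          also have "\<dots> = (g + e) * t" using s(3) by (simp add: mult.left_commute)
          finally show ?thesis using 1 True by (simp add: distrib_right)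
        next
          case False
          define s where "s = (- t) / k"
          have tk: "0 \<le> - t" "- t \<le> k" using False t by auto
          have s: "0 \<le> s" "s \<le> 1" "s * k = - t"
            using divide_nonneg_pos[OF tk(1) k(1)] divide_right_mono[OF tk(2), of k] k(1) by (simp_all add: s_def)
          have "x + t *\<^sub>R i = (1 - s) *\<^sub>R x + s *\<^sub>R (x - k *\<^sub>R i)" using s(3) by (simp add: algebra_simps)
          then have "f (x + t *\<^sub>R i) \<le> (1 - s) * f x + s * f (x - k *\<^sub>R i)"
            using convex_onD[OF f, of s x "x - k *\<^sub>R i"] s k xS by simp
          then have 1: "f (x + t *\<^sub>R i) - f x \<le> - (s * (f x - f (x - k *\<^sub>R i)))" by (simp add: algebra_simps)
          have "(g - e) * k \<le> f x - f (x - k *\<^sub>R i)" using k by (simp add: pos_less_divide_eq)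
          then have "s * ((g - e) * k) \<le> s * (f x - f (x - k *\<^sub>R i))" using s by (intro mult_left_mono)
          moreover have "s * ((g - e) * k) = (g - e) * (- t)" by (simp only: mult.left_commute[of s] s(3))
          ultimately show ?thesis using 1 False by (simp add: left_diff_distrib)
        qed
        moreover have "x + t *\<^sub>R i \<in> S" if "\<bar>t\<bar> < r" for t using inS[OF that] .
        ultimately show ?thesis using h k r by (intro exI[of _ "min r (min h k)"]) auto
      qed
      then show ?thesis by blast
    qed
    then have "f differentiable (at x)" using convex_on_differentiable_partial[OF f S xS] by blast
    then show False using x by simp
  qed
  moreover have "negligible (\<Union>i\<in>Basis. \<Union>(p, q)\<in>{(p, q). p \<in> \<rat> \<and> q \<in> \<rat> \<and> p < q}. N i p q)"
  proof -
    have "countable {(p, q). p \<in> \<rat> \<and> q \<in> \<rat> \<and> (p::real) < q}"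
      by (rule countable_subset[of _ "\<rat> \<times> \<rat>"]) (auto intro: countable_rat)
    then have "negligible (\<Union>(p, q)\<in>{(p, q). p \<in> \<rat> \<and> q \<in> \<rat> \<and> p < q}. N i p q)" if "i \<in> Basis" for i
      by (intro negligible_countable_Union countable_image) (auto intro: neg that)
    then show ?thesis by (intro negligible_Union) auto
  qed
  ultimately show ?thesis by (rule negligible_subset[rotated])
qed

section \<open>Subgradients under epi-convergence\<close>

lemma frequently_subsequence:
  assumes "\<exists>\<^sub>F k in sequentially. P k"
  shows "\<exists>r :: nat \<Rightarrow> nat. strict_mono r \<and> (\<forall>j. P (r j))"
proof -
  have "infinite {k. P k}" using assms by (simp add: frequently_cofinite[symmetric] cofinite_eq_sequentially)
  then show ?thesis using infinite_enumerate[of "{k. P k}"] by auto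
qed

context
  fixes u :: "'n::finite cfun"
  assumes u: "u \<in> conv_sc"
begin

lemma conv_sc_minf: "- \<infinity> < u x"
  using u by (auto simp: conv_sc_def)

lemma conv_sc_dom: "x \<in> dom_fn u \<Longrightarrow> u x = ereal (real_of_ereal (u x))"
  using conv_sc_minf[of x] by (cases "u x") (auto simp: dom_fn_def)

lemma conv_sc_lsc: "xs \<longlonglongrightarrow> x \<Longrightarrow> u x \<le> Liminf sequentially (\<lambda>k. u (xs k))"
  using u by (auto simp: conv_sc_def)

lemma conv_sc_convex: "0 \<le> t \<Longrightarrow> t \<le> 1 \<Longrightarrow> u ((1 - t) *\<^sub>R x + t *\<^sub>R y) \<le> ereal (1 - t) * u x + ereal t * u y"
  using u by (auto simp: conv_sc_def)

lemma conv_sc_convex_le: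
  assumes "0 \<le> t" "t \<le> 1" "u x \<le> ereal a" "u y \<le> ereal b"
  shows "u ((1 - t) *\<^sub>R x + t *\<^sub>R y) \<le> ereal ((1 - t) * a + t * b)"
proof -
  have "u ((1 - t) *\<^sub>R x + t *\<^sub>R y) \<le> ereal (1 - t) * u x + ereal t * u y" by (rule conv_sc_convex[OF assms(1,2)])
  also have "\<dots> \<le> ereal (1 - t) * ereal a + ereal t * ereal b"
    using assms by (intro add_mono ereal_mult_left_mono) auto
  finally show ?thesis by simp
qed

lemma conv_sc_nonempty: "\<exists>x c. u x = ereal c"
proof -
  obtain x where "u x < \<infinity>" using u by (auto simp: conv_sc_def)
  then show ?thesis using conv_sc_minf[of x] by (cases "u x") auto
qed

lemma convex_sublevel: "convex {x. u x \<le> ereal c}"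
proof (rule convexI)
  fix x y :: "real^'n" and a b :: real
  assume xy: "x \<in> {x. u x \<le> ereal c}" "y \<in> {x. u x \<le> ereal c}" and ab: "0 \<le> a" "0 \<le> b" "a + b = 1"
  have a: "a = 1 - b" using ab by simp
  have c: "(1 - b) * c + b * c = c" by (simp add: algebra_simps)
  show "a *\<^sub>R x + b *\<^sub>R y \<in> {x. u x \<le> ereal c}"
    using conv_sc_convex_le[of b x c y c] xy ab(1,2) unfolding a c by simp
qed

lemma convex_on_dom: "convex_on (dom_fn u) (\<lambda>x. real_of_ereal (u x))" "convex (dom_fn u)"
proof -
  have *: "(1 - t) *\<^sub>R x + t *\<^sub>R y \<in> dom_fn u \<and> real_of_ereal (u ((1 - t) *\<^sub>R x + t *\<^sub>R y)) \<le> (1 - t) * real_of_ereal (u x) + t * real_of_ereal (u y)"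
    if "0 \<le> t" "t \<le> 1" "x \<in> dom_fn u" "y \<in> dom_fn u" for t x y
  proof -
    have le: "u ((1 - t) *\<^sub>R x + t *\<^sub>R y) \<le> ereal ((1 - t) * real_of_ereal (u x) + t * real_of_ereal (u y))"
      by (rule conv_sc_convex_le) (use that conv_sc_dom in auto)
    then have d: "(1 - t) *\<^sub>R x + t *\<^sub>R y \<in> dom_fn u" by (auto simp: dom_fn_def intro: le_less_trans)
    then show ?thesis using le conv_sc_dom[OF d] by (metis ereal_less_eq(3))
  qed
  show c: "convex (dom_fn u)" unfolding convex_alt using * by blast
  show "convex_on (dom_fn u) (\<lambda>x. real_of_ereal (u x))" by (rule convex_onI[OF _ c]) (use * in simp)
qed

end

section \<open>Subgradients and points of differentiability\<close>

definition subgradient :: "'n::finite cfun \<Rightarrow> real^'n \<Rightarrow> real^'n \<Rightarrow> bool" where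
  "subgradient u x g \<longleftrightarrow> (\<forall>z. u x + ereal (g \<bullet> (z - x)) \<le> u z)"

definition regular :: "'n::finite cfun \<Rightarrow> (real^'n) set" where
  "regular u = {x \<in> interior (dom_fn u). (\<lambda>y. real_of_ereal (u y)) differentiable (at x)}"

lemma regular_subset: "regular u \<subseteq> interior (dom_fn u)" "regular u \<subseteq> dom_fn u"
  using interior_subset by (auto simp: regular_def)

lemma negligible_irregular:
  assumes u: "u \<in> conv_sc"
  shows "negligible (interior (dom_fn u) - regular u)" "negligible (dom_fn u - regular u)"
proof -
  have "convex_on (interior (dom_fn u)) (\<lambda>x. real_of_ereal (u x))"
    by (rule convex_on_subset[OF convex_on_dom(1)[OF u] interior_subset convex_interior[OF convex_on_dom(2)[OF u]]])
  then have "negligible {x \<in> interior (dom_fn u). \<not> (\<lambda>y. real_of_ereal (u y)) differentiable (at x)}"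
    by (rule convex_on_AE_differentiable) simp
  also have "{x \<in> interior (dom_fn u). \<not> (\<lambda>y. real_of_ereal (u y)) differentiable (at x)} = interior (dom_fn u) - regular u"
    by (auto simp: regular_def)
  finally show *: "negligible (interior (dom_fn u) - regular u)" .
  have "dom_fn u - regular u \<subseteq> (interior (dom_fn u) - regular u) \<union> frontier (dom_fn u)"
    using closure_subset by (auto simp: frontier_def)
  then show "negligible (dom_fn u - regular u)"
    using negligible_Un[OF * negligible_convex_frontier[OF convex_on_dom(2)[OF u]]] negligible_subset by blast
qed

lemma grad_has_derivative:
  assumes "x \<in> regular u"
  shows "((\<lambda>y. real_of_ereal (u y)) has_derivative (\<lambda>h. grad u x \<bullet> h)) (at x)"
proof -
  obtain D where D: "((\<lambda>y. real_of_ereal (u y)) has_derivative D) (at x)"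
    using assms by (auto simp: regular_def differentiable_def)
  then interpret bounded_linear D by (rule has_derivative_bounded_linear)
  have "D h = (\<Sum>i\<in>Basis. D i *\<^sub>R i) \<bullet> h" for h
  proof -
    have "D h = D (\<Sum>i\<in>Basis. (h \<bullet> i) *\<^sub>R i)" by (simp only: euclidean_representation)
    also have "\<dots> = (\<Sum>i\<in>Basis. (h \<bullet> i) * D i)" by (simp only: sum scaleR real_scaleR_def)
    also have "\<dots> = (\<Sum>i\<in>Basis. D i *\<^sub>R i) \<bullet> h" unfolding inner_sum_left by (intro sum.cong) (simp_all add: inner_commute)
    finally show ?thesis .
  qed
  then have "D = (\<lambda>h. (\<Sum>i\<in>Basis. D i *\<^sub>R i) \<bullet> h)" by blast
  then have "\<exists>g. ((\<lambda>y. real_of_ereal (u y)) has_derivative (\<lambda>h. g \<bullet> h)) (at x)" using D by metis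
  then show ?thesis unfolding grad_def by (rule someI_ex)
qed

lemma difference_quotient_limit:
  fixes f :: "'a::real_normed_vector \<Rightarrow> real"
  assumes "(f has_derivative D) (at x)"
  shows "(\<lambda>k. (f (x + inverse (real (Suc k)) *\<^sub>R v) - f x) / inverse (real (Suc k))) \<longlonglongrightarrow> D v"
proof -
  interpret bounded_linear D using assms by (rule has_derivative_bounded_linear)
  define F where "F t = f (x + t *\<^sub>R v)" for t
  have "((\<lambda>t. x + t *\<^sub>R v) has_derivative (\<lambda>t. t *\<^sub>R v)) (at 0)" by (auto intro!: derivative_eq_intros)
  moreover have "(f has_derivative D) (at (x + 0 *\<^sub>R v))" using assms by simp
  ultimately have "((\<lambda>t. f (x + t *\<^sub>R v)) has_derivative (\<lambda>t. D (t *\<^sub>R v))) (at 0)"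
    by (rule has_derivative_compose)
  then have "(F has_real_derivative D v) (at 0)"
    unfolding has_field_derivative_def F_def by (simp add: scaleR mult_commute_abs)
  then have "((\<lambda>h. (F (0 + h) - F 0) / h) \<longlongrightarrow> D v) (at 0)" by (rule DERIV_D)
  moreover have "filterlim (\<lambda>k. inverse (real (Suc k))) (at 0) sequentially"
    by (rule filterlim_atI) (use LIMSEQ_inverse_real_of_nat in auto)
  ultimately show ?thesis using filterlim_compose[of "\<lambda>h. (F (0 + h) - F 0) / h"] by (simp add: F_def)
qed

lemma subgradient_grad:
  assumes u: "u \<in> conv_sc" and x: "x \<in> regular u"
  shows "subgradient u x (grad u x)"
  unfolding subgradient_def
proof
  fix z
  let ?f = "\<lambda>y. real_of_ereal (u y)"
  have xd: "x \<in> dom_fn u" using x regular_subset by blast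
  show "u x + ereal (grad u x \<bullet> (z - x)) \<le> u z"
  proof (cases "z \<in> dom_fn u")
    case True
    have "grad u x \<bullet> (z - x) \<le> ?f z - ?f x"
    proof (rule LIMSEQ_le_const2[OF difference_quotient_limit[OF grad_has_derivative[OF x]]])
      have "(?f (x + inverse (real (Suc k)) *\<^sub>R (z - x)) - ?f x) / inverse (real (Suc k)) \<le> ?f z - ?f x" for k
      proof -
        define t where "t = inverse (real (Suc k))"
        have t: "0 < t" "t \<le> 1" by (auto simp: t_def field_simps)
        have "x + t *\<^sub>R (z - x) = (1 - t) *\<^sub>R x + t *\<^sub>R z" by (simp add: algebra_simps)
        then have "?f (x + t *\<^sub>R (z - x)) \<le> (1 - t) * ?f x + t * ?f z"
          using convex_onD[OF convex_on_dom(1)[OF u], of t x z] t xd True by simp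
        then have "?f (x + t *\<^sub>R (z - x)) - ?f x \<le> (?f z - ?f x) * t" by (simp add: algebra_simps)
        then show ?thesis unfolding t_def[symmetric] using t by (simp only: pos_divide_le_eq)
      qed
      then show "\<exists>N. \<forall>k\<ge>N. (?f (x + inverse (real (Suc k)) *\<^sub>R (z - x)) - ?f x) / inverse (real (Suc k)) \<le> ?f z - ?f x" by blast
    qed
    then have "ereal (?f x) + ereal (grad u x \<bullet> (z - x)) \<le> ereal (?f z)" by simp
    then show ?thesis using conv_sc_dom[OF u True] conv_sc_dom[OF u xd] by simp
  qed (simp add: dom_fn_def)
qed

lemma subgradient_unique:
  assumes u: "u \<in> conv_sc" and x: "x \<in> regular u" and g: "subgradient u x g"
  shows "g = grad u x"
proof -
  let ?f = "\<lambda>y. real_of_ereal (u y)"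
  have xd: "x \<in> dom_fn u" using x regular_subset by blast
  have le: "g \<bullet> v \<le> grad u x \<bullet> v" for v
  proof (rule LIMSEQ_le_const[OF difference_quotient_limit[OF grad_has_derivative[OF x]]])
    have "(\<lambda>k. x + inverse (real (Suc k)) *\<^sub>R v) \<longlonglongrightarrow> x + 0 *\<^sub>R v"
      by (intro tendsto_intros LIMSEQ_inverse_real_of_nat)
    then have "\<forall>\<^sub>F k in sequentially. x + inverse (real (Suc k)) *\<^sub>R v \<in> interior (dom_fn u)"
      using x by (intro topological_tendstoD[of _ x]) (auto simp: regular_def)
    then have "\<forall>\<^sub>F k in sequentially. g \<bullet> v \<le> (?f (x + inverse (real (Suc k)) *\<^sub>R v) - ?f x) / inverse (real (Suc k))"
    proof eventually_elim
      case (elim k)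
      define t where "t = inverse (real (Suc k))"
      have t: "0 < t" by (simp add: t_def)
      have d: "x + t *\<^sub>R v \<in> dom_fn u" using elim interior_subset by (auto simp: t_def)
      have "u x + ereal (g \<bullet> (x + t *\<^sub>R v - x)) \<le> u (x + t *\<^sub>R v)" using g by (simp only: subgradient_def)
      then have "?f x + t * (g \<bullet> v) \<le> ?f (x + t *\<^sub>R v)"
        using conv_sc_dom[OF u d] conv_sc_dom[OF u xd] by (metis add_diff_cancel_left' ereal_less_eq(3) inner_scaleR_right plus_ereal.simps(1))
      then have "(g \<bullet> v) * t \<le> ?f (x + t *\<^sub>R v) - ?f x" by (simp add: mult.commute)
      then show ?case unfolding t_def[symmetric] using t by (simp only: pos_le_divide_eq)
    qed
    then show "\<exists>N. \<forall>k\<ge>N. g \<bullet> v \<le> (?f (x + inverse (real (Suc k)) *\<^sub>R v) - ?f x) / inverse (real (Suc k))"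
      by (simp only: eventually_sequentially)
  qed
  have "(g - grad u x) \<bullet> (g - grad u x) \<le> 0" using le[of "g - grad u x"] by (simp add: inner_diff_left)
  then have "g - grad u x = 0" by (metis inner_eq_zero_iff inner_ge_zero order_antisym)
  then show ?thesis by simp
qed

text \<open>Where \<open>u\<close> lies below \<open>w\<close> and touches it, a subgradient of
  \<open>u\<close> is also one of \<open>w\<close>. The pointwise identity in
  \<open>gfun_valuation\<close> comes from here.\<close>

lemma grad_touching:
  assumes u: "u \<in> conv_sc" and w: "w \<in> conv_sc" and le: "\<And>y. u y \<le> w y"
    and x: "x \<in> regular u" "x \<in> regular w" and eq: "u x = w x"
  shows "grad w x = grad u x"
proof -
  have "subgradient w x (grad u x)"
    unfolding subgradient_def eq[symmetric]
    using subgradient_grad[OF u x(1)] le order_trans unfolding subgradient_def by blast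
  then show ?thesis using subgradient_unique[OF w x(2)] by simp
qed

lemma epi_conv_const: "u \<in> conv_sc \<Longrightarrow> epi_conv (\<lambda>_. u) u"
  unfolding epi_conv_def using conv_sc_lsc by (auto intro!: exI[of _ "\<lambda>_. _"])

text \<open>The liminf inequality concerns full sequences, so \<open>ps\<close> is completed by the
  constant \<open>p\<close> outside the range of \<open>r\<close>.\<close>

lemma epi_conv_subsequence_le:
  assumes epi: "epi_conv us u" and r: "strict_mono r" and ps: "ps \<longlonglongrightarrow> p"
    and le: "\<forall>j. us (r j) (ps j) \<le> ereal C"
  shows "u p \<le> ereal C"
proof (rule ccontr)
  assume "\<not> u p \<le> ereal C"
  then have C: "ereal C < u p" by simp
  define xs where "xs k = (if k \<in> range r then ps (inv r k) else p)" for k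
  have inj: "inj r" using r by (rule strict_mono_imp_inj_on)
  have xr: "xs (r j) = ps j" for j by (simp add: xs_def inv_f_f[OF inj])
  have "xs \<longlonglongrightarrow> p"
  proof (rule metric_LIMSEQ_I)
    fix e :: real assume e: "0 < e"
    then obtain J where J: "\<forall>j\<ge>J. dist (ps j) p < e" using metric_LIMSEQ_D[OF ps] by blast
    have "dist (xs k) p < e" if "k \<ge> r J" for k
    proof (cases "k \<in> range r")
      case True
      then obtain j where j: "k = r j" by blast
      then have "J \<le> j" using that r by (simp add: strict_mono_less_eq)
      then show ?thesis using J j xr by simp
    qed (simp add: xs_def e)
    then show "\<exists>no. \<forall>n\<ge>no. dist (xs n) p < e" by blast
  qed
  then have "u p \<le> Liminf sequentially (\<lambda>k. us k (xs k))" using epi by (simp add: epi_conv_def)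
  then have "\<forall>\<^sub>F k in sequentially. ereal C < us k (xs k)" using C by (intro less_LiminfD) (rule less_le_trans)
  then obtain N where N: "\<forall>k\<ge>N. ereal C < us k (xs k)" by (auto simp: eventually_sequentially)
  have "N \<le> r N" by (rule seq_suble[OF r])
  then have "ereal C < us (r N) (ps N)" using N xr by metis
  then show False using le by (simp add: not_less[symmetric])
qed

lemma epi_conv_recovery:
  assumes "epi_conv us u"
  obtains zs where "zs \<longlonglongrightarrow> z" "(\<lambda>k. us k (zs k)) \<longlonglongrightarrow> u z"
  using assms unfolding epi_conv_def by blast

lemma subgradient_upper:
  assumes g: "subgradient u x g" and x: "x \<in> dom_fn u" and u: "u \<in> conv_sc" and z: "u z \<le> ereal b"
  shows "u x \<le> ereal (b + norm g * norm (x - z))"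
proof -
  have "u x + ereal (g \<bullet> (z - x)) \<le> ereal b" using g z unfolding subgradient_def by (meson order_trans)
  then have "real_of_ereal (u x) + g \<bullet> (z - x) \<le> b" using conv_sc_dom[OF u x] by (metis ereal_less_eq(3) plus_ereal.simps(1))
  moreover have "- (g \<bullet> (z - x)) \<le> norm g * norm (x - z)"
    using norm_cauchy_schwarz[of g "x - z"] by (simp add: inner_diff_right)
  ultimately have "ereal (real_of_ereal (u x)) \<le> ereal (b + norm g * norm (x - z))" by simp
  then show ?thesis using conv_sc_dom[OF u x] by simp
qed

lemma conv_sc_coercive:
  fixes u :: "'n::finite cfun"
  assumes u: "u \<in> conv_sc"
  obtains \<rho> where "0 < \<rho>" "\<forall>p. norm (p - x0) = \<rho> \<longrightarrow> ereal (C + R * \<rho>) < u p"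
proof -
  define K where "K = \<bar>R\<bar> + 1"
  have "((\<lambda>x. u x / ereal (norm x)) \<longlongrightarrow> \<infinity>) at_infinity" using u by (auto simp: conv_sc_def)
  then have "\<forall>\<^sub>F x in at_infinity. ereal K < u x / ereal (norm x)" unfolding tendsto_PInfty by blast
  then obtain b where b: "\<forall>x. b \<le> norm x \<longrightarrow> ereal K < u x / ereal (norm x)" by (auto simp: eventually_at_infinity)
  \<comment> \<open>Large enough that points at distance \<open>\<rho>\<close> from
    \<open>x0\<close> have norm at least \<open>b\<close>, and that the extra unit of slope in
    \<open>K\<close> pays for \<open>C\<close> and for the shift by \<open>x0\<close>.\<close>
  define \<rho> where "\<rho> = \<bar>b\<bar> + norm x0 + 1 + \<bar>C\<bar> + K * norm x0"
  have K: "1 \<le> K" by (simp add: K_def)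
  have Kx: "0 \<le> K * norm x0" using K by simp
  have "ereal (C + R * \<rho>) < u p" if p: "norm (p - x0) = \<rho>" for p
  proof -
    have np: "\<rho> - norm x0 \<le> norm p" using norm_triangle_ineq2[of "p - x0" "- x0"] p by simp
    then have pos: "0 < norm p" "b \<le> norm p" using Kx by (auto simp: \<rho>_def)
    have "ereal K < u p / ereal (norm p)" using b pos by blast
    then have "ereal (K * norm p) < u p"
    proof (cases "u p")
      case (real a)
      then have "K < a / norm p" using \<open>ereal K < u p / ereal (norm p)\<close> pos by simp
      then show ?thesis using real pos by (simp add: pos_less_divide_eq)
    qed (use conv_sc_minf[OF u, of p] in auto)
    moreover have "C + R * \<rho> \<le> K * norm p"
    proof -
      have "K * (\<rho> - norm x0) \<le> K * norm p" using np K by (intro mult_left_mono) auto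
      moreover have "R * \<rho> \<le> \<bar>R\<bar> * \<rho>" using Kx by (intro mult_right_mono) (auto simp: \<rho>_def)
      moreover have "K * (\<rho> - norm x0) = \<bar>R\<bar> * \<rho> + \<rho> - K * norm x0" by (simp add: K_def algebra_simps)
      moreover have "C + K * norm x0 \<le> \<rho>"
        unfolding \<rho>_def using abs_ge_self[of C] abs_ge_zero[of b] norm_ge_zero[of x0] by linarith
      ultimately show ?thesis by linarith
    qed
    ultimately show ?thesis by (meson ereal_less_eq(3) le_less_trans)
  qed
  moreover have "0 < \<rho>"
    unfolding \<rho>_def using Kx abs_ge_zero[of C] abs_ge_zero[of b] norm_ge_zero[of x0] by linarith
  ultimately show ?thesis using that by blast
qed

section \<open>Subgradients along an epi-convergent sequence\<close>

context
  fixes us :: "nat \<Rightarrow> 'n::finite cfun" and u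
  assumes us: "\<And>k. us k \<in> conv_sc" and u: "u \<in> conv_sc" and epi: "epi_conv us u"
begin

lemma epi_conv_base:
  obtains x0 zs C where "\<forall>\<^sub>F k in sequentially. us k (zs k) \<le> ereal C" "zs \<longlonglongrightarrow> x0"
proof -
  obtain x0 c where c: "u x0 = ereal c" using conv_sc_nonempty[OF u] by blast
  obtain zs where zs: "zs \<longlonglongrightarrow> x0" "(\<lambda>k. us k (zs k)) \<longlonglongrightarrow> u x0" by (rule epi_conv_recovery[OF epi])
  have "\<forall>\<^sub>F k in sequentially. us k (zs k) < ereal (c + 1)"
    by (rule order_tendstoD(2)[OF zs(2)]) (simp add: c)
  then have "\<forall>\<^sub>F k in sequentially. us k (zs k) \<le> ereal (c + 1)" by eventually_elim simp
  then show ?thesis using that zs(1) by blast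
qed

text \<open>A point far from \<open>zs k\<close> with a small subgradient would keep
  \<open>us k\<close> low along the segment to \<open>zs k\<close>, in particular at distance
  \<open>\<rho>\<close>; a cluster point of such points contradicts the growth of
  \<open>u\<close>.\<close>

lemma epi_conv_bounded_subgradients:
  "\<exists>R'. \<forall>\<^sub>F k in sequentially. \<forall>x g. x \<in> dom_fn (us k) \<longrightarrow> subgradient (us k) x g \<longrightarrow> norm g \<le> R \<longrightarrow> norm x \<le> R'"
proof -
  obtain x0 zs C where C: "\<forall>\<^sub>F k in sequentially. us k (zs k) \<le> ereal C" and zs: "zs \<longlonglongrightarrow> x0" by (rule epi_conv_base)
  obtain \<rho> where \<rho>: "0 < \<rho>" "\<forall>p. norm (p - x0) = \<rho> \<longrightarrow> ereal (C + \<bar>R\<bar> * \<rho>) < u p" by (rule conv_sc_coercive[OF u])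
  have "\<forall>\<^sub>F k in sequentially. \<not> (\<exists>p. norm (p - zs k) = \<rho> \<and> us k p \<le> ereal (C + \<bar>R\<bar> * \<rho>))"
  proof (rule ccontr)
    assume "\<not> ?thesis"
    then have "\<exists>\<^sub>F k in sequentially. \<exists>p. norm (p - zs k) = \<rho> \<and> us k p \<le> ereal (C + \<bar>R\<bar> * \<rho>)" by (simp add: not_eventually)
    from frequently_subsequence[OF this] obtain r :: "nat \<Rightarrow> nat" where r: "strict_mono r" "\<forall>j. \<exists>p. norm (p - zs (r j)) = \<rho> \<and> us (r j) p \<le> ereal (C + \<bar>R\<bar> * \<rho>)" by blast
    then obtain ps where ps: "\<forall>j. norm (ps j - zs (r j)) = \<rho>" "\<forall>j. us (r j) (ps j) \<le> ereal (C + \<bar>R\<bar> * \<rho>)" by metis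
    have zr: "(\<lambda>j. zs (r j)) \<longlonglongrightarrow> x0" using LIMSEQ_subseq_LIMSEQ[OF zs r(1)] by (simp add: o_def)
    have comp: "seq_compact (sphere (0::real^'n) \<rho>)" by (intro compact_imp_seq_compact) simp
    have "\<forall>j. ps j - zs (r j) \<in> sphere 0 \<rho>" using ps by simp
    then obtain l q where l: "l \<in> sphere 0 \<rho>" "strict_mono (q :: nat \<Rightarrow> nat)" "((\<lambda>j. ps j - zs (r j)) \<circ> q) \<longlonglongrightarrow> l"
      by (rule seq_compactE[OF comp])
    have "(\<lambda>j. (ps (q j) - zs (r (q j))) + zs (r (q j))) \<longlonglongrightarrow> l + x0"
      using l(3) LIMSEQ_subseq_LIMSEQ[OF zr l(2)] by (intro tendsto_add) (simp_all add: o_def)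
    then have "(\<lambda>j. ps (q j)) \<longlonglongrightarrow> l + x0" by simp
    then have "u (l + x0) \<le> ereal (C + \<bar>R\<bar> * \<rho>)"
      by (rule epi_conv_subsequence_le[OF epi strict_mono_o[OF r(1) l(2)]]) (use ps in simp)
    then show False using \<rho>(2)[rule_format, of "l + x0"] l(1) by simp
  qed
  moreover have "\<forall>\<^sub>F k in sequentially. dist (zs k) x0 < 1" using zs by (intro tendstoD) auto
  ultimately have "\<forall>\<^sub>F k in sequentially. \<forall>x g. x \<in> dom_fn (us k) \<longrightarrow> subgradient (us k) x g \<longrightarrow> norm g \<le> R \<longrightarrow> norm x \<le> norm x0 + 1 + \<rho>"
    using C
  proof eventually_elim
    case (elim k)
    show ?case
    proof (intro allI impI)
      fix x g assume x: "x \<in> dom_fn (us k)" and g: "subgradient (us k) x g" "norm g \<le> R"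
      define d where "d = norm (x - zs k)"
      have "d \<le> \<rho>"
      proof (rule ccontr)
        assume "\<not> d \<le> \<rho>"
        then have d: "0 < d" "\<rho> < d" using \<rho>(1) by auto
        define s where "s = \<rho> / d"
        have s: "0 \<le> s" "s \<le> 1" "s * d = \<rho>" using d \<rho>(1) by (auto simp: s_def)
        define p where "p = (1 - s) *\<^sub>R zs k + s *\<^sub>R x"
        have "p - zs k = s *\<^sub>R (x - zs k)" by (simp add: p_def algebra_simps)
        then have "norm (p - zs k) = \<rho>" using s by (simp add: d_def)
        moreover have "us k p \<le> ereal ((1 - s) * C + s * (C + norm g * d))"
          unfolding p_def d_def by (rule conv_sc_convex_le[OF us s(1,2) elim(3) subgradient_upper[OF g(1) x us elim(3)]])
        moreover have "(1 - s) * C + s * (C + norm g * d) = C + norm g * \<rho>"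
          by (simp add: algebra_simps s(3)[symmetric])
        moreover have "norm g * \<rho> \<le> \<bar>R\<bar> * \<rho>" using g(2) \<rho>(1) by (intro mult_right_mono) auto
        ultimately have "norm (p - zs k) = \<rho> \<and> us k p \<le> ereal (C + \<bar>R\<bar> * \<rho>)"
          by (auto elim: order_trans)
        then show False using elim(1) by blast
      qed
      then have "norm (x - zs k) \<le> \<rho>" by (simp add: d_def)
      moreover have "norm (zs k - x0) < 1" using elim(2) by (simp add: dist_norm)
      moreover have "norm x \<le> norm (x - zs k) + norm (zs k - x0) + norm x0"
        using norm_triangle_ineq[of "x - zs k" "zs k"] norm_triangle_ineq[of "zs k - x0" x0] by simp
      ultimately show "norm x \<le> norm x0 + 1 + \<rho>" by linarith
    qed
  qed
  then show ?thesis by blast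
qed

text \<open>A subgradient of norm at most \<open>R\<close> at \<open>x\<close> bounds
  \<open>us k x\<close> by the values at \<open>zs k\<close>. If this happened infinitely often,
  \<open>u x\<close> would be finite.\<close>

lemma epi_conv_outside:
  assumes x: "x \<notin> dom_fn u"
  shows "\<forall>\<^sub>F k in sequentially. \<forall>g. x \<in> dom_fn (us k) \<longrightarrow> subgradient (us k) x g \<longrightarrow> R < norm g"
proof (rule ccontr)
  obtain x0 zs C where C: "\<forall>\<^sub>F k in sequentially. us k (zs k) \<le> ereal C" and zs: "zs \<longlonglongrightarrow> x0" by (rule epi_conv_base)
  assume "\<not> ?thesis"
  then have "\<exists>\<^sub>F k in sequentially. \<exists>g. x \<in> dom_fn (us k) \<and> subgradient (us k) x g \<and> norm g \<le> R"
    by (simp add: not_eventually not_less)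
  moreover have "\<forall>\<^sub>F k in sequentially. us k (zs k) \<le> ereal C \<and> dist (zs k) x0 < 1"
    by (rule eventually_conj[OF C]) (use zs in \<open>intro tendstoD; auto\<close>)
  ultimately have "\<exists>\<^sub>F k in sequentially. (\<exists>g. x \<in> dom_fn (us k) \<and> subgradient (us k) x g \<and> norm g \<le> R) \<and> (us k (zs k) \<le> ereal C \<and> dist (zs k) x0 < 1)"
    by (rule frequently_eventually_frequently)
  then have "\<exists>\<^sub>F k in sequentially. us k x \<le> ereal (C + \<bar>R\<bar> * (norm (x - x0) + 1))"
  proof (rule frequently_elim1)
    fix k assume k: "(\<exists>g. x \<in> dom_fn (us k) \<and> subgradient (us k) x g \<and> norm g \<le> R) \<and> (us k (zs k) \<le> ereal C \<and> dist (zs k) x0 < 1)"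
    then obtain g where g: "x \<in> dom_fn (us k)" "subgradient (us k) x g" "norm g \<le> R" by blast
    have "norm (x - zs k) \<le> norm (x - x0) + 1"
      using k norm_triangle_ineq[of "x - x0" "x0 - zs k"] by (simp add: dist_norm norm_minus_commute)
    then have "norm g * norm (x - zs k) \<le> \<bar>R\<bar> * (norm (x - x0) + 1)" using g(3) by (intro mult_mono) auto
    moreover have "us k x \<le> ereal (C + norm g * norm (x - zs k))"
      using subgradient_upper[OF g(2,1) us, of "zs k" C] k by blast
    ultimately show "us k x \<le> ereal (C + \<bar>R\<bar> * (norm (x - x0) + 1))"
      by (elim order_trans) simp
  qed
  from frequently_subsequence[OF this] obtain r :: "nat \<Rightarrow> nat" where r: "strict_mono r" "\<forall>j. us (r j) x \<le> ereal (C + \<bar>R\<bar> * (norm (x - x0) + 1))" by blast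
  have "u x \<le> ereal (C + \<bar>R\<bar> * (norm (x - x0) + 1))" by (rule epi_conv_subsequence_le[OF epi r(1) tendsto_const r(2)])
  then show False using x by (auto simp: dom_fn_def)
qed

text \<open>Recovery sequences act on single points, so they are taken at the vertices of a cube
  around \<open>x\<close>. The hull of the slightly moved vertices still contains a smaller ball,
  and there \<open>us k\<close> is bounded by its values at these vertices.\<close>

lemma epi_conv_local_bound:
  assumes x: "x \<in> interior (dom_fn u)"
  obtains M \<delta> where "0 < \<delta>" "\<forall>\<^sub>F k in sequentially. \<forall>y. norm (y - x) \<le> \<delta> \<longrightarrow> us k y \<le> ereal M"
proof -
  obtain e where e: "0 < e" "cball x e \<subseteq> dom_fn u" using x by (auto simp: mem_interior_cball)
  define d where "d = e / real DIM(real^'n)"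
  have d: "0 < d" "d * real DIM(real^'n) = e" using e by (auto simp: d_def)
  obtain W where W': "finite W" "cbox (x - (\<Sum>i\<in>Basis. d *\<^sub>R i)) (x + (\<Sum>i\<in>Basis. d *\<^sub>R i)) = convex hull W"
    by (rule cube_convex_hull[OF d(1), of x])
  then have W: "finite W" "cbox (x - d *\<^sub>R One) (x + d *\<^sub>R One) = convex hull W"
    by (simp_all only: scaleR_sum_right)
  have sub: "cbox (x - d *\<^sub>R One) (x + d *\<^sub>R One) \<subseteq> cball x e"
  proof
    fix y assume "y \<in> cbox (x - d *\<^sub>R One) (x + d *\<^sub>R One)"
    then have "\<bar>(y - x) \<bullet> i\<bar> \<le> d" if "i \<in> Basis" for i
      using that by (auto simp: mem_box inner_diff_left inner_add_left abs_le_iff algebra_simps)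
    then have "norm (y - x) \<le> (\<Sum>i\<in>(Basis::(real^'n) set). d)" by (intro order_trans[OF norm_le_l1] sum_mono)
    also have "\<dots> = e" using d(2) by (simp add: mult.commute)
    finally show "y \<in> cball x e" by (simp add: dist_norm norm_minus_commute)
  qed
  have ball: "cball x d \<subseteq> convex hull W"
  proof
    fix y assume "y \<in> cball x d"
    then have "\<bar>(y - x) \<bullet> i\<bar> \<le> d" if "i \<in> Basis" for i
      using Basis_le_norm[OF that, of "y - x"] by (simp add: dist_norm norm_minus_commute)
    then show "y \<in> convex hull W" unfolding W(2)[symmetric]
      by (auto simp: mem_box inner_diff_left inner_add_left abs_le_iff algebra_simps)
  qed
  have Wd: "w \<in> dom_fn u" if "w \<in> W" for w using hull_inc[OF that, of convex] W(2) sub e(2) by blast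
  have "\<exists>zs. zs \<longlonglongrightarrow> w \<and> (\<lambda>k. us k (zs k)) \<longlonglongrightarrow> u w" for w using epi unfolding epi_conv_def by blast
  then obtain z where z: "\<forall>w. z w \<longlonglongrightarrow> w" "\<forall>w. (\<lambda>k. us k (z w k)) \<longlonglongrightarrow> u w" by metis
  define M where "M = (\<Sum>w\<in>W. \<bar>real_of_ereal (u w)\<bar>) + 1"
  have uM: "u w < ereal M" if "w \<in> W" for w
  proof -
    have "\<bar>real_of_ereal (u w)\<bar> \<le> (\<Sum>w\<in>W. \<bar>real_of_ereal (u w)\<bar>)" by (rule member_le_sum[OF that _ W(1)]) (rule abs_ge_zero)
    then have "real_of_ereal (u w) < M" unfolding M_def using abs_ge_self[of "real_of_ereal (u w)"] by linarith
    then have "ereal (real_of_ereal (u w)) < ereal M" by simp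
    then show ?thesis using conv_sc_dom[OF u Wd[OF that]] by simp
  qed
  have "\<forall>\<^sub>F k in sequentially. \<forall>w\<in>W. us k (z w k) \<le> ereal M \<and> dist (z w k) w < d / 2"
  proof (rule eventually_ball_finite[OF W(1)], rule ballI)
    fix w assume w: "w \<in> W"
    have "\<forall>\<^sub>F k in sequentially. us k (z w k) < ereal M" using z(2) uM[OF w] order_tendstoD(2) by blast
    moreover have "\<forall>\<^sub>F k in sequentially. dist (z w k) w < d / 2" using z(1) d(1) by (intro tendstoD) auto
    ultimately show "\<forall>\<^sub>F k in sequentially. us k (z w k) \<le> ereal M \<and> dist (z w k) w < d / 2" by eventually_elim simp
  qed
  then have "\<forall>\<^sub>F k in sequentially. \<forall>y. norm (y - x) \<le> d / 2 \<longrightarrow> us k y \<le> ereal M"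
  proof eventually_elim
    case (elim k)
    define Q where "Q = convex hull ((\<lambda>w. z w k) ` W)"
    have Qle: "Q \<subseteq> {y. us k y \<le> ereal M}" unfolding Q_def
      by (rule hull_minimal) (use elim convex_sublevel[OF us] in auto)
    have cQ: "closed Q" unfolding Q_def using W(1) by (intro compact_imp_closed finite_imp_compact_convex_hull) simp
    show ?case
    proof (intro allI impI)
      fix y assume y: "norm (y - x) \<le> d / 2"
      have "y \<in> Q"
      proof (rule ccontr)
        assume "y \<notin> Q"
        then obtain a b where ab: "inner a y < b" "\<forall>q\<in>Q. b < inner a q"
          using separating_hyperplane_closed_point[OF _ cQ, of y] unfolding Q_def by auto
        have "W \<noteq> {}" using ball d(1) by (metis centre_in_cball convex_hull_empty empty_iff less_imp_le subsetD)
        then obtain w0 where w0: "w0 \<in> W" by blast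
        have wQ: "z w k \<in> Q" if "w \<in> W" for w unfolding Q_def using that by (intro hull_inc) auto
        have "a \<noteq> 0" using ab(1) ab(2)[rule_format, OF wQ[OF w0]] by auto
        then have na: "0 < norm a" by simp
        \<comment> \<open>Moving a vertex costs at most \<open>d / 2\<close>, and so does passing
          from \<open>y\<close> to \<open>x\<close>. All vertices thus satisfy a strict inequality
          that fails at the point of \<open>cball x d\<close> in direction
          \<open>- a\<close>.\<close>
        have aw: "a \<bullet> x - norm a * d < a \<bullet> w" if w: "w \<in> W" for w
        proof -
          have "a \<bullet> y < a \<bullet> z w k" using ab wQ[OF w] by force
          moreover have "a \<bullet> (z w k - w) \<le> norm a * (d / 2)"
          proof -
            have "a \<bullet> (z w k - w) \<le> norm a * norm (z w k - w)" by (rule norm_cauchy_schwarz)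
            also have "\<dots> \<le> norm a * (d / 2)" using elim w na by (intro mult_left_mono) (auto simp: dist_norm intro: less_imp_le)
            finally show ?thesis .
          qed
          moreover have "a \<bullet> (x - y) \<le> norm a * (d / 2)"
          proof -
            have "a \<bullet> (x - y) \<le> norm a * norm (x - y)" by (rule norm_cauchy_schwarz)
            also have "\<dots> \<le> norm a * (d / 2)" using y na by (intro mult_left_mono) (auto simp: norm_minus_commute)
            finally show ?thesis .
          qed
          ultimately show ?thesis by (simp add: inner_diff_right)
        qed
        define p where "p = x - (d / norm a) *\<^sub>R a"
        have "p \<in> convex hull W" using ball na d(1) by (auto simp: p_def dist_norm subset_iff)
        moreover have "convex hull W \<subseteq> {w. a \<bullet> x - norm a * d < a \<bullet> w}"
          by (rule hull_minimal) (use aw convex_halfspace_gt[of "a \<bullet> x - norm a * d" a] in auto)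
        moreover have "a \<bullet> p = a \<bullet> x - norm a * d"
          using na by (simp add: p_def inner_diff_right power2_norm_eq_inner[symmetric] power2_eq_square)
        ultimately show False by auto
      qed
      then show "us k y \<le> ereal M" using Qle by blast
    qed
  qed
  then show ?thesis using that[of "d / 2" M] d(1) by simp
qed

text \<open>A local upper bound and a lower bound at \<open>x\<close> keep the gradients bounded.
  Every cluster point of them is a subgradient of \<open>u\<close> at \<open>x\<close> and hence
  equals \<open>grad u x\<close>.\<close>

lemma epi_conv_grad:
  assumes x: "x \<in> regular u" and xk: "\<forall>k. x \<in> regular (us k) \<or> x \<notin> dom_fn (us k)"
  shows "\<forall>\<^sub>F k in sequentially. x \<in> regular (us k)" "(\<lambda>k. grad (us k) x) \<longlonglongrightarrow> grad u x"
proof -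
  obtain M \<delta> where \<delta>: "0 < \<delta>" and M: "\<forall>\<^sub>F k in sequentially. \<forall>y. norm (y - x) \<le> \<delta> \<longrightarrow> us k y \<le> ereal M"
    using epi_conv_local_bound[of x] x regular_subset(1) by blast
  show reg: "\<forall>\<^sub>F k in sequentially. x \<in> regular (us k)"
    using M
  proof eventually_elim
    case (elim k)
    have "us k x \<le> ereal M" using elim[rule_format, of x] \<delta> by simp
    then have "us k x < \<infinity>" by (rule le_less_trans) simp
    then show ?case using xk by (auto simp: dom_fn_def)
  qed
  have xd: "x \<in> dom_fn u" using x regular_subset by blast
  define c where "c = real_of_ereal (u x)"
  have c: "u x = ereal c" using conv_sc_dom[OF u xd] by (simp add: c_def)
  have "xs \<longlonglongrightarrow> x \<Longrightarrow> u x \<le> Liminf sequentially (\<lambda>k. us k (xs k))" for xs using epi by (simp add: epi_conv_def)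
  from this[OF tendsto_const] have "ereal (c - 1) < Liminf sequentially (\<lambda>k. us k x)"
    by (rule less_le_trans[rotated]) (simp add: c)
  then have low: "\<forall>\<^sub>F k in sequentially. ereal (c - 1) < us k x" by (rule less_LiminfD)
  define B where "B = (M - (c - 1)) / \<delta>"
  have bnd: "\<forall>\<^sub>F k in sequentially. norm (grad (us k) x) \<le> B"
    using M low reg
  proof eventually_elim
    case (elim k)
    define g where "g = grad (us k) x"
    define z where "z = x + (\<delta> / norm g) *\<^sub>R g"
    have sg: "subgradient (us k) x g" unfolding g_def by (rule subgradient_grad[OF us elim(3)])
    show ?case
    proof (cases "g = 0")
      case True
      have "us k x \<le> ereal M" using elim(1)[rule_format, of x] \<delta> by simp
      then have "ereal (c - 1) < ereal M" using elim(2) by (rule less_le_trans[rotated])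
      then show ?thesis using True \<delta> by (simp add: g_def B_def)
    next
      case False
      then have "norm (z - x) \<le> \<delta>" using \<delta> by (simp add: z_def)
      then have "us k x + ereal (g \<bullet> (z - x)) \<le> ereal M" using sg elim(1) unfolding subgradient_def by (meson order_trans)
      moreover have "g \<bullet> (z - x) = \<delta> * norm g" using False by (simp add: z_def power2_norm_eq_inner[symmetric] power2_eq_square)
      moreover have "ereal (c - 1) + ereal (\<delta> * norm g) \<le> us k x + ereal (\<delta> * norm g)" using elim(2) by (intro add_right_mono) simp
      ultimately have "ereal (c - 1) + ereal (\<delta> * norm g) \<le> ereal M" by (metis order_trans)
      then have "norm g * \<delta> \<le> M - (c - 1)" by (simp add: mult.commute)
      then show ?thesis unfolding B_def g_def[symmetric] using \<delta> by (simp only: pos_le_divide_eq)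
    qed
  qed
  show "(\<lambda>k. grad (us k) x) \<longlonglongrightarrow> grad u x"
  proof (rule ccontr)
    assume "\<not> ?thesis"
    then obtain e where e: "0 < e" "\<not> (\<forall>\<^sub>F k in sequentially. dist (grad (us k) x) (grad u x) < e)" by (auto simp: tendsto_iff)
    then have "\<exists>\<^sub>F k in sequentially. e \<le> dist (grad (us k) x) (grad u x)" by (simp add: not_eventually not_less)
    moreover have "\<forall>\<^sub>F k in sequentially. x \<in> regular (us k) \<and> norm (grad (us k) x) \<le> B" using reg bnd by eventually_elim simp
    ultimately have "\<exists>\<^sub>F k in sequentially. e \<le> dist (grad (us k) x) (grad u x) \<and> (x \<in> regular (us k) \<and> norm (grad (us k) x) \<le> B)"
      by (rule frequently_eventually_frequently)
    from frequently_subsequence[OF this] obtain r :: "nat \<Rightarrow> nat" where r: "strict_mono r" "\<forall>j. e \<le> dist (grad (us (r j)) x) (grad u x) \<and> (x \<in> regular (us (r j)) \<and> norm (grad (us (r j)) x) \<le> B)" by blast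
    have comp: "seq_compact (cball (0::real^'n) B)" by (intro compact_imp_seq_compact) simp
    have "\<forall>j. grad (us (r j)) x \<in> cball 0 B" using r(2) by simp
    then obtain l0 q where "l0 \<in> cball 0 B" and l: "strict_mono (q :: nat \<Rightarrow> nat)" "((\<lambda>j. grad (us (r j)) x) \<circ> q) \<longlonglongrightarrow> l0"
      by (rule seq_compactE[OF comp])
    define s where "s = r \<circ> q"
    have s: "strict_mono s" unfolding s_def by (rule strict_mono_o[OF r(1) l(1)])
    have gl: "(\<lambda>j. grad (us (s j)) x) \<longlonglongrightarrow> l0" using l(2) by (simp add: s_def o_def)
    have "subgradient u x l0" unfolding subgradient_def
    proof
      fix z
      show "u x + ereal (l0 \<bullet> (z - x)) \<le> u z"
      proof (cases "z \<in> dom_fn u")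
        case True
        define b where "b = real_of_ereal (u z)"
        have b: "u z = ereal b" using conv_sc_dom[OF u True] by (simp add: b_def)
        obtain zs where zs: "zs \<longlonglongrightarrow> z" "(\<lambda>k. us k (zs k)) \<longlonglongrightarrow> u z" by (rule epi_conv_recovery[OF epi])
        have "c \<le> b - l0 \<bullet> (z - x) + \<epsilon>" if \<epsilon>: "0 < \<epsilon>" for \<epsilon>
        proof -
          have "\<forall>\<^sub>F k in sequentially. us k (zs k) < ereal (b + \<epsilon> / 2)" by (rule order_tendstoD(2)[OF zs(2)]) (simp add: b \<epsilon>)
          then have 1: "\<forall>\<^sub>F j in sequentially. us (s j) (zs (s j)) < ereal (b + \<epsilon> / 2)" by (rule eventually_subseq[OF s])
          have "(\<lambda>j. zs (s j)) \<longlonglongrightarrow> z" using LIMSEQ_subseq_LIMSEQ[OF zs(1) s] by (simp add: o_def)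
          then have "(\<lambda>j. grad (us (s j)) x \<bullet> (zs (s j) - x)) \<longlonglongrightarrow> l0 \<bullet> (z - x)" by (intro tendsto_intros gl)
          then have 2: "\<forall>\<^sub>F j in sequentially. l0 \<bullet> (z - x) - \<epsilon> / 2 < grad (us (s j)) x \<bullet> (zs (s j) - x)"
            by (rule order_tendstoD(1)) (simp add: \<epsilon>)
          have "\<forall>\<^sub>F j in sequentially. us (s j) x \<le> ereal (b - l0 \<bullet> (z - x) + \<epsilon>)" using 1 2
          proof eventually_elim
            case (elim j)
            have rj: "x \<in> regular (us (s j))" using r(2) by (simp add: s_def)
            then have xdj: "x \<in> dom_fn (us (s j))" using regular_subset by blast
            have "us (s j) x + ereal (grad (us (s j)) x \<bullet> (zs (s j) - x)) \<le> us (s j) (zs (s j))"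
              using subgradient_grad[OF us rj] unfolding subgradient_def by blast
            also have "\<dots> < ereal (b + \<epsilon> / 2)" by (rule elim(1))
            finally have "real_of_ereal (us (s j) x) + grad (us (s j)) x \<bullet> (zs (s j) - x) < b + \<epsilon> / 2"
              using conv_sc_dom[OF us xdj] by (metis less_ereal.simps(1) plus_ereal.simps(1))
            then have "real_of_ereal (us (s j) x) \<le> b - l0 \<bullet> (z - x) + \<epsilon>" using elim(2) by simp
            then have "ereal (real_of_ereal (us (s j) x)) \<le> ereal (b - l0 \<bullet> (z - x) + \<epsilon>)" by simp
            then show ?case using conv_sc_dom[OF us xdj] by simp
          qed
          then obtain J where J: "\<forall>j\<ge>J. us (s j) x \<le> ereal (b - l0 \<bullet> (z - x) + \<epsilon>)" by (auto simp: eventually_sequentially)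
          have sJ: "strict_mono (\<lambda>j. s (j + J))" using s by (simp add: strict_mono_def)
          have "u x \<le> ereal (b - l0 \<bullet> (z - x) + \<epsilon>)"
            by (rule epi_conv_subsequence_le[OF epi sJ tendsto_const]) (use J in simp)
          then show ?thesis by (simp add: c)
        qed
        then have "c \<le> b - l0 \<bullet> (z - x)" by (rule field_le_epsilon)
        then show ?thesis by (simp add: c b)
      qed (simp add: dom_fn_def)
    qed
    then have "l0 = grad u x" by (rule subgradient_unique[OF u x])
    then have "(\<lambda>j. grad (us (s j)) x) \<longlonglongrightarrow> grad u x" using gl by simp
    then have "\<forall>\<^sub>F j in sequentially. dist (grad (us (s j)) x) (grad u x) < e" using e(1) by (rule tendstoD)
    then obtain j where "dist (grad (us (s j)) x) (grad u x) < e" by (auto simp: eventually_sequentially)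
    then show False using r(2) by (simp add: s_def not_less[symmetric])
  qed
qed

end

section \<open>Integrals of functions of the gradient\<close>

text \<open>The form without division survives adding constants and composing with maps that shrink
  norms by a bounded amount.\<close>

lemma coercive_iff:
  fixes u :: "'n::finite cfun"
  assumes "\<And>x. - \<infinity> < u x"
  shows "((\<lambda>x. u x / ereal (norm x)) \<longlongrightarrow> \<infinity>) at_infinity \<longleftrightarrow> (\<forall>K. \<exists>b. \<forall>x. b \<le> norm x \<longrightarrow> ereal (K * norm x) \<le> u x)"
proof -
  have *: "ereal K < u x / ereal (norm x) \<longleftrightarrow> ereal (K * norm x) < u x" if "0 < norm x" for K x
    using assms[of x] that by (cases "u x") (auto simp: pos_less_divide_eq)
  show ?thesis
  proof
    assume L: "((\<lambda>x. u x / ereal (norm x)) \<longlongrightarrow> \<infinity>) at_infinity"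
    show "\<forall>K. \<exists>b. \<forall>x. b \<le> norm x \<longrightarrow> ereal (K * norm x) \<le> u x"
    proof
      fix K
      obtain b where b: "\<forall>x. b \<le> norm x \<longrightarrow> ereal K < u x / ereal (norm x)"
        using L unfolding tendsto_PInfty eventually_at_infinity by blast
      show "\<exists>b. \<forall>x. b \<le> norm x \<longrightarrow> ereal (K * norm x) \<le> u x"
      proof (intro exI[of _ "\<bar>b\<bar> + 1"] allI impI)
        fix x :: "real^'n" assume x: "\<bar>b\<bar> + 1 \<le> norm x"
        then have "0 < norm x" "b \<le> norm x" by linarith+
        then show "ereal (K * norm x) \<le> u x" using b * by (intro less_imp_le) blast
      qed
    qed
  next
    assume R: "\<forall>K. \<exists>b. \<forall>x. b \<le> norm x \<longrightarrow> ereal (K * norm x) \<le> u x"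
    show "((\<lambda>x. u x / ereal (norm x)) \<longlongrightarrow> \<infinity>) at_infinity"
      unfolding tendsto_PInfty eventually_at_infinity
    proof
      fix K
      obtain b where b: "\<forall>x. b \<le> norm x \<longrightarrow> ereal ((K + 1) * norm x) \<le> u x" using R by blast
      show "\<exists>b. \<forall>x. b \<le> norm x \<longrightarrow> ereal K < u x / ereal (norm x)"
      proof (intro exI[of _ "\<bar>b\<bar> + 1"] allI impI)
        fix x :: "real^'n" assume x: "\<bar>b\<bar> + 1 \<le> norm x"
        then have x': "0 < norm x" "b \<le> norm x" by linarith+
        have "ereal (K * norm x) < ereal ((K + 1) * norm x)" using x' by (simp add: distrib_right)
        also have "\<dots> \<le> u x" using b x' by blast
        finally show "ereal K < u x / ereal (norm x)" using * x' by blast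
      qed
    qed
  qed
qed

text \<open>A common source for translations, rotations and vertical translations. The loss
  \<open>m\<close> in \<open>nT\<close> is absorbed by the superlinear growth.\<close>

lemma conv_sc_isometry:
  fixes u :: "'n::finite cfun" and T :: "real^'n \<Rightarrow> real^'n"
  assumes u: "u \<in> conv_sc" and T: "\<And>(t::real) x y. T ((1 - t) *\<^sub>R x + t *\<^sub>R y) = (1 - t) *\<^sub>R T x + t *\<^sub>R T y"
    and cont: "continuous_on UNIV T" and surj: "surj T" and nT: "\<And>y. norm y - m \<le> norm (T y)"
  shows "(\<lambda>y. u (T y) + ereal c) \<in> conv_sc"
proof -
  have minf: "- \<infinity> < u (T y) + ereal c" for y using conv_sc_minf[OF u, of "T y"] by (cases "u (T y)") auto
  have "((\<lambda>x. u x / ereal (norm x)) \<longlongrightarrow> \<infinity>) at_infinity" using u by (auto simp: conv_sc_def)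
  then have co: "\<forall>K. \<exists>b. \<forall>x. b \<le> norm x \<longrightarrow> ereal (K * norm x) \<le> u x" using coercive_iff[of u] conv_sc_minf[OF u] by blast
  have "\<exists>x. u (T x) + ereal c < \<infinity>"
  proof -
    obtain x a where "u x = ereal a" using conv_sc_nonempty[OF u] by blast
    moreover obtain y where "x = T y" using surj by blast
    ultimately show ?thesis by (intro exI[of _ y]) simp
  qed
  moreover have "u (T x) + ereal c \<le> Liminf sequentially (\<lambda>k. u (T (xs k)) + ereal c)" if "xs \<longlonglongrightarrow> x" for x xs
  proof -
    have "(\<lambda>k. T (xs k)) \<longlonglongrightarrow> T x" using continuous_on_tendsto_compose[OF cont that] by simp
    then have "u (T x) \<le> Liminf sequentially (\<lambda>k. u (T (xs k)))" by (rule conv_sc_lsc[OF u])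
    then have "u (T x) + ereal c \<le> Liminf sequentially (\<lambda>k. u (T (xs k))) + ereal c" by (rule add_right_mono)
    also have "\<dots> = Liminf sequentially (\<lambda>k. u (T (xs k)) + ereal c)" by (rule Liminf_add_ereal_right[symmetric]) auto
    finally show ?thesis .
  qed
  moreover have "u (T ((1 - t) *\<^sub>R x + t *\<^sub>R y)) + ereal c \<le> ereal (1 - t) * (u (T x) + ereal c) + ereal t * (u (T y) + ereal c)"
    if t: "0 \<le> t \<and> t \<le> 1" for t x y
  proof -
    have "ereal (1 - t) * (u (T x) + ereal c) + ereal t * (u (T y) + ereal c) = (ereal (1 - t) * u (T x) + ereal t * u (T y)) + ereal c"
      using t conv_sc_minf[OF u, of "T x"] conv_sc_minf[OF u, of "T y"]
      by (cases "u (T x)"; cases "u (T y)"; cases "t = 0"; cases "t = 1") (auto simp: algebra_simps)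
    then show ?thesis using conv_sc_convex[OF u, of t "T x" "T y"] t by (simp add: T add_right_mono)
  qed
  moreover have "((\<lambda>x. (u (T x) + ereal c) / ereal (norm x)) \<longlongrightarrow> \<infinity>) at_infinity"
    unfolding coercive_iff[OF minf]
  proof
    fix K
    obtain b where b: "\<forall>x. b \<le> norm x \<longrightarrow> ereal ((\<bar>K\<bar> + 1) * norm x) \<le> u x" using co by blast
    show "\<exists>b. \<forall>x. b \<le> norm x \<longrightarrow> ereal (K * norm x) \<le> u (T x) + ereal c"
    proof (intro exI[of _ "\<bar>b\<bar> + \<bar>m\<bar> + (\<bar>K\<bar> + 1) * \<bar>m\<bar> + \<bar>c\<bar>"] allI impI)
      fix x :: "real^'n" assume x: "\<bar>b\<bar> + \<bar>m\<bar> + (\<bar>K\<bar> + 1) * \<bar>m\<bar> + \<bar>c\<bar> \<le> norm x"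
      have nn: "0 \<le> (\<bar>K\<bar> + 1) * \<bar>m\<bar>" by simp
      have "b \<le> norm (T x)" using nT[of x] x nn by linarith
      then have 1: "ereal ((\<bar>K\<bar> + 1) * norm (T x)) \<le> u (T x)" using b by blast
      have "(\<bar>K\<bar> + 1) * (norm x - \<bar>m\<bar>) \<le> (\<bar>K\<bar> + 1) * norm (T x)" using nT[of x] by (intro mult_left_mono) auto
      moreover have "(\<bar>K\<bar> + 1) * (norm x - \<bar>m\<bar>) = \<bar>K\<bar> * norm x + norm x - (\<bar>K\<bar> + 1) * \<bar>m\<bar>" by (simp add: algebra_simps)
      moreover have "K * norm x \<le> \<bar>K\<bar> * norm x" by (intro mult_right_mono) auto
      ultimately have "K * norm x \<le> (\<bar>K\<bar> + 1) * norm (T x) + c" using x by linarith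
      then have "ereal (K * norm x) \<le> ereal ((\<bar>K\<bar> + 1) * norm (T x)) + ereal c" by simp
      also have "\<dots> \<le> u (T x) + ereal c" by (rule add_right_mono[OF 1])
      finally show "ereal (K * norm x) \<le> u (T x) + ereal c" .
    qed
  qed
  ultimately show ?thesis unfolding conv_sc_def using minf by simp
qed

lemma conv_sc_translate: "u \<in> conv_sc \<Longrightarrow> (\<lambda>y. u (y - a)) \<in> conv_sc"
proof -
  assume u: "u \<in> conv_sc"
  have "(\<lambda>y. u (y - a) + ereal 0) \<in> conv_sc"
  proof (rule conv_sc_isometry[OF u, where m = "norm a"])
    show "surj (\<lambda>y. y - a)" by (rule surjI[of _ "\<lambda>y. y + a"]) simp
    show "norm y - norm a \<le> norm (y - a)" for y by (rule norm_triangle_ineq2)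
  qed (auto intro!: continuous_intros simp: algebra_simps)
  then show ?thesis by simp
qed

lemma conv_sc_add_const: "u \<in> conv_sc \<Longrightarrow> (\<lambda>y. u y + ereal c) \<in> conv_sc"
  by (rule conv_sc_isometry[where m = 0]) auto

lemma orthogonal_matrix_inverse:
  fixes A :: "real^'n::finite^'n"
  assumes "orthogonal_matrix A"
  shows "transpose A *v (A *v x) = x" "A *v (transpose A *v x) = x"
    "(transpose A *v x) \<bullet> (transpose A *v y) = x \<bullet> y" "norm (transpose A *v x) = norm x"
proof -
  have o: "transpose A ** A = mat 1" "A ** transpose A = mat 1" using assms by (auto simp: orthogonal_matrix_def)
  show "transpose A *v (A *v x) = x" "A *v (transpose A *v x) = x" for x
    by (simp_all only: matrix_vector_mul_assoc o matrix_vector_mul_lid)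
  then show i: "(transpose A *v x) \<bullet> (transpose A *v y) = x \<bullet> y" for x y
    by (metis dot_lmul_matrix transpose_matrix_vector)
  show "norm (transpose A *v x) = norm x" by (simp only: norm_eq_sqrt_inner i)
qed

lemma conv_sc_rotate:
  fixes A :: "real^'n::finite^'n"
  assumes A: "orthogonal_matrix A" and u: "u \<in> conv_sc"
  shows "(\<lambda>y. u (transpose A *v y)) \<in> conv_sc"
proof -
  have "(\<lambda>y. u (transpose A *v y) + ereal 0) \<in> conv_sc"
  proof (rule conv_sc_isometry[OF u, where m = 0])
    show "surj ((*v) (transpose A))" by (rule surjI[of _ "\<lambda>y. A *v y"]) (rule orthogonal_matrix_inverse(1)[OF A])
    show "continuous_on UNIV ((*v) (transpose A))" by (rule matrix_vector_mult_linear_continuous_on)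
  qed (simp_all only: orthogonal_matrix_inverse(4)[OF A] matrix_vector_right_distrib matrix_vector_mult_scaleR diff_0_right order_refl)
  then show ?thesis by simp
qed

text \<open>Subgradient inequalities can be transported along \<open>T\<close> directly; uniqueness
  at regular points then identifies the gradients.\<close>

lemma grad_isometry:
  fixes u :: "'n::finite cfun" and T :: "real^'n \<Rightarrow> real^'n"
  assumes u: "u \<in> conv_sc" and u': "u' \<in> conv_sc" "u' = (\<lambda>y. u (T y) + ereal c)" and surj: "surj T"
    and T: "\<And>x z. T z - T x = L (z - x)" and L: "\<And>v w. L v \<bullet> L w = v \<bullet> w"
    and x: "x \<in> regular u'" "T x \<in> regular u"
  shows "grad u (T x) = L (grad u' x)"
proof -
  define g where "g = grad u' x"
  have sg: "u' x + ereal (g \<bullet> (z - x)) \<le> u' z" for z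
    using subgradient_grad[OF u'(1) x(1)] by (simp add: subgradient_def g_def)
  have "subgradient u (T x) (L g)" unfolding subgradient_def
  proof
    fix w
    obtain z where z: "w = T z" using surj by blast
    have e: "L g \<bullet> (w - T x) = g \<bullet> (z - x)" by (simp add: z T L)
    have "(u (T x) + ereal (g \<bullet> (z - x))) + ereal c \<le> u (T z) + ereal c"
      using sg[of z] by (simp add: u'(2) add_ac)
    then show "u (T x) + ereal (L g \<bullet> (w - T x)) \<le> u w" unfolding e unfolding z
      by (simp add: ereal_add_le_add_iff2)
  qed
  then show ?thesis using subgradient_unique[OF u x(2)] by (simp add: g_def)
qed

text \<open>Extending the integrand by 0 lets integrands of functions with different domains be
  added and compared pointwise.\<close>

definition gfun :: "(real^'n \<Rightarrow> real^'n \<Rightarrow> 'b::real_normed_vector) \<Rightarrow> 'n::finite cfun \<Rightarrow> real^'n \<Rightarrow> 'b" where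
  "gfun h u x = (if x \<in> regular u then h x (grad u x) else 0)"

lemma integral_dom_eq_gfun:
  fixes h :: "real^'n::finite \<Rightarrow> real^'n \<Rightarrow> 'b::euclidean_space"
  assumes u: "u \<in> conv_sc"
  shows "integral (dom_fn u) (\<lambda>x. h x (grad u x)) = integral UNIV (gfun h u)"
proof -
  have "integral (dom_fn u) (\<lambda>x. h x (grad u x)) = integral UNIV (\<lambda>x. if x \<in> dom_fn u then h x (grad u x) else 0)"
    by (rule Henstock_Kurzweil_Integration.integral_restrict_UNIV[symmetric])
  also have "\<dots> = integral UNIV (gfun h u)"
    by (rule integral_spike[OF negligible_irregular(2)[OF u]]) (use regular_subset in \<open>auto simp: gfun_def\<close>)
  finally show ?thesis .
qed

lemma borel_measurable_conv_sc: "u \<in> conv_sc \<Longrightarrow> u \<in> borel_measurable borel"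
proof (rule borel_measurableI_le)
  fix y assume u: "u \<in> conv_sc"
  have "closed {x. u x \<le> y}" unfolding closed_sequential_limits
  proof (intro allI impI)
    fix xs l assume *: "(\<forall>n. xs n \<in> {x. u x \<le> y}) \<and> xs \<longlonglongrightarrow> l"
    then have "u l \<le> Liminf sequentially (\<lambda>n. u (xs n))" using conv_sc_lsc[OF u] by blast
    also have "\<dots> \<le> Liminf sequentially (\<lambda>n::nat. y)" using * by (intro Liminf_mono always_eventually) auto
    finally show "l \<in> {x. u x \<le> y}" by (simp add: Liminf_const)
  qed
  then show "{x \<in> space borel. u x \<le> y} \<in> sets borel" by simp
qed

lemma integral_UNIV_translate:
  fixes F :: "'a::euclidean_space \<Rightarrow> 'b::euclidean_space"
  assumes "bounded {x. F x \<noteq> 0}"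
  shows "integral UNIV (\<lambda>x. F (x - a)) = integral UNIV F"
proof -
  obtain b where b: "{x. F x \<noteq> 0} \<subseteq> cbox (- b) b" using bounded_subset_cbox_symmetric[OF assms] by blast
  have restrict: "integral UNIV G = integral S G" if "\<And>x. x \<notin> S \<Longrightarrow> G x = 0" for G :: "'a \<Rightarrow> 'b" and S
  proof -
    have "G = (\<lambda>x. if x \<in> S then G x else 0)" using that by auto
    then show ?thesis using Henstock_Kurzweil_Integration.integral_restrict_UNIV[of S G] by simp
  qed
  have "integral UNIV F = integral (cbox (- b) b) F" by (rule restrict) (use b in blast)
  also have "\<dots> = integral (cbox (- b + a) (b + a)) (\<lambda>x. F (x - a))"
    using integral_shift_cbox[of "- b" "- a" b F] by simp
  also have "\<dots> = integral UNIV (\<lambda>x. F (x - a))"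
  proof (rule restrict[symmetric], rule ccontr)
    fix x assume x: "x \<notin> cbox (- b + a) (b + a)" "F (x - a) \<noteq> 0"
    then have "x - a \<in> cbox (- b) b" using b by blast
    then have "x \<in> cbox (- b + a) (b + a)" by (auto simp: mem_box inner_diff_left inner_add_left algebra_simps)
    then show False using x by simp
  qed
  finally show ?thesis by simp
qed

section \<open>Functionals given by integrals over the gradient\<close>

locale gradient_integrand =
  fixes h :: "real^'n::finite \<Rightarrow> real^'n \<Rightarrow> 'b::euclidean_space" and R :: real
  assumes cont: "continuous_on UNIV (\<lambda>(x, g). h x g)" and supp: "\<And>x g. R \<le> norm g \<Longrightarrow> h x g = 0"
begin

lemma tendsto_integrand:
  "xs \<longlonglongrightarrow> x \<Longrightarrow> gs \<longlonglongrightarrow> g \<Longrightarrow> (\<lambda>k::nat. h (xs k) (gs k)) \<longlonglongrightarrow> h x g"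
  using continuous_on_tendsto_compose[OF cont tendsto_Pair, of xs x sequentially gs g] by simp

text \<open>The gradient is a limit of Borel difference quotients, and \<open>regular u\<close>
  differs from an open set by a null set.\<close>

lemma gfun_measurable:
  assumes u: "u \<in> conv_sc"
  shows "gfun h u \<in> borel_measurable lebesgue"
proof (rule borel_measurable_LIMSEQ_metric)
  define f where "f x = real_of_ereal (u x)" for x
  define t where "t k = inverse (real (Suc k))" for k
  define q where "q k x = (\<Sum>i\<in>Basis. ((f (x + t k *\<^sub>R i) - f x) / t k) *\<^sub>R i)" for k x
  have [measurable]: "u \<in> borel_measurable borel" by (rule borel_measurable_conv_sc[OF u])
  have f[measurable]: "f \<in> borel_measurable borel" unfolding f_def[abs_def] by measurable
  have q[measurable]: "q k \<in> borel_measurable borel" for k unfolding q_def[abs_def] by measurable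
  have hm: "(\<lambda>(x, g). h x g) \<in> borel_measurable borel" by (rule borel_measurable_continuous_onI[OF cont])
  have "(\<lambda>x. (x, q k x)) \<in> borel_measurable borel" for k by measurable
  from measurable_compose[OF this hm] have "(\<lambda>x. h x (q k x)) \<in> borel_measurable borel" for k by simp
  then have hq: "(\<lambda>x. h x (q k x)) \<in> borel_measurable lebesgue" for k by (intro measurable_completion) simp
  have "interior (dom_fn u) \<in> sets lebesgue" by (rule sets_completionI_sets) simp
  then have "interior (dom_fn u) - (interior (dom_fn u) - regular u) \<in> sets lebesgue"
    using negligible_imp_sets[OF negligible_irregular(1)[OF u]] by (rule sets.Diff)
  moreover have "interior (dom_fn u) - (interior (dom_fn u) - regular u) = regular u" using regular_subset by blast
  ultimately have reg: "regular u \<in> sets lebesgue" by simp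
  show "(\<lambda>x. indicator (regular u) x *\<^sub>R h x (q k x)) \<in> borel_measurable lebesgue" for k
    using hq reg by (intro borel_measurable_scaleR borel_measurable_indicator)
  fix x :: "real^'n" assume "x \<in> space lebesgue"
  show "(\<lambda>k. indicator (regular u) x *\<^sub>R h x (q k x)) \<longlonglongrightarrow> gfun h u x"
  proof (cases "x \<in> regular u")
    case True
    have "(\<lambda>k. q k x) \<longlonglongrightarrow> (\<Sum>i\<in>Basis. (grad u x \<bullet> i) *\<^sub>R i)"
      unfolding q_def f_def t_def
      by (intro tendsto_sum tendsto_scaleR tendsto_const difference_quotient_limit[OF grad_has_derivative[OF True]])
    then have "(\<lambda>k. q k x) \<longlonglongrightarrow> grad u x" by (simp only: euclidean_representation)
    then have "(\<lambda>k. h x (q k x)) \<longlonglongrightarrow> h x (grad u x)" by (rule tendsto_integrand[OF tendsto_const])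
    then show ?thesis using True by (simp add: gfun_def)
  qed (simp add: gfun_def)
qed

text \<open>Where the integrand is nonzero the gradient is a subgradient of norm less than
  \<open>R\<close>, so \<open>epi_conv_bounded_subgradients\<close> places the point in a fixed
  ball.\<close>

lemma gfun_dominated:
  assumes us: "\<And>k. us k \<in> conv_sc" and u: "u \<in> conv_sc" and epi: "epi_conv us u"
  shows "\<exists>B R'. \<forall>\<^sub>F k in sequentially. \<forall>x. norm (gfun h (us k) x) \<le> B * indicator (cball 0 R') x"
proof -
  obtain R' where R': "\<forall>\<^sub>F k in sequentially. \<forall>x g. x \<in> dom_fn (us k) \<longrightarrow> subgradient (us k) x g \<longrightarrow> norm g \<le> R \<longrightarrow> norm x \<le> R'"
    using epi_conv_bounded_subgradients[OF us u epi] by blast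
  have "compact (cball (0::real^'n) R' \<times> cball (0::real^'n) R)" by (intro compact_Times compact_cball)
  from compact_imp_bounded[OF compact_continuous_image[OF continuous_on_subset[OF cont subset_UNIV] this]]
  obtain B where B: "\<forall>p\<in>cball 0 R' \<times> cball 0 R. norm ((\<lambda>(x, g). h x g) p) \<le> B" by (auto simp: bounded_iff)
  have "\<forall>\<^sub>F k in sequentially. \<forall>x. norm (gfun h (us k) x) \<le> \<bar>B\<bar> * indicator (cball 0 R') x"
    using R'
  proof eventually_elim
    case (elim k)
    show ?case
    proof
      fix x
      show "norm (gfun h (us k) x) \<le> \<bar>B\<bar> * indicator (cball 0 R') x"
      proof (cases "x \<in> regular (us k) \<and> norm (grad (us k) x) < R")
        case True
        then have "x \<in> dom_fn (us k)" using regular_subset by blast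
        then have x: "norm x \<le> R'" using elim subgradient_grad[OF us] True less_imp_le by blast
        then have "norm (h x (grad (us k) x)) \<le> B" using B[rule_format, of "(x, grad (us k) x)"] True by simp
        then show ?thesis using x True by (simp add: gfun_def)
      next
        case False
        then show ?thesis using supp by (auto simp: gfun_def not_less)
      qed
    qed
  qed
  then show ?thesis by blast
qed

lemma gfun_bounded_support: "u \<in> conv_sc \<Longrightarrow> bounded {x. gfun h u x \<noteq> 0}"
proof -
  assume u: "u \<in> conv_sc"
  obtain B R' where "\<forall>\<^sub>F k in sequentially. \<forall>x. norm (gfun h u x) \<le> B * indicator (cball 0 R') x"
    using gfun_dominated[OF u u epi_conv_const[OF u]] by blast
  then have "\<forall>x. norm (gfun h u x) \<le> B * indicator (cball 0 R') x" by simp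
  then have "gfun h u x = 0" if "x \<notin> cball 0 R'" for x using that by (metis indicator_simps(2) mult_zero_right norm_le_zero_iff)
  then have "{x. gfun h u x \<noteq> 0} \<subseteq> cball 0 R'" by blast
  then show ?thesis by (rule bounded_subset[OF bounded_cball])
qed

lemma dominating_integrable: "(\<lambda>x. B * indicator (cball (0::real^'n) R') x :: real) integrable_on UNIV"
proof -
  have "(indicator (cball (0::real^'n) R') :: real^'n \<Rightarrow> real) integrable_on UNIV"
    using lmeasurable_cball[of "0::real^'n" R'] unfolding lmeasurable_iff_has_integral by (rule has_integral_integrable)
  from integrable_cmul[OF this, of B] show ?thesis by simp
qed

lemma gfun_integrable: "u \<in> conv_sc \<Longrightarrow> gfun h u integrable_on UNIV"
proof -
  assume u: "u \<in> conv_sc"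
  obtain B R' where "\<forall>\<^sub>F k in sequentially. \<forall>x. norm (gfun h u x) \<le> B * indicator (cball 0 R') x"
    using gfun_dominated[OF u u epi_conv_const[OF u]] by blast
  then have le: "norm (gfun h u x) \<le> B * indicator (cball 0 R') x" for x by simp
  have "gfun h u absolutely_integrable_on UNIV"
    by (rule measurable_bounded_by_integrable_imp_absolutely_integrable[OF _ _ dominating_integrable le])
      (use gfun_measurable[OF u] in \<open>auto simp: lebesgue_on_UNIV_eq\<close>)
  then show ?thesis by (rule set_lebesgue_integral_eq_integral(1))
qed

text \<open>Dominated convergence off a null set: at regular points of \<open>u\<close> the
  gradients converge, and outside its domain they eventually leave the support of
  \<open>h\<close>.\<close>

lemma gfun_epi_continuous: "epi_continuous (\<lambda>u. integral UNIV (gfun h u))"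
  unfolding epi_continuous_def
proof (intro allI impI)
  fix us :: "nat \<Rightarrow> 'n cfun" and u assume us: "\<forall>k. us k \<in> conv_sc" and u: "u \<in> conv_sc" and epi: "epi_conv us u"
  define Z where "Z = (\<Union>k. dom_fn (us k) - regular (us k)) \<union> (dom_fn u - regular u)"
  have negZ: "negligible Z" unfolding Z_def
    by (intro negligible_Un negligible_countable_Union) (use negligible_irregular(2) us u in auto)
  have lim: "(\<lambda>k. gfun h (us k) x) \<longlonglongrightarrow> gfun h u x" if x: "x \<notin> Z" for x
  proof (cases "x \<in> dom_fn u")
    case True
    then have xr: "x \<in> regular u" using x by (simp add: Z_def)
    have xk: "\<forall>k. x \<in> regular (us k) \<or> x \<notin> dom_fn (us k)" using x by (auto simp: Z_def)
    note g = epi_conv_grad[OF us[rule_format] u epi xr xk]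
    have "(\<lambda>k. h x (grad (us k) x)) \<longlonglongrightarrow> h x (grad u x)" by (rule tendsto_integrand[OF tendsto_const g(2)])
    moreover have "\<forall>\<^sub>F k in sequentially. h x (grad (us k) x) = gfun h (us k) x"
      using g(1) by eventually_elim (simp add: gfun_def)
    ultimately show ?thesis using xr Lim_transform_eventually by (fastforce simp: gfun_def)
  next
    case False
    have "\<forall>\<^sub>F k in sequentially. gfun h (us k) x = 0"
      using epi_conv_outside[OF us[rule_format] u epi False, of R]
    proof eventually_elim
      case (elim k)
      show ?case
      proof (cases "x \<in> regular (us k)")
        case True
        then have "R < norm (grad (us k) x)" using elim subgradient_grad[OF us[rule_format] True] regular_subset by blast
        then show ?thesis using supp by (simp add: gfun_def)
      qed (simp add: gfun_def)
    qed
    moreover have "gfun h u x = 0" using False regular_subset by (auto simp: gfun_def)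
    ultimately show ?thesis using tendsto_eventually by simp
  qed
  obtain B R' where "\<forall>\<^sub>F k in sequentially. \<forall>x. norm (gfun h (us k) x) \<le> B * indicator (cball 0 R') x"
    using gfun_dominated[OF us[rule_format] u epi] by blast
  then obtain N where N: "\<And>k x. k \<ge> N \<Longrightarrow> norm (gfun h (us k) x) \<le> B * indicator (cball 0 R') x"
    by (auto simp: eventually_sequentially)
  \<comment> \<open>Domination starts at the index \<open>N\<close>, so the sequence is shifted; on
    the null set all functions are set to 0.\<close>
  define f where "f k x = (if x \<in> Z then 0 else gfun h (us (k + N)) x)" for k x
  define g where "g x = (if x \<in> Z then 0 else gfun h u x)" for x
  have fi: "f k integrable_on UNIV" for k
    by (rule integrable_spike[OF gfun_integrable[OF us[rule_format, of "k + N"]] negZ]) (simp add: f_def)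
  have "(\<lambda>k. integral UNIV (f k)) \<longlonglongrightarrow> integral UNIV g"
  proof (rule dominated_convergence(2)[OF fi dominating_integrable])
    show "norm (f k x) \<le> \<bar>B\<bar> * indicator (cball 0 R') x" for k x
      using N[of "k + N" x] by (auto simp: f_def indicator_def split: if_splits)
    show "(\<lambda>k. f k x) \<longlonglongrightarrow> g x" for x
      using LIMSEQ_ignore_initial_segment[OF lim, of x N] by (simp add: f_def g_def)
  qed
  moreover have "integral UNIV (f k) = integral UNIV (gfun h (us (k + N)))" for k
    by (rule integral_spike[OF negZ]) (simp add: f_def)
  moreover have "integral UNIV g = integral UNIV (gfun h u)"
    by (rule integral_spike[OF negZ]) (simp add: g_def)
  ultimately have "(\<lambda>k. integral UNIV (gfun h (us (k + N)))) \<longlonglongrightarrow> integral UNIV (gfun h u)" by simp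
  then show "(\<lambda>k. integral UNIV (gfun h (us k))) \<longlonglongrightarrow> integral UNIV (gfun h u)" by (rule LIMSEQ_offset)
qed

lemma gfun_simple: "simple_val (\<lambda>u. integral UNIV (gfun h u))"
  unfolding simple_val_def
proof (intro ballI impI)
  fix u :: "'n cfun" assume u: "u \<in> conv_sc" and d: "aff_dim (dom_fn u) < int CARD('n)"
  have "interior (dom_fn u) = {}"
    using d aff_dim_nonempty_interior[of "dom_fn u"] by (cases "interior (dom_fn u) = {}") auto
  then have "regular u = {}" using regular_subset by blast
  then have "gfun h u = (\<lambda>x. 0)" by (auto simp: gfun_def)
  then show "integral UNIV (gfun h u) = 0" by simp
qed

lemma gfun_valuation: "is_valuation (\<lambda>u. integral UNIV (gfun h u))"
  unfolding is_valuation_def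
proof (intro ballI impI)
  fix u w :: "'n cfun" assume u: "u \<in> conv_sc" and w: "w \<in> conv_sc"
    and M': "(\<lambda>x. max (u x) (w x)) \<in> conv_sc" and m': "(\<lambda>x. min (u x) (w x)) \<in> conv_sc"
  define M where "M = (\<lambda>x. max (u x) (w x))"
  define m where "m = (\<lambda>x. min (u x) (w x))"
  have M: "M \<in> conv_sc" and m: "m \<in> conv_sc" using M' m' by (simp_all add: M_def m_def)
  have Mm: "max (u x) (w x) = M x" "min (u x) (w x) = m x" for x by (simp_all add: M_def m_def)
  define Z where "Z = (dom_fn u - regular u) \<union> (dom_fn w - regular w) \<union> (dom_fn M - regular M) \<union> (dom_fn m - regular m)"
  have negZ: "negligible Z" unfolding Z_def by (intro negligible_Un negligible_irregular u w M m)
  have dM: "x \<in> dom_fn M \<longleftrightarrow> x \<in> dom_fn u \<and> x \<in> dom_fn w" and dm: "x \<in> dom_fn m \<longleftrightarrow> x \<in> dom_fn u \<or> x \<in> dom_fn w" for x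
    by (auto simp: dom_fn_def M_def m_def max_def min_def split: if_splits)
  \<comment> \<open>At such a point the smaller function touches \<open>m\<close> and, when both are
    finite, the larger one touches \<open>M\<close>; so the gradients of \<open>m\<close> and
    \<open>M\<close> are those of \<open>u\<close> and \<open>w\<close> in some order.\<close>
  have key: "gfun h M x + gfun h m x = gfun h u x + gfun h w x" if x: "x \<notin> Z" for x
  proof -
    have reg: "x \<in> regular v \<longleftrightarrow> x \<in> dom_fn v" if "v \<in> {u, w, M, m}" for v
      using x that regular_subset by (auto simp: Z_def)
    have le: "m y \<le> u y" "m y \<le> w y" "u y \<le> M y" "w y \<le> M y" for y by (simp_all add: M_def m_def)
    have mu: "grad m x = grad u x" if "x \<in> dom_fn u" "u x \<le> w x"
      using grad_touching[OF m u le(1)] that reg dm by (simp add: m_def min_def)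
    have mw: "grad m x = grad w x" if "x \<in> dom_fn w" "w x \<le> u x"
      using grad_touching[OF m w le(2)] that reg dm by (simp add: m_def min_def)
    have Mu: "grad M x = grad u x" if "x \<in> dom_fn u" "x \<in> dom_fn w" "w x \<le> u x"
      using grad_touching[OF u M le(3)] that reg dM by (simp add: M_def max_def)
    have Mw: "grad M x = grad w x" if "x \<in> dom_fn u" "x \<in> dom_fn w" "u x \<le> w x"
      using grad_touching[OF w M le(4)] that reg dM by (simp add: M_def max_def)
    show ?thesis
    proof (cases "x \<in> dom_fn u"; cases "x \<in> dom_fn w")
      assume d: "x \<in> dom_fn u" "x \<in> dom_fn w"
      show ?thesis
      proof (cases "u x \<le> w x")
        case True
        then show ?thesis using d mu Mw reg dM dm by (simp add: gfun_def)
      next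
        case False
        then show ?thesis using d mw Mu reg dM dm by (simp add: gfun_def)
      qed
    next
      assume d: "x \<in> dom_fn u" "x \<notin> dom_fn w"
      then have "u x \<le> w x" by (simp add: dom_fn_def)
      then show ?thesis using d mu reg dM dm by (simp add: gfun_def)
    next
      assume d: "x \<notin> dom_fn u" "x \<in> dom_fn w"
      then have "w x \<le> u x" by (simp add: dom_fn_def)
      then show ?thesis using d mw reg dM dm by (simp add: gfun_def)
    next
      assume d: "x \<notin> dom_fn u" "x \<notin> dom_fn w"
      then show ?thesis using reg dM dm by (simp add: gfun_def)
    qed
  qed
  have "integral UNIV (gfun h M) + integral UNIV (gfun h m) = integral UNIV (\<lambda>x. gfun h M x + gfun h m x)"
    by (rule integral_add[symmetric]) (intro gfun_integrable M m)+
  also have "\<dots> = integral UNIV (\<lambda>x. gfun h u x + gfun h w x)"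
    by (rule integral_spike[OF negZ]) (simp add: key)
  also have "\<dots> = integral UNIV (gfun h u) + integral UNIV (gfun h w)"
    by (rule integral_add) (intro gfun_integrable u w)+
  finally show "integral UNIV (gfun h (\<lambda>x. max (u x) (w x))) + integral UNIV (gfun h (\<lambda>x. min (u x) (w x))) =
    integral UNIV (gfun h u) + integral UNIV (gfun h w)" by (simp add: M_def m_def)
qed

lemma gfun_vert: "vert_trans_invariant (\<lambda>u. integral UNIV (gfun h u))"
  unfolding vert_trans_invariant_def
proof (intro ballI allI)
  fix u :: "'n cfun" and c assume u: "u \<in> conv_sc"
  let ?u = "\<lambda>x. u x + ereal c"
  have u': "?u \<in> conv_sc" by (rule conv_sc_add_const[OF u])
  have d: "dom_fn ?u = dom_fn u" by (auto simp: dom_fn_def)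
  show "integral UNIV (gfun h ?u) = integral UNIV (gfun h u)"
  proof (rule integral_spike[OF negligible_Un[OF negligible_irregular(2)[OF u] negligible_irregular(2)[OF u']]])
    fix x assume x: "x \<in> UNIV - ((dom_fn u - regular u) \<union> (dom_fn ?u - regular ?u))"
    then have r: "x \<in> regular u \<longleftrightarrow> x \<in> regular ?u" using d regular_subset(2)[of u] regular_subset(2)[of ?u] by blast
    show "gfun h u x = gfun h ?u x"
    proof (cases "x \<in> regular u")
      case True
      have "grad u x = grad ?u x"
        by (rule grad_isometry[where T = "\<lambda>y. y" and L = "\<lambda>v. v" and c = c, OF u u']) (use True r in auto)
      then show ?thesis using True r by (simp add: gfun_def)
    qed (simp add: gfun_def r)
  qed
qed

lemma gfun_translate:
  assumes u: "u \<in> conv_sc"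
  shows "integral UNIV (gfun h (\<lambda>y. u (y - a))) = integral UNIV (gfun (\<lambda>x. h (x + a)) u)"
proof -
  let ?u = "\<lambda>y. u (y - a)"
  have u': "?u \<in> conv_sc" by (rule conv_sc_translate[OF u])
  have d: "x \<in> dom_fn ?u \<longleftrightarrow> x - a \<in> dom_fn u" for x by (auto simp: dom_fn_def)
  interpret s: gradient_integrand "\<lambda>x. h (x + a)" R
  proof
    have "continuous_on UNIV (\<lambda>p. (\<lambda>(x, g). h x g) (fst p + a, snd p))"
      by (rule continuous_on_compose2[OF cont]) (auto intro!: continuous_intros)
    then show "continuous_on UNIV (\<lambda>(x, g). h (x + a) g)" by (simp add: case_prod_beta)
  qed (rule supp)
  have neg: "negligible ((dom_fn ?u - regular ?u) \<union> (+) a ` (dom_fn u - regular u))"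
    by (intro negligible_Un negligible_translation negligible_irregular u u')
  have "integral UNIV (gfun h ?u) = integral UNIV (\<lambda>x. gfun (\<lambda>x. h (x + a)) u (x - a))"
  proof (rule integral_spike[OF neg])
    fix x assume x: "x \<in> UNIV - ((dom_fn ?u - regular ?u) \<union> (+) a ` (dom_fn u - regular u))"
    have "x - a \<notin> dom_fn u - regular u"
    proof
      assume "x - a \<in> dom_fn u - regular u"
      then have "a + (x - a) \<in> (+) a ` (dom_fn u - regular u)" by (rule imageI)
      then show False using x by simp
    qed
    then have r: "x - a \<in> regular u \<longleftrightarrow> x \<in> regular ?u"
      using x d[of x] regular_subset(2)[of u] regular_subset(2)[of ?u] by blast
    show "gfun (\<lambda>x. h (x + a)) u (x - a) = gfun h ?u x"
    proof (cases "x \<in> regular ?u")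
      case True
      have "surj (\<lambda>y. y - a)" by (rule surjI[of _ "\<lambda>y. y + a"]) simp
      then have "grad u (x - a) = grad ?u x"
        by (intro grad_isometry[where T = "\<lambda>y. y - a" and L = "\<lambda>v. v" and c = 0, OF u u']) (use True r in auto)
      then show ?thesis using True r by (simp add: gfun_def)
    qed (simp add: gfun_def r)
  qed
  also have "\<dots> = integral UNIV (gfun (\<lambda>x. h (x + a)) u)"
    by (rule integral_UNIV_translate[OF s.gfun_bounded_support[OF u]])
  finally show ?thesis .
qed

text \<open>On \<open>unit_piece\<close> this shows that a gradient integral has its integrand as
  density.\<close>

lemma gfun_affine_piece:
  assumes u: "u \<in> conv_sc" and C: "\<And>x. x \<in> dom_fn u \<Longrightarrow> u x = ereal (\<tau> \<bullet> x + c)"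
  shows "integral UNIV (gfun h u) = integral (dom_fn u) (\<lambda>x. h x \<tau>)"
proof -
  have "grad u x = \<tau>" if x: "x \<in> regular u" for x
  proof -
    have xd: "x \<in> dom_fn u" using x regular_subset by blast
    have "subgradient u x \<tau>" unfolding subgradient_def
    proof
      fix z
      show "u x + ereal (\<tau> \<bullet> (z - x)) \<le> u z"
      proof (cases "z \<in> dom_fn u")
        case True
        then show ?thesis using C[OF True] C[OF xd] by (simp add: inner_diff_right)
      qed (simp add: dom_fn_def)
    qed
    then show ?thesis using subgradient_unique[OF u x] by simp
  qed
  then have "gfun h u = gfun (\<lambda>x g. h x \<tau>) u" by (auto simp: gfun_def)
  then show ?thesis using integral_dom_eq_gfun[OF u, of "\<lambda>x g. h x \<tau>"] by simp
qed

end

section \<open>Translation invariant functionals\<close>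

definition epi_translation_invariant :: "('n::finite cfun \<Rightarrow> real) \<Rightarrow> bool" where
  "epi_translation_invariant \<mu> \<longleftrightarrow> (\<forall>u\<in>conv_sc. \<forall>a. \<mu> (\<lambda>y. u (y - a)) = \<mu> u) \<and> vert_trans_invariant \<mu>"

definition classifiable :: "('n::finite cfun \<Rightarrow> real) \<Rightarrow> bool" where
  "classifiable \<mu> \<longleftrightarrow> epi_continuous \<mu> \<and> epi_translation_invariant \<mu> \<and> simple_val \<mu> \<and> is_valuation \<mu>"

lemma classifiableI:
  assumes "\<And>us u. (\<And>k. us k \<in> conv_sc) \<Longrightarrow> u \<in> conv_sc \<Longrightarrow> epi_conv us u \<Longrightarrow> (\<lambda>k. \<mu> (us k)) \<longlonglongrightarrow> \<mu> u"
    and "\<And>u a. u \<in> conv_sc \<Longrightarrow> \<mu> (\<lambda>y. u (y - a)) = \<mu> u"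
    and "\<And>u c. u \<in> conv_sc \<Longrightarrow> \<mu> (\<lambda>y. u y + ereal c) = \<mu> u"
    and "\<And>u. u \<in> conv_sc \<Longrightarrow> aff_dim (dom_fn u) < int CARD('n) \<Longrightarrow> \<mu> u = 0"
    and "\<And>u w. u \<in> conv_sc \<Longrightarrow> w \<in> conv_sc \<Longrightarrow> (\<lambda>x. max (u x) (w x)) \<in> conv_sc \<Longrightarrow> (\<lambda>x. min (u x) (w x)) \<in> conv_sc \<Longrightarrow>
      \<mu> (\<lambda>x. max (u x) (w x)) + \<mu> (\<lambda>x. min (u x) (w x)) = \<mu> u + \<mu> w"
  shows "classifiable (\<mu> :: 'n::finite cfun \<Rightarrow> real)"
  using assms unfolding classifiable_def epi_translation_invariant_def epi_continuous_def vert_trans_invariant_def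
    simple_val_def is_valuation_def by simp

lemma classifiableD:
  assumes "classifiable (\<mu> :: 'n::finite cfun \<Rightarrow> real)"
  shows "(\<And>k. us k \<in> conv_sc) \<Longrightarrow> u \<in> conv_sc \<Longrightarrow> epi_conv us u \<Longrightarrow> (\<lambda>k. \<mu> (us k)) \<longlonglongrightarrow> \<mu> u"
    and "u \<in> conv_sc \<Longrightarrow> \<mu> (\<lambda>y. u (y - a)) = \<mu> u"
    and "u \<in> conv_sc \<Longrightarrow> \<mu> (\<lambda>y. u y + ereal c) = \<mu> u"
    and "u \<in> conv_sc \<Longrightarrow> aff_dim (dom_fn u) < int CARD('n) \<Longrightarrow> \<mu> u = 0"
    and "u \<in> conv_sc \<Longrightarrow> w \<in> conv_sc \<Longrightarrow> (\<lambda>x. max (u x) (w x)) \<in> conv_sc \<Longrightarrow> (\<lambda>x. min (u x) (w x)) \<in> conv_sc \<Longrightarrow>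
      \<mu> (\<lambda>x. max (u x) (w x)) + \<mu> (\<lambda>x. min (u x) (w x)) = \<mu> u + \<mu> w"
  using assms unfolding classifiable_def epi_translation_invariant_def epi_continuous_def vert_trans_invariant_def
    simple_val_def is_valuation_def by auto

lemma classifiable_diff:
  assumes \<mu>: "classifiable \<mu>" and \<nu>: "classifiable \<nu>"
  shows "classifiable (\<lambda>u. \<mu> u - \<nu> u)"
proof (rule classifiableI)
  fix us :: "nat \<Rightarrow> 'a cfun" and u assume "\<And>k. us k \<in> conv_sc" "u \<in> conv_sc" "epi_conv us u"
  then show "(\<lambda>k. \<mu> (us k) - \<nu> (us k)) \<longlonglongrightarrow> \<mu> u - \<nu> u"
    by (intro tendsto_diff classifiableD(1)[OF \<mu>] classifiableD(1)[OF \<nu>])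
next
  fix u w :: "'a cfun" assume a: "u \<in> conv_sc" "w \<in> conv_sc" "(\<lambda>x. max (u x) (w x)) \<in> conv_sc" "(\<lambda>x. min (u x) (w x)) \<in> conv_sc"
  show "\<mu> (\<lambda>x. max (u x) (w x)) - \<nu> (\<lambda>x. max (u x) (w x)) + (\<mu> (\<lambda>x. min (u x) (w x)) - \<nu> (\<lambda>x. min (u x) (w x))) =
      \<mu> u - \<nu> u + (\<mu> w - \<nu> w)"
    using classifiableD(5)[OF \<mu> a] classifiableD(5)[OF \<nu> a] by linarith
qed (simp_all add: classifiableD(2-4)[OF \<mu>] classifiableD(2-4)[OF \<nu>])

lemma classifiable_dual:
  assumes \<mu>: "classifiable \<mu>"
  shows "dual_val_cart (\<lambda>v. \<mu> (fenchel v))"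
proof
  fix v w :: "real^'a \<Rightarrow> real" assume c: "cvx v" "cvx w" "cvx (\<lambda>y. min (v y) (w y))"
  have "fenchel (\<lambda>y. max (v y) (w y)) \<in> conv_sc" "fenchel (\<lambda>y. min (v y) (w y)) \<in> conv_sc"
    by (intro fenchel_conv_sc cvx_max c)+
  then show "\<mu> (fenchel (\<lambda>y. max (v y) (w y))) + \<mu> (fenchel (\<lambda>y. min (v y) (w y))) = \<mu> (fenchel v) + \<mu> (fenchel w)"
    using classifiableD(5)[OF \<mu> fenchel_conv_sc[OF c(1)] fenchel_conv_sc[OF c(2)]]
    unfolding fenchel_max[OF c] fenchel_min by simp
next
  fix vs :: "nat \<Rightarrow> real^'a \<Rightarrow> real" and v assume "\<And>k. cvx (vs k)" "cvx v" "\<And>y. (\<lambda>k. vs k y) \<longlonglongrightarrow> v y"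
  then show "(\<lambda>k. \<mu> (fenchel (vs k))) \<longlonglongrightarrow> \<mu> (fenchel v)"
    by (intro classifiableD(1)[OF \<mu>] fenchel_conv_sc epi_conv_fenchel)
next
  fix v :: "real^'a \<Rightarrow> real" and b c assume v: "cvx v"
  show "\<mu> (fenchel (\<lambda>y. v y + (b \<bullet> y + c))) = \<mu> (fenchel v)"
    unfolding fenchel_affine
    using classifiableD(3)[OF \<mu> conv_sc_translate[OF fenchel_conv_sc[OF v]], of b "- c"]
      classifiableD(2)[OF \<mu> fenchel_conv_sc[OF v], of b] by simp
next
  fix v :: "real^'a \<Rightarrow> real" and d assume "cvx v" "d \<noteq> 0" "\<And>y s. v (y + s *\<^sub>R d) = v y"
  then show "\<mu> (fenchel v) = 0" by (intro classifiableD(4)[OF \<mu>] fenchel_conv_sc fenchel_degenerate)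
qed

text \<open>Introduced as a conjugate, so that the values of a functional on it are the
  \<open>density\<close> of its dual.\<close>

definition unit_piece :: "real^'n \<Rightarrow> 'n::finite cfun" where
  "unit_piece \<tau> = fenchel (hinge_frame (\<lambda>i. axis i 1) \<tau>)"

lemma unit_piece_conv_sc: "unit_piece \<tau> \<in> conv_sc"
  unfolding unit_piece_def by (rule fenchel_conv_sc[OF cvx_hinge_frame])

lemma unit_piece_eq: "unit_piece \<tau> x = (if x \<in> cbox 0 1 then ereal (\<tau> \<bullet> x) else \<infinity>)"
proof (cases "x \<in> cbox 0 1")
  case True
  then have x: "0 \<le> x $ i" "x $ i \<le> 1" for i by (auto simp: mem_box_cart)
  have hf: "hinge_frame (\<lambda>i. axis i 1) \<tau> y = (\<Sum>i\<in>UNIV. max 0 (y $ i - \<tau> $ i))" for y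
    by (simp add: hinge_frame_def inner_axis')
  have "fenchel (hinge_frame (\<lambda>i. axis i 1) \<tau>) x \<le> ereal (\<tau> \<bullet> x)"
    unfolding fenchel_le_iff
  proof
    fix y
    have "x \<bullet> (y - \<tau>) = (\<Sum>i\<in>UNIV. x $ i * (y $ i - \<tau> $ i))" by (simp add: inner_vec_def)
    also have "\<dots> \<le> (\<Sum>i\<in>UNIV. max 0 (y $ i - \<tau> $ i))"
    proof (rule sum_mono)
      fix i
      show "x $ i * (y $ i - \<tau> $ i) \<le> max 0 (y $ i - \<tau> $ i)"
      proof (cases "0 \<le> y $ i - \<tau> $ i")
        case True
        then show ?thesis using x[of i] mult_right_mono[of "x $ i" 1 "y $ i - \<tau> $ i"] by simp
      next
        case False
        then show ?thesis using x[of i] mult_nonneg_nonpos[of "x $ i" "y $ i - \<tau> $ i"] by simp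
      qed
    qed
    finally show "x \<bullet> y - hinge_frame (\<lambda>i. axis i 1) \<tau> y \<le> \<tau> \<bullet> x"
      by (simp add: hf inner_diff_right inner_commute)
  qed
  moreover have "ereal (\<tau> \<bullet> x) \<le> fenchel (hinge_frame (\<lambda>i. axis i 1) \<tau>) x"
    using fenchel_upper[of x \<tau> "hinge_frame (\<lambda>i. axis i 1) \<tau>"] by (simp add: hf inner_commute)
  ultimately show ?thesis using True by (simp add: unit_piece_def)
next
  case False
  then obtain i where i: "x $ i < 0 \<or> 1 < x $ i" by (auto simp: mem_box_cart not_le)
  \<comment> \<open>On the line through \<open>\<tau>\<close> in direction \<open>i\<close> only one
    hinge is active. A coordinate of \<open>x\<close> outside the unit interval therefore makes the
    supremum infinite.\<close>
  have hf: "hinge_frame (\<lambda>i. axis i 1) \<tau> (\<tau> + s *\<^sub>R axis i 1) = max 0 s" for s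
  proof -
    have "hinge_frame (\<lambda>i. axis i 1) \<tau> (\<tau> + s *\<^sub>R axis i 1) = (\<Sum>j\<in>UNIV. if j = i then max 0 s else 0)"
      unfolding hinge_frame_def by (rule sum.cong) (auto simp: inner_axis_axis)
    then show ?thesis by simp
  qed
  have "unit_piece \<tau> x = \<infinity>"
  proof (rule ccontr)
    assume "unit_piece \<tau> x \<noteq> \<infinity>"
    then obtain m where m: "unit_piece \<tau> x \<le> ereal m" by (cases "unit_piece \<tau> x") auto
    have le: "x \<bullet> \<tau> + s * x $ i - max 0 s \<le> m" for s
      using m[unfolded unit_piece_def fenchel_le_iff, rule_format, of "\<tau> + s *\<^sub>R axis i 1"]
      by (simp add: hf inner_add_right inner_axis)
    from i show False
    proof
      assume i0: "x $ i < 0"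
      define s where "s = (\<bar>m - x \<bullet> \<tau>\<bar> + 1) / x $ i"
      have "s \<le> 0" "s * x $ i = \<bar>m - x \<bullet> \<tau>\<bar> + 1" using i0 by (auto simp: s_def divide_nonneg_neg)
      then show False using le[of s] by simp
    next
      assume i1: "1 < x $ i"
      define s where "s = (\<bar>m - x \<bullet> \<tau>\<bar> + 1) / (x $ i - 1)"
      have "0 \<le> s" "s * (x $ i - 1) = \<bar>m - x \<bullet> \<tau>\<bar> + 1" using i1 by (auto simp: s_def)
      then show False using le[of s] by (simp add: right_diff_distrib)
    qed
  qed
  then show ?thesis using False by simp
qed

lemma dom_unit_piece: "dom_fn (unit_piece \<tau>) = cbox 0 1"
  by (auto simp: dom_fn_def unit_piece_eq)

lemma conv_sc_restrict:
  fixes u :: "'n::finite cfun"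
  assumes u: "u \<in> conv_sc" and K: "closed K" "convex K" and ne: "x0 \<in> K" "u x0 < \<infinity>"
  shows "(\<lambda>x. if x \<in> K then u x else \<infinity>) \<in> conv_sc"
proof -
  let ?w = "\<lambda>x. if x \<in> K then u x else \<infinity>"
  have minf: "- \<infinity> < ?w x" for x using conv_sc_minf[OF u] by simp
  have le: "u x \<le> ?w x" for x by simp
  have "\<exists>x. ?w x < \<infinity>" using ne by (intro exI[of _ x0]) simp
  moreover have "?w x \<le> Liminf sequentially (\<lambda>k. ?w (xs k))" if xs: "xs \<longlonglongrightarrow> x" for x xs
  proof (cases "x \<in> K")
    case True
    have "u x \<le> Liminf sequentially (\<lambda>k. u (xs k))" by (rule conv_sc_lsc[OF u xs])
    also have "\<dots> \<le> Liminf sequentially (\<lambda>k. ?w (xs k))" by (intro Liminf_mono always_eventually allI le)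
    finally show ?thesis using True by simp
  next
    case False
    have "\<forall>\<^sub>F k in sequentially. xs k \<in> - K" using K(1) False by (intro topological_tendstoD[OF xs]) auto
    then have "\<forall>\<^sub>F k in sequentially. \<infinity> \<le> ?w (xs k)" by eventually_elim simp
    then have "Liminf sequentially (\<lambda>k::nat. \<infinity>::ereal) \<le> Liminf sequentially (\<lambda>k. ?w (xs k))" by (rule Liminf_mono)
    then show ?thesis by (simp add: Liminf_const)
  qed
  moreover have "?w ((1 - t) *\<^sub>R x + t *\<^sub>R y) \<le> ereal (1 - t) * ?w x + ereal t * ?w y"
    if t: "0 \<le> t \<and> t \<le> 1" for t x y
  proof -
    consider "t = 0" | "t = 1" | "0 < t" "t < 1" "x \<in> K" "y \<in> K" | "0 < t" "t < 1" "x \<notin> K \<or> y \<notin> K" using t by fastforce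
    then show ?thesis
    proof cases
      case 3
      then have "(1 - t) *\<^sub>R x + t *\<^sub>R y \<in> K" using K(2) by (intro convexD_alt) auto
      then show ?thesis using conv_sc_convex[OF u, of t x y] t 3 by simp
    next
      case 4
      have "ereal (1 - t) * ?w x + ereal t * ?w y = \<infinity>"
        using 4 conv_sc_minf[OF u, of x] conv_sc_minf[OF u, of y]
        by (cases "u x"; cases "u y") auto
      then show ?thesis by (simp only: ereal_less_eq(1))
    qed (simp_all add: zero_ereal_def[symmetric] one_ereal_def[symmetric])
  qed
  moreover have "((\<lambda>x. ?w x / ereal (norm x)) \<longlongrightarrow> \<infinity>) at_infinity"
    unfolding coercive_iff[OF minf]
  proof
    fix K'
    have "((\<lambda>x. u x / ereal (norm x)) \<longlongrightarrow> \<infinity>) at_infinity" using u by (auto simp: conv_sc_def)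
    then obtain b where "\<forall>x. b \<le> norm x \<longrightarrow> ereal (K' * norm x) \<le> u x"
      using coercive_iff[of u] conv_sc_minf[OF u] by blast
    then show "\<exists>b. \<forall>x. b \<le> norm x \<longrightarrow> ereal (K' * norm x) \<le> ?w x" using le order_trans by blast
  qed
  ultimately show ?thesis unfolding conv_sc_def using minf by simp
qed

text \<open>Truncations of \<open>u\<close> to growing balls have bounded domain, hence Lipschitz
  conjugates, and epi-converge to \<open>u\<close>. The radii start at \<open>norm x0\<close> to
  keep the truncations proper.\<close>

lemma classifiable_zero:
  fixes \<mu> :: "'n::finite cfun \<Rightarrow> real"
  assumes \<mu>: "classifiable \<mu>" and zero: "\<And>\<tau>. \<mu> (unit_piece \<tau>) = 0" and u: "u \<in> conv_sc"
  shows "\<mu> u = 0"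
proof -
  interpret dual_val_cart "\<lambda>v. \<mu> (fenchel v)" by (rule classifiable_dual[OF \<mu>])
  have dens: "density \<tau> = 0" for \<tau> using zero[of \<tau>] by (simp add: density_def unit_piece_def)
  have bdd: "\<mu> w = 0" if w: "w \<in> conv_sc" "dom_fn w \<subseteq> cball 0 R" for w R
  proof -
    obtain v L where v: "cvx v" "0 \<le> L" "\<And>x y. \<bar>v x - v y\<bar> \<le> L * norm (x - y)" "fenchel v = w"
      using conv_sc_biconjugate[OF w] by metis
    show ?thesis using density_zero_imp_zero[OF dens v(1,2,3)] v(4) by simp
  qed
  obtain x0 c where x0: "u x0 = ereal c" using conv_sc_nonempty[OF u] by blast
  define K where "K k = cball (0::real^'n) (norm x0 + real k)" for k
  define us where "us k x = (if x \<in> K k then u x else \<infinity>)" for k x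
  have us: "us k \<in> conv_sc" for k unfolding us_def
    by (rule conv_sc_restrict[OF u, of _ x0]) (auto simp: K_def x0)
  have epi: "epi_conv us u" unfolding epi_conv_def
  proof (intro allI conjI impI)
    fix x and xs :: "nat \<Rightarrow> real^'n" assume xs: "xs \<longlonglongrightarrow> x"
    have "u x \<le> Liminf sequentially (\<lambda>k. u (xs k))" by (rule conv_sc_lsc[OF u xs])
    also have "\<dots> \<le> Liminf sequentially (\<lambda>k. us k (xs k))" by (intro Liminf_mono always_eventually) (simp add: us_def)
    finally show "u x \<le> Liminf sequentially (\<lambda>k. us k (xs k))" .
  next
    fix x :: "real^'n"
    obtain N :: nat where N: "norm x \<le> real N" using real_arch_simple by blast
    have "us k x = u x" if "k \<ge> N" for k
    proof -
      have "norm x \<le> norm x0 + real k" using N that norm_ge_zero[of x0] of_nat_mono[OF that, where 'a = real] by linarith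
      then show ?thesis by (simp add: us_def K_def)
    qed
    then have "\<forall>\<^sub>F k in sequentially. us k x = u x" unfolding eventually_sequentially by blast
    then have "(\<lambda>k. us k x) \<longlonglongrightarrow> u x" by (rule tendsto_eventually)
    then show "\<exists>xs. xs \<longlonglongrightarrow> x \<and> (\<lambda>k. us k (xs k)) \<longlonglongrightarrow> u x" by (intro exI[of _ "\<lambda>_. x"]) simp
  qed
  have "\<mu> (us k) = 0" for k
    by (rule bdd[OF us, of _ "norm x0 + real k"]) (auto simp: dom_fn_def us_def K_def split: if_splits)
  then show ?thesis using classifiableD(1)[OF \<mu> us u epi] LIMSEQ_unique[OF _ tendsto_const] by auto
qed

lemma classifiable_eqI:
  fixes \<mu> :: "'n::finite cfun \<Rightarrow> real"
  assumes "classifiable \<mu>" "classifiable \<nu>" "\<And>\<tau>. \<mu> (unit_piece \<tau>) = \<nu> (unit_piece \<tau>)" "u \<in> conv_sc"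
  shows "\<mu> u = \<nu> u"
  using classifiable_zero[OF classifiable_diff[OF assms(1,2)] _ assms(4)] assms(3) by simp

lemma Cc_support:
  fixes f :: "'a::euclidean_space \<Rightarrow> 'b::real_normed_vector"
  assumes "Cc f"
  obtains R where "\<And>g. R \<le> norm g \<Longrightarrow> f g = 0"
proof -
  have "bounded (closure {x. f x \<noteq> 0})" using assms by (auto simp: Cc_def compact_imp_bounded)
  then have "bounded {x. f x \<noteq> 0}" using closure_subset bounded_subset by blast
  then obtain B where B: "\<forall>x\<in>{x. f x \<noteq> 0}. norm x \<le> B" by (auto simp: bounded_iff)
  have "f g = 0" if "B + 1 \<le> norm g" for g using B that by force
  then show ?thesis using that by blast
qed

lemma CcI:
  fixes f :: "'a::euclidean_space \<Rightarrow> 'b::real_normed_vector"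
  assumes "continuous_on UNIV f" "\<And>g. R \<le> norm g \<Longrightarrow> f g = 0"
  shows "Cc f"
proof -
  have "{x. f x \<noteq> 0} \<subseteq> cball 0 R" using assms(2) by (auto simp: not_le intro: less_imp_le ccontr)
  then have "bounded {x. f x \<noteq> 0}" using bounded_subset[OF bounded_cball] by blast
  then show ?thesis using assms(1) by (simp add: Cc_def compact_closure)
qed

lemma gradient_integrand_Cc:
  fixes \<psi> :: "real^'n::finite \<Rightarrow> 'b::euclidean_space"
  assumes "Cc \<psi>"
  obtains R where "gradient_integrand (\<lambda>x. \<psi>) R"
proof -
  obtain R where R: "\<And>g. R \<le> norm g \<Longrightarrow> \<psi> g = 0" using Cc_support[OF assms] by metis
  have "continuous_on UNIV (\<lambda>p :: (real^'n) \<times> (real^'n). \<psi> (snd p))"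
    by (rule continuous_on_compose2[of UNIV \<psi>]) (use assms in \<open>auto simp: Cc_def intro!: continuous_intros\<close>)
  then have "gradient_integrand (\<lambda>x. \<psi>) R" by unfold_locales (use R in \<open>auto simp: case_prod_beta\<close>)
  then show ?thesis using that by blast
qed

lemma gradient_integrand_moment:
  fixes \<psi> :: "real^'n::finite \<Rightarrow> real^'n" and \<zeta> :: "real^'n \<Rightarrow> real"
  assumes "Cc \<psi>" "Cc \<zeta>"
  obtains R where "gradient_integrand (\<lambda>x g. \<psi> g + \<zeta> g *\<^sub>R x) R"
proof -
  obtain R1 where R1: "\<And>g. R1 \<le> norm g \<Longrightarrow> \<psi> g = 0" using Cc_support[OF assms(1)] by metis
  obtain R2 where R2: "\<And>g. R2 \<le> norm g \<Longrightarrow> \<zeta> g = 0" using Cc_support[OF assms(2)] by metis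
  have c: "continuous_on UNIV (\<lambda>p :: (real^'n) \<times> (real^'n). \<psi> (snd p))" "continuous_on UNIV (\<lambda>p :: (real^'n) \<times> (real^'n). \<zeta> (snd p))"
    by (rule continuous_on_compose2[of UNIV \<psi>] continuous_on_compose2[of UNIV \<zeta>];
      use assms in \<open>auto simp: Cc_def intro!: continuous_intros\<close>)+
  have "continuous_on UNIV (\<lambda>p :: (real^'n) \<times> (real^'n). \<psi> (snd p) + \<zeta> (snd p) *\<^sub>R fst p)"
    by (intro continuous_intros c)
  then have "gradient_integrand (\<lambda>x g. \<psi> g + \<zeta> g *\<^sub>R x) (max R1 R2)"
    by unfold_locales (use R1 R2 in \<open>auto simp: case_prod_beta\<close>)
  then show ?thesis using that by blast
qed

lemma content_unit_cube: "measure lborel (cbox 0 (1::real^'n::finite)) = 1"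
proof -
  have "(1::real^'n) \<bullet> i = 1" if "i \<in> Basis" for i using that by (auto simp: Basis_vec_def inner_axis)
  then show ?thesis by (subst content_cbox) auto
qed

definition grad_integral :: "(real^'n \<Rightarrow> 'b::euclidean_space) \<Rightarrow> 'n::finite cfun \<Rightarrow> 'b" where
  "grad_integral \<psi> u = integral UNIV (gfun (\<lambda>x. \<psi>) u)"

text \<open>The inner product with \<open>b\<close> reduces vector-valued integrals to real
  functionals, to which uniqueness applies. The cube has volume 1, so no factor appears.\<close>

lemma grad_integral_props:
  fixes \<psi> :: "real^'n::finite \<Rightarrow> 'b::euclidean_space"
  assumes \<psi>: "Cc \<psi>"
  shows "classifiable (\<lambda>u. b \<bullet> grad_integral \<psi> u)" "grad_integral \<psi> (unit_piece \<tau>) = \<psi> \<tau>"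
proof -
  obtain R where "gradient_integrand (\<lambda>x. \<psi>) R" using gradient_integrand_Cc[OF \<psi>] by metis
  then interpret gradient_integrand "\<lambda>x. \<psi>" R .
  show "classifiable (\<lambda>u. b \<bullet> grad_integral \<psi> u)" unfolding grad_integral_def
  proof (rule classifiableI)
    fix us :: "nat \<Rightarrow> 'n cfun" and u assume "\<And>k. us k \<in> conv_sc" "u \<in> conv_sc" "epi_conv us u"
    then show "(\<lambda>k. b \<bullet> integral UNIV (gfun (\<lambda>x. \<psi>) (us k))) \<longlonglongrightarrow> b \<bullet> integral UNIV (gfun (\<lambda>x. \<psi>) u)"
      using gfun_epi_continuous unfolding epi_continuous_def by (intro tendsto_intros) blast
  next
    fix u :: "'n cfun" and a assume "u \<in> conv_sc"
    then show "b \<bullet> integral UNIV (gfun (\<lambda>x. \<psi>) (\<lambda>y. u (y - a))) = b \<bullet> integral UNIV (gfun (\<lambda>x. \<psi>) u)"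
      using gfun_translate by metis
  next
    fix u w :: "'n cfun" assume "u \<in> conv_sc" "w \<in> conv_sc" "(\<lambda>x. max (u x) (w x)) \<in> conv_sc" "(\<lambda>x. min (u x) (w x)) \<in> conv_sc"
    then show "b \<bullet> integral UNIV (gfun (\<lambda>x. \<psi>) (\<lambda>x. max (u x) (w x))) + b \<bullet> integral UNIV (gfun (\<lambda>x. \<psi>) (\<lambda>x. min (u x) (w x))) =
      b \<bullet> integral UNIV (gfun (\<lambda>x. \<psi>) u) + b \<bullet> integral UNIV (gfun (\<lambda>x. \<psi>) w)"
      using gfun_valuation unfolding is_valuation_def inner_add_right[symmetric] by simp
  qed (use gfun_simple gfun_vert in \<open>simp_all add: simple_val_def vert_trans_invariant_def\<close>)
  show "grad_integral \<psi> (unit_piece \<tau>) = \<psi> \<tau>"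
    unfolding grad_integral_def
    using gfun_affine_piece[OF unit_piece_conv_sc, of \<tau> \<tau> 0] dom_unit_piece[of \<tau>]
    by (simp add: unit_piece_eq content_unit_cube)
qed

lemma classifiable_density:
  fixes \<mu> :: "'n::finite cfun \<Rightarrow> real"
  assumes \<mu>: "classifiable \<mu>"
  shows "Cc (\<lambda>\<tau>. \<mu> (unit_piece \<tau>))" "u \<in> conv_sc \<Longrightarrow> \<mu> u = grad_integral (\<lambda>\<tau>. \<mu> (unit_piece \<tau>)) u"
proof -
  interpret dual_val_cart "\<lambda>v. \<mu> (fenchel v)" by (rule classifiable_dual[OF \<mu>])
  have d: "density = (\<lambda>\<tau>. \<mu> (unit_piece \<tau>))" by (simp add: fun_eq_iff density_def unit_piece_def)
  show Cc: "Cc (\<lambda>\<tau>. \<mu> (unit_piece \<tau>))"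
    using continuous_density bounded_density_support unfolding d by (simp add: Cc_def compact_closure)
  show "\<mu> u = grad_integral (\<lambda>\<tau>. \<mu> (unit_piece \<tau>)) u" if "u \<in> conv_sc"
    using classifiable_eqI[OF \<mu> grad_integral_props(1)[OF Cc, of 1] _ that] grad_integral_props(2)[OF Cc] by simp
qed

section \<open>Translation covariant maps and rotations\<close>

definition simple_functional :: "('n::finite cfun \<Rightarrow> 'b::real_normed_vector) \<Rightarrow> bool" where
  "simple_functional F \<longleftrightarrow> epi_continuous F \<and> vert_trans_invariant F \<and> simple_val F \<and> is_valuation F"

lemma classifiable_iff:
  "classifiable \<mu> \<longleftrightarrow> simple_functional \<mu> \<and> (\<forall>u\<in>conv_sc. \<forall>a. \<mu> (\<lambda>y. u (y - a)) = \<mu> u)"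
  by (auto simp: classifiable_def epi_translation_invariant_def simple_functional_def)

lemma simple_functional_cong:
  fixes F G :: "'a::finite cfun \<Rightarrow> 'b::real_normed_vector"
  assumes F: "simple_functional F" and eq: "\<And>u. u \<in> conv_sc \<Longrightarrow> G u = F u"
  shows "simple_functional G"
proof -
  have "epi_continuous G" using F eq unfolding simple_functional_def epi_continuous_def by simp
  moreover have "vert_trans_invariant G" unfolding vert_trans_invariant_def
  proof (intro ballI allI)
    fix u :: "'a cfun" and c assume u: "u \<in> conv_sc"
    show "G (\<lambda>x. u x + ereal c) = G u"
      unfolding eq[OF conv_sc_add_const[OF u]] eq[OF u] using F u by (simp add: simple_functional_def vert_trans_invariant_def)
  qed
  moreover have "simple_val G" "is_valuation G"
    using F eq unfolding simple_functional_def simple_val_def is_valuation_def by simp_all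
  ultimately show ?thesis by (simp add: simple_functional_def)
qed

lemma simple_functional_diff:
  assumes F: "simple_functional F" and G: "simple_functional G"
  shows "simple_functional (\<lambda>u. F u - G u)"
  using F G unfolding simple_functional_def epi_continuous_def vert_trans_invariant_def simple_val_def is_valuation_def
  by (auto intro!: tendsto_diff simp: algebra_simps)

lemma simple_functional_bounded_linear:
  assumes F: "simple_functional F" and L: "bounded_linear L"
  shows "simple_functional (\<lambda>u. L (F u))"
proof -
  interpret bounded_linear L by (rule L)
  show ?thesis
    using F unfolding simple_functional_def epi_continuous_def vert_trans_invariant_def simple_val_def is_valuation_def
    by (simp add: zero tendsto flip: add)
qed

lemma epi_conv_precompose:
  fixes T T' :: "real^'n::finite \<Rightarrow> real^'n"
  assumes epi: "epi_conv us u" and inv: "\<And>x. T' (T x) = x" "\<And>x. T (T' x) = x"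
    and cont: "continuous_on UNIV T" "continuous_on UNIV T'"
  shows "epi_conv (\<lambda>k y. us k (T y)) (\<lambda>y. u (T y))"
  unfolding epi_conv_def
proof (intro allI conjI impI)
  fix x and xs :: "nat \<Rightarrow> real^'n" assume "xs \<longlonglongrightarrow> x"
  then have "(\<lambda>k. T (xs k)) \<longlonglongrightarrow> T x" using continuous_on_tendsto_compose[OF cont(1)] by simp
  moreover have "ys \<longlonglongrightarrow> T x \<Longrightarrow> u (T x) \<le> Liminf sequentially (\<lambda>k. us k (ys k))" for ys using epi by (simp add: epi_conv_def)
  ultimately show "u (T x) \<le> Liminf sequentially (\<lambda>k. us k (T (xs k)))" by blast
next
  fix x
  obtain zs where zs: "zs \<longlonglongrightarrow> T x" "(\<lambda>k. us k (zs k)) \<longlonglongrightarrow> u (T x)" by (rule epi_conv_recovery[OF epi])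
  have "(\<lambda>k. T' (zs k)) \<longlonglongrightarrow> T' (T x)" using continuous_on_tendsto_compose[OF cont(2) zs(1)] by simp
  then show "\<exists>xs. xs \<longlonglongrightarrow> x \<and> (\<lambda>k. us k (T (xs k))) \<longlonglongrightarrow> u (T x)"
    using zs(2) inv by (intro exI[of _ "\<lambda>k. T' (zs k)"]) simp
qed

lemma simple_functional_precompose:
  fixes T T' :: "real^'n::finite \<Rightarrow> real^'n"
  assumes F: "simple_functional F" and inv: "\<And>x. T' (T x) = x" "\<And>x. T (T' x) = x"
    and cont: "continuous_on UNIV T" "continuous_on UNIV T'"
    and conv: "\<And>u. u \<in> conv_sc \<Longrightarrow> (\<lambda>y. u (T y)) \<in> conv_sc" and dim: "\<And>S. aff_dim (T' ` S) = aff_dim S"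
  shows "simple_functional (\<lambda>u. F (\<lambda>y. u (T y)))"
proof -
  have dom: "dom_fn (\<lambda>y. u (T y)) = T' ` dom_fn u" for u :: "'n cfun"
  proof
    show "dom_fn (\<lambda>y. u (T y)) \<subseteq> T' ` dom_fn u"
    proof
      fix x assume "x \<in> dom_fn (\<lambda>y. u (T y))"
      then have "T x \<in> dom_fn u" by (simp add: dom_fn_def)
      then have "T' (T x) \<in> T' ` dom_fn u" by (rule imageI)
      then show "x \<in> T' ` dom_fn u" by (simp add: inv)
    qed
  qed (auto simp: dom_fn_def inv)
  have "epi_continuous (\<lambda>u. F (\<lambda>y. u (T y)))" unfolding epi_continuous_def
  proof (intro allI impI)
    fix us :: "nat \<Rightarrow> 'n cfun" and u assume a: "\<forall>k. us k \<in> conv_sc" "u \<in> conv_sc" "epi_conv us u"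
    have "epi_continuous F" using F by (simp add: simple_functional_def)
    moreover have "\<forall>k. (\<lambda>y. us k (T y)) \<in> conv_sc" using a(1) conv by simp
    ultimately show "(\<lambda>k. F (\<lambda>y. us k (T y))) \<longlonglongrightarrow> F (\<lambda>y. u (T y))"
      using conv[OF a(2)] epi_conv_precompose[OF a(3) inv cont]
      unfolding epi_continuous_def by (elim allE[of _ "\<lambda>k y. us k (T y)"] allE[of _ "\<lambda>y. u (T y)"]) simp
  qed
  moreover have "vert_trans_invariant (\<lambda>u. F (\<lambda>y. u (T y)))" "simple_val (\<lambda>u. F (\<lambda>y. u (T y)))"
    using F conv unfolding simple_functional_def vert_trans_invariant_def simple_val_def by (simp_all add: dom dim)
  moreover have "is_valuation (\<lambda>u. F (\<lambda>y. u (T y)))" unfolding is_valuation_def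
  proof (intro ballI impI)
    fix u w :: "'n cfun" assume a: "u \<in> conv_sc" "w \<in> conv_sc" "(\<lambda>x. max (u x) (w x)) \<in> conv_sc" "(\<lambda>x. min (u x) (w x)) \<in> conv_sc"
    show "F (\<lambda>y. max (u (T y)) (w (T y))) + F (\<lambda>y. min (u (T y)) (w (T y))) = F (\<lambda>y. u (T y)) + F (\<lambda>y. w (T y))"
      using F conv[OF a(1)] conv[OF a(2)] conv[OF a(3)] conv[OF a(4)] unfolding simple_functional_def is_valuation_def by simp
  qed
  ultimately show ?thesis by (simp add: simple_functional_def)
qed

lemma simple_functional_translate:
  fixes F :: "'n::finite cfun \<Rightarrow> 'b::real_normed_vector"
  assumes "simple_functional F"
  shows "simple_functional (\<lambda>u. F (\<lambda>y. u (y - a)))"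
proof (rule simple_functional_precompose[OF assms, of "\<lambda>y. a + y"])
  show "aff_dim ((+) a ` S) = aff_dim S" for S :: "(real^'n) set" by (rule aff_dim_translation_eq)
qed (auto intro!: continuous_intros conv_sc_translate)

lemma simple_functional_rotate:
  fixes A :: "real^'n::finite^'n" and F :: "'n cfun \<Rightarrow> 'b::real_normed_vector"
  assumes A: "orthogonal_matrix A" and F: "simple_functional F"
  shows "simple_functional (\<lambda>u. F (\<lambda>y. u (transpose A *v y)))"
proof (rule simple_functional_precompose[OF F, of "(*v) A"])
  have "inj ((*v) A)" by (rule inj_on_inverseI[of _ "(*v) (transpose A)"]) (rule orthogonal_matrix_inverse(1)[OF A])
  then show "aff_dim ((*v) A ` S) = aff_dim S" for S by (intro aff_dim_injective_linear_image matrix_vector_mul_linear)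
  show "A *v (transpose A *v x) = x" "transpose A *v (A *v x) = x" for x by (rule orthogonal_matrix_inverse[OF A])+
  show "continuous_on UNIV ((*v) (transpose A))" "continuous_on UNIV ((*v) A)" by (rule matrix_vector_mult_linear_continuous_on)+
  show "(\<lambda>y. u (transpose A *v y)) \<in> conv_sc" if "u \<in> conv_sc" for u by (rule conv_sc_rotate[OF A that])
qed

definition moment_integral :: "(real^'n \<Rightarrow> real) \<Rightarrow> 'n::finite cfun \<Rightarrow> real^'n" where
  "moment_integral \<zeta> u = integral UNIV (gfun (\<lambda>x g. \<zeta> g *\<^sub>R x) u)"

lemma (in gradient_integrand) simple_functional_integral: "simple_functional (\<lambda>u. integral UNIV (gfun h u))"
  using gfun_epi_continuous gfun_vert gfun_simple gfun_valuation by (simp add: simple_functional_def)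

lemma Cc_zero: "Cc (\<lambda>_. 0)"
  by (rule CcI[where R = 0]) auto

lemma moment_integral_translate:
  fixes \<zeta> :: "real^'n::finite \<Rightarrow> real"
  assumes \<zeta>: "Cc \<zeta>"
  shows "simple_functional (moment_integral \<zeta>)"
    "u \<in> conv_sc \<Longrightarrow> moment_integral \<zeta> (\<lambda>y. u (y - a)) = moment_integral \<zeta> u + grad_integral \<zeta> u *\<^sub>R a"
    "u \<in> conv_sc \<Longrightarrow> gfun (\<lambda>x g. \<zeta> g *\<^sub>R x) u integrable_on UNIV"
proof -
  obtain R1 where "gradient_integrand (\<lambda>x g. (\<lambda>_. 0) g + \<zeta> g *\<^sub>R x) R1"
    using gradient_integrand_moment[OF Cc_zero \<zeta>] by metis
  then interpret m: gradient_integrand "\<lambda>x g. \<zeta> g *\<^sub>R x" R1 by simp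
  obtain R2 where "gradient_integrand (\<lambda>x. \<zeta>) R2" using gradient_integrand_Cc[OF \<zeta>] by metis
  then interpret c: gradient_integrand "\<lambda>x. \<zeta>" R2 .
  show "simple_functional (moment_integral \<zeta>)" unfolding moment_integral_def[abs_def] by (rule m.simple_functional_integral)
  show "gfun (\<lambda>x g. \<zeta> g *\<^sub>R x) u integrable_on UNIV" if "u \<in> conv_sc" by (rule m.gfun_integrable[OF that])
  assume u: "u \<in> conv_sc"
  have "gfun (\<lambda>x g. \<zeta> g *\<^sub>R (x + a)) u = (\<lambda>x. gfun (\<lambda>x g. \<zeta> g *\<^sub>R x) u x + gfun (\<lambda>x. \<zeta>) u x *\<^sub>R a)"
    by (auto simp: gfun_def scaleR_add_right)
  moreover have "(\<dots> has_integral moment_integral \<zeta> u + grad_integral \<zeta> u *\<^sub>R a) UNIV"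
    unfolding moment_integral_def grad_integral_def
    by (intro has_integral_add has_integral_scaleR_left integrable_integral m.gfun_integrable c.gfun_integrable u)
  ultimately show "moment_integral \<zeta> (\<lambda>y. u (y - a)) = moment_integral \<zeta> u + grad_integral \<zeta> u *\<^sub>R a"
    using m.gfun_translate[OF u, of a] integral_unique by (simp add: moment_integral_def)
qed

lemma grad_integral_simple_functional:
  fixes \<psi> :: "real^'n::finite \<Rightarrow> 'b::euclidean_space"
  assumes \<psi>: "Cc \<psi>"
  shows "simple_functional (grad_integral \<psi>)" "u \<in> conv_sc \<Longrightarrow> grad_integral \<psi> (\<lambda>y. u (y - a)) = grad_integral \<psi> u"
    "u \<in> conv_sc \<Longrightarrow> gfun (\<lambda>x. \<psi>) u integrable_on UNIV"
proof -
  obtain R where "gradient_integrand (\<lambda>x. \<psi>) R" using gradient_integrand_Cc[OF \<psi>] by metis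
  then interpret c: gradient_integrand "\<lambda>x. \<psi>" R .
  show "simple_functional (grad_integral \<psi>)" unfolding grad_integral_def[abs_def] by (rule c.simple_functional_integral)
  show "gfun (\<lambda>x. \<psi>) u integrable_on UNIV" if "u \<in> conv_sc" by (rule c.gfun_integrable[OF that])
  show "grad_integral \<psi> (\<lambda>y. u (y - a)) = grad_integral \<psi> u" if "u \<in> conv_sc"
    unfolding grad_integral_def using c.gfun_translate[OF that, of a] .
qed

lemma integral_dom_split:
  fixes \<psi> :: "real^'n::finite \<Rightarrow> real^'n"
  assumes "u \<in> conv_sc"
  shows "integral (dom_fn u) (\<lambda>x. \<psi> (grad u x)) + integral (dom_fn u) (\<lambda>x. \<zeta> (grad u x) *\<^sub>R x) =
    grad_integral \<psi> u + moment_integral \<zeta> u"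
  using integral_dom_eq_gfun[OF assms, of "\<lambda>x. \<psi>"] integral_dom_eq_gfun[OF assms, of "\<lambda>x g. \<zeta> g *\<^sub>R x"]
  by (simp add: grad_integral_def moment_integral_def)

lemma classifiable_inner:
  fixes F :: "'n::finite cfun \<Rightarrow> real^'n"
  assumes F: "simple_functional F" and inv: "\<And>u a. u \<in> conv_sc \<Longrightarrow> F (\<lambda>y. u (y - a)) = F u"
  shows "classifiable (\<lambda>u. b \<bullet> F u)"
  unfolding classifiable_iff using simple_functional_bounded_linear[OF F bounded_linear_inner_right] inv by auto

lemma covariant_representation:
  fixes z :: "'n::finite cfun \<Rightarrow> real^'n"
  assumes z: "simple_functional z" and cov: "translation_covariant z"
  obtains \<psi> \<zeta> where "Cc \<psi>" "Cc \<zeta>" "\<forall>u\<in>conv_sc. z u = grad_integral \<psi> u + moment_integral \<zeta> u"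
proof -
  obtain z0 where z0: "\<And>u x. u \<in> conv_sc \<Longrightarrow> z (\<lambda>y. u (y - x)) = z u + z0 u *\<^sub>R x"
    using cov by (auto simp: translation_covariant_def)
  define e where "e = (axis undefined 1 :: real^'n)"
  have e: "e \<bullet> e = 1" by (simp add: e_def inner_axis_axis)
  \<comment> \<open>\<open>z0\<close> is only known to exist. On \<open>conv_sc\<close> it equals
    \<open>m0\<close>, which is built from \<open>z\<close> and inherits continuity, simplicity and
    the valuation property.\<close>
  define m0 where "m0 u = e \<bullet> (z (\<lambda>y. u (y - e)) - z u)" for u
  have m0: "m0 u = z0 u" if "u \<in> conv_sc" for u using z0[OF that, of e] e by (simp add: m0_def)
  \<comment> \<open>Translating by \<open>a + e\<close> at once or in two steps must give the same
    result.\<close>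
  have z0_inv: "z0 (\<lambda>y. u (y - a)) = z0 u" if u: "u \<in> conv_sc" for u a
  proof -
    have "z (\<lambda>y. u (y - e - a)) = z (\<lambda>y. u (y - a)) + z0 (\<lambda>y. u (y - a)) *\<^sub>R e"
      using z0[OF conv_sc_translate[OF u], of e a] by simp
    moreover have "z (\<lambda>y. u (y - e - a)) = z u + z0 u *\<^sub>R (a + e)"
      using z0[OF u, of "a + e"] by (simp add: algebra_simps)
    ultimately have "z0 u *\<^sub>R e = z0 (\<lambda>y. u (y - a)) *\<^sub>R e" using z0[OF u, of a] by (auto simp: scaleR_add_right)
    moreover have "e \<noteq> 0" using e by auto
    ultimately show ?thesis by simp
  qed
  have "simple_functional m0" unfolding m0_def[abs_def]
    by (rule simple_functional_bounded_linear[OF simple_functional_diff[OF simple_functional_translate[OF z] z] bounded_linear_inner_right])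
  moreover have "m0 (\<lambda>y. u (y - a)) = m0 u" if "u \<in> conv_sc" for u a
    unfolding m0[OF that] m0[OF conv_sc_translate[OF that]] by (rule z0_inv[OF that])
  ultimately have cm: "classifiable m0" unfolding classifiable_iff by blast
  define \<zeta> where "\<zeta> = (\<lambda>\<tau>. m0 (unit_piece \<tau>))"
  have \<zeta>: "Cc \<zeta>" and z0\<zeta>: "\<And>u. u \<in> conv_sc \<Longrightarrow> z0 u = grad_integral \<zeta> u"
    using classifiable_density[OF cm] m0 by (auto simp: \<zeta>_def)
  \<comment> \<open>By \<open>z0\<zeta>\<close> the moment part changes under translations exactly
    as \<open>z\<close> does, so the difference is translation invariant.\<close>
  define z1 where "z1 u = z u - moment_integral \<zeta> u" for u
  have z1: "simple_functional z1" unfolding z1_def[abs_def]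
    by (rule simple_functional_diff[OF z moment_integral_translate(1)[OF \<zeta>]])
  have c1: "classifiable (\<lambda>u. b \<bullet> z1 u)" for b
    by (rule classifiable_inner[OF z1]) (simp add: z1_def z0 z0\<zeta> moment_integral_translate(2)[OF \<zeta>])
  define \<psi> where "\<psi> \<tau> = z1 (unit_piece \<tau>)" for \<tau>
  have comp: "Cc (\<lambda>\<tau>. \<psi> \<tau> $ i)" for i
    using classifiable_density(1)[OF c1[of "axis i 1"]] by (simp add: \<psi>_def inner_axis')
  have \<psi>: "Cc \<psi>"
  proof -
    have "continuous_on UNIV (\<lambda>\<tau>. \<chi> i. \<psi> \<tau> $ i)"
      using comp by (intro continuous_on_vec_lambda) (simp add: Cc_def)
    moreover have "bounded (\<Union>i. {\<tau>. \<psi> \<tau> $ i \<noteq> 0})"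
      using comp by (intro bounded_UN) (auto simp: Cc_def intro: bounded_subset[OF compact_imp_bounded closure_subset])
    moreover have "{\<tau>. \<psi> \<tau> \<noteq> 0} \<subseteq> (\<Union>i. {\<tau>. \<psi> \<tau> $ i \<noteq> 0})" by (auto simp: vec_eq_iff)
    ultimately show ?thesis using bounded_subset by (auto simp: Cc_def compact_closure)
  qed
  have "z u = grad_integral \<psi> u + moment_integral \<zeta> u" if u: "u \<in> conv_sc" for u
  proof -
    have "b \<bullet> z1 u = b \<bullet> grad_integral \<psi> u" for b
      by (rule classifiable_eqI[OF c1 grad_integral_props(1)[OF \<psi>] _ u]) (simp add: grad_integral_props(2)[OF \<psi>] \<psi>_def)
    then have "z1 u = grad_integral \<psi> u" using vector_eq_ldot by metis
    then show ?thesis by (simp add: z1_def algebra_simps)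
  qed
  then show ?thesis using that \<psi> \<zeta> by blast
qed

lemma representation_properties:
  fixes z :: "'n::finite cfun \<Rightarrow> real^'n"
  assumes \<psi>: "Cc \<psi>" and \<zeta>: "Cc \<zeta>" and z: "\<forall>u\<in>conv_sc. z u = grad_integral \<psi> u + moment_integral \<zeta> u"
  shows "simple_functional z" "translation_covariant z"
proof -
  have "simple_functional (\<lambda>u. - 1 *\<^sub>R moment_integral \<zeta> u)"
    by (rule simple_functional_bounded_linear[OF moment_integral_translate(1)[OF \<zeta>] bounded_linear_scaleR_right])
  from simple_functional_diff[OF grad_integral_simple_functional(1)[OF \<psi>] this]
  show "simple_functional z" by (rule simple_functional_cong) (simp add: z)
  show "translation_covariant z" unfolding translation_covariant_def
    by (rule exI[of _ "grad_integral \<zeta>"])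
      (simp add: z conv_sc_translate grad_integral_simple_functional(2)[OF \<psi>] moment_integral_translate(2)[OF \<zeta>])
qed

section \<open>Orthogonal maps\<close>

lemma rotate_translate:
  fixes A :: "real^'n::finite^'n"
  assumes A: "orthogonal_matrix A"
  shows "(\<lambda>y. u (transpose A *v y - a)) = (\<lambda>y. u (transpose A *v (y - A *v a)))"
  by (simp add: matrix_vector_mult_diff_distrib orthogonal_matrix_inverse(1)[OF A] del: transpose_matrix_vector)

lemma classifiable_rotate:
  fixes A :: "real^'n::finite^'n"
  assumes A: "orthogonal_matrix A" and \<mu>: "classifiable \<mu>"
  shows "classifiable (\<lambda>u. \<mu> (\<lambda>y. u (transpose A *v y)))"
  unfolding classifiable_iff
proof (intro conjI ballI allI)
  show "simple_functional (\<lambda>u. \<mu> (\<lambda>y. u (transpose A *v y)))"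
    by (rule simple_functional_rotate[OF A]) (use \<mu> in \<open>simp add: classifiable_iff\<close>)
  fix u :: "'n cfun" and a assume u: "u \<in> conv_sc"
  show "\<mu> (\<lambda>y. u (transpose A *v y - a)) = \<mu> (\<lambda>y. u (transpose A *v y))"
    unfolding rotate_translate[OF A] by (rule classifiableD(2)[OF \<mu> conv_sc_rotate[OF A u]])
qed

text \<open>The rotated piece is the conjugate of a frame with apex \<open>A *v \<tau>\<close> and
  determinant of absolute value 1, so \<open>frame_density\<close> leads back to the axis-parallel
  cube.\<close>

lemma rotate_unit_piece:
  fixes A :: "real^'n::finite^'n"
  assumes A: "orthogonal_matrix A" and \<mu>: "classifiable \<mu>"
  shows "\<mu> (\<lambda>y. unit_piece \<tau> (transpose A *v y)) = \<mu> (unit_piece (A *v \<tau>))"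
proof -
  interpret dual_val_cart "\<lambda>v. \<mu> (fenchel v)" by (rule classifiable_dual[OF \<mu>])
  note inv = orthogonal_matrix_inverse[OF A]
  have dual: "x \<bullet> (transpose A *v w) = (A *v x) \<bullet> w" for x w
    using inv(3)[of "A *v x" w] by (simp only: inv(1))
  have "(\<lambda>y. fenchel v (transpose A *v y)) = fenchel (\<lambda>y. v (transpose A *v y))" for v
  proof
    fix x
    have "fenchel v (transpose A *v x) = (SUP y. ereal (x \<bullet> (A *v y) - v y))"
      unfolding fenchel_def by (rule SUP_cong[OF refl]) (simp only: dual inner_commute[of "transpose A *v x"] inner_commute[of x])
    also have "\<dots> = (SUP y\<in>range ((*v) (transpose A)). ereal (x \<bullet> (A *v y) - v y))"
    proof -
      have "surj ((*v) (transpose A))" by (rule surjI[of _ "\<lambda>y. A *v y"]) (rule inv(1))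
      then show ?thesis by simp
    qed
    also have "\<dots> = fenchel (\<lambda>y. v (transpose A *v y)) x"
      unfolding fenchel_def image_image by (simp only: inv(2))
    finally show "fenchel v (transpose A *v x) = fenchel (\<lambda>y. v (transpose A *v y)) x" .
  qed
  moreover have "(\<lambda>y. hinge_frame (\<lambda>i. axis i 1) \<tau> (transpose A *v y)) = hinge_frame (\<lambda>i. A *v axis i 1) (A *v \<tau>)"
  proof
    fix y
    have "axis i 1 \<bullet> (transpose A *v y - \<tau>) = (A *v axis i 1) \<bullet> (y - A *v \<tau>)" for i
    proof -
      have "transpose A *v y - \<tau> = transpose A *v (y - A *v \<tau>)" by (simp only: matrix_vector_mult_diff_distrib inv(1))
      then show ?thesis by (simp only: dual)
    qed
    then show "hinge_frame (\<lambda>i. axis i 1) \<tau> (transpose A *v y) = hinge_frame (\<lambda>i. A *v axis i 1) (A *v \<tau>) y"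
      by (simp only: hinge_frame_def)
  qed
  ultimately have "\<mu> (\<lambda>y. unit_piece \<tau> (transpose A *v y)) = \<mu> (fenchel (hinge_frame (\<lambda>i. A *v axis i 1) (A *v \<tau>)))"
    by (simp only: unit_piece_def)
  also have "\<dots> = \<bar>det (\<chi> i. A *v axis i 1)\<bar> * density (A *v \<tau>)" by (rule frame_density)
  also have "(\<chi> i. A *v axis i 1) = transpose A"
    by (simp add: vec_eq_iff matrix_vector_mult_basis column_def transpose_def)
  also have "\<bar>det (transpose A)\<bar> = 1" using det_orthogonal_matrix[OF A] by auto
  finally show ?thesis by (simp add: density_def unit_piece_def)
qed

lemma grad_integral_rotate_scalar:
  fixes A :: "real^'n::finite^'n" and \<zeta> :: "real^'n \<Rightarrow> real"
  assumes A: "orthogonal_matrix A" and \<zeta>: "Cc \<zeta>" "\<And>\<tau>. \<zeta> (A *v \<tau>) = \<zeta> \<tau>" and u: "u \<in> conv_sc"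
  shows "grad_integral \<zeta> (\<lambda>y. u (transpose A *v y)) = grad_integral \<zeta> u"
proof -
  have c: "classifiable (grad_integral \<zeta>)" using grad_integral_props(1)[OF \<zeta>(1), of 1] by simp
  show ?thesis
    by (rule classifiable_eqI[OF classifiable_rotate[OF A c] c _ u])
      (simp add: rotate_unit_piece[OF A c] grad_integral_props(2)[OF \<zeta>(1)] \<zeta>(2) del: transpose_matrix_vector)
qed

lemma grad_integral_rotate:
  fixes A :: "real^'n::finite^'n" and \<psi> :: "real^'n \<Rightarrow> real^'n"
  assumes A: "orthogonal_matrix A" and \<psi>: "Cc \<psi>" "\<And>\<tau>. \<psi> (A *v \<tau>) = A *v \<psi> \<tau>" and u: "u \<in> conv_sc"
  shows "grad_integral \<psi> (\<lambda>y. u (transpose A *v y)) = A *v grad_integral \<psi> u"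
proof -
  have "b \<bullet> grad_integral \<psi> (\<lambda>y. u (transpose A *v y)) = b \<bullet> (A *v grad_integral \<psi> u)" for b
  proof -
    have c: "classifiable (\<lambda>u. b \<bullet> grad_integral \<psi> u)" for b by (rule grad_integral_props(1)[OF \<psi>(1)])
    have dual: "b \<bullet> (A *v w) = (transpose A *v b) \<bullet> w" for w
      using orthogonal_matrix_inverse(3)[OF A, of b "A *v w"] by (simp only: orthogonal_matrix_inverse(1)[OF A])
    show ?thesis unfolding dual
      by (rule classifiable_eqI[OF classifiable_rotate[OF A c] c _ u])
        (simp only: rotate_unit_piece[OF A c] grad_integral_props(2)[OF \<psi>(1)] \<psi>(2) dual)
  qed
  then show ?thesis using vector_eq_ldot by metis
qed

text \<open>The integrand, extended by 0 to a symmetric box, is odd, so its integral equals its own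
  negative.\<close>

lemma integral_symmetric_zero:
  fixes S :: "'a::euclidean_space set"
  assumes "bounded S" and sym: "\<And>x. x \<in> S \<Longrightarrow> - x \<in> S"
  shows "integral S (\<lambda>x. c *\<^sub>R x) = 0"
proof -
  obtain b where b: "S \<subseteq> cbox (- b) b" using bounded_subset_cbox_symmetric[OF assms(1)] by blast
  define F where "F x = (if x \<in> S then c *\<^sub>R x else 0)" for x
  have S: "- x \<in> S \<longleftrightarrow> x \<in> S" for x using sym[of x] sym[of "- x"] by auto
  have eq: "integral S (\<lambda>x. c *\<^sub>R x) = integral (cbox (- b) b) F"
  proof -
    have "F x = 0" if "x \<notin> cbox (- b) b" for x using b that by (auto simp: F_def)
    then have F: "(\<lambda>x. if x \<in> cbox (- b) b then F x else 0) = F" by (intro ext) simp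
    have "integral S (\<lambda>x. c *\<^sub>R x) = integral UNIV F"
      using Henstock_Kurzweil_Integration.integral_restrict_UNIV[of S "\<lambda>x. c *\<^sub>R x"] by (simp only: F_def[abs_def])
    then show ?thesis
      using Henstock_Kurzweil_Integration.integral_restrict_UNIV[of "cbox (- b) b" F] by (simp only: F)
  qed
  have "integral (cbox (- b) b) F = integral (cbox (- b) b) (\<lambda>x. F (- x))"
    using integral_reflect[of b "- b" F] by (simp only: minus_minus)
  also have "(\<lambda>x. F (- x)) = (\<lambda>x. - F x)" by (auto simp: F_def S)
  finally have neg: "integral (cbox (- b) b) F = - integral (cbox (- b) b) F" by (simp only: integral_neg)
  have "(2::real) *\<^sub>R integral (cbox (- b) b) F = integral (cbox (- b) b) F + - integral (cbox (- b) b) F"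
    unfolding scaleR_2 by (rule arg_cong[OF neg, of "(+) (integral (cbox (- b) b) F)"])
  then show ?thesis unfolding eq by simp
qed

text \<open>The gradient is constant on an affine piece, so the moment is the integral of a multiple
  of \<open>x\<close> over a symmetric set.\<close>

lemma moment_integral_symmetric_piece:
  fixes u :: "'n::finite cfun"
  assumes \<zeta>: "Cc \<zeta>" and u: "u \<in> conv_sc" and affine: "\<And>x. x \<in> dom_fn u \<Longrightarrow> u x = ereal (\<tau> \<bullet> x + c)"
    and dom: "bounded (dom_fn u)" "\<And>x. x \<in> dom_fn u \<Longrightarrow> - x \<in> dom_fn u"
  shows "moment_integral \<zeta> u = 0"
proof -
  obtain R1 where "gradient_integrand (\<lambda>x g. (\<lambda>_. 0) g + \<zeta> g *\<^sub>R x) R1"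
    using gradient_integrand_moment[OF Cc_zero \<zeta>] by metis
  then interpret gradient_integrand "\<lambda>x g. \<zeta> g *\<^sub>R x" R1 by simp
  show ?thesis unfolding moment_integral_def
    using gfun_affine_piece[OF u affine] integral_symmetric_zero[OF dom] by simp
qed

text \<open>The defect of equivariance is translation invariant, and on a cube it can be evaluated after
  centring the cube at the origin, where both moments vanish.\<close>

lemma moment_integral_rotate:
  fixes A :: "real^'n::finite^'n" and \<zeta> :: "real^'n \<Rightarrow> real"
  assumes A: "orthogonal_matrix A" and \<zeta>: "Cc \<zeta>" "\<And>\<tau>. \<zeta> (A *v \<tau>) = \<zeta> \<tau>" and u: "u \<in> conv_sc"
  shows "moment_integral \<zeta> (\<lambda>y. u (transpose A *v y)) = A *v moment_integral \<zeta> u"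
proof -
  note inv = orthogonal_matrix_inverse[OF A]
  define F where "F u = moment_integral \<zeta> (\<lambda>y. u (transpose A *v y)) - A *v moment_integral \<zeta> u" for u
  have sF: "simple_functional F" unfolding F_def[abs_def]
    by (intro simple_functional_diff simple_functional_rotate[OF A] simple_functional_bounded_linear[of _ "(*v) A"]
      moment_integral_translate(1)[OF \<zeta>(1)] matrix_vector_mul_bounded_linear)
  have F_inv: "F (\<lambda>y. u (y - a)) = F u" if u: "u \<in> conv_sc" for u a
    unfolding F_def rotate_translate[OF A]
    using moment_integral_translate(2)[OF \<zeta>(1) conv_sc_rotate[OF A u], of "A *v a"] moment_integral_translate(2)[OF \<zeta>(1) u, of a]
      grad_integral_rotate_scalar[OF A \<zeta> u]
    by (simp add: matrix_vector_right_distrib matrix_vector_mult_scaleR del: transpose_matrix_vector)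
  have F_unit: "F (unit_piece \<tau>) = 0" for \<tau>
  proof -
    define h where "h = ((1/2) *\<^sub>R 1 :: real^'n)"
    define w where "w y = unit_piece \<tau> (y - (- h))" for y
    have w: "w \<in> conv_sc" unfolding w_def[abs_def] by (rule conv_sc_translate[OF unit_piece_conv_sc])
    have dw: "x \<in> dom_fn w \<longleftrightarrow> (\<forall>i. \<bar>x $ i\<bar> \<le> 1 / 2)" for x
    proof -
      have "x \<in> dom_fn w \<longleftrightarrow> x + h \<in> dom_fn (unit_piece \<tau>)" by (simp add: dom_fn_def w_def)
      also have "\<dots> \<longleftrightarrow> (\<forall>i. 0 \<le> x $ i + 1 / 2 \<and> x $ i + 1 / 2 \<le> 1)"
        by (simp add: dom_unit_piece mem_box_cart h_def)
      also have "\<dots> \<longleftrightarrow> (\<forall>i. \<bar>x $ i\<bar> \<le> 1 / 2)" by (intro all_cong1) (auto simp: abs_le_iff)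
      finally show ?thesis .
    qed
    have wv: "w x = ereal (\<tau> \<bullet> x + \<tau> \<bullet> h)" if "x \<in> dom_fn w" for x
      using that by (auto simp: dom_fn_def w_def unit_piece_eq inner_add_right split: if_splits)
    have wb: "bounded (dom_fn w)"
    proof -
      have "x \<in> cbox (- h) h" if x: "x \<in> dom_fn w" for x
        unfolding mem_box_cart
      proof
        fix i
        have "\<bar>x $ i\<bar> \<le> 1 / 2" using x dw by simp
        then have "- (1 / 2) \<le> x $ i" "x $ i \<le> 1 / 2" by linarith+
        then show "(- h) $ i \<le> x $ i \<and> x $ i \<le> h $ i" by (simp add: h_def)
      qed
      then have "dom_fn w \<subseteq> cbox (- h) h" by blast
      then show ?thesis using bounded_subset[OF bounded_cbox] by blast
    qed
    have "moment_integral \<zeta> w = 0"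
      by (rule moment_integral_symmetric_piece[OF \<zeta>(1) w wv wb]) (auto simp: dw)
    moreover have "moment_integral \<zeta> (\<lambda>y. w (transpose A *v y)) = 0"
    proof (rule moment_integral_symmetric_piece[OF \<zeta>(1) conv_sc_rotate[OF A w]])
      have d: "x \<in> dom_fn (\<lambda>y. w (transpose A *v y)) \<longleftrightarrow> transpose A *v x \<in> dom_fn w" for x by (simp add: dom_fn_def)
      have dual: "\<tau> \<bullet> (transpose A *v x) = (A *v \<tau>) \<bullet> x" for x
        using inv(3)[of "A *v \<tau>" x] by (simp only: inv(1))
      show "w (transpose A *v x) = ereal ((A *v \<tau>) \<bullet> x + \<tau> \<bullet> h)" if "x \<in> dom_fn (\<lambda>y. w (transpose A *v y))" for x
        using wv that by (simp only: d dual)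
      show "- x \<in> dom_fn (\<lambda>y. w (transpose A *v y))" if "x \<in> dom_fn (\<lambda>y. w (transpose A *v y))" for x
      proof -
        have "transpose A *v (- x) = - (transpose A *v x)" using matrix_vector_mult_scaleR[of "transpose A" "- 1" x] by simp
        then show ?thesis using that unfolding d dw by (simp del: transpose_matrix_vector)
      qed
      obtain B where B: "\<And>x. x \<in> dom_fn w \<Longrightarrow> norm x \<le> B" using wb by (auto simp: bounded_iff)
      have "norm x \<le> B" if "x \<in> dom_fn (\<lambda>y. w (transpose A *v y))" for x
        using B[of "transpose A *v x"] that by (simp only: d inv(4))
      then show "bounded (dom_fn (\<lambda>y. w (transpose A *v y)))" by (auto simp: bounded_iff)
    qed
    ultimately have "F w = 0" by (simp add: F_def del: transpose_matrix_vector)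
    then show ?thesis using F_inv[OF unit_piece_conv_sc, of \<tau> "- h"] by (simp add: w_def[abs_def])
  qed
  have "b \<bullet> F u = 0" for b
    by (rule classifiable_zero[OF classifiable_inner[OF sF F_inv] _ u]) (simp_all only: F_unit inner_zero_right)
  then have "F u = 0" using inner_eq_zero_iff by blast
  then show ?thesis by (simp add: F_def del: transpose_matrix_vector)
qed

text \<open>Comparing the translation terms on both sides of the equivariance isolates
  \<open>\<zeta>\<close>. Then \<open>moment_integral_rotate\<close> allows the moment part to be
  subtracted, which isolates \<open>\<psi>\<close>.\<close>

lemma equivariant_imp_densities:
  fixes A :: "real^'n::finite^'n" and z :: "'n cfun \<Rightarrow> real^'n"
  assumes A: "orthogonal_matrix A" and \<psi>: "Cc \<psi>" and \<zeta>: "Cc \<zeta>"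
    and z: "\<forall>u\<in>conv_sc. z u = grad_integral \<psi> u + moment_integral \<zeta> u"
    and eqv: "\<forall>u\<in>conv_sc. z (\<lambda>y. u (transpose A *v y)) = A *v z u"
  shows "\<zeta> (A *v \<tau>) = \<zeta> \<tau>" "\<psi> (A *v \<tau>) = A *v \<psi> \<tau>"
proof -
  note inv = orthogonal_matrix_inverse[OF A]
  define e where "e = (axis undefined 1 :: real^'n)"
  have e: "e \<noteq> 0" by (simp add: e_def axis_eq_0_iff)
  then have Ae: "A *v e \<noteq> 0" using inv(1)[of e] by (metis matrix_vector_mult_0_right)
  have zt: "z (\<lambda>y. u (y - a)) = z u + grad_integral \<zeta> u *\<^sub>R a" if "u \<in> conv_sc" for u a
    using that by (simp add: z conv_sc_translate grad_integral_simple_functional(2)[OF \<psi>] moment_integral_translate(2)[OF \<zeta>])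
  have I: "grad_integral \<zeta> (\<lambda>y. u (transpose A *v y)) = grad_integral \<zeta> u" if u: "u \<in> conv_sc" for u
  proof -
    have "A *v z (\<lambda>y. u (y - e)) = z (\<lambda>y. u (transpose A *v y - e))" by (rule eqv[rule_format, OF conv_sc_translate[OF u], symmetric])
    also have "\<dots> = z (\<lambda>y. u (transpose A *v y)) + grad_integral \<zeta> (\<lambda>y. u (transpose A *v y)) *\<^sub>R (A *v e)"
      unfolding rotate_translate[OF A] using zt[OF conv_sc_rotate[OF A u]] by simp
    finally have "grad_integral \<zeta> u *\<^sub>R (A *v e) = grad_integral \<zeta> (\<lambda>y. u (transpose A *v y)) *\<^sub>R (A *v e)"
      using eqv u by (simp add: zt matrix_vector_right_distrib matrix_vector_mult_scaleR del: transpose_matrix_vector)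
    then show ?thesis using Ae by (simp del: transpose_matrix_vector)
  qed
  have c: "classifiable (grad_integral \<zeta>)" using grad_integral_props(1)[OF \<zeta>, of 1] by simp
  show zeta: "\<zeta> (A *v \<tau>) = \<zeta> \<tau>" for \<tau>
    using I[OF unit_piece_conv_sc, of \<tau>] unfolding rotate_unit_piece[OF A c] grad_integral_props(2)[OF \<zeta>] .
  have P: "grad_integral \<psi> (\<lambda>y. u (transpose A *v y)) = A *v grad_integral \<psi> u" if u: "u \<in> conv_sc" for u
    using eqv[rule_format, OF u] moment_integral_rotate[OF A \<zeta> zeta u] z u conv_sc_rotate[OF A u]
    by (simp add: matrix_vector_right_distrib del: transpose_matrix_vector)
  have "b \<bullet> \<psi> (A *v \<tau>) = b \<bullet> (A *v \<psi> \<tau>)" for b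
    using rotate_unit_piece[OF A grad_integral_props(1)[OF \<psi>, of b], of \<tau>]
    unfolding P[OF unit_piece_conv_sc] grad_integral_props(2)[OF \<psi>] by simp
  then show "\<psi> (A *v \<tau>) = A *v \<psi> \<tau>" using vector_eq_ldot by metis
qed

section \<open>Radial densities\<close>

lemma orthogonal_matrix_norm:
  fixes A :: "real^'n::finite^'n"
  assumes "orthogonal_matrix A"
  shows "norm (A *v g) = norm g"
  using orthogonal_matrix_inverse(4)[OF assms, of "A *v g"] by (simp only: orthogonal_matrix_inverse(1)[OF assms])

lemma orthogonal_transformation_matrixE:
  fixes f :: "real^'n::finite \<Rightarrow> real^'n"
  assumes "orthogonal_transformation f"
  shows "orthogonal_matrix (matrix f)" "matrix f *v x = f x"
  using assms by (auto simp: orthogonal_transformation_matrix matrix_works linear_matrix_vector_mul_eq)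

text \<open>This holds for the orthogonal group in every dimension and for the rotations from
  dimension 3 on. A plane rotation that fixes a unit vector is the identity, and on the line the
  identity is the only rotation.\<close>

definition radially_transitive :: "(real^'n::finite^'n) set \<Rightarrow> bool" where
  "radially_transitive S \<longleftrightarrow> (\<forall>A\<in>S. orthogonal_matrix A) \<and> (\<forall>a b. norm a = norm b \<longrightarrow> (\<exists>A\<in>S. A *v a = b)) \<and>
    (\<forall>e p. norm e = 1 \<longrightarrow> e \<bullet> p = 0 \<longrightarrow> p \<noteq> 0 \<longrightarrow> (\<exists>A\<in>S. A *v e = e \<and> A *v p = - p))"

lemma radial_densities:
  fixes S :: "(real^'n::finite^'n) set"
  assumes S: "radially_transitive S" and \<psi>: "Cc \<psi>" and \<zeta>: "Cc \<zeta>"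
    and \<zeta>S: "\<And>A \<tau>. A \<in> S \<Longrightarrow> \<zeta> (A *v \<tau>) = \<zeta> \<tau>" and \<psi>S: "\<And>A \<tau>. A \<in> S \<Longrightarrow> \<psi> (A *v \<tau>) = A *v \<psi> \<tau>"
  obtains \<alpha> \<xi> where "Cc_halfline \<alpha>" "Cb_open_halfline \<xi>" "((\<lambda>t. \<xi> t * t) \<longlongrightarrow> 0) (at_right 0)"
    "\<zeta> = (\<lambda>g. \<alpha> (norm g))" "\<psi> = (\<lambda>g. if g = 0 then 0 else \<xi> (norm g) *\<^sub>R g)"
proof -
  have trans: "\<exists>A\<in>S. A *v a = b" if "norm a = norm b" for a b using S that by (simp add: radially_transitive_def)
  have refl: "\<exists>A\<in>S. A *v e = e \<and> A *v p = - p" if "norm e = 1" "e \<bullet> p = 0" "p \<noteq> 0" for e p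
    using S that by (simp add: radially_transitive_def)
  define e where "e = (axis undefined 1 :: real^'n)"
  have e: "norm e = 1" by (simp add: e_def)
  define \<alpha> where "\<alpha> t = \<zeta> (t *\<^sub>R e)" for t
  \<comment> \<open>The division by \<open>t\<close> compensates for the length of \<open>g\<close>.
    So \<open>\<xi>\<close> may be unbounded near 0, while \<open>\<xi> t * t\<close> tends to
    \<open>\<psi> 0 \<bullet> e\<close>, which is 0.\<close>
  define \<xi> where "\<xi> t = (\<psi> (t *\<^sub>R e) \<bullet> e) / t" for t
  have c: "continuous_on UNIV \<psi>" "continuous_on UNIV \<zeta>" using \<psi> \<zeta> by (simp_all add: Cc_def)
  obtain R where R: "\<And>g. R \<le> norm g \<Longrightarrow> \<psi> g = 0" using Cc_support[OF \<psi>] by metis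
  obtain R' where R': "\<And>g. R' \<le> norm g \<Longrightarrow> \<zeta> g = 0" using Cc_support[OF \<zeta>] by metis
  have "Cc_halfline \<alpha>" unfolding Cc_halfline_def
  proof (intro conjI exI[of _ R'] allI impI)
    show "continuous_on {0..} \<alpha>" unfolding \<alpha>_def[abs_def]
      by (rule continuous_on_compose2[OF c(2)]) (auto intro!: continuous_intros)
    show "\<alpha> t = 0" if "t \<ge> R'" for t unfolding \<alpha>_def using R'[of "t *\<^sub>R e"] that e by simp
  qed
  moreover have "Cb_open_halfline \<xi>" unfolding Cb_open_halfline_def
  proof (intro conjI exI[of _ R] allI impI)
    have "continuous_on {0<..} (\<lambda>t. \<psi> (t *\<^sub>R e))"
      by (rule continuous_on_compose2[OF c(1)]) (auto intro!: continuous_intros)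
    then show "continuous_on {0<..} \<xi>" unfolding \<xi>_def[abs_def]
      by (intro continuous_intros) auto
    show "\<xi> t = 0" if "t \<ge> R" for t unfolding \<xi>_def using R[of "t *\<^sub>R e"] that e by simp
  qed
  \<comment> \<open>Every member of \<open>S\<close> fixes \<open>\<psi> 0\<close>, as it fixes the
    point 0, and some member negates it.\<close>
  moreover have \<psi>0: "\<psi> 0 = 0"
  proof -
    obtain A where "A \<in> S" "A *v \<psi> 0 = - \<psi> 0" using trans[of "\<psi> 0" "- \<psi> 0"] by auto
    then have "\<psi> 0 = - \<psi> 0" using \<psi>S[of A 0] by simp
    then have "(2::real) *\<^sub>R \<psi> 0 = \<psi> 0 + - \<psi> 0" unfolding scaleR_2 by (rule arg_cong)
    then show ?thesis by simp
  qed
  moreover have "((\<lambda>t. \<xi> t * t) \<longlongrightarrow> 0) (at_right 0)"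
  proof -
    have "continuous_on UNIV (\<lambda>t. \<psi> (t *\<^sub>R e))"
      by (rule continuous_on_compose2[OF c(1)]) (auto intro!: continuous_intros)
    then have "continuous_on UNIV (\<lambda>t. \<psi> (t *\<^sub>R e) \<bullet> e)" by (intro continuous_intros)
    then have "((\<lambda>t. \<psi> (t *\<^sub>R e) \<bullet> e) \<longlongrightarrow> \<psi> (0 *\<^sub>R e) \<bullet> e) (at 0)" by (simp only: continuous_on_def UNIV_I)
    then have "((\<lambda>t. \<psi> (t *\<^sub>R e) \<bullet> e) \<longlongrightarrow> \<psi> (0 *\<^sub>R e) \<bullet> e) (at_right 0)" by (rule tendsto_within_subset) simp
    then have "((\<lambda>t. \<psi> (t *\<^sub>R e) \<bullet> e) \<longlongrightarrow> 0) (at_right 0)" using \<psi>0 by simp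
    then show ?thesis
      by (rule Lim_transform_eventually) (auto simp: \<xi>_def eventually_at_filter)
  qed
  moreover have "\<zeta> = (\<lambda>g. \<alpha> (norm g))"
  proof
    fix g
    obtain A where A: "A \<in> S" "A *v (norm g *\<^sub>R e) = g" using trans[of "norm g *\<^sub>R e" g] e by auto
    show "\<zeta> g = \<alpha> (norm g)" using \<zeta>S[OF A(1), of "norm g *\<^sub>R e"] A(2) by (simp add: \<alpha>_def)
  qed
  moreover have "\<psi> = (\<lambda>g. if g = 0 then 0 else \<xi> (norm g) *\<^sub>R g)"
  proof
    fix g
    show "\<psi> g = (if g = 0 then 0 else \<xi> (norm g) *\<^sub>R g)"
    proof (cases "g = 0")
      case False
      then have t: "norm g > 0" by simp
      define q where "q = \<psi> (norm g *\<^sub>R e)"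
      \<comment> \<open>\<open>p\<close> is the part of the value \<open>q\<close> orthogonal to
        \<open>e\<close>. A member of \<open>S\<close> that fixes \<open>e\<close> also fixes
        \<open>q\<close> and hence \<open>p\<close>; one that negates \<open>p\<close> forces
        \<open>p = 0\<close>.\<close>
      define p where "p = q - (q \<bullet> e) *\<^sub>R e"
      have ee: "e \<bullet> e = 1" using e by (simp add: norm_eq_1)
      have ep: "e \<bullet> p = 0" by (simp add: p_def inner_diff_right ee inner_commute)
      have "p = 0"
      proof (rule ccontr)
        assume "p \<noteq> 0"
        then obtain B where B: "B \<in> S" "B *v e = e" "B *v p = - p" using refl[OF e ep] by blast
        have "B *v q = q" using \<psi>S[OF B(1), of "norm g *\<^sub>R e"] by (simp add: q_def matrix_vector_mult_scaleR B(2))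
        then have "B *v p = p" by (simp add: p_def matrix_vector_mult_diff_distrib matrix_vector_mult_scaleR B(2))
        then have "(2::real) *\<^sub>R p = 0" unfolding scaleR_2 using B(3) by (metis add.right_inverse)
        then show False using \<open>p \<noteq> 0\<close> by simp
      qed
      then have q: "q = (q \<bullet> e) *\<^sub>R e" by (simp add: p_def)
      obtain A where A: "A \<in> S" "A *v (norm g *\<^sub>R e) = g" using trans[of "norm g *\<^sub>R e" g] e by auto
      have "\<psi> g = A *v q" using \<psi>S[OF A(1), of "norm g *\<^sub>R e"] A(2) by (simp add: q_def)
      also have "\<dots> = (q \<bullet> e) *\<^sub>R (A *v e)" by (subst q) (rule matrix_vector_mult_scaleR)
      also have "\<dots> = \<xi> (norm g) *\<^sub>R (A *v (norm g *\<^sub>R e))"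
        using t by (simp add: \<xi>_def q_def matrix_vector_mult_scaleR)
      finally show ?thesis using A(2) False by simp
    qed (simp add: \<psi>0)
  qed
  ultimately show ?thesis using that by blast
qed

text \<open>The delicate point is continuity of the vector field at 0: its norm at \<open>g\<close>
  is \<open>\<bar>\<xi> t * t\<bar>\<close> with \<open>t = norm g\<close>.\<close>

lemma radial_densities_Cc:
  fixes \<alpha> \<xi> :: "real \<Rightarrow> real"
  shows "Cc_halfline \<alpha> \<Longrightarrow> Cc (\<lambda>g :: real^'n::finite. \<alpha> (norm g))"
    and "Cb_open_halfline \<xi> \<Longrightarrow> ((\<lambda>t. \<xi> t * t) \<longlongrightarrow> 0) (at_right 0) \<Longrightarrow>
      Cc (\<lambda>g :: real^'n::finite. if g = 0 then 0 else \<xi> (norm g) *\<^sub>R g)"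
proof -
  assume \<alpha>: "Cc_halfline \<alpha>"
  then obtain R where R: "\<And>t. R \<le> t \<Longrightarrow> \<alpha> t = 0" by (auto simp: Cc_halfline_def)
  show "Cc (\<lambda>g :: real^'n. \<alpha> (norm g))"
  proof (rule CcI)
    have "continuous_on {0..} \<alpha>" using \<alpha> by (simp add: Cc_halfline_def)
    then show "continuous_on UNIV (\<lambda>g :: real^'n. \<alpha> (norm g))"
      by (rule continuous_on_compose2[OF _ continuous_on_norm_id]) auto
    show "\<alpha> (norm g) = 0" if "R \<le> norm g" for g :: "real^'n" by (rule R[OF that])
  qed
next
  assume \<xi>: "Cb_open_halfline \<xi>" and lim: "((\<lambda>t. \<xi> t * t) \<longlongrightarrow> 0) (at_right 0)"
  let ?f = "\<lambda>g :: real^'n. if g = 0 then 0 else \<xi> (norm g) *\<^sub>R g"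
  obtain R where R: "\<And>t. R \<le> t \<Longrightarrow> \<xi> t = 0" using \<xi> by (auto simp: Cb_open_halfline_def)
  show "Cc ?f"
  proof (rule CcI)
    show "?f g = 0" if "R \<le> norm g" for g :: "real^'n" using R[OF that] by simp
    have "isCont ?f g" for g
    proof (cases "g = 0")
      case True
      have "filterlim norm (at_right 0) (at (0 :: real^'n))"
        unfolding filterlim_at by (auto simp: eventually_at_filter intro!: tendsto_eq_intros)
      from filterlim_compose[OF tendsto_rabs_zero[OF lim] this]
      have "((\<lambda>g :: real^'n. norm (\<xi> (norm g) *\<^sub>R g)) \<longlongrightarrow> 0) (at 0)" by (simp add: abs_mult)
      then have "((\<lambda>g :: real^'n. \<xi> (norm g) *\<^sub>R g) \<longlongrightarrow> 0) (at 0)" by (rule tendsto_norm_zero_cancel)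
      then have "(?f \<longlongrightarrow> 0) (at 0)" by (rule Lim_transform_eventually) (simp add: eventually_at_filter)
      then show ?thesis unfolding True isCont_def by (simp only: if_True refl)
    next
      case False
      have "continuous_on {0<..} \<xi>" using \<xi> by (simp add: Cb_open_halfline_def)
      moreover have "norm ` (- {0 :: real^'n}) \<subseteq> {0<..}" by auto
      ultimately have "continuous_on (- {0}) (\<lambda>g :: real^'n. \<xi> (norm g))"
        by (rule continuous_on_compose2[OF _ continuous_on_norm_id])
      then have "continuous_on (- {0}) (\<lambda>g :: real^'n. \<xi> (norm g) *\<^sub>R g)" by (rule continuous_on_scaleR) (rule continuous_on_id)
      then have "isCont (\<lambda>g :: real^'n. \<xi> (norm g) *\<^sub>R g) g"
        by (rule continuous_on_interior) (use False in \<open>simp add: interior_open open_Compl\<close>)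
      moreover have "\<forall>\<^sub>F g in nhds g. ?f g = \<xi> (norm g) *\<^sub>R g"
        using False t1_space_nhds[of g 0] by (auto elim: eventually_mono)
      ultimately show ?thesis using isCont_cong[of ?f "\<lambda>g. \<xi> (norm g) *\<^sub>R g" g] by blast
    qed
    then show "continuous_on UNIV ?f" by (simp add: continuous_at_imp_continuous_on)
  qed
qed

section \<open>Reflections and transitive groups\<close>

definition hyperplane_reflection :: "'a::real_inner \<Rightarrow> 'a \<Rightarrow> 'a" where
  "hyperplane_reflection p x = x - (2 * (x \<bullet> p) / (p \<bullet> p)) *\<^sub>R p"

lemma hyperplane_reflection:
  fixes p :: "real^'n::finite"
  assumes "p \<noteq> 0"
  shows "orthogonal_transformation (hyperplane_reflection p)" "hyperplane_reflection p p = - p"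
    "x \<bullet> p = 0 \<Longrightarrow> hyperplane_reflection p x = x"
proof -
  have "linear (hyperplane_reflection p)" unfolding hyperplane_reflection_def
    by (rule linearI) (simp_all add: algebra_simps inner_add_left add_divide_distrib scaleR_add_left)
  moreover have "hyperplane_reflection p v \<bullet> hyperplane_reflection p w = v \<bullet> w" for v w
    using assms by (simp add: hyperplane_reflection_def inner_diff_left inner_diff_right inner_commute field_simps)
  ultimately show "orthogonal_transformation (hyperplane_reflection p)" by (simp add: orthogonal_transformation_def)
  show "hyperplane_reflection p p = - p" using assms by (simp add: hyperplane_reflection_def scaleR_2)
  show "x \<bullet> p = 0 \<Longrightarrow> hyperplane_reflection p x = x" by (simp add: hyperplane_reflection_def)
qed

lemma radially_transitive_O: "radially_transitive {A :: real^'n::finite^'n. orthogonal_matrix A}"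
  unfolding radially_transitive_def
proof (intro conjI allI impI)
  fix a b :: "real^'n" assume "norm a = norm b"
  then obtain f where "orthogonal_transformation f" "f a = b" by (rule orthogonal_transformation_exists)
  then show "\<exists>A\<in>{A. orthogonal_matrix A}. A *v a = b"
    using orthogonal_transformation_matrixE[of f] by (intro bexI[of _ "matrix f"]) auto
next
  fix e p :: "real^'n" assume ep: "e \<bullet> p = 0" "p \<noteq> 0"
  show "\<exists>A\<in>{A. orthogonal_matrix A}. A *v e = e \<and> A *v p = - p"
    using orthogonal_transformation_matrixE[OF hyperplane_reflection(1)[OF ep(2)]] hyperplane_reflection(2,3)[OF ep(2)] ep(1)
    by (intro bexI[of _ "matrix (hyperplane_reflection p)"]) auto
qed auto

text \<open>A single reflection has determinant -1. The third dimension provides \<open>w\<close>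
  orthogonal to \<open>e\<close> and \<open>p\<close> and as long as \<open>p\<close>;
  \<open>B\<close>, a product of two reflections, is a quarter turn in the plane of \<open>p\<close>
  and \<open>w\<close>, so its square fixes \<open>e\<close>, negates \<open>p\<close> and has
  determinant 1.\<close>

lemma radially_transitive_SO:
  assumes n: "CARD('n::finite) \<ge> 3"
  shows "radially_transitive {A :: real^'n^'n. orthogonal_matrix A \<and> det A = 1}"
  unfolding radially_transitive_def
proof (intro conjI allI impI)
  fix a b :: "real^'n" assume ab: "norm a = norm b"
  have "2 \<le> CARD('n)" using n by simp
  from rotation_exists[OF this ab]
  obtain f where "orthogonal_transformation f" "det (matrix f) = 1" "f a = b" by metis
  then show "\<exists>A\<in>{A. orthogonal_matrix A \<and> det A = 1}. A *v a = b"
    using orthogonal_transformation_matrixE[of f] by (intro bexI[of _ "matrix f"]) auto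
next
  fix e p :: "real^'n" assume ep: "norm e = 1" "e \<bullet> p = 0" "p \<noteq> 0"
  have "dim {e, p} \<le> card {e, p}" by (rule dim_le_card') simp
  also have "\<dots> \<le> 2" by (simp add: card_insert_if)
  finally have "dim {e, p} < DIM(real^'n)" using n by simp
  then obtain w' where w': "w' \<noteq> 0" "\<And>y. y \<in> span {e, p} \<Longrightarrow> orthogonal w' y" by (rule orthogonal_to_subspace_exists) blast
  define w where "w = (norm p / norm w') *\<^sub>R w'"
  have we: "e \<bullet> w = 0" and pw: "p \<bullet> w = 0"
    using w'(2)[of e] w'(2)[of p] by (auto simp: w_def orthogonal_def span_base inner_commute)
  have ww: "w \<bullet> w = p \<bullet> p" using w'(1) by (simp add: w_def dot_square_norm power2_eq_square)
  have pp: "p \<bullet> p \<noteq> 0" using ep(3) by simp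
  have "(p - w) \<bullet> (p - w) = 2 * (p \<bullet> p)" by (simp add: inner_diff_left inner_diff_right ww pw inner_commute)
  then have d: "p - w \<noteq> 0" using pp by auto
  note P = orthogonal_transformation_matrixE[OF hyperplane_reflection(1)[OF ep(3)]]
  note D = orthogonal_transformation_matrixE[OF hyperplane_reflection(1)[OF d]]
  define B where "B = matrix (hyperplane_reflection p) ** matrix (hyperplane_reflection (p - w))"
  have Bx: "B *v x = hyperplane_reflection p (hyperplane_reflection (p - w) x)" for x
    by (simp only: B_def P(2) D(2) flip: matrix_vector_mul_assoc)
  have Dpw: "hyperplane_reflection (p - w) p = w" "hyperplane_reflection (p - w) w = p"
    using pp by (simp_all add: hyperplane_reflection_def inner_diff_left inner_diff_right ww pw inner_commute[of w p])
  have "B *v e = e" "B *v p = w" "B *v w = - p"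
    unfolding Bx Dpw using hyperplane_reflection(2,3)[OF ep(3)] hyperplane_reflection(3)[OF d, of e] ep(2) we pw
    by (simp_all add: inner_diff_right inner_commute)
  then have "(B ** B) *v e = e" "(B ** B) *v p = - p" by (simp_all flip: matrix_vector_mul_assoc)
  moreover have B: "orthogonal_matrix B" unfolding B_def by (intro orthogonal_matrix_mul P(1) D(1))
  moreover have "det (B ** B) = 1" using det_orthogonal_matrix[OF B] by (auto simp: det_mul)
  ultimately show "\<exists>A\<in>{A. orthogonal_matrix A \<and> det A = 1}. A *v e = e \<and> A *v p = - p"
    by (intro bexI[of _ "B ** B"]) (simp_all add: orthogonal_matrix_mul)
qed auto

lemma operators_eq:
  fixes \<alpha> \<xi> :: "real \<Rightarrow> real" and u :: "'n::finite cfun"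
  assumes "u \<in> conv_sc"
  shows "t_op \<xi> u + m_op \<alpha> u =
    grad_integral (\<lambda>g. if g = 0 then 0 else \<xi> (norm g) *\<^sub>R g) u + moment_integral (\<lambda>g. \<alpha> (norm g)) u"
  unfolding t_op_def m_op_def using integral_dom_split[OF assms, of "\<lambda>g. if g = 0 then 0 else \<xi> (norm g) *\<^sub>R g" "\<lambda>g. \<alpha> (norm g)"] .

lemma equivariant_iff_radial:
  fixes z :: "'n::finite cfun \<Rightarrow> real^'n"
  assumes S: "radially_transitive S" and z: "simple_functional z" "translation_covariant z"
  shows "(\<forall>A\<in>S. \<forall>u\<in>conv_sc. z (\<lambda>y. u (transpose A *v y)) = A *v z u) \<longleftrightarrow>
    (\<exists>\<alpha> \<xi>. Cc_halfline \<alpha> \<and> Cb_open_halfline \<xi> \<and> ((\<lambda>t. \<xi> t * t) \<longlongrightarrow> 0) (at_right 0) \<and>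
      (\<forall>u\<in>conv_sc. z u = t_op \<xi> u + m_op \<alpha> u))" (is "?L \<longleftrightarrow> ?R")
proof
  assume eqv: ?L
  have orth: "orthogonal_matrix A" if "A \<in> S" for A using S that by (simp add: radially_transitive_def)
  obtain \<psi> \<zeta> where d: "Cc \<psi>" "Cc \<zeta>" "\<forall>u\<in>conv_sc. z u = grad_integral \<psi> u + moment_integral \<zeta> u"
    by (rule covariant_representation[OF z])
  obtain \<alpha> \<xi> where r: "Cc_halfline \<alpha>" "Cb_open_halfline \<xi>" "((\<lambda>t. \<xi> t * t) \<longlongrightarrow> 0) (at_right 0)"
    "\<zeta> = (\<lambda>g. \<alpha> (norm g))" "\<psi> = (\<lambda>g. if g = 0 then 0 else \<xi> (norm g) *\<^sub>R g)"
    by (rule radial_densities[OF S d(1,2) equivariant_imp_densities[OF orth d bspec[OF eqv]]])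
  have "z u = t_op \<xi> u + m_op \<alpha> u" if "u \<in> conv_sc" for u
    unfolding operators_eq[OF that] using d(3) that unfolding r(4,5) by blast
  then show ?R using r(1-3) by blast
next
  assume ?R
  then obtain \<alpha> \<xi> where r: "Cc_halfline \<alpha>" "Cb_open_halfline \<xi>" "((\<lambda>t. \<xi> t * t) \<longlongrightarrow> 0) (at_right 0)"
    and zr: "\<forall>u\<in>conv_sc. z u = t_op \<xi> u + m_op \<alpha> u" by blast
  show ?L
  proof (intro ballI)
    fix A :: "real^'n^'n" and u :: "'n cfun" assume "A \<in> S" and u: "u \<in> conv_sc"
    then have A: "orthogonal_matrix A" using S by (simp add: radially_transitive_def)
    note n = orthogonal_matrix_norm[OF A]
    have A0: "A *v \<tau> = 0 \<longleftrightarrow> \<tau> = 0" for \<tau> using n[of \<tau>] by (metis norm_eq_zero)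
    have rot: "(\<lambda>y. u (transpose A *v y)) \<in> conv_sc" by (rule conv_sc_rotate[OF A u])
    have "grad_integral (\<lambda>g. if g = 0 then 0 else \<xi> (norm g) *\<^sub>R g) (\<lambda>y. u (transpose A *v y)) =
        A *v grad_integral (\<lambda>g. if g = 0 then 0 else \<xi> (norm g) *\<^sub>R g) u"
      by (rule grad_integral_rotate[OF A radial_densities_Cc(2)[OF r(2,3)] _ u]) (simp add: n A0 matrix_vector_mult_scaleR)
    moreover have "moment_integral (\<lambda>g. \<alpha> (norm g)) (\<lambda>y. u (transpose A *v y)) = A *v moment_integral (\<lambda>g. \<alpha> (norm g)) u"
      by (rule moment_integral_rotate[OF A radial_densities_Cc(1)[OF r(1)] _ u]) (simp only: n)
    ultimately show "z (\<lambda>y. u (transpose A *v y)) = A *v z u"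
      using zr u rot by (simp only: operators_eq matrix_vector_right_distrib)
  qed
qed

theorem theorem3p6:
  fixes z :: "('n::finite) cfun \<Rightarrow> real^'n"
  shows
   "(epi_continuous z \<and> translation_covariant z \<and> vert_trans_invariant z \<and> simple_val z
       \<and> is_valuation z
     \<longleftrightarrow> (\<exists>(\<psi>::real^'n \<Rightarrow> real^'n) (\<zeta>::real^'n \<Rightarrow> real). Cc \<psi> \<and> Cc \<zeta> \<and>
           (\<forall>u\<in>conv_sc. z u = integral (dom_fn u) (\<lambda>x. \<psi> (grad u x))
                              + integral (dom_fn u) (\<lambda>x. \<zeta> (grad u x) *\<^sub>R x))))
  \<and> (CARD('n) \<ge> 3 \<longrightarrow>
       epi_continuous z \<and> translation_covariant z \<and> vert_trans_invariant z \<and> simple_val z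
       \<and> is_valuation z \<longrightarrow>
       (SO_equivariant z \<longleftrightarrow>
         (\<exists>\<alpha> \<xi>. Cc_halfline \<alpha> \<and> Cb_open_halfline \<xi> \<and>
            ((\<lambda>t. \<xi> t * t) \<longlongrightarrow> 0) (at_right 0) \<and>
            (\<forall>u\<in>conv_sc. z u = t_op \<xi> u + m_op \<alpha> u))))
  \<and> (CARD('n) \<le> 2 \<longrightarrow>
       epi_continuous z \<and> translation_covariant z \<and> vert_trans_invariant z \<and> simple_val z
       \<and> is_valuation z \<longrightarrow>
       (O_equivariant z \<longleftrightarrow>
         (\<exists>\<alpha> \<xi>. Cc_halfline \<alpha> \<and> Cb_open_halfline \<xi> \<and>
            ((\<lambda>t. \<xi> t * t) \<longlongrightarrow> 0) (at_right 0) \<and>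
            (\<forall>u\<in>conv_sc. z u = t_op \<xi> u + m_op \<alpha> u))))"
proof -
  have five: "epi_continuous z \<and> translation_covariant z \<and> vert_trans_invariant z \<and> simple_val z \<and> is_valuation z \<longleftrightarrow>
      simple_functional z \<and> translation_covariant z" by (auto simp: simple_functional_def)
  have rep: "simple_functional z \<and> translation_covariant z \<longleftrightarrow>
    (\<exists>(\<psi>::real^'n \<Rightarrow> real^'n) (\<zeta>::real^'n \<Rightarrow> real). Cc \<psi> \<and> Cc \<zeta> \<and>
      (\<forall>u\<in>conv_sc. z u = integral (dom_fn u) (\<lambda>x. \<psi> (grad u x)) + integral (dom_fn u) (\<lambda>x. \<zeta> (grad u x) *\<^sub>R x)))"
    (is "_ = ?R")
  proof
    assume "simple_functional z \<and> translation_covariant z"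
    then obtain \<psi> \<zeta> where "Cc \<psi>" "Cc \<zeta>" "\<forall>u\<in>conv_sc. z u = grad_integral \<psi> u + moment_integral \<zeta> u"
      using covariant_representation by blast
    then show ?R by (intro exI[of _ \<psi>] exI[of _ \<zeta>]) (simp add: integral_dom_split)
  next
    assume ?R
    then obtain \<psi> :: "real^'n \<Rightarrow> real^'n" and \<zeta> where d: "Cc \<psi>" "Cc \<zeta>"
      "\<forall>u\<in>conv_sc. z u = integral (dom_fn u) (\<lambda>x. \<psi> (grad u x)) + integral (dom_fn u) (\<lambda>x. \<zeta> (grad u x) *\<^sub>R x)" by blast
    have "\<forall>u\<in>conv_sc. z u = grad_integral \<psi> u + moment_integral \<zeta> u" using d(3) by (simp add: integral_dom_split)
    then show "simple_functional z \<and> translation_covariant z" using representation_properties[OF d(1,2)] by blast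
  qed
  have SO: "SO_equivariant z \<longleftrightarrow> (\<forall>A\<in>{A. orthogonal_matrix A \<and> det A = 1}. \<forall>u\<in>conv_sc. z (\<lambda>y. u (transpose A *v y)) = A *v z u)"
    unfolding SO_equivariant_def by blast
  have O: "O_equivariant z \<longleftrightarrow> (\<forall>A\<in>{A. orthogonal_matrix A}. \<forall>u\<in>conv_sc. z (\<lambda>y. u (transpose A *v y)) = A *v z u)"
    unfolding O_equivariant_def by blast
  show ?thesis unfolding five SO O
    using rep equivariant_iff_radial[OF radially_transitive_SO, of z] equivariant_iff_radial[OF radially_transitive_O, of z] by blast
qed

end
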